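(* Let $T^*$ be the maximal singular integral operator $$T^*f(x)=\sup_{0<\varepsilon<\delta}\Big|\int_{\varepsilon<|x-y|<\delta}f(y)K(x-y)\,dy\Big|,$$ where $K$ is one of the following kernels: (i) $K(x)=\frac1x$ on $\mathbb{R}$ (so $n=1$); (ii) $K(x)=\frac{x_j}{|x|^{n+1}}$ on $\mathbb{R}^n$, $n\ge 2$, for some $1\le j\le n$; (iii) $K(z)=\frac{1}{z^2}$, $z\in\mathbb{C}$ (with $\mathbb{C}$ identified with $\mathbb{R}^2$, so $n=2$); (iv) $K$ is any odd, one-dimensional (so $n=1$) $C^2$ kernel on $\mathbb{R}\setminus\{0\}$ satisfying $|K^{(i)}(x)|\le c|x|^{-1-i}$ for $i=0,1,2$. Then for any $2\le p\le r<\infty$ there is a constant $c(T,p,r,n)$, depending only on the operator, $p$, $r$ and $n$, such that for every weight $w$ on $\mathbb{R}^n$, $$\|T^*\|_{L^p(w)}\le c(T,p,r,n)\,\|w\|_{(A_p)^{\frac{1}{p-1}}(A_r)^{1-\frac{1}{p-1}}}.$$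
   Context: A weight is a non-negative locally integrable function $w$ on $\mathbb{R}^n$. $L^p(w)$ is the space with norm $\|f\|_{L^p(w)}=(\int_{\mathbb{R}^n}|f|^p w\,dx)^{1/p}$, and $\|T^*\|_{L^p(w)}$ denotes the operator norm of $T^*$ on $L^p(w)$, i.e. the least constant $C$ with $\|T^*f\|_{L^p(w)}\le C\|f\|_{L^p(w)}$ for all $f\in L^p(w)$. For a cube $Q\subset\mathbb{R}^n$ and $1<p<\infty$, $$A_p(w;Q)=\Big(\frac{1}{|Q|}\int_Q w\Big)\Big(\frac{1}{|Q|}\int_Q w^{-\frac{1}{p-1}}\Big)^{p-1}.$$ For exponents $\alpha,\beta$ and $1<p,r<\infty$, $$\|w\|_{(A_p)^{\alpha}(A_r)^{\beta}}=\sup_{Q\subset\mathbb{R}^n}A_p(w;Q)^{\alpha}A_r(w;Q)^{\beta},$$ where a single supremum is taken over all cubes $Q\subset\mathbb{R}^n$. The inequality is understood to have content only when this quantity is finite. *)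

theory Defs
  imports "HOL-Analysis.Analysis"
begin

text \<open>
  All ambient spaces are Euclidean spaces with Lebesgue measure, and functions and kernels are
  complex-valued. Quantities that may be infinite (norms, averages, the maximal operator) live in
  the extended nonnegative reals, where 0 times infinity is 0.
\<close>

text \<open>
  Real powers of extended nonnegative reals. Unlike \<open>powr\<close> on the reals, an exponent 0 always
  gives 1 (also at 0 and at infinity), and 0 to a negative exponent is infinity.
\<close>

definition epowr :: "ennreal \<Rightarrow> real \<Rightarrow> ennreal" where
  "epowr x a =
    (if a = 0 then 1
     else if x = 0 then (if a < 0 then top else 0)
     else if x = top then (if a < 0 then 0 else top)
     else ennreal (enn2real x powr a))"

definition weight :: "('a::euclidean_space \<Rightarrow> real) \<Rightarrow> bool" where
  "weight w \<longleftrightarrow> (\<forall>x. 0 \<le> w x) \<and> (\<forall>S. compact S \<longrightarrow> w absolutely_integrable_on S)"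

definition cube :: "'a::euclidean_space set \<Rightarrow> bool" where
  "cube Q \<longleftrightarrow> (\<exists>a. \<exists>l>0. Q = cbox a (a + l *\<^sub>R One))"

definition average :: "'a::euclidean_space set \<Rightarrow> ('a \<Rightarrow> ennreal) \<Rightarrow> ennreal" where
  "average Q g = (\<integral>\<^sup>+x\<in>Q. g x \<partial>lebesgue) / emeasure lebesgue Q"

definition Ap :: "real \<Rightarrow> ('a::euclidean_space \<Rightarrow> real) \<Rightarrow> 'a set \<Rightarrow> ennreal" where
  "Ap p w Q =
    average Q (\<lambda>x. ennreal (w x)) *
    epowr (average Q (\<lambda>x. epowr (ennreal (w x)) (- (1 / (p - 1))))) (p - 1)"

definition mixed_constant ::
  "real \<Rightarrow> real \<Rightarrow> real \<Rightarrow> real \<Rightarrow> ('a::euclidean_space \<Rightarrow> real) \<Rightarrow> ennreal" where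
  "mixed_constant p \<alpha> r \<beta> w =
    (SUP Q\<in>{Q. cube Q}. epowr (Ap p w Q) \<alpha> * epowr (Ap r w Q) \<beta>)"

definition wnorm :: "real \<Rightarrow> ('a::euclidean_space \<Rightarrow> real) \<Rightarrow> ('a \<Rightarrow> ennreal) \<Rightarrow> ennreal" where
  "wnorm p w g = epowr (\<integral>\<^sup>+x. epowr (g x) p * ennreal (w x) \<partial>lebesgue) (1 / p)"

definition Lp :: "real \<Rightarrow> ('a::euclidean_space \<Rightarrow> real) \<Rightarrow> ('a \<Rightarrow> complex) set" where
  "Lp p w = {f \<in> borel_measurable lebesgue. wnorm p w (\<lambda>x. ennreal (norm (f x))) < top}"

text \<open>
  The operator norm of an operator whose values are extended nonnegative functions; it is infinity
  if the operator is unbounded.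
\<close>

definition opnorm ::
  "real \<Rightarrow> ('a::euclidean_space \<Rightarrow> real) \<Rightarrow> (('a \<Rightarrow> complex) \<Rightarrow> 'a \<Rightarrow> ennreal) \<Rightarrow> ennreal" where
  "opnorm p w T =
    Inf {C. \<forall>f\<in>Lp p w. wnorm p w (T f) \<le> C * wnorm p w (\<lambda>x. ennreal (norm (f x)))}"

text \<open>
  The truncated integrals converge absolutely for a locally integrable \<open>f\<close> when the kernel is
  bounded on annuli. If the mixed constant of \<open>w\<close> is finite and \<open>w\<close> is not null, then every \<open>f\<close> in
  \<open>Lp p w\<close> is locally integrable, so the value 0 that the Bochner integral assigns to a
  non-integrable function plays no role.
\<close>

definition max_sing_int ::
  "('a::euclidean_space \<Rightarrow> complex) \<Rightarrow> ('a \<Rightarrow> complex) \<Rightarrow> 'a \<Rightarrow> ennreal" where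
  "max_sing_int K f x =
    (SUP (\<epsilon>, \<delta>)\<in>{(\<epsilon>, \<delta>). 0 < \<epsilon> \<and> \<epsilon> < \<delta>}.
      ennreal (norm (LINT y:{y. \<epsilon> < norm (x - y) \<and> norm (x - y) < \<delta>}|lebesgue. f y * K (x - y))))"

text \<open>
  Odd kernels of class \<open>C\<^sup>2\<close> on the punctured line with the size bounds; \<open>D i\<close> is the \<open>i\<close>-th
  derivative of \<open>K\<close>. The value of \<open>K\<close> at 0 is irrelevant.
\<close>

definition odd_C2_kernel :: "(real \<Rightarrow> complex) \<Rightarrow> bool" where
  "odd_C2_kernel K \<longleftrightarrow>
    (\<forall>x. x \<noteq> 0 \<longrightarrow> K (- x) = - K x) \<and>
    (\<exists>D :: nat \<Rightarrow> real \<Rightarrow> complex. \<exists>c::real.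
      D 0 = K \<and>
      (\<forall>i<2. \<forall>x. x \<noteq> 0 \<longrightarrow> (D i has_vector_derivative D (Suc i) x) (at x)) \<and>
      continuous_on (- {0}) (D 2) \<and>
      (\<forall>i\<le>2. \<forall>x. x \<noteq> 0 \<longrightarrow> norm (D i x) \<le> c / \<bar>x\<bar> ^ (1 + i)))"

end

theory Submission
  imports Defs
begin

text \<open>
  The maximal truncations are dominated by a sparse operator, and the sparse operator is estimated by
  duality; the mixed constant enters through an estimate for a single cube.

  Each of the kernels has the size and smoothness of a standard kernel, and its sign changes under a
  norm-preserving map that also preserves Lebesgue measure: the reflection, or the rotation by a right
  angle for \<open>1 / z\<^sup>2\<close>. So its means over spheres vanish, and
  \<open>maximal_operator_bound\<close> treats all of them at once. Cut into pieces at dyadic scales,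
  such a kernel has almost orthogonal pieces, and \<open>Cotlar_Stein_conv\<close> bounds its
  truncations on \<open>L\<^sup>2\<close> uniformly. The Calderon--Zygmund decomposition gives the
  weak type inequality (\<open>weak_type\<close>), and Cotlar's comparison extends it to maximal
  truncations (\<open>truncations_weak_type\<close>).

  Hence, on a dyadic cube \<open>Q\<close>, the maximal truncation of \<open>f\<close> restricted to
  the triple \<open>3Q\<close> is at most a multiple of the mean of \<open>\<bar>f\<bar>\<close> over
  \<open>3Q\<close>, except on smaller cubes that fill at most half of \<open>Q\<close>; there it
  exceeds the mean by at most the corresponding quantity of the smaller cube
  (\<open>sparse_step\<close>). Iteration bounds the operator by \<open>\<Sum>\<^sub>Q
  \<langle>\<bar>f\<bar>\<rangle>\<^sub>3\<^sub>Q 1\<^sub>Q\<close>, where each \<open>Q\<close>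
  contains a set \<open>E\<^sub>Q\<close> of at least half its measure and the sets
  \<open>E\<^sub>Q\<close> are disjoint (\<open>sparse_domination\<close>).

  Put \<open>\<sigma> = w\<^bsup>-1/(p-1)\<^esup>\<close> and let \<open>P = 3Q\<close>. The heart of
  the matter is \<open>one_cube_estimate\<close>: \<open>w(P) \<sigma>(P) / \<bar>P\<bar>\<close> is
  at most a constant times \<open>A\<^sub>p(w; P)\<^bsup>1/(p-1)\<^esup> A\<^sub>r(w;
  P)\<^bsup>1-1/(p-1)\<^esup> w(E\<^sub>Q)\<^bsup>1-1/p\<^esup>
  \<sigma>(E\<^sub>Q)\<^bsup>1/p\<^esup>\<close>. Indeed, the mixed product is \<open>W S
  R\<^sup>g\<close> with \<open>W\<close>, \<open>S\<close>, \<open>R\<close> the averages of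
  \<open>w\<close>, \<open>\<sigma>\<close>, \<open>w\<^bsup>-1/(r-1)\<^esup>\<close> and \<open>g =
  (r-1)(1-1/(p-1))\<close>, which is nonnegative as \<open>p \<ge> 2\<close>; and Jensen's inequality
  on \<open>E\<^sub>Q\<close> bounds \<open>R\<^bsup>-g\<^esup>\<close> by the means of
  \<open>w\<close> and \<open>\<sigma>\<close> over \<open>E\<^sub>Q\<close>. Summing over the cubes
  with Hoelder's inequality, and embedding the \<open>\<sigma>\<close>-means over triples and the
  \<open>w\<close>-means over cubes by the maximal theorem for laminar families
  (\<open>Carleson_embedding\<close>), yields the linear bound in the mixed constant
  (\<open>sparse_operator_finite\<close>).

  A weight that is not null and has finite mixed constant is positive almost everywhere, with
  \<open>\<sigma>\<close> locally integrable; this makes every \<open>f\<close> in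
  \<open>L\<^sup>p(w)\<close> locally integrable.
\<close>

section \<open>Convolutions and their norms\<close>

lemma lborel_distr_reflect:
  fixes x :: "'a::euclidean_space"
  shows "distr lborel borel (\<lambda>y. x - y) = lborel"
  using lborel_affine[of "-1" x] by (simp add: density_1)

lemma lborel_distr_translate:
  fixes x :: "'a::euclidean_space"
  shows "distr lborel borel (\<lambda>y. y - x) = lborel"
  using lborel_affine[of "1" "-x"] by (simp add: density_1)

lemma integrable_reflect_iff:
  fixes f :: "'a::euclidean_space \<Rightarrow> real"
  assumes [measurable]: "f \<in> borel_measurable borel"
  shows "integrable lborel (\<lambda>y. f (x - y)) \<longleftrightarrow> integrable lborel f"
  using integrable_distr_eq[of "\<lambda>y. x - y" lborel borel f] by (simp add: lborel_distr_reflect)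

lemma integrable_translate_iff:
  fixes f :: "'a::euclidean_space \<Rightarrow> real"
  assumes [measurable]: "f \<in> borel_measurable borel"
  shows "integrable lborel (\<lambda>y. f (y - x)) \<longleftrightarrow> integrable lborel f"
  using integrable_distr_eq[of "\<lambda>y. y - x" lborel borel f] by (simp add: lborel_distr_translate)

lemma integral_reflect:
  fixes f :: "'a::euclidean_space \<Rightarrow> real"
  assumes [measurable]: "f \<in> borel_measurable borel"
  shows "(\<integral>y. f (x - y) \<partial>lborel) = (\<integral>y. f y \<partial>lborel)"
  using integral_distr[of "\<lambda>y. x - y" lborel borel f] by (simp add: lborel_distr_reflect)

lemma integral_translate:
  fixes f :: "'a::euclidean_space \<Rightarrow> real"
  assumes [measurable]: "f \<in> borel_measurable borel"
  shows "(\<integral>y. f (y - x) \<partial>lborel) = (\<integral>y. f y \<partial>lborel)"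
  using integral_distr[of "\<lambda>y. y - x" lborel borel f] by (simp add: lborel_distr_translate)

text \<open>
  A common domain for all convolutions: closed under linear combinations, reflection and convolution,
  and contained in \<open>L\<^sup>2\<close>.
\<close>

definition bdd_L1 :: "('a::euclidean_space \<Rightarrow> real) set" where
  "bdd_L1 = {f. f \<in> borel_measurable borel \<and> integrable lborel f \<and> (\<exists>B. \<forall>x. \<bar>f x\<bar> \<le> B)}"

definition conv :: "('a::euclidean_space \<Rightarrow> real) \<Rightarrow> ('a \<Rightarrow> real) \<Rightarrow> 'a \<Rightarrow> real" where
  "conv f g x = (\<integral>y. f (x - y) * g y \<partial>lborel)"

text \<open>
  Convolution with the reflection of \<open>k\<close> is the adjoint of convolution with
  \<open>k\<close>.
\<close>

definition reflection :: "('a::euclidean_space \<Rightarrow> real) \<Rightarrow> 'a \<Rightarrow> real" where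
  "reflection f x = f (- x)"

definition L1norm :: "('a::euclidean_space \<Rightarrow> real) \<Rightarrow> real" where
  "L1norm f = (\<integral>x. \<bar>f x\<bar> \<partial>lborel)"

definition L2norm :: "('a::euclidean_space \<Rightarrow> real) \<Rightarrow> real" where
  "L2norm f = sqrt (\<integral>x. (f x)\<^sup>2 \<partial>lborel)"

lemma bdd_L1_measurable [measurable_dest]: "f \<in> bdd_L1 \<Longrightarrow> f \<in> borel_measurable borel"
  and bdd_L1_integrable: "f \<in> bdd_L1 \<Longrightarrow> integrable lborel f"
  by (auto simp: bdd_L1_def)

lemma bdd_L1_bound:
  assumes "f \<in> bdd_L1"
  obtains B where "0 \<le> B" "\<And>x. \<bar>f x\<bar> \<le> B"
proof -
  obtain B where "\<And>x. \<bar>f x\<bar> \<le> B" using assms by (auto simp: bdd_L1_def)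
  then show thesis using that[of "\<bar>B\<bar>"] by (meson abs_ge_self abs_ge_zero order_trans)
qed

lemma integrable_bdd_mult:
  fixes f g :: "'a::euclidean_space \<Rightarrow> real"
  assumes [measurable]: "f \<in> borel_measurable borel" and B: "\<And>x. \<bar>f x\<bar> \<le> B"
    and g: "integrable lborel g"
  shows "integrable lborel (\<lambda>x. f x * g x)"
proof (rule Bochner_Integration.integrable_bound[where f="\<lambda>x. B * g x"])
  show "(\<lambda>x. f x * g x) \<in> borel_measurable lborel"
    using borel_measurable_integrable[OF g] by measurable
  show "AE x in lborel. norm (f x * g x) \<le> norm (B * g x)"
    using B by (intro AE_I2) (auto simp: abs_mult intro!: mult_right_mono order_trans[OF B])
qed (use g in auto)

lemma integrable_conv_integrand:
  fixes f g :: "'a::euclidean_space \<Rightarrow> real"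
  assumes [measurable]: "f \<in> borel_measurable borel" and B: "\<And>x. \<bar>f x\<bar> \<le> B"
    and g: "integrable lborel g"
  shows "integrable lborel (\<lambda>y. f (x - y) * g y)"
  by (rule integrable_bdd_mult[where B=B]) (use B g in auto)

lemma abs_conv_le:
  fixes f g :: "'a::euclidean_space \<Rightarrow> real"
  assumes [measurable]: "f \<in> borel_measurable borel" and B: "\<And>x. \<bar>f x\<bar> \<le> B"
    and g: "integrable lborel g"
  shows "\<bar>conv f g x\<bar> \<le> B * L1norm g"
proof -
  have "\<bar>conv f g x\<bar> \<le> (\<integral>y. \<bar>f (x - y) * g y\<bar> \<partial>lborel)"
    unfolding conv_def by (rule integral_abs_bound)
  also have "... \<le> (\<integral>y. B * \<bar>g y\<bar> \<partial>lborel)"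
    using integrable_abs[OF integrable_conv_integrand[OF assms]] g B
    by (intro integral_mono) (auto simp: abs_mult intro!: mult_right_mono)
  finally show ?thesis by (simp add: L1norm_def)
qed

lemma borel_measurable_conv [measurable]:
  fixes f g :: "'a::euclidean_space \<Rightarrow> real"
  assumes [measurable]: "f \<in> borel_measurable borel" "g \<in> borel_measurable borel"
  shows "conv f g \<in> borel_measurable borel"
  unfolding conv_def by measurable

lemma integrable_conv_prod:
  fixes f g :: "'a::euclidean_space \<Rightarrow> real"
  assumes f: "integrable lborel f" and g: "integrable lborel g"
  shows "integrable (lborel \<Otimes>\<^sub>M lborel) (\<lambda>(y, x). f (x - y) * g y)"
proof (rule lborel_pair.Fubini_integrable)
  have [measurable]: "f \<in> borel_measurable borel" "g \<in> borel_measurable borel"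
    using f g by auto
  show "(\<lambda>(y, x). f (x - y) * g y) \<in> borel_measurable (lborel \<Otimes>\<^sub>M lborel)" by measurable
  have "(\<integral>x. norm (f (x - y) * g y) \<partial>lborel) = L1norm f * \<bar>g y\<bar>" for y
    using integral_translate[of "\<lambda>x. \<bar>f x\<bar>" y] by (simp add: abs_mult L1norm_def)
  then show "integrable lborel (\<lambda>y. \<integral>x. norm (case (y, x) of (y, x) \<Rightarrow> f (x - y) * g y) \<partial>lborel)"
    using g by simp
  show "AE y in lborel. integrable lborel (\<lambda>x. case (y, x) of (y, x) \<Rightarrow> f (x - y) * g y)"
    using f integrable_translate_iff[of f] by (intro AE_I2) auto
qed

lemma integrable_conv:
  fixes f g :: "'a::euclidean_space \<Rightarrow> real"
  assumes f: "integrable lborel f" and g: "integrable lborel g"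
  shows "integrable lborel (conv f g)"
  using lborel_pair.integrable_snd[OF integrable_conv_prod[OF assms]]
  by (simp add: conv_def[abs_def])

lemma L1norm_conv:
  fixes f g :: "'a::euclidean_space \<Rightarrow> real"
  assumes f: "integrable lborel f" and g: "integrable lborel g"
  shows "L1norm (conv f g) \<le> L1norm f * L1norm g"
proof -
  have [measurable]: "f \<in> borel_measurable borel" "g \<in> borel_measurable borel"
    using f g by auto
  have i: "integrable (lborel \<Otimes>\<^sub>M lborel) (\<lambda>(y, x). \<bar>f (x - y)\<bar> * \<bar>g y\<bar>)"
    using integrable_conv_prod[of "\<lambda>x. \<bar>f x\<bar>" "\<lambda>x. \<bar>g x\<bar>"] f g by simp
  have "L1norm (conv f g) \<le> (\<integral>x. (\<integral>y. \<bar>f (x - y)\<bar> * \<bar>g y\<bar> \<partial>lborel) \<partial>lborel)"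
    unfolding L1norm_def
  proof (rule integral_mono)
    show "integrable lborel (\<lambda>x. \<bar>conv f g x\<bar>)" using integrable_conv[OF assms] by simp
    show "integrable lborel (\<lambda>x. \<integral>y. \<bar>f (x - y)\<bar> * \<bar>g y\<bar> \<partial>lborel)"
      using lborel_pair.integrable_snd[OF i] by simp
    show "\<bar>conv f g x\<bar> \<le> (\<integral>y. \<bar>f (x - y)\<bar> * \<bar>g y\<bar> \<partial>lborel)" for x
      unfolding conv_def using integral_abs_bound[of lborel "\<lambda>y. f (x - y) * g y"]
      by (simp add: abs_mult)
  qed
  also have "... = (\<integral>y. (\<integral>x. \<bar>f (x - y)\<bar> * \<bar>g y\<bar> \<partial>lborel) \<partial>lborel)"
    using lborel_pair.Fubini_integral[OF i] by simp
  also have "... = L1norm f * L1norm g"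
    using integral_translate[of "\<lambda>x. \<bar>f x\<bar>"] by (simp add: L1norm_def)
  finally show ?thesis .
qed

lemma conv_bdd_L1:
  assumes "f \<in> bdd_L1" "g \<in> bdd_L1"
  shows "conv f g \<in> bdd_L1"
proof -
  obtain B where "\<And>x. \<bar>f x\<bar> \<le> B" using bdd_L1_bound[OF assms(1)] by blast
  then have "\<forall>x. \<bar>conv f g x\<bar> \<le> B * L1norm g"
    using abs_conv_le assms by (metis bdd_L1_integrable bdd_L1_measurable)
  then show ?thesis
    using assms integrable_conv[of f g] by (auto simp: bdd_L1_def)
qed

lemma conv_commute:
  fixes f g :: "'a::euclidean_space \<Rightarrow> real"
  assumes [measurable]: "f \<in> borel_measurable borel" "g \<in> borel_measurable borel"
  shows "conv f g = conv g f"
proof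
  fix x
  show "conv f g x = conv g f x"
    using integral_reflect[of "\<lambda>y. f (x - y) * g y" x] by (simp add: conv_def mult.commute)
qed

lemma conv_assoc:
  assumes f: "f \<in> bdd_L1" and g: "g \<in> bdd_L1" and h: "h \<in> bdd_L1"
  shows "conv (conv f g) h = conv f (conv g h)"
proof
  fix x
  note [measurable] = bdd_L1_measurable[OF f] bdd_L1_measurable[OF g] bdd_L1_measurable[OF h]
  obtain B where B: "\<And>x. \<bar>f x\<bar> \<le> B" using bdd_L1_bound[OF f] by blast
  have i: "integrable (lborel \<Otimes>\<^sub>M lborel) (\<lambda>(z, y). f (x - y) * (g (y - z) * h z))"
  proof (rule Bochner_Integration.integrable_bound)
    show "integrable (lborel \<Otimes>\<^sub>M lborel) (\<lambda>p. B * (case p of (z, y) \<Rightarrow> g (y - z) * h z))"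
      using integrable_conv_prod[OF bdd_L1_integrable[OF g] bdd_L1_integrable[OF h]] by simp
    show "AE p in lborel \<Otimes>\<^sub>M lborel. norm (case p of (z, y) \<Rightarrow> f (x - y) * (g (y - z) * h z))
        \<le> norm (B * (case p of (z, y) \<Rightarrow> g (y - z) * h z))"
      by (intro AE_I2) (auto simp: abs_mult intro!: mult_right_mono order_trans[OF B])
  qed measurable
  have "conv f (conv g h) x = (\<integral>y. (\<integral>z. f (x - y) * (g (y - z) * h z) \<partial>lborel) \<partial>lborel)"
    by (simp add: conv_def)
  also have "... = (\<integral>z. (\<integral>y. f (x - y) * (g (y - z) * h z) \<partial>lborel) \<partial>lborel)"
    using lborel_pair.Fubini_integral[OF i] by simp
  also have "... = (\<integral>z. conv f g (x - z) * h z \<partial>lborel)"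
  proof (rule Bochner_Integration.integral_cong)
    fix z
    have "(\<integral>y. f (x - y) * (g (y - z) * h z) \<partial>lborel)
        = (\<integral>y. (f (x - z - (y - z)) * g (y - z)) * h z \<partial>lborel)"
      by (simp add: mult.assoc)
    also have "... = conv f g (x - z) * h z"
      unfolding conv_def using integral_translate[of "\<lambda>y. f (x - z - y) * g y" z] by simp
    finally show "(\<integral>y. f (x - y) * (g (y - z) * h z) \<partial>lborel) = conv f g (x - z) * h z" .
  qed simp
  finally show "conv (conv f g) h x = conv f (conv g h) x" by (simp add: conv_def)
qed

lemma reflection_bdd_L1: "f \<in> bdd_L1 \<Longrightarrow> reflection f \<in> bdd_L1"
  using integrable_reflect_iff[of f 0] by (auto simp: bdd_L1_def reflection_def[abs_def])

lemma L1norm_reflection: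
  assumes [measurable]: "f \<in> borel_measurable borel"
  shows "L1norm (reflection f) = L1norm f"
  using integral_reflect[of "\<lambda>x. \<bar>f x\<bar>" 0] by (simp add: L1norm_def reflection_def)

lemma reflection_reflection [simp]: "reflection (reflection f) = f"
  by (simp add: reflection_def fun_eq_iff)

lemma reflection_conv:
  assumes [measurable]: "f \<in> borel_measurable borel" "g \<in> borel_measurable borel"
  shows "reflection (conv f g) = conv (reflection f) (reflection g)"
proof
  fix x
  show "reflection (conv f g) x = conv (reflection f) (reflection g) x"
    using integral_reflect[of "\<lambda>y. f (- x - y) * g y" 0]
    by (simp add: conv_def reflection_def add.commute)
qed

lemma L1norm_nonneg: "0 \<le> L1norm f"
  by (simp add: L1norm_def)

lemma L2norm_nonneg: "0 \<le> L2norm f"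
  by (simp add: L2norm_def)

lemma L2norm_power2: "(L2norm f)\<^sup>2 = (\<integral>x. (f x)\<^sup>2 \<partial>lborel)"
  by (simp add: L2norm_def)

lemma integrable_square:
  assumes "f \<in> bdd_L1"
  shows "integrable lborel (\<lambda>x. (f x)\<^sup>2)"
proof -
  obtain B where B: "\<And>x. \<bar>f x\<bar> \<le> B" using bdd_L1_bound[OF assms] by blast
  show ?thesis
    using integrable_bdd_mult[OF bdd_L1_measurable[OF assms] B bdd_L1_integrable[OF assms]]
    by (simp add: power2_eq_square)
qed

lemma integrable_mult_of_squares:
  fixes f g :: "'a \<Rightarrow> real"
  assumes [measurable]: "f \<in> borel_measurable M" "g \<in> borel_measurable M"
    and i: "integrable M (\<lambda>x. (f x)\<^sup>2)" "integrable M (\<lambda>x. (g x)\<^sup>2)"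
  shows "integrable M (\<lambda>x. f x * g x)"
proof (rule Bochner_Integration.integrable_bound[where f="\<lambda>x. (f x)\<^sup>2 + (g x)\<^sup>2"])
  have "\<bar>a * b\<bar> \<le> a\<^sup>2 + b\<^sup>2" for a b :: real
  proof -
    have "2 * (\<bar>a\<bar> * \<bar>b\<bar>) \<le> a\<^sup>2 + b\<^sup>2"
      using sum_squares_bound[of "\<bar>a\<bar>" "\<bar>b\<bar>"] by (simp add: mult.assoc)
    moreover have "0 \<le> \<bar>a\<bar> * \<bar>b\<bar>" by simp
    ultimately show ?thesis unfolding abs_mult by linarith
  qed
  then show "AE x in M. norm (f x * g x) \<le> norm ((f x)\<^sup>2 + (g x)\<^sup>2)" by auto
qed (use i in auto)

lemma Cauchy_Schwarz_integral:
  fixes f g :: "'a \<Rightarrow> real"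
  assumes [measurable]: "f \<in> borel_measurable M" "g \<in> borel_measurable M"
    and i: "integrable M (\<lambda>x. (f x)\<^sup>2)" "integrable M (\<lambda>x. (g x)\<^sup>2)"
  shows "(\<integral>x. f x * g x \<partial>M)\<^sup>2 \<le> (\<integral>x. (f x)\<^sup>2 \<partial>M) * (\<integral>x. (g x)\<^sup>2 \<partial>M)"
proof -
  have ifg: "integrable M (\<lambda>x. f x * g x)" using assms by (rule integrable_mult_of_squares)
  define a b c where "a = (\<integral>x. (f x)\<^sup>2 \<partial>M)" "b = (\<integral>x. f x * g x \<partial>M)" "c = (\<integral>x. (g x)\<^sup>2 \<partial>M)"
  have pos: "0 \<le> a + 2 * t * b + t\<^sup>2 * c" for t
  proof -
    have "0 \<le> (\<integral>x. (f x + t * g x)\<^sup>2 \<partial>M)" by simp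
    also have "... = (\<integral>x. (f x)\<^sup>2 + (2 * t) * (f x * g x) + t\<^sup>2 * (g x)\<^sup>2 \<partial>M)"
      by (simp add: power2_eq_square algebra_simps)
    also have "... = a + 2 * t * b + t\<^sup>2 * c" using i ifg by (simp add: a_b_c_def)
    finally show ?thesis .
  qed
  have "b\<^sup>2 \<le> a * c"
  proof (cases "c = 0")
    case True
    have "b = 0"
    proof (rule ccontr)
      assume "b \<noteq> 0"
      then show False using pos[of "- (a + 1) / (2 * b)"] True by (simp add: field_simps)
    qed
    then show ?thesis using True by simp
  next
    case False
    moreover have "0 \<le> c" by (simp add: a_b_c_def)
    ultimately have c: "c > 0" by simp
    have "0 \<le> a - b\<^sup>2 / c"
      using pos[of "- b / c"] c by (simp add: field_simps power2_eq_square)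
    then show ?thesis using c by (simp add: field_simps)
  qed
  then show ?thesis by (simp add: a_b_c_def)
qed

lemma integral_mult_le_L2norm:
  assumes f: "f \<in> bdd_L1" and g: "g \<in> bdd_L1"
  shows "(\<integral>x. f x * g x \<partial>lborel) \<le> L2norm f * L2norm g"
proof (rule power2_le_imp_le)
  show "(\<integral>x. f x * g x \<partial>lborel)\<^sup>2 \<le> (L2norm f * L2norm g)\<^sup>2"
    using Cauchy_Schwarz_integral[of f lborel g] integrable_square[OF f] integrable_square[OF g]
      bdd_L1_measurable[OF f] bdd_L1_measurable[OF g]
    by (simp add: power_mult_distrib L2norm_power2)
qed (simp add: L2norm_nonneg)

lemma bdd_L1_zero: "(\<lambda>_. 0) \<in> bdd_L1"
  by (auto simp: bdd_L1_def)

lemma bdd_L1_add: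
  assumes "f \<in> bdd_L1" "g \<in> bdd_L1"
  shows "(\<lambda>x. f x + g x) \<in> bdd_L1"
proof -
  obtain B C where "\<And>x. \<bar>f x\<bar> \<le> B" "\<And>x. \<bar>g x\<bar> \<le> C" using assms by (meson bdd_L1_bound)
  then have "\<forall>x. \<bar>f x + g x\<bar> \<le> B + C" by (meson abs_triangle_ineq add_mono order_trans)
  then show ?thesis using assms by (auto simp: bdd_L1_def)
qed

lemma bdd_L1_cmult:
  assumes "f \<in> bdd_L1"
  shows "(\<lambda>x. c * f x) \<in> bdd_L1"
proof -
  obtain B where "\<And>x. \<bar>f x\<bar> \<le> B" using assms by (meson bdd_L1_bound)
  then have "\<forall>x. \<bar>c * f x\<bar> \<le> \<bar>c\<bar> * B" by (simp add: abs_mult mult_left_mono)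
  then show ?thesis using assms by (auto simp: bdd_L1_def)
qed

lemma bdd_L1_sum:
  assumes "\<And>i. i \<in> I \<Longrightarrow> f i \<in> bdd_L1"
  shows "(\<lambda>x. \<Sum>i\<in>I. f i x) \<in> bdd_L1"
  using assms by (induction I rule: infinite_finite_induct) (auto simp: bdd_L1_zero bdd_L1_add)

lemma L2norm_add:
  assumes f: "f \<in> bdd_L1" and g: "g \<in> bdd_L1"
  shows "L2norm (\<lambda>x. f x + g x) \<le> L2norm f + L2norm g"
proof (rule power2_le_imp_le)
  note i = integrable_square[OF f] integrable_square[OF g]
  have ifg: "integrable lborel (\<lambda>x. f x * g x)"
    by (rule integrable_mult_of_squares) (use f g i bdd_L1_measurable in auto)
  have "(L2norm (\<lambda>x. f x + g x))\<^sup>2 = (\<integral>x. (f x)\<^sup>2 + 2 * (f x * g x) + (g x)\<^sup>2 \<partial>lborel)"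
    by (simp add: L2norm_power2 power2_sum algebra_simps)
  also have "... = (L2norm f)\<^sup>2 + 2 * (\<integral>x. f x * g x \<partial>lborel) + (L2norm g)\<^sup>2"
    using i ifg by (simp add: L2norm_power2)
  also have "... \<le> (L2norm f + L2norm g)\<^sup>2"
    using integral_mult_le_L2norm[OF f g] by (simp add: power2_sum)
  finally show "(L2norm (\<lambda>x. f x + g x))\<^sup>2 \<le> (L2norm f + L2norm g)\<^sup>2" .
qed (simp add: L2norm_nonneg)

lemma L2norm_sum:
  assumes "finite I" "\<And>i. i \<in> I \<Longrightarrow> f i \<in> bdd_L1"
  shows "L2norm (\<lambda>x. \<Sum>i\<in>I. f i x) \<le> (\<Sum>i\<in>I. L2norm (f i))"
  using assms
proof (induction I rule: finite_induct)
  case (insert i I)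
  then have "L2norm (\<lambda>x. f i x + (\<Sum>i\<in>I. f i x)) \<le> L2norm (f i) + L2norm (\<lambda>x. \<Sum>i\<in>I. f i x)"
    by (intro L2norm_add bdd_L1_sum) auto
  then show ?case using insert by simp
qed (simp add: L2norm_def)

lemma L2norm_cmult: "L2norm (\<lambda>x. c * f x) = \<bar>c\<bar> * L2norm f"
  by (simp add: L2norm_def power_mult_distrib real_sqrt_mult)

lemma L1norm_cmult: "L1norm (\<lambda>x. c * f x) = \<bar>c\<bar> * L1norm f"
  by (simp add: L1norm_def abs_mult)

lemma conv_cmult_left: "conv (\<lambda>x. c * f x) g = (\<lambda>x. c * conv f g x)"
  by (simp add: conv_def fun_eq_iff mult.assoc)

lemma conv_cmult_right: "conv f (\<lambda>x. c * g x) = (\<lambda>x. c * conv f g x)"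
  by (simp add: conv_def fun_eq_iff mult.left_commute)

lemma conv_sum_left:
  assumes "\<And>i. i \<in> I \<Longrightarrow> f i \<in> bdd_L1" "g \<in> bdd_L1"
  shows "conv (\<lambda>x. \<Sum>i\<in>I. f i x) g = (\<lambda>x. \<Sum>i\<in>I. conv (f i) g x)"
proof
  fix x
  have "integrable lborel (\<lambda>y. f i (x - y) * g y)" if "i \<in> I" for i
    using bdd_L1_bound[OF assms(1)[OF that]] integrable_conv_integrand
      bdd_L1_integrable[OF assms(2)] bdd_L1_measurable[OF assms(1)[OF that]] by metis
  then show "conv (\<lambda>x. \<Sum>i\<in>I. f i x) g x = (\<Sum>i\<in>I. conv (f i) g x)"
    by (simp add: conv_def sum_distrib_right Bochner_Integration.integral_sum)
qed

lemma conv_sum_right: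
  assumes "\<And>i. i \<in> I \<Longrightarrow> f i \<in> bdd_L1" "g \<in> bdd_L1"
  shows "conv g (\<lambda>x. \<Sum>i\<in>I. f i x) = (\<lambda>x. \<Sum>i\<in>I. conv g (f i) x)"
proof -
  have "conv g (\<lambda>x. \<Sum>i\<in>I. f i x) = conv (\<lambda>x. \<Sum>i\<in>I. f i x) g"
    using assms bdd_L1_sum[of I f] by (intro conv_commute bdd_L1_measurable) auto
  also have "... = (\<lambda>x. \<Sum>i\<in>I. conv (f i) g x)" using assms by (rule conv_sum_left)
  also have "... = (\<lambda>x. \<Sum>i\<in>I. conv g (f i) x)"
    using assms by (intro ext sum.cong refl) (metis bdd_L1_measurable conv_commute)
  finally show ?thesis .
qed

lemma conv_adjoint:
  assumes k: "k \<in> bdd_L1" and f: "f \<in> bdd_L1" and g: "g \<in> bdd_L1"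
  shows "(\<integral>x. conv k f x * g x \<partial>lborel) = (\<integral>x. f x * conv (reflection k) g x \<partial>lborel)"
proof -
  note [measurable] = bdd_L1_measurable[OF k] bdd_L1_measurable[OF f] bdd_L1_measurable[OF g]
  obtain B where B: "\<And>x. \<bar>g x\<bar> \<le> B" using bdd_L1_bound[OF g] by blast
  have i: "integrable (lborel \<Otimes>\<^sub>M lborel) (\<lambda>(y, x). g x * (k (x - y) * f y))"
  proof (rule Bochner_Integration.integrable_bound)
    show "integrable (lborel \<Otimes>\<^sub>M lborel) (\<lambda>p. B * (case p of (y, x) \<Rightarrow> k (x - y) * f y))"
      using integrable_conv_prod[OF bdd_L1_integrable[OF k] bdd_L1_integrable[OF f]] by simp
    show "AE p in lborel \<Otimes>\<^sub>M lborel. norm (case p of (y, x) \<Rightarrow> g x * (k (x - y) * f y))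
        \<le> norm (B * (case p of (y, x) \<Rightarrow> k (x - y) * f y))"
      by (intro AE_I2) (auto simp: abs_mult intro!: mult_right_mono order_trans[OF B])
  qed measurable
  have "(\<integral>x. conv k f x * g x \<partial>lborel) = (\<integral>x. (\<integral>y. g x * (k (x - y) * f y) \<partial>lborel) \<partial>lborel)"
    by (simp add: conv_def mult.commute)
  also have "... = (\<integral>y. (\<integral>x. g x * (k (x - y) * f y) \<partial>lborel) \<partial>lborel)"
    using lborel_pair.Fubini_integral[OF i] by simp
  also have "... = (\<integral>y. f y * (\<integral>x. k (x - y) * g x \<partial>lborel) \<partial>lborel)"
    by (simp add: mult_ac flip: integral_mult_right_zero)
  finally show ?thesis by (simp add: conv_def reflection_def)
qed

text \<open>The identity \<open>\<parallel>T\<parallel>\<^sup>2 = \<parallel>T\<^sup>* T\<parallel>\<close>, for \<open>T\<close> the convolution with \<open>k\<close>.\<close>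

lemma L2norm_conv_power2:
  assumes k: "k \<in> bdd_L1" and f: "f \<in> bdd_L1"
  shows "(L2norm (conv k f))\<^sup>2 \<le> L2norm (conv (conv (reflection k) k) f) * L2norm f"
proof -
  note kf = conv_bdd_L1[OF k f] and rk = reflection_bdd_L1[OF k]
  have "(L2norm (conv k f))\<^sup>2 = (\<integral>x. conv k f x * conv k f x \<partial>lborel)"
    by (simp only: L2norm_power2) (simp add: power2_eq_square)
  also have "... = (\<integral>x. f x * conv (reflection k) (conv k f) x \<partial>lborel)"
    by (rule conv_adjoint[OF k f kf])
  also have "... = (\<integral>x. conv (conv (reflection k) k) f x * f x \<partial>lborel)"
    by (simp add: conv_assoc[OF rk k f] mult.commute)
  also have "... \<le> L2norm (conv (conv (reflection k) k) f) * L2norm f"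
    by (intro integral_mult_le_L2norm conv_bdd_L1 rk k f)
  finally show ?thesis .
qed

text \<open>
  Young's inequality. By Cauchy--Schwarz, \<open>(k * f)\<^sup>2\<close> is at most
  \<open>\<parallel>k\<parallel>\<^sub>1 (\<bar>k\<bar> * f\<^sup>2)\<close> pointwise.
\<close>

lemma L2norm_conv:
  assumes k: "k \<in> bdd_L1" and f: "f \<in> bdd_L1"
  shows "L2norm (conv k f) \<le> L1norm k * L2norm f"
proof (rule power2_le_imp_le)
  note [measurable] = bdd_L1_measurable[OF k] bdd_L1_measurable[OF f]
  obtain B where B: "\<And>x. \<bar>k x\<bar> \<le> B" using bdd_L1_bound[OF k] by blast
  have ik: "integrable lborel (\<lambda>y. \<bar>k (x - y)\<bar>)" for x
    using bdd_L1_integrable[OF k] integrable_reflect_iff[of k x] by simp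
  have ikf: "integrable lborel (\<lambda>y. \<bar>k (x - y)\<bar> * (f y)\<^sup>2)" for x
    using integrable_conv_integrand[of "\<lambda>x. \<bar>k x\<bar>" B "\<lambda>y. (f y)\<^sup>2" x] B integrable_square[OF f]
    by simp
  have pt: "(conv k f x)\<^sup>2 \<le> L1norm k * conv (\<lambda>x. \<bar>k x\<bar>) (\<lambda>y. (f y)\<^sup>2) x" for x
  proof -
    have "(conv k f x)\<^sup>2 = \<bar>conv k f x\<bar>\<^sup>2" by simp
    also have "... \<le> (\<integral>y. \<bar>k (x - y) * f y\<bar> \<partial>lborel)\<^sup>2"
      unfolding conv_def by (intro power_mono integral_abs_bound) simp
    also have "... = (\<integral>y. sqrt \<bar>k (x - y)\<bar> * (sqrt \<bar>k (x - y)\<bar> * \<bar>f y\<bar>) \<partial>lborel)\<^sup>2"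
      by (simp add: abs_mult flip: mult.assoc)
    also have "... \<le> (\<integral>y. (sqrt \<bar>k (x - y)\<bar>)\<^sup>2 \<partial>lborel)
        * (\<integral>y. (sqrt \<bar>k (x - y)\<bar> * \<bar>f y\<bar>)\<^sup>2 \<partial>lborel)"
      using ik ikf by (intro Cauchy_Schwarz_integral) (auto simp: power_mult_distrib)
    also have "... = (\<integral>y. \<bar>k (x - y)\<bar> \<partial>lborel) * conv (\<lambda>x. \<bar>k x\<bar>) (\<lambda>y. (f y)\<^sup>2) x"
      by (simp add: power_mult_distrib conv_def)
    also have "(\<integral>y. \<bar>k (x - y)\<bar> \<partial>lborel) = L1norm k"
      using integral_reflect[of "\<lambda>y. \<bar>k y\<bar>" x] by (simp add: L1norm_def)
    finally show ?thesis .
  qed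
  have iak: "integrable lborel (\<lambda>x. \<bar>k x\<bar>)" using bdd_L1_integrable[OF k] by simp
  note isq = integrable_square[OF f]
  have "(L2norm (conv k f))\<^sup>2 \<le> (\<integral>x. L1norm k * conv (\<lambda>x. \<bar>k x\<bar>) (\<lambda>y. (f y)\<^sup>2) x \<partial>lborel)"
    unfolding L2norm_power2 using pt integrable_conv[OF iak isq]
    by (intro integral_mono integrable_square conv_bdd_L1 k f) auto
  also have "... \<le> L1norm k * L1norm (conv (\<lambda>x. \<bar>k x\<bar>) (\<lambda>y. (f y)\<^sup>2))"
    using integral_mono[OF integrable_conv[OF iak isq] integrable_abs[OF integrable_conv[OF iak isq]]]
    by (simp add: L1norm_nonneg mult_left_mono L1norm_def)
  also have "... \<le> L1norm k * (L1norm (\<lambda>x. \<bar>k x\<bar>) * L1norm (\<lambda>y. (f y)\<^sup>2))"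
    by (intro mult_left_mono L1norm_conv iak isq L1norm_nonneg)
  also have "... = (L1norm k * L2norm f)\<^sup>2"
    by (simp add: power_mult_distrib L2norm_power2) (simp add: L1norm_def power2_eq_square)
  finally show "(L2norm (conv k f))\<^sup>2 \<le> (L1norm k * L2norm f)\<^sup>2" .
qed (simp add: L1norm_nonneg L2norm_nonneg)

section \<open>Almost orthogonality\<close>

lemma conv_interchange:
  assumes "f \<in> bdd_L1" "g \<in> bdd_L1" "h \<in> bdd_L1" "k \<in> bdd_L1"
  shows "conv (conv f g) (conv h k) = conv (conv f h) (conv g k)"
proof -
  have "conv (conv f g) (conv h k) = conv f (conv g (conv h k))"
    using assms by (simp add: conv_assoc conv_bdd_L1)
  also have "conv g (conv h k) = conv (conv h g) k"
    using assms by (simp add: conv_assoc[symmetric] conv_commute[of g h] bdd_L1_measurable)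
  also have "... = conv h (conv g k)" using assms by (simp add: conv_assoc)
  also have "conv f ... = conv (conv f h) (conv g k)"
    using assms by (simp add: conv_assoc conv_bdd_L1)
  finally show ?thesis .
qed

text \<open>
  The family is indexed by all integers, with zeros outside of \<open>{0..<N}\<close>, so that indices
  can be shifted freely. The decay is written as a square because its square root is what gets summed.
\<close>

definition almost_orthogonal :: "int \<Rightarrow> (int \<Rightarrow> real) \<Rightarrow> (int \<Rightarrow> 'a::euclidean_space \<Rightarrow> real) \<Rightarrow> bool" where
  "almost_orthogonal N a k \<longleftrightarrow>
    (\<forall>i. k i \<in> bdd_L1) \<and> (\<forall>i. i \<notin> {0..<N} \<longrightarrow> k i = (\<lambda>_. 0)) \<and>
    (\<forall>i j. L1norm (conv (reflection (k i)) (k j)) \<le> (a (i - j))\<^sup>2)"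

text \<open>
  Convolutions commute, so \<open>T\<^sub>i\<^sub>+\<^sub>d T\<^sub>i\<^sup>* T\<^sub>j\<^sub>+\<^sub>d\<^sup>* T\<^sub>j\<close> can be bracketed in two ways; the
  geometric mean of the two resulting bounds is \<open>a (i - j)\<^sup>2 a(d)\<^sup>2\<close>.
\<close>

lemma almost_orthogonal_products:
  assumes k: "almost_orthogonal N a k" and a: "\<And>d. 0 < a d" "\<And>d. a (- d) = a d"
  shows "almost_orthogonal N a (\<lambda>j x. inverse (a d) * conv (reflection (k (j + d))) (k j) x)"
  unfolding almost_orthogonal_def
proof (intro conjI allI impI)
  have V: "k i \<in> bdd_L1" "reflection (k i) \<in> bdd_L1" for i
    using k by (auto simp: almost_orthogonal_def reflection_bdd_L1)
  note VM = V[THEN bdd_L1_measurable]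
  note C = conv_bdd_L1
  have L: "L1norm (conv (reflection (k i)) (k j)) \<le> (a (i - j))\<^sup>2" for i j
    using k by (auto simp: almost_orthogonal_def)
  have L': "L1norm (conv (k i) (reflection (k j))) \<le> (a (i - j))\<^sup>2" for i j
  proof -
    have "conv (k i) (reflection (k j)) = reflection (conv (reflection (k i)) (k j))"
      using VM by (simp add: reflection_conv)
    then show ?thesis using L L1norm_reflection[OF bdd_L1_measurable[OF C[OF V(2) V(1)]]] by simp
  qed
  show "(\<lambda>x. inverse (a d) * conv (reflection (k (j + d))) (k j) x) \<in> bdd_L1" for j
    by (intro bdd_L1_cmult C V)
  show "(\<lambda>x. inverse (a d) * conv (reflection (k (j + d))) (k j) x) = (\<lambda>_. 0)"
    if "j \<notin> {0..<N}" for j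
    using k that by (auto simp: almost_orthogonal_def conv_def)
  fix i j
  let ?l = "\<lambda>j. conv (reflection (k (j + d))) (k j)"
  have r: "reflection (?l i) = conv (k (i + d)) (reflection (k i))"
    using VM by (simp add: reflection_conv)
  define M where "M = L1norm (conv (reflection (?l i)) (?l j))"
  have "M \<le> L1norm (conv (k (i + d)) (reflection (k i))) * L1norm (?l j)"
    unfolding M_def r by (intro L1norm_conv bdd_L1_integrable C V)
  also have "... \<le> (a d)\<^sup>2 * (a d)\<^sup>2"
    using L'[of "i + d" i] L[of "j + d" j] by (intro mult_mono L1norm_nonneg) auto
  finally have 1: "M \<le> (a d)\<^sup>2 * (a d)\<^sup>2" .
  have "M = L1norm (conv (conv (k (i + d)) (reflection (k (j + d)))) (conv (reflection (k i)) (k j)))"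
    unfolding M_def r by (simp add: conv_interchange V)
  also have "... \<le> L1norm (conv (k (i + d)) (reflection (k (j + d)))) * L1norm (conv (reflection (k i)) (k j))"
    by (intro L1norm_conv bdd_L1_integrable C V)
  also have "... \<le> (a (i - j))\<^sup>2 * (a (i - j))\<^sup>2"
    using L'[of "i + d" "j + d"] L[of i j] by (intro mult_mono L1norm_nonneg) auto
  finally have 2: "M \<le> (a (i - j))\<^sup>2 * (a (i - j))\<^sup>2" .
  have "M \<le> (a d)\<^sup>2 * (a (i - j))\<^sup>2"
  proof (cases "a d \<le> a (i - j)")
    case True
    then have "(a d)\<^sup>2 \<le> (a (i - j))\<^sup>2" using a(1)[of d] by (intro power_mono) auto
    then show ?thesis using 1 by (meson mult_left_mono order_trans zero_le_power2)
  next
    case False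
    then have "(a (i - j))\<^sup>2 \<le> (a d)\<^sup>2" using a(1)[of "i - j"] by (intro power_mono) auto
    then show ?thesis using 2 by (meson mult_right_mono order_trans zero_le_power2)
  qed
  moreover have "L1norm (conv (reflection (\<lambda>x. inverse (a d) * ?l i x)) (\<lambda>x. inverse (a d) * ?l j x))
      = (inverse (a d))\<^sup>2 * M"
  proof -
    have "reflection (\<lambda>x. inverse (a d) * ?l i x) = (\<lambda>x. inverse (a d) * reflection (?l i) x)"
      by (simp add: reflection_def fun_eq_iff)
    then show ?thesis
      using a(1)[of d] by (simp add: conv_cmult_left conv_cmult_right L1norm_cmult M_def power2_eq_square)
  qed
  moreover have "(inverse (a d))\<^sup>2 * M \<le> (a (i - j))\<^sup>2" if "M \<le> (a d)\<^sup>2 * (a (i - j))\<^sup>2"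
    using a(1)[of d] that by (simp add: power_inverse divide_inverse[symmetric] pos_divide_le_eq mult.commute)
  ultimately show "L1norm (conv (reflection (\<lambda>x. inverse (a d) * ?l i x)) (\<lambda>x. inverse (a d) * ?l j x))
      \<le> (a (i - j))\<^sup>2" by simp
qed

text \<open>
  The bound is uniform over all families with the given decay, since the next lemma applies it to the
  families of products \<open>T\<^sub>j\<^sub>+\<^sub>d\<^sup>* T\<^sub>j\<close> instead of the
  family that it starts from.
\<close>

definition uniform_L2_bound :: "int \<Rightarrow> (int \<Rightarrow> real) \<Rightarrow> 'a::euclidean_space itself \<Rightarrow> real \<Rightarrow> bool" where
  "uniform_L2_bound N a _ C \<longleftrightarrow> (\<forall>k :: int \<Rightarrow> 'a \<Rightarrow> real. \<forall>f\<in>bdd_L1. almost_orthogonal N a k \<longrightarrow>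
    L2norm (conv (\<lambda>x. \<Sum>i\<in>{0..<N}. k i x) f) \<le> C * L2norm f)"

lemma sum_shift_diagonal:
  fixes F :: "int \<Rightarrow> 'b::comm_monoid_add"
  assumes j: "j \<in> {0..<N}" and z: "\<And>i. i \<notin> {0..<N} \<Longrightarrow> F i = 0"
  shows "(\<Sum>i\<in>{0..<N}. F i) = (\<Sum>d\<in>{-N..N}. F (j + d))"
proof -
  have "(\<Sum>d\<in>{-N..N}. F (j + d)) = (\<Sum>i\<in>(+) j ` {-N..N}. F i)"
    by (subst sum.reindex) auto
  also have "... = (\<Sum>i\<in>{0..<N}. F i)"
    using j z by (intro sum.mono_neutral_right) (auto simp: image_iff intro!: bexI[of _ "_ - j"])
  finally show ?thesis by simp
qed

text \<open>
  With \<open>T = \<Sum>\<^sub>i T\<^sub>i\<close>, group \<open>T\<^sup>* T\<close> by the difference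
  \<open>d\<close> of the indices. The terms with difference \<open>d\<close> are \<open>a(d)\<close>
  times an almost orthogonal family, which \<open>C\<close> bounds, and
  \<open>\<parallel>T\<parallel>\<^sup>2 = \<parallel>T\<^sup>* T\<parallel>\<close>.
\<close>

lemma uniform_L2_bound_improve:
  assumes C: "uniform_L2_bound N a TYPE('a::euclidean_space) C" and C0: "0 \<le> C"
    and a: "\<And>d. 0 < a d" "\<And>d. a (- d) = a d"
  shows "uniform_L2_bound N a TYPE('a) (sqrt ((\<Sum>d\<in>{-N..N}. a d) * C))"
  unfolding uniform_L2_bound_def
proof (intro allI ballI impI)
  fix k :: "int \<Rightarrow> 'a \<Rightarrow> real" and f :: "'a \<Rightarrow> real"
  assume f: "f \<in> bdd_L1" and k: "almost_orthogonal N a k"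
  have V: "k i \<in> bdd_L1" "reflection (k i) \<in> bdd_L1" for i
    using k by (auto simp: almost_orthogonal_def reflection_bdd_L1)
  have Z: "k i = (\<lambda>_. 0)" if "i \<notin> {0..<N}" for i
    using k that by (auto simp: almost_orthogonal_def)
  define S where "S = (\<lambda>x. \<Sum>i\<in>{0..<N}. k i x)"
  define l where "l d j x = inverse (a d) * conv (reflection (k (j + d))) (k j) x" for d j x
  have lV: "l d j \<in> bdd_L1" for d j
    unfolding l_def[abs_def] by (intro bdd_L1_cmult conv_bdd_L1 V)
  define G where "G d = (\<lambda>x. \<Sum>j\<in>{0..<N}. l d j x)" for d
  have GV: "G d \<in> bdd_L1" for d unfolding G_def by (intro bdd_L1_sum lV)
  have SV: "S \<in> bdd_L1" unfolding S_def by (intro bdd_L1_sum V)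
  have rS: "reflection S = (\<lambda>x. \<Sum>i\<in>{0..<N}. reflection (k i) x)"
    by (simp add: S_def reflection_def fun_eq_iff)
  have "conv (reflection S) S = (\<lambda>x. \<Sum>j\<in>{0..<N}. \<Sum>i\<in>{0..<N}. conv (reflection (k i)) (k j) x)"
  proof -
    have "conv (reflection S) S = (\<lambda>x. \<Sum>j\<in>{0..<N}. conv (reflection S) (k j) x)"
      unfolding S_def by (rule conv_sum_right) (use V reflection_bdd_L1[OF SV] S_def in auto)
    also have "... = (\<lambda>x. \<Sum>j\<in>{0..<N}. \<Sum>i\<in>{0..<N}. conv (reflection (k i)) (k j) x)"
      unfolding rS by (subst conv_sum_left) (use V in auto)
    finally show ?thesis .
  qed
  also have "... = (\<lambda>x. \<Sum>d\<in>{-N..N}. a d * G d x)"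
  proof
    fix x
    have "(\<Sum>i\<in>{0..<N}. conv (reflection (k i)) (k j) x)
        = (\<Sum>d\<in>{-N..N}. conv (reflection (k (j + d))) (k j) x)" if "j \<in> {0..<N}" for j
      by (rule sum_shift_diagonal[OF that]) (simp add: Z reflection_def conv_def)
    moreover have "conv (reflection (k (j + d))) (k j) x = a d * l d j x" for d j
      using a(1)[of d] by (simp add: l_def)
    ultimately have "(\<Sum>j\<in>{0..<N}. \<Sum>i\<in>{0..<N}. conv (reflection (k i)) (k j) x)
        = (\<Sum>j\<in>{0..<N}. \<Sum>d\<in>{-N..N}. a d * l d j x)"
      by simp
    also have "... = (\<Sum>d\<in>{-N..N}. a d * G d x)"
      by (subst sum.swap) (simp add: G_def sum_distrib_left)
    finally show "(\<Sum>j\<in>{0..<N}. \<Sum>i\<in>{0..<N}. conv (reflection (k i)) (k j) x)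
        = (\<Sum>d\<in>{-N..N}. a d * G d x)" .
  qed
  finally have SS: "conv (reflection S) S = (\<lambda>x. \<Sum>d\<in>{-N..N}. a d * G d x)" .
  have "L2norm (conv (conv (reflection S) S) f) \<le> (\<Sum>d\<in>{-N..N}. L2norm (conv (\<lambda>x. a d * G d x) f))"
    unfolding SS using f GV
    by (subst conv_sum_left) (auto intro!: L2norm_sum conv_bdd_L1 bdd_L1_cmult)
  also have "... \<le> (\<Sum>d\<in>{-N..N}. a d * (C * L2norm f))"
  proof (rule sum_mono)
    fix d
    have "almost_orthogonal N a (l d)"
      using almost_orthogonal_products[OF k a] by (simp add: l_def[abs_def])
    then have "L2norm (conv (G d) f) \<le> C * L2norm f"
      using C f unfolding uniform_L2_bound_def G_def by blast
    then show "L2norm (conv (\<lambda>x. a d * G d x) f) \<le> a d * (C * L2norm f)"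
      using a(1)[of d] by (simp add: conv_cmult_left L2norm_cmult)
  qed
  finally have "L2norm (conv (conv (reflection S) S) f) * L2norm f
      \<le> (\<Sum>d\<in>{-N..N}. a d * (C * L2norm f)) * L2norm f"
    by (intro mult_right_mono L2norm_nonneg)
  also have "... = ((\<Sum>d\<in>{-N..N}. a d) * C) * (L2norm f)\<^sup>2"
    by (simp add: sum_distrib_right power2_eq_square mult.assoc)
  finally have "(L2norm (conv S f))\<^sup>2 \<le> ((\<Sum>d\<in>{-N..N}. a d) * C) * (L2norm f)\<^sup>2"
    using L2norm_conv_power2[OF SV f] by linarith
  moreover have "0 \<le> (\<Sum>d\<in>{-N..N}. a d) * C"
    using a(1) C0 by (intro mult_nonneg_nonneg sum_nonneg) (auto intro: less_imp_le)
  ultimately have "(L2norm (conv S f))\<^sup>2 \<le> (sqrt ((\<Sum>d\<in>{-N..N}. a d) * C) * L2norm f)\<^sup>2"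
    by (simp add: power_mult_distrib)
  then show "L2norm (conv (\<lambda>x. \<Sum>i\<in>{0..<N}. k i x) f) \<le> sqrt ((\<Sum>d\<in>{-N..N}. a d) * C) * L2norm f"
    unfolding S_def[symmetric]
    using \<open>0 \<le> (\<Sum>d\<in>{-N..N}. a d) * C\<close> by (intro power2_le_imp_le[of "L2norm (conv S f)"]) (auto simp: L2norm_nonneg)
qed

lemma uniform_L2_bound_trivial:
  assumes a: "\<And>d. 0 < a d"
  shows "uniform_L2_bound N a TYPE('a::euclidean_space) (of_int \<bar>N\<bar> * a 0)"
  unfolding uniform_L2_bound_def
proof (intro allI ballI impI)
  fix k :: "int \<Rightarrow> 'a \<Rightarrow> real" and f :: "'a \<Rightarrow> real"
  assume f: "f \<in> bdd_L1" and k: "almost_orthogonal N a k"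
  have V: "k i \<in> bdd_L1" for i using k by (auto simp: almost_orthogonal_def)
  have 1: "L2norm (conv (k i) f) \<le> a 0 * L2norm f" for i
  proof (rule power2_le_imp_le)
    have "L1norm (conv (reflection (k i)) (k i)) \<le> (a 0)\<^sup>2"
      using k by (simp add: almost_orthogonal_def) (metis diff_self)
    then have "L2norm (conv (conv (reflection (k i)) (k i)) f) \<le> (a 0)\<^sup>2 * L2norm f"
      by (intro order_trans[OF L2norm_conv] mult_right_mono conv_bdd_L1 reflection_bdd_L1 V f L2norm_nonneg)
    then have "L2norm (conv (conv (reflection (k i)) (k i)) f) * L2norm f \<le> (a 0)\<^sup>2 * L2norm f * L2norm f"
      by (intro mult_right_mono L2norm_nonneg)
    then show "(L2norm (conv (k i) f))\<^sup>2 \<le> (a 0 * L2norm f)\<^sup>2"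
      using L2norm_conv_power2[OF V f, of i] by (simp add: power2_eq_square mult_ac)
  qed (use a[of 0] L2norm_nonneg[of f] in simp)
  have "L2norm (conv (\<lambda>x. \<Sum>i\<in>{0..<N}. k i x) f) \<le> (\<Sum>i\<in>{0..<N}. L2norm (conv (k i) f))"
    using V f by (subst conv_sum_left) (auto intro!: L2norm_sum conv_bdd_L1)
  also have "... \<le> (\<Sum>i\<in>{0..<N}. a 0 * L2norm f)" by (intro sum_mono 1)
  also have "... \<le> of_int \<bar>N\<bar> * a 0 * L2norm f"
    using a[of 0] L2norm_nonneg[of f] by (auto intro!: mult_right_mono)
  finally show "L2norm (conv (\<lambda>x. \<Sum>i\<in>{0..<N}. k i x) f) \<le> of_int \<bar>N\<bar> * a 0 * L2norm f" .
qed

text \<open>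
  The Cotlar--Stein lemma for convolutions. The best constant \<open>C\<close> valid for all families with the
  given decay satisfies \<open>C\<^sup>2 \<le> D C\<close> by the improvement above; it is finite because the families are
  finite.
\<close>

lemma Cotlar_Stein_conv:
  assumes k: "almost_orthogonal N a k" and f: "f \<in> bdd_L1"
    and a: "\<And>d. 0 < a d" "\<And>d. a (- d) = a d"
  shows "L2norm (conv (\<lambda>x. \<Sum>i\<in>{0..<N}. k i x) f) \<le> (\<Sum>d\<in>{-N..N}. a d) * L2norm (f :: 'a::euclidean_space \<Rightarrow> real)"
proof -
  define D where "D = (\<Sum>d\<in>{-N..N}. a d)"
  have D: "0 \<le> D" unfolding D_def by (intro sum_nonneg less_imp_le a)
  define CC where "CC = {C. 0 \<le> C \<and> uniform_L2_bound N a TYPE('a) C}"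
  have ne: "CC \<noteq> {}"
    using uniform_L2_bound_trivial[OF a(1), of N] a(1)[of 0] unfolding CC_def
    by (auto intro!: exI[of _ "of_int \<bar>N\<bar> * a 0"])
  have bdd: "bdd_below CC" unfolding CC_def by (auto intro: bdd_belowI[of _ 0])
  define c where "c = Inf CC"
  have c0: "0 \<le> c" unfolding c_def using ne by (intro cInf_greatest) (auto simp: CC_def)
  have c: "uniform_L2_bound N a TYPE('a) c"
    unfolding uniform_L2_bound_def
  proof (intro allI ballI impI)
    fix k :: "int \<Rightarrow> 'a \<Rightarrow> real" and f :: "'a \<Rightarrow> real"
    assume fk: "f \<in> bdd_L1" "almost_orthogonal N a k"
    let ?L = "L2norm (conv (\<lambda>x. \<Sum>i\<in>{0..<N}. k i x) f)"
    have *: "?L \<le> C * L2norm f" if "C \<in> CC" for C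
      using that fk by (auto simp: CC_def uniform_L2_bound_def)
    show "?L \<le> c * L2norm f"
    proof (cases "L2norm f = 0")
      case True then show ?thesis using * ne by auto
    next
      case False
      then have "0 < L2norm f" using L2norm_nonneg[of f] by simp
      then have "?L / L2norm f \<le> c" unfolding c_def using * ne
        by (intro cInf_greatest) (auto simp: field_simps)
      then show ?thesis using \<open>0 < L2norm f\<close> by (simp add: field_simps)
    qed
  qed
  have "sqrt (D * c) \<in> CC"
    using uniform_L2_bound_improve[OF c c0 a] D c0 by (simp add: CC_def D_def)
  then have "c \<le> sqrt (D * c)" unfolding c_def using bdd by (rule cInf_lower)
  then have "c\<^sup>2 \<le> D * c" using c0 D by (metis mult_nonneg_nonneg real_le_rsqrt real_sqrt_pow2 power_mono)
  then have "c \<le> D" using c0 D by (cases "c = 0") (auto simp: power2_eq_square)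
  have "L2norm (conv (\<lambda>x. \<Sum>i\<in>{0..<N}. k i x) f) \<le> c * L2norm f"
    using c k f by (auto simp: uniform_L2_bound_def)
  also have "... \<le> D * L2norm f" using \<open>c \<le> D\<close> by (intro mult_right_mono L2norm_nonneg)
  finally show ?thesis by (simp add: D_def)
qed

section \<open>Calderon--Zygmund kernels and their truncations\<close>

definition CZ_kernel :: "real \<Rightarrow> ('a::euclidean_space \<Rightarrow> real) \<Rightarrow> bool" where
  "CZ_kernel A K \<longleftrightarrow> 0 < A \<and> K \<in> borel_measurable borel \<and>
    (\<forall>x. x \<noteq> 0 \<longrightarrow> \<bar>K x\<bar> \<le> A / norm x ^ DIM('a)) \<and>
    (\<forall>x y. x \<noteq> 0 \<longrightarrow> 2 * norm (x - y) \<le> norm x \<longrightarrow>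
      \<bar>K x - K y\<bar> \<le> A * norm (x - y) / norm x ^ (DIM('a) + 1))"

text \<open>
  Mean zero over the spheres about the origin, tested against functions of the norm. Where
  \<open>\<phi> (norm x) * K x\<close> is not integrable, the equation holds because the integral is
  \<open>0\<close> by convention.
\<close>

definition radial_cancellation :: "('a::euclidean_space \<Rightarrow> real) \<Rightarrow> bool" where
  "radial_cancellation K \<longleftrightarrow>
    (\<forall>\<phi>::real \<Rightarrow> real. \<phi> \<in> borel_measurable borel \<longrightarrow> (\<integral>x. \<phi> (norm x) * K x \<partial>lborel) = 0)"

definition cutoff :: "real \<Rightarrow> real" where
  "cutoff t = max 0 (min 1 (2 - t))"

lemma cutoff_range: "0 \<le> cutoff t" "cutoff t \<le> 1"
  and cutoff_eq_1: "t \<le> 1 \<Longrightarrow> cutoff t = 1"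
  and cutoff_eq_0: "2 \<le> t \<Longrightarrow> cutoff t = 0"
  and cutoff_Lipschitz: "\<bar>cutoff s - cutoff t\<bar> \<le> \<bar>s - t\<bar>"
  by (auto simp: cutoff_def)

lemma cutoff_measurable [measurable]: "cutoff \<in> borel_measurable borel"
  unfolding cutoff_def[abs_def] by measurable

text \<open>
  The difference telescopes when the scale \<open>s\<close> runs through powers of \<open>2\<close>.
\<close>

definition bump :: "real \<Rightarrow> real \<Rightarrow> real" where
  "bump s t = cutoff (t / s) - cutoff (2 * t / s)"

lemma bump_measurable [measurable]: "bump s \<in> borel_measurable borel"
  unfolding bump_def[abs_def] by measurable

lemma bump_le_1: "\<bar>bump s t\<bar> \<le> 1"
  using cutoff_range[of "t / s"] cutoff_range[of "2 * t / s"] by (simp add: bump_def)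

lemma bump_eq_0:
  assumes "0 < s" "t \<le> s / 2 \<or> 2 * s \<le> t"
  shows "bump s t = 0"
  using assms(2)
proof
  assume "t \<le> s / 2"
  then have "t / s \<le> 1" "2 * t / s \<le> 1" using assms(1) by (auto simp: field_simps)
  then show ?thesis by (simp add: bump_def cutoff_eq_1)
next
  assume "2 * s \<le> t"
  then have "2 \<le> t / s" "2 \<le> 2 * t / s" using assms(1) by (auto simp: field_simps)
  then show ?thesis by (simp add: bump_def cutoff_eq_0)
qed

lemma abs_diff_divide:
  fixes s :: real
  shows "0 < s \<Longrightarrow> \<bar>a / s - b / s\<bar> = \<bar>a - b\<bar> / s"
  by (metis abs_divide abs_of_pos diff_divide_distrib)

lemma abs_double_diff:
  fixes a b :: real
  shows "\<bar>2 * a - 2 * b\<bar> = 2 * \<bar>a - b\<bar>"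
  by (simp only: right_diff_distrib[symmetric] abs_mult abs_numeral)

lemma bump_Lipschitz:
  assumes "0 < s"
  shows "\<bar>bump s t - bump s u\<bar> \<le> 3 * \<bar>t - u\<bar> / s"
proof -
  have "bump s t - bump s u = (cutoff (t / s) - cutoff (u / s)) - (cutoff (2 * t / s) - cutoff (2 * u / s))"
    by (simp add: bump_def)
  also have "\<bar>...\<bar> \<le> \<bar>t / s - u / s\<bar> + \<bar>2 * t / s - 2 * u / s\<bar>"
    by (rule order_trans[OF abs_triangle_ineq4 add_mono[OF cutoff_Lipschitz cutoff_Lipschitz]])
  also have "... = \<bar>t - u\<bar> / s + 2 * \<bar>t - u\<bar> / s"
    by (simp only: abs_diff_divide[OF assms] abs_double_diff)
  also have "... = 3 * \<bar>t - u\<bar> / s"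
    by (simp only: add_divide_distrib[symmetric]) (rule arg_cong2[where f="(/)"]; simp)
  finally show ?thesis .
qed

definition kernel_piece :: "('a::euclidean_space \<Rightarrow> real) \<Rightarrow> real \<Rightarrow> 'a \<Rightarrow> real" where
  "kernel_piece K s x = bump s (norm x) * K x"

lemma kernel_piece_eq_0: "0 < s \<Longrightarrow> norm x \<le> s / 2 \<or> 2 * s \<le> norm x \<Longrightarrow> kernel_piece K s x = 0"
  by (simp add: kernel_piece_def bump_eq_0)

lemma kernel_piece_bound:
  fixes K :: "'a::euclidean_space \<Rightarrow> real"
  assumes K: "CZ_kernel A K" and s: "0 < s"
  shows "\<bar>kernel_piece K s x\<bar> \<le> A * 2 ^ DIM('a) / s ^ DIM('a)"
proof (cases "norm x \<le> s / 2")
  case True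
  then show ?thesis using s K by (simp add: kernel_piece_eq_0 CZ_kernel_def)
next
  case False
  then have x: "x \<noteq> 0" "s / 2 \<le> norm x" using s by auto
  have A: "0 < A" using K by (simp add: CZ_kernel_def)
  have "\<bar>kernel_piece K s x\<bar> \<le> 1 * \<bar>K x\<bar>"
    unfolding kernel_piece_def abs_mult by (intro mult_right_mono bump_le_1) simp
  also have "... \<le> A / norm x ^ DIM('a)" using K x by (simp add: CZ_kernel_def)
  also have "... \<le> A / (s / 2) ^ DIM('a)"
    using A s x by (intro divide_left_mono power_mono mult_pos_pos zero_less_power) auto
  finally show ?thesis by (simp add: power_divide)
qed

lemma kernel_piece_Lipschitz:
  fixes K :: "'a::euclidean_space \<Rightarrow> real"
  assumes K: "CZ_kernel A K" and s: "0 < s"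
  shows "\<bar>kernel_piece K s x - kernel_piece K s y\<bar> \<le> 8 * A * 2 ^ DIM('a) / s ^ (DIM('a) + 1) * norm (x - y)"
    (is "?d x y \<le> ?L * _")
proof -
  let ?n = "DIM('a)"
  have A: "0 < A" using K by (simp add: CZ_kernel_def)
  have near: "?d x y \<le> ?L * norm (x - y)" if b: "norm (x - y) < s / 4" "bump s (norm x) \<noteq> 0" for x y
  proof -
    have x: "s / 2 \<le> norm x" using bump_eq_0[OF s, of "norm x"] b by force
    then have x0: "x \<noteq> 0" using s by auto
    have p: "1 / norm x ^ m \<le> 2 ^ m / s ^ m" for m
    proof -
      have "1 / norm x ^ m \<le> 1 / (s / 2) ^ m"
        using s x by (intro divide_left_mono power_mono mult_pos_pos zero_less_power) auto
      then show ?thesis by (simp add: power_divide)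
    qed
    have "\<bar>K x\<bar> \<le> A * (1 / norm x ^ ?n)" using K x0 by (simp add: CZ_kernel_def)
    also have "... \<le> A * (2 ^ ?n / s ^ ?n)" using A by (intro mult_left_mono p) simp
    finally have K1: "\<bar>K x\<bar> \<le> A * (2 ^ ?n / s ^ ?n)" .
    have "\<bar>K x - K y\<bar> \<le> A * norm (x - y) * (1 / norm x ^ (?n + 1))"
      using K x0 b x unfolding CZ_kernel_def by auto
    also have "... \<le> A * norm (x - y) * (2 ^ (?n + 1) / s ^ (?n + 1))"
      using A by (intro mult_left_mono p) simp
    finally have K2: "\<bar>K x - K y\<bar> \<le> A * norm (x - y) * (2 ^ (?n + 1) / s ^ (?n + 1))" .
    have "\<bar>bump s (norm x) - bump s (norm y)\<bar> \<le> 3 * \<bar>norm x - norm y\<bar> / s"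
      by (rule bump_Lipschitz[OF s])
    also have "... \<le> 3 * norm (x - y) / s"
      using s norm_triangle_ineq3[of x y] by (intro divide_right_mono mult_left_mono) auto
    finally have B: "\<bar>bump s (norm x) - bump s (norm y)\<bar> \<le> 3 * norm (x - y) / s" .
    have "kernel_piece K s x - kernel_piece K s y
        = (bump s (norm x) - bump s (norm y)) * K x + bump s (norm y) * (K x - K y)"
      by (simp add: kernel_piece_def algebra_simps)
    also have "\<bar>...\<bar> \<le> \<bar>bump s (norm x) - bump s (norm y)\<bar> * \<bar>K x\<bar> + \<bar>bump s (norm y)\<bar> * \<bar>K x - K y\<bar>"
      by (simp add: abs_mult[symmetric])
    also have "... \<le> (3 * norm (x - y) / s) * (A * (2 ^ ?n / s ^ ?n))
        + 1 * (A * norm (x - y) * (2 ^ (?n + 1) / s ^ (?n + 1)))"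
      using B K1 K2 A s by (intro add_mono mult_mono bump_le_1) auto
    also have "... = 5 * A * 2 ^ ?n / s ^ (?n + 1) * norm (x - y)"
      using s by (simp add: field_simps)
    also have "... \<le> ?L * norm (x - y)"
      using A s by (intro mult_right_mono divide_right_mono) auto
    finally show ?thesis .
  qed
  consider "s / 4 \<le> norm (x - y)" | "norm (x - y) < s / 4" "bump s (norm x) \<noteq> 0"
    | "norm (x - y) < s / 4" "bump s (norm y) \<noteq> 0"
    | "bump s (norm x) = 0" "bump s (norm y) = 0" by linarith
  then show ?thesis
  proof cases
    case 1
    have "?d x y \<le> A * 2 ^ ?n / s ^ ?n + A * 2 ^ ?n / s ^ ?n"
      using kernel_piece_bound[OF K s, of x] kernel_piece_bound[OF K s, of y] by linarith
    also have "... = ?L * (s / 4)" using s by (simp add: field_simps)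
    also have "... \<le> ?L * norm (x - y)" using 1 A s by (intro mult_left_mono) auto
    finally show ?thesis .
  next
    case 3
    then have "?d y x \<le> ?L * norm (y - x)" by (intro near) (auto simp: norm_minus_commute)
    then show ?thesis by (simp add: norm_minus_commute abs_minus_commute)
  next
    case 4 then show ?thesis using A s by (simp add: kernel_piece_def)
  qed (use near in auto)
qed

abbreviation unit_vol :: "'a::euclidean_space itself \<Rightarrow> real" where
  "unit_vol _ \<equiv> unit_ball_vol (real DIM('a))"

lemma L1norm_supported_bounded:
  fixes f :: "'a::euclidean_space \<Rightarrow> real"
  assumes [measurable]: "f \<in> borel_measurable borel" and b: "\<And>x. \<bar>f x\<bar> \<le> b"
    and z: "\<And>x. R < norm x \<Longrightarrow> f x = 0" and R: "0 \<le> R"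
  shows "f \<in> bdd_L1" and "L1norm f \<le> b * (unit_vol TYPE('a) * R ^ DIM('a))"
proof -
  have i: "integrable lborel (\<lambda>x. b * indicator (cball (0::'a) R) x)"
    by (intro integrable_mult_right integrable_real_indicator)
      (use emeasure_bounded_finite[of "cball (0::'a) R"] in auto)
  have le: "\<bar>f x\<bar> \<le> b * indicator (cball 0 R) x" for x
    using b[of x] z[of x] by (auto simp: indicator_def)
  have int: "integrable lborel f"
    by (rule Bochner_Integration.integrable_bound[OF i])
      (use le in \<open>auto intro!: AE_I2 order_trans[OF le abs_ge_self]\<close>)
  then show "f \<in> bdd_L1" using b by (auto simp: bdd_L1_def)
  have "L1norm f \<le> (\<integral>x. b * indicator (cball (0::'a) R) x \<partial>lborel)"
    unfolding L1norm_def using int le i by (intro integral_mono) auto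
  also have "... = b * (unit_vol TYPE('a) * R ^ DIM('a))"
    using R by (simp add: content_cball)
  finally show "L1norm f \<le> b * (unit_vol TYPE('a) * R ^ DIM('a))" .
qed

text \<open>
  Convolving a function of mean zero that lives at scale \<open>R\<close> with a function that is smooth at the
  coarser scale \<open>S\<close> gains the ratio of the scales.
\<close>

lemma L1norm_conv_mean_zero:
  fixes f g :: "'a::euclidean_space \<Rightarrow> real"
  assumes f: "f \<in> bdd_L1" and f0: "(\<integral>x. f x \<partial>lborel) = 0" and fR: "\<And>x. R < norm x \<Longrightarrow> f x = 0"
    and g: "g \<in> bdd_L1" and gL: "\<And>x y. \<bar>g x - g y\<bar> \<le> L * norm (x - y)"
    and gS: "\<And>x. S < norm x \<Longrightarrow> g x = 0" and nonneg: "0 \<le> R" "0 \<le> S" "0 \<le> L"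
  shows "L1norm (conv f g) \<le> L * R * L1norm f * (unit_vol TYPE('a) * (R + S) ^ DIM('a))"
proof (rule L1norm_supported_bounded(2))
  note [measurable] = bdd_L1_measurable[OF f] bdd_L1_measurable[OF g]
  show "conv f g \<in> borel_measurable borel" by measurable
  have c: "conv f g x = (\<integral>y. g (x - y) * f y \<partial>lborel)" for x
    by (simp add: conv_commute[of f g] conv_def)
  obtain B where B: "\<And>x. \<bar>g x\<bar> \<le> B" using bdd_L1_bound[OF g] by blast
  show "\<bar>conv f g x\<bar> \<le> L * R * L1norm f" for x
  proof -
    have i: "integrable lborel (\<lambda>y. g (x - y) * f y)"
      by (rule integrable_conv_integrand[OF _ B bdd_L1_integrable[OF f]]) measurable
    have "conv f g x = (\<integral>y. g (x - y) * f y \<partial>lborel) - (\<integral>y. g x * f y \<partial>lborel)"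
      using f0 by (simp add: c)
    also have "... = (\<integral>y. (g (x - y) - g x) * f y \<partial>lborel)"
      using Bochner_Integration.integral_diff[OF i integrable_mult_right[OF bdd_L1_integrable[OF f], of "g x"]]
      by (simp add: left_diff_distrib)
    finally have "\<bar>conv f g x\<bar> \<le> (\<integral>y. \<bar>(g (x - y) - g x) * f y\<bar> \<partial>lborel)"
      using integral_abs_bound by metis
    also have "... \<le> (\<integral>y. (L * R) * \<bar>f y\<bar> \<partial>lborel)"
    proof (rule integral_mono)
      have "integrable lborel (\<lambda>y. g (x - y) * f y - g x * f y)" using i bdd_L1_integrable[OF f] by simp
      then show "integrable lborel (\<lambda>y. \<bar>(g (x - y) - g x) * f y\<bar>)"
        by (simp add: left_diff_distrib)
      show "integrable lborel (\<lambda>y. (L * R) * \<bar>f y\<bar>)" using bdd_L1_integrable[OF f] by simp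
      show "\<bar>(g (x - y) - g x) * f y\<bar> \<le> (L * R) * \<bar>f y\<bar>" for y
      proof (cases "R < norm y")
        case False
        have "\<bar>g (x - y) - g x\<bar> \<le> L * norm y" using gL[of "x - y" x] by simp
        also have "... \<le> L * R" using False nonneg by (intro mult_left_mono) auto
        finally show ?thesis unfolding abs_mult by (intro mult_right_mono) auto
      qed (simp add: fR)
    qed
    finally show ?thesis by (simp add: L1norm_def)
  qed
  show "conv f g x = 0" if "R + S < norm x" for x
  proof -
    have "(\<lambda>y. g (x - y) * f y) = (\<lambda>_. 0)"
    proof
      fix y
      show "g (x - y) * f y = 0"
        using that fR[of y] gS[of "x - y"] norm_triangle_ineq[of "x - y" y] by fastforce
    qed
    then show ?thesis by (simp only: c) simp
  qed
qed (use nonneg in auto)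


lemma kernel_piece_measurable [measurable]:
  "CZ_kernel A K \<Longrightarrow> kernel_piece K s \<in> borel_measurable borel"
proof -
  assume "CZ_kernel A K"
  then have [measurable]: "K \<in> borel_measurable borel" by (simp add: CZ_kernel_def)
  show ?thesis unfolding kernel_piece_def[abs_def] by measurable
qed

lemma kernel_piece_L1:
  fixes K :: "'a::euclidean_space \<Rightarrow> real"
  assumes K: "CZ_kernel A K" and s: "0 < s"
  shows "kernel_piece K s \<in> bdd_L1" "L1norm (kernel_piece K s) \<le> A * 4 ^ DIM('a) * unit_vol TYPE('a)"
proof -
  note L = L1norm_supported_bounded[OF kernel_piece_measurable[OF K] kernel_piece_bound[OF K s],
      of "2 * s"]
  show "kernel_piece K s \<in> bdd_L1" using s by (intro L) (auto simp: kernel_piece_eq_0)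
  have "L1norm (kernel_piece K s) \<le> A * 2 ^ DIM('a) / s ^ DIM('a) * (unit_vol TYPE('a) * (2 * s) ^ DIM('a))"
    using s by (intro L) (auto simp: kernel_piece_eq_0)
  also have "... = A * (2 ^ DIM('a) * 2 ^ DIM('a)) * unit_vol TYPE('a)"
    using s by (simp add: power_mult_distrib field_simps)
  finally show "L1norm (kernel_piece K s) \<le> A * 4 ^ DIM('a) * unit_vol TYPE('a)"
    by (simp flip: power_mult_distrib)
qed

lemma integral_kernel_piece:
  assumes "radial_cancellation K"
  shows "(\<integral>x. kernel_piece K s x \<partial>lborel) = 0"
  using assms unfolding radial_cancellation_def kernel_piece_def by simp

definition orthogonality_const :: "real \<Rightarrow> 'a::euclidean_space itself \<Rightarrow> real" where
  "orthogonality_const A _ =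
    16 * A * 2 ^ DIM('a) * (A * 4 ^ DIM('a) * unit_vol TYPE('a)) * (unit_vol TYPE('a) * 4 ^ DIM('a))"

text \<open>
  The piece of the finer scale has mean zero because of the cancellation, and the other one is
  Lipschitz at its scale; so the previous estimate gains \<open>s / t\<close>, whichever of the two is
  reflected.
\<close>

lemma kernel_piece_decay:
  fixes K :: "'a::euclidean_space \<Rightarrow> real"
  assumes K: "CZ_kernel A K" "radial_cancellation K" and s: "0 < s" "s \<le> t"
  shows "L1norm (conv (reflection (kernel_piece K s)) (kernel_piece K t)) \<le> orthogonality_const A TYPE('a) * (s / t)"
    and "L1norm (conv (reflection (kernel_piece K t)) (kernel_piece K s)) \<le> orthogonality_const A TYPE('a) * (s / t)"
proof -
  have t: "0 < t" using s by simp
  have A: "0 < A" using K by (simp add: CZ_kernel_def)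
  let ?n = "DIM('a)" and ?P = "kernel_piece K"
  let ?L = "8 * A * 2 ^ ?n / t ^ (?n + 1)"
  note m = kernel_piece_measurable[OF K(1)]
  have bound: "L1norm (conv f g) \<le> orthogonality_const A TYPE('a) * (s / t)"
    if f: "f \<in> bdd_L1" "(\<integral>x. f x \<partial>lborel) = 0" "\<And>x. 2 * s < norm x \<Longrightarrow> f x = 0"
       "L1norm f \<le> A * 4 ^ ?n * unit_vol TYPE('a)"
     and g: "g \<in> bdd_L1" "\<And>x y. \<bar>g x - g y\<bar> \<le> ?L * norm (x - y)" "\<And>x. 2 * t < norm x \<Longrightarrow> g x = 0"
    for f g :: "'a \<Rightarrow> real"
  proof -
    have "L1norm (conv f g) \<le> ?L * (2 * s) * L1norm f * (unit_vol TYPE('a) * (2 * s + 2 * t) ^ ?n)"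
      using s t A by (intro L1norm_conv_mean_zero f g) auto
    also have "... \<le> ?L * (2 * s) * (A * 4 ^ ?n * unit_vol TYPE('a)) * (unit_vol TYPE('a) * (4 * t) ^ ?n)"
      using s t A by (intro mult_mono f power_mono L1norm_nonneg mult_nonneg_nonneg) (auto simp: L1norm_nonneg)
    also have "... = orthogonality_const A TYPE('a) * (s / t)"
      using t by (simp add: orthogonality_const_def power_mult_distrib field_simps)
    finally show ?thesis .
  qed
  have refl: "reflection (?P u) \<in> bdd_L1" "(\<integral>x. reflection (?P u) x \<partial>lborel) = 0"
     "2 * u < norm x \<Longrightarrow> reflection (?P u) x = 0"
     "L1norm (reflection (?P u)) \<le> A * 4 ^ ?n * unit_vol TYPE('a)" if "0 < u" for u x
    using that kernel_piece_L1[OF K(1) that] integral_reflect[OF m, of u 0] integral_kernel_piece[OF K(2), of u] m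
    by (auto simp: reflection_bdd_L1 L1norm_reflection) (auto simp: reflection_def kernel_piece_eq_0)
  show "L1norm (conv (reflection (?P s)) (?P t)) \<le> orthogonality_const A TYPE('a) * (s / t)"
    using s t kernel_piece_L1[OF K(1)] by (intro bound refl kernel_piece_Lipschitz[OF K(1)]) (auto simp: kernel_piece_eq_0)
  have "L1norm (conv (?P s) (reflection (?P t))) \<le> orthogonality_const A TYPE('a) * (s / t)"
  proof (intro bound refl t kernel_piece_L1[OF K(1)] s integral_kernel_piece[OF K(2)])
    show "\<bar>reflection (?P t) x - reflection (?P t) y\<bar> \<le> ?L * norm (x - y)" for x y
      using kernel_piece_Lipschitz[OF K(1) t, of "-x" "-y"]
      by (simp add: reflection_def norm_minus_commute)
  qed (use s in \<open>auto simp: kernel_piece_eq_0\<close>)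
  then show "L1norm (conv (reflection (?P t)) (?P s)) \<le> orthogonality_const A TYPE('a) * (s / t)"
    using bdd_L1_measurable[OF refl(1)[OF t]] m[of s] by (simp add: conv_commute)
qed

text \<open>
  It agrees with \<open>K\<close> where \<open>s \<le> \<bar>x\<bar> \<le> 2\<^bsup>N-1\<^esup>
  s\<close>.
\<close>

definition annular_truncation :: "('a::euclidean_space \<Rightarrow> real) \<Rightarrow> real \<Rightarrow> nat \<Rightarrow> 'a \<Rightarrow> real" where
  "annular_truncation K s N x = (cutoff (2 * norm x / (s * 2 ^ N)) - cutoff (2 * norm x / s)) * K x"

lemma annular_truncation_eq_sum:
  assumes s: "0 < s"
  shows "annular_truncation K s N = (\<lambda>x. \<Sum>i\<in>{0..<int N}. kernel_piece K (s * 2 ^ nat i) x)"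
proof (induction N)
  case (Suc N)
  have *: "{0..<int (Suc N)} = insert (int N) {0..<int N}" by auto
  have "annular_truncation K s (Suc N) x = kernel_piece K (s * 2 ^ N) x + annular_truncation K s N x" for x
    using s by (simp add: annular_truncation_def kernel_piece_def bump_def algebra_simps)
  then show ?case unfolding * by (simp add: Suc fun_eq_iff)
qed (simp add: annular_truncation_def fun_eq_iff)

text \<open>
  The constants \<open>A\<close> and \<open>B\<close> are the same for all truncations of a kernel and
  are the only ones that enter the estimates. The Lipschitz constant \<open>L\<close> depends on the
  truncation; it only makes errors tend to \<open>0\<close>.
\<close>

definition good_kernel :: "real \<Rightarrow> real \<Rightarrow> ('a::euclidean_space \<Rightarrow> real) \<Rightarrow> bool" where
  "good_kernel A B k \<longleftrightarrow> CZ_kernel A k \<and> k \<in> bdd_L1 \<and> (\<exists>L. \<forall>x y. \<bar>k x - k y\<bar> \<le> L * norm (x - y)) \<and>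
    (\<forall>f\<in>bdd_L1. L2norm (conv k f) \<le> B * L2norm f)"

lemma sum_geometric_two_sided:
  fixes q :: real
  assumes q: "0 < q" "q < 1"
  shows "(\<Sum>d\<in>{-int N..int N}. q ^ nat \<bar>d\<bar>) \<le> 2 / (1 - q)"
proof -
  have g: "(\<Sum>n\<le>N. q ^ n) \<le> 1 / (1 - q)"
    using q sum_le_suminf[of "\<lambda>n. q ^ n" "{..N}"] suminf_geometric[of q] by auto
  have "(\<Sum>d\<in>{-int N..int N}. q ^ nat \<bar>d\<bar>) \<le> (\<Sum>d\<in>int ` {..N} \<union> (\<lambda>n. - int n) ` {..N}. q ^ nat \<bar>d\<bar>)"
  proof (rule sum_mono2)
    show "{- int N..int N} \<subseteq> int ` {..N} \<union> (\<lambda>n. - int n) ` {..N}"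
    proof
      fix d assume "d \<in> {- int N..int N}"
      then have "d = int (nat d) \<and> nat d \<le> N \<or> d = - int (nat (- d)) \<and> nat (- d) \<le> N" by auto
      then show "d \<in> int ` {..N} \<union> (\<lambda>n. - int n) ` {..N}" by blast
    qed
  qed (use q in auto)
  also have "... \<le> (\<Sum>d\<in>int ` {..N}. q ^ nat \<bar>d\<bar>) + (\<Sum>d\<in>(\<lambda>n. - int n) ` {..N}. q ^ nat \<bar>d\<bar>)"
    using q by (subst sum.union_inter[symmetric]) (auto intro!: sum_nonneg)
  also have "... = (\<Sum>n\<le>N. q ^ n) + (\<Sum>n\<le>N. q ^ n)"
    by (subst sum.reindex, simp add: inj_on_def, subst sum.reindex) (auto simp: inj_on_def)
  finally show ?thesis using g by simp
qed

text \<open>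
  Pieces at distance \<open>d\<close> in scale have products of size
  \<open>2\<^bsup>-d\<^esup>\<close>, whose square roots form a geometric series. The Cotlar--Stein
  lemma gives a bound independent of the number of pieces.
\<close>

lemma annular_truncation_L2:
  fixes K :: "'a::euclidean_space \<Rightarrow> real"
  assumes K: "CZ_kernel A K" "radial_cancellation K" and s: "0 < s" and f: "f \<in> bdd_L1"
  shows "L2norm (conv (annular_truncation K s N) f)
    \<le> sqrt (orthogonality_const A TYPE('a)) * (2 / (1 - sqrt (1 / 2))) * L2norm f"
proof -
  define q where "q = sqrt (1 / 2 :: real)"
  have q: "0 < q" "q < 1" "q\<^sup>2 = 1 / 2" by (auto simp: q_def real_sqrt_less_iff[of _ 1, simplified])
  have C: "0 < orthogonality_const A TYPE('a)"
    using K by (auto simp: orthogonality_const_def CZ_kernel_def intro!: mult_pos_pos)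
  define a where "a d = sqrt (orthogonality_const A TYPE('a)) * q ^ nat \<bar>d\<bar>" for d :: int
  have a2: "(a d)\<^sup>2 = orthogonality_const A TYPE('a) * (1 / 2) ^ nat \<bar>d\<bar>" for d
  proof -
    have "(q ^ m)\<^sup>2 = (1 / 2) ^ m" for m
      unfolding q(3)[symmetric] by (simp add: power_mult[symmetric] mult.commute)
    then show ?thesis using C by (simp add: a_def power_mult_distrib)
  qed
  define k where "k i = (if i \<in> {0..<int N} then kernel_piece K (s * 2 ^ nat i) else (\<lambda>_. 0))" for i
  have ao: "almost_orthogonal (int N) a k"
    unfolding almost_orthogonal_def
  proof (intro conjI allI impI)
    show "k i \<in> bdd_L1" for i
      using s by (auto simp: k_def bdd_L1_zero intro!: kernel_piece_L1[OF K(1)])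
    show "k i = (\<lambda>_. 0)" if "i \<notin> {0..<int N}" for i using that by (auto simp: k_def)
    fix i j
    show "L1norm (conv (reflection (k i)) (k j)) \<le> (a (i - j))\<^sup>2"
    proof (cases "i \<in> {0..<int N} \<and> j \<in> {0..<int N}")
      case False
      then have "conv (reflection (k i)) (k j) = (\<lambda>_. 0)"
        by (auto simp: k_def conv_def reflection_def fun_eq_iff)
      then show ?thesis by (simp add: L1norm_def)
    next
      case True
      have r: "s * 2 ^ nat m / (s * 2 ^ nat n) = (1 / 2) ^ nat \<bar>m - n\<bar>" if "0 \<le> m" "m \<le> n" for m n :: int
      proof -
        have "nat n = nat m + nat \<bar>m - n\<bar>" using that by auto
        then have "(2::real) ^ nat n = 2 ^ nat m * 2 ^ nat \<bar>m - n\<bar>" by (metis power_add)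
        then show ?thesis using s by (simp add: field_simps power_one_over)
      qed
      show ?thesis
      proof (cases "i \<le> j")
        case le: True
        have "s * 2 ^ nat i \<le> s * 2 ^ nat j" using le s by (intro mult_left_mono power_increasing) auto
        then have "L1norm (conv (reflection (kernel_piece K (s * 2 ^ nat i))) (kernel_piece K (s * 2 ^ nat j)))
            \<le> orthogonality_const A TYPE('a) * (s * 2 ^ nat i / (s * 2 ^ nat j))"
          using s by (intro kernel_piece_decay K) auto
        also note r[of i j]
        finally show ?thesis using True le by (simp add: k_def a2)
      next
        case le: False
        have "s * 2 ^ nat j \<le> s * 2 ^ nat i" using le s by (intro mult_left_mono power_increasing) auto
        then have "L1norm (conv (reflection (kernel_piece K (s * 2 ^ nat i))) (kernel_piece K (s * 2 ^ nat j)))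
            \<le> orthogonality_const A TYPE('a) * (s * 2 ^ nat j / (s * 2 ^ nat i))"
          using s by (intro kernel_piece_decay K) auto
        also note r[of j i]
        finally show ?thesis using True le by (simp add: k_def a2 abs_minus_commute)
      qed
    qed
  qed
  have "0 < a d" "a (- d) = a d" for d using q C by (auto simp: a_def)
  then have "L2norm (conv (\<lambda>x. \<Sum>i\<in>{0..<int N}. k i x) f) \<le> (\<Sum>d\<in>{-int N..int N}. a d) * L2norm f"
    by (rule Cotlar_Stein_conv[OF ao f])
  also have "... \<le> sqrt (orthogonality_const A TYPE('a)) * (2 / (1 - q)) * L2norm f"
    unfolding a_def sum_distrib_left[symmetric] using C
    by (intro mult_right_mono mult_left_mono sum_geometric_two_sided q L2norm_nonneg) auto
  also have "(\<lambda>x. \<Sum>i\<in>{0..<int N}. k i x) = annular_truncation K s N"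
    by (simp add: annular_truncation_eq_sum[OF s] k_def)
  finally show ?thesis by (simp add: q_def)
qed

text \<open>
  The cutoff at scale \<open>S\<close> only varies at distances comparable to \<open>S\<close>, so its
  Lipschitz constant \<open>1/S\<close> can be traded for \<open>1/u\<close>.
\<close>

lemma cutoff_relative_Lipschitz:
  assumes "0 < S" "0 < u" "u \<le> 2 * v"
  shows "\<bar>cutoff (2 * u / S) - cutoff (2 * v / S)\<bar> \<le> 4 * \<bar>u - v\<bar> / u"
proof (cases "S \<le> u \<and> S \<le> v")
  case True
  then have "2 \<le> 2 * u / S" "2 \<le> 2 * v / S" using assms by (auto simp: field_simps)
  then show ?thesis using assms by (simp add: cutoff_eq_0)
next
  case False
  then have "u \<le> 2 * S" using assms by auto
  have "\<bar>cutoff (2 * u / S) - cutoff (2 * v / S)\<bar> \<le> \<bar>2 * u / S - 2 * v / S\<bar>"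
    by (rule cutoff_Lipschitz)
  also have "... = 2 * \<bar>u - v\<bar> / S"
    by (simp only: abs_diff_divide[OF assms(1)] abs_double_diff)
  also have "... \<le> 2 * \<bar>u - v\<bar> / (u / 2)"
    using assms \<open>u \<le> 2 * S\<close> by (intro divide_left_mono mult_pos_pos) auto
  finally show ?thesis by simp
qed

text \<open>
  The factor is \<open>9 = 1 + 2 \<cdot> 4\<close>: the smoothness of \<open>K\<close> itself, and the
  relative Lipschitz constant of each of the two cutoffs.
\<close>

lemma annular_truncation_CZ:
  fixes K :: "'a::euclidean_space \<Rightarrow> real"
  assumes K: "CZ_kernel A K" and s: "0 < s"
  shows "CZ_kernel (9 * A) (annular_truncation K s N)"
  unfolding CZ_kernel_def
proof (intro conjI allI impI)
  let ?n = "DIM('a)" and ?k = "annular_truncation K s N"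
  define m where "m t = cutoff (2 * t / (s * 2 ^ N)) - cutoff (2 * t / s)" for t
  have k: "?k x = m (norm x) * K x" for x by (simp add: annular_truncation_def m_def)
  have m1: "\<bar>m t\<bar> \<le> 1" for t
    using cutoff_range[of "2 * t / (s * 2 ^ N)"] cutoff_range[of "2 * t / s"] by (simp add: m_def)
  have A: "0 < A" and [measurable]: "K \<in> borel_measurable borel"
    and K1: "\<And>x. x \<noteq> 0 \<Longrightarrow> \<bar>K x\<bar> \<le> A / norm x ^ ?n" using K by (auto simp: CZ_kernel_def)
  show "0 < 9 * A" using A by simp
  show "?k \<in> borel_measurable borel" unfolding annular_truncation_def[abs_def] by measurable
  show "\<bar>?k x\<bar> \<le> 9 * A / norm x ^ ?n" if "x \<noteq> 0" for x
  proof -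
    have "\<bar>?k x\<bar> \<le> 1 * (A / norm x ^ ?n)"
      unfolding k abs_mult using that by (intro mult_mono m1 K1) auto
    also have "... \<le> 9 * A / norm x ^ ?n" using A by (auto intro!: divide_right_mono)
    finally show ?thesis .
  qed
  fix x y :: 'a
  assume x: "x \<noteq> 0" and xy: "2 * norm (x - y) \<le> norm x"
  have K2: "\<bar>K x - K y\<bar> \<le> A * norm (x - y) / norm x ^ (?n + 1)"
    using K x xy unfolding CZ_kernel_def by blast
  have u: "norm x \<le> 2 * norm y" using xy norm_triangle_ineq2[of x y] by simp
  have "\<bar>m (norm x) - m (norm y)\<bar> \<le> 4 * \<bar>norm x - norm y\<bar> / norm x + 4 * \<bar>norm x - norm y\<bar> / norm x"
    using cutoff_relative_Lipschitz[of "s * 2 ^ N" "norm x" "norm y"] x u s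
      cutoff_relative_Lipschitz[of s "norm x" "norm y"] unfolding m_def by simp
  also have "... \<le> 8 * norm (x - y) / norm x"
    using norm_triangle_ineq3[of x y] by (auto simp: add_divide_distrib[symmetric] intro!: divide_right_mono)
  finally have M: "\<bar>m (norm x) - m (norm y)\<bar> \<le> 8 * norm (x - y) / norm x" .
  have "?k x - ?k y = (m (norm x) - m (norm y)) * K x + m (norm y) * (K x - K y)"
    by (simp add: k algebra_simps)
  also have "\<bar>...\<bar> \<le> \<bar>m (norm x) - m (norm y)\<bar> * \<bar>K x\<bar> + \<bar>m (norm y)\<bar> * \<bar>K x - K y\<bar>"
    by (simp add: abs_mult[symmetric])
  also have "... \<le> (8 * norm (x - y) / norm x) * (A / norm x ^ ?n) + 1 * (A * norm (x - y) / norm x ^ (?n + 1))"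
    using M K1[OF x] K2 by (intro add_mono mult_mono m1) auto
  also have "... = 9 * A * norm (x - y) / norm x ^ (?n + 1)"
    by (simp add: field_simps)
  finally show "\<bar>?k x - ?k y\<bar> \<le> 9 * A * norm (x - y) / norm x ^ (?n + 1)" .
qed

lemma annular_truncation_good:
  fixes K :: "'a::euclidean_space \<Rightarrow> real"
  assumes K: "CZ_kernel A K" "radial_cancellation K" and s: "0 < s"
  shows "good_kernel (9 * A) (sqrt (orthogonality_const A TYPE('a)) * (2 / (1 - sqrt (1 / 2))))
    (annular_truncation K s N)"
  unfolding good_kernel_def
proof (intro conjI)
  note eq = annular_truncation_eq_sum[OF s]
  show "annular_truncation K s N \<in> bdd_L1"
    unfolding eq using s by (intro bdd_L1_sum kernel_piece_L1[OF K(1)]) auto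
  show "\<exists>L. \<forall>x y. \<bar>annular_truncation K s N x - annular_truncation K s N y\<bar> \<le> L * norm (x - y)"
  proof (intro exI allI)
    fix x y
    let ?L = "\<lambda>i. 8 * A * 2 ^ DIM('a) / (s * 2 ^ nat i) ^ (DIM('a) + 1)"
    have "\<bar>annular_truncation K s N x - annular_truncation K s N y\<bar>
        = \<bar>\<Sum>i\<in>{0..<int N}. kernel_piece K (s * 2 ^ nat i) x - kernel_piece K (s * 2 ^ nat i) y\<bar>"
      by (simp add: eq sum_subtractf)
    also have "... \<le> (\<Sum>i\<in>{0..<int N}. ?L i * norm (x - y))"
      using s by (intro order_trans[OF sum_abs] sum_mono kernel_piece_Lipschitz[OF K(1)]) auto
    finally show "\<bar>annular_truncation K s N x - annular_truncation K s N y\<bar>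
        \<le> (\<Sum>i\<in>{0..<int N}. ?L i) * norm (x - y)" by (simp add: sum_distrib_right)
  qed
qed (intro annular_truncation_CZ ballI annular_truncation_L2 K s)+

theorem exists_good_truncation:
  fixes K :: "'a::euclidean_space \<Rightarrow> real"
  assumes K: "CZ_kernel A K" "radial_cancellation K"
  shows "\<exists>A' B. 0 < A' \<and> 0 \<le> B \<and> (\<forall>a b. 0 < a \<longrightarrow> (\<exists>k. good_kernel A' B k \<and> (\<forall>x. a \<le> norm x \<longrightarrow> norm x \<le> b \<longrightarrow> k x = K x)))"
proof -
  let ?B = "sqrt (orthogonality_const A TYPE('a)) * (2 / (1 - sqrt (1 / 2)))"
  have 1: "0 < 9 * A" using K by (simp add: CZ_kernel_def)
  have 2: "0 \<le> ?B"
    using K real_sqrt_less_iff[of "1/2" 1]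
    by (auto simp: orthogonality_const_def CZ_kernel_def intro!: mult_nonneg_nonneg divide_nonneg_nonneg)
  have 3: "\<exists>k. good_kernel (9 * A) ?B k \<and> (\<forall>x. a \<le> norm x \<longrightarrow> norm x \<le> b \<longrightarrow> k x = K x)"
    if a: "0 < a" for a b
  proof -
  obtain N where N: "2 * b / a < 2 ^ N" using real_arch_pow[of 2 "2 * b / a"] by auto
  have "annular_truncation K a N x = K x" if "a \<le> norm x" "norm x \<le> b" for x
  proof -
    have "2 * b \<le> a * 2 ^ N" using N a by (simp add: field_simps)
    then have "2 * norm x \<le> a * 2 ^ N" using that by linarith
    then have "2 * norm x / (a * 2 ^ N) \<le> 1" "2 \<le> 2 * norm x / a"
      using a that by (auto simp: field_simps)
    then show ?thesis by (simp add: annular_truncation_def cutoff_eq_0 cutoff_eq_1)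
  qed
  then show "\<exists>k. good_kernel (9 * A) ?B k \<and> (\<forall>x. a \<le> norm x \<longrightarrow> norm x \<le> b \<longrightarrow> k x = K x)"
    using annular_truncation_good[OF K a] by blast
  qed
  show ?thesis using 1 2 3 by blast
qed

section \<open>The maximal function\<close>

lemma emeasure_UN_le_nn_integral:
  assumes "countable I" and A: "\<And>i. i \<in> I \<Longrightarrow> A i \<in> sets M"
  shows "emeasure M (\<Union>i\<in>I. A i) \<le> (\<integral>\<^sup>+i. emeasure M (A i) \<partial>count_space I)"
proof -
  have "emeasure M (\<Union>i\<in>I. A i) = (\<integral>\<^sup>+x. indicator (\<Union>i\<in>I. A i) x \<partial>M)"
    using assms by (subst nn_integral_indicator) auto
  also have "... \<le> (\<integral>\<^sup>+x. (\<integral>\<^sup>+i. indicator (A i) x \<partial>count_space I) \<partial>M)"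
  proof (rule nn_integral_mono)
    fix x
    show "indicator (\<Union>i\<in>I. A i) x \<le> (\<integral>\<^sup>+i. indicator (A i) x \<partial>count_space I)"
    proof (cases "x \<in> (\<Union>i\<in>I. A i)")
      case True
      then obtain i where i: "i \<in> I" "x \<in> A i" by blast
      have "indicator (A i) x \<le> (\<integral>\<^sup>+i. indicator (A i) x \<partial>count_space I)"
        using nn_integral_ge_point[OF i(1), of "\<lambda>i. indicator (A i) x"] by simp
      then show ?thesis using i by (auto simp: indicator_def)
    qed auto
  qed
  also have "... = (\<integral>\<^sup>+i. (\<integral>\<^sup>+x. indicator (A i) x \<partial>M) \<partial>count_space I)"
    using assms by (intro nn_integral_count_space_nn_integral) auto
  also have "... = (\<integral>\<^sup>+i. emeasure M (A i) \<partial>count_space I)"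
    using A by (intro nn_integral_cong) auto
  finally show ?thesis .
qed

lemma nn_integral_disjoint_UN:
  assumes [measurable]: "g \<in> borel_measurable M"
    and "countable I" "disjoint_family_on A I" and A: "\<And>i. i \<in> I \<Longrightarrow> A i \<in> sets M"
  shows "(\<integral>\<^sup>+i. (\<integral>\<^sup>+x\<in>A i. g x \<partial>M) \<partial>count_space I) = (\<integral>\<^sup>+x\<in>(\<Union>i\<in>I. A i). g x \<partial>M)"
proof -
  have "(\<integral>\<^sup>+x\<in>(\<Union>i\<in>I. A i). g x \<partial>M) = emeasure (density M g) (\<Union>i\<in>I. A i)"
    using assms by (subst emeasure_density) auto
  also have "... = (\<integral>\<^sup>+i. emeasure (density M g) (A i) \<partial>count_space I)"
    using assms by (intro emeasure_UN_countable) auto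
  also have "... = (\<integral>\<^sup>+i. (\<integral>\<^sup>+x\<in>A i. g x \<partial>M) \<partial>count_space I)"
    using A by (intro nn_integral_cong) (auto simp: emeasure_density)
  finally show ?thesis by simp
qed

text \<open>Sum over the dyadic annuli \<open>2\<^sup>k \<rho> \<le> \<bar>x - y\<bar> < 2\<^sup>k\<^sup>+\<^sup>1 \<rho>\<close>.\<close>

lemma nn_integral_tail_bound:
  fixes g :: "'a::euclidean_space \<Rightarrow> ennreal"
  assumes [measurable]: "g \<in> borel_measurable borel" and \<mu>: "0 \<le> \<mu>" and \<rho>: "0 < \<rho>"
    and b: "\<And>r. 0 < r \<Longrightarrow> (\<integral>\<^sup>+y\<in>ball x r. g y \<partial>lborel) \<le> ennreal (\<mu> * r ^ DIM('a))"
  shows "(\<integral>\<^sup>+y\<in>{y. \<rho> \<le> norm (x - y)}. g y * ennreal (1 / norm (x - y) ^ (DIM('a) + 1)) \<partial>lborel)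
    \<le> ennreal (2 ^ (DIM('a) + 1) * \<mu> / \<rho>)"
proof -
  let ?n = "DIM('a)"
  define s where "s k = 2 ^ k * \<rho>" for k :: nat
  have s: "0 < s k" "s (Suc k) = 2 * s k" for k using \<rho> by (auto simp: s_def)
  have pt: "g y * ennreal (1 / norm (x - y) ^ (?n + 1)) * indicator {y. \<rho> \<le> norm (x - y)} y
     \<le> (\<Sum>k. ennreal (1 / s k ^ (?n + 1)) * (g y * indicator (ball x (s (Suc k))) y))" for y
  proof (cases "\<rho> \<le> norm (x - y)")
    case True
    define P where "P k \<longleftrightarrow> norm (x - y) < s k" for k
    obtain N where N: "norm (x - y) / \<rho> < 2 ^ N" using real_arch_pow[of 2] by auto
    have "\<exists>k. \<not> P k \<and> P (Suc k)"
    proof (rule ccontr)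
      assume "\<nexists>k. \<not> P k \<and> P (Suc k)"
      moreover have "\<not> P 0" using True by (simp add: P_def s_def)
      ultimately have "\<not> P N" by (induction N) auto
      then show False using N \<rho> by (simp add: P_def s_def field_simps)
    qed
    then obtain k where k: "s k \<le> norm (x - y)" "norm (x - y) < s (Suc k)" by (metis P_def linorder_not_less)
    have "g y * ennreal (1 / norm (x - y) ^ (?n + 1)) \<le> g y * ennreal (1 / s k ^ (?n + 1))"
      using k s(1)[of k]
      by (intro mult_left_mono ennreal_leI divide_left_mono power_mono mult_pos_pos zero_less_power) auto
    also have "... = (\<Sum>j\<in>{k}. ennreal (1 / s j ^ (?n + 1)) * (g y * indicator (ball x (s (Suc j))) y))"
      using k by (simp add: dist_norm mult.commute)
    also have "... \<le> (\<Sum>k. ennreal (1 / s k ^ (?n + 1)) * (g y * indicator (ball x (s (Suc k))) y))"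
      by (rule sum_le_suminf) auto
    finally show ?thesis using True by simp
  qed simp
  have "(\<integral>\<^sup>+y\<in>{y. \<rho> \<le> norm (x - y)}. g y * ennreal (1 / norm (x - y) ^ (?n + 1)) \<partial>lborel)
      \<le> (\<integral>\<^sup>+y. (\<Sum>k. ennreal (1 / s k ^ (?n + 1)) * (g y * indicator (ball x (s (Suc k))) y)) \<partial>lborel)"
    by (intro nn_integral_mono pt)
  also have "... = (\<Sum>k. ennreal (1 / s k ^ (?n + 1)) * (\<integral>\<^sup>+y\<in>ball x (s (Suc k)). g y \<partial>lborel))"
  proof -
    have [measurable]: "(\<lambda>y. g y * indicator (ball x r) y) \<in> borel_measurable borel" for r
      by (intro borel_measurable_times_ennreal borel_measurable_indicator) auto
    show ?thesis by (subst nn_integral_suminf) (auto intro!: suminf_cong nn_integral_cmult)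
  qed
  also have "... \<le> (\<Sum>k. ennreal (2 ^ ?n * \<mu> / \<rho> * (1 / 2) ^ k))"
  proof (intro suminf_le)
    fix k
    have "ennreal (1 / s k ^ (?n + 1)) * (\<integral>\<^sup>+y\<in>ball x (s (Suc k)). g y \<partial>lborel)
        \<le> ennreal (1 / s k ^ (?n + 1)) * ennreal (\<mu> * s (Suc k) ^ ?n)"
      using s by (intro mult_left_mono b) auto
    also have "... = ennreal (2 ^ ?n * \<mu> / \<rho> * (1 / 2) ^ k)"
    proof -
      have "1 / s k ^ (?n + 1) * (\<mu> * s (Suc k) ^ ?n) = 2 ^ ?n * \<mu> / s k"
        using s(1)[of k] by (simp add: s(2) power_mult_distrib)
      also have "... = 2 ^ ?n * \<mu> / \<rho> * (1 / 2) ^ k"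
        using \<rho> by (simp add: s_def power_one_over field_simps)
      finally show ?thesis
        using s(1)[of k] s(1)[of "Suc k"] \<mu> by (subst ennreal_mult[symmetric]) (auto intro!: mult_nonneg_nonneg simp: less_imp_le)
    qed
    finally show "ennreal (1 / s k ^ (?n + 1)) * (\<integral>\<^sup>+y\<in>ball x (s (Suc k)). g y \<partial>lborel)
       \<le> ennreal (2 ^ ?n * \<mu> / \<rho> * (1 / 2) ^ k)" .
  qed auto
  also have "... = ennreal (\<Sum>k. 2 ^ ?n * \<mu> / \<rho> * (1 / 2) ^ k)"
    using \<mu> \<rho> by (intro suminf_ennreal2 summable_mult summable_geometric) auto
  also have "(\<Sum>k. 2 ^ ?n * \<mu> / \<rho> * (1 / 2) ^ k) = 2 ^ (?n + 1) * \<mu> / \<rho>"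
    by (subst suminf_mult) (auto simp: suminf_geometric summable_geometric)
  finally show ?thesis .
qed

text \<open>
  The level sets of the centred maximal function, normalized by \<open>r\<^sup>n\<close> instead of
  the volume of the ball.
\<close>

definition maximal_set :: "('a::euclidean_space \<Rightarrow> ennreal) \<Rightarrow> real \<Rightarrow> 'a set" where
  "maximal_set g \<tau> = {x. \<exists>r>0. ennreal (\<tau> * r ^ DIM('a)) < (\<integral>\<^sup>+y\<in>ball x r. g y \<partial>lborel)}"

lemma maximal_setD:
  fixes g :: "'a::euclidean_space \<Rightarrow> ennreal"
  assumes "x \<notin> maximal_set g \<tau>" "0 < r"
  shows "(\<integral>\<^sup>+y\<in>ball x r. g y \<partial>lborel) \<le> ennreal (\<tau> * r ^ DIM('a))"
proof (rule leI, rule notI)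
  assume "ennreal (\<tau> * r ^ DIM('a)) < (\<integral>\<^sup>+y\<in>ball x r. g y \<partial>lborel)"
  then show False using assms unfolding maximal_set_def by blast
qed

text \<open>
  By monotone convergence a slightly smaller ball about \<open>x\<close> still violates the
  inequality, and the ball of radius \<open>r\<close> about any nearby point contains it.
\<close>

lemma open_maximal_set:
  fixes g :: "'a::euclidean_space \<Rightarrow> ennreal"
  assumes [measurable]: "g \<in> borel_measurable borel" and \<tau>: "0 \<le> \<tau>"
  shows "open (maximal_set g \<tau>)"
  unfolding open_dist
proof
  fix x assume "x \<in> maximal_set g \<tau>"
  then obtain r where r: "0 < r" "ennreal (\<tau> * r ^ DIM('a)) < (\<integral>\<^sup>+y\<in>ball x r. g y \<partial>lborel)"
    by (auto simp: maximal_set_def)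
  define q where "q m = r - r / real (m + 2)" for m :: nat
  have q: "0 < q m" "q m < r" for m
  proof -
    have "r / real (m + 2) \<le> r / 2" using r(1) by (intro divide_left_mono) auto
    moreover have "0 < r / real (m + 2)" using r(1) by (intro divide_pos_pos) auto
    ultimately show "0 < q m" "q m < r" using r(1) unfolding q_def by linarith+
  qed
  have U: "(\<Union>m. ball x (q m)) = ball x r"
  proof (intro equalityI subsetI)
    fix y assume "y \<in> ball x r"
    then have "0 < (r - dist x y) / r" using r(1) by simp
    then obtain m where "inverse (real (Suc m)) < (r - dist x y) / r" using reals_Archimedean by blast
    then have "r / real (Suc m) < r - dist x y" using r(1) by (simp add: field_simps)
    moreover have "r / real (m + 2) \<le> r / real (Suc m)" using r(1) by (intro divide_left_mono) auto
    ultimately have "dist x y < q m" by (simp add: q_def)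
    then show "y \<in> (\<Union>m. ball x (q m))" by auto
  qed (use q in \<open>force intro: less_trans\<close>)
  let ?M = "density lborel g"
  have eM: "emeasure ?M (ball z s) = (\<integral>\<^sup>+y\<in>ball z s. g y \<partial>lborel)" for z s
    by (subst emeasure_density) auto
  have "incseq (\<lambda>m. ball x (q m))"
  proof (rule monoI, rule subset_ball)
    fix m l :: nat assume "m \<le> l"
    then show "q m \<le> q l" using r(1) by (auto simp: q_def intro!: divide_left_mono)
  qed
  then have "(SUP m. emeasure ?M (ball x (q m))) = emeasure ?M (ball x r)"
    using SUP_emeasure_incseq[of "\<lambda>m. ball x (q m)" ?M] by (auto simp: U image_subset_iff)
  then have "ennreal (\<tau> * r ^ DIM('a)) < (SUP m. emeasure ?M (ball x (q m)))"
    using r(2) by (simp add: eM)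
  then obtain m where m: "ennreal (\<tau> * r ^ DIM('a)) < emeasure ?M (ball x (q m))"
    by (auto simp: less_SUP_iff)
  have "y \<in> maximal_set g \<tau>" if "dist y x < r - q m" for y
  proof -
    have "ball x (q m) \<subseteq> ball y r"
    proof
      fix z assume "z \<in> ball x (q m)"
      then show "z \<in> ball y r" using that dist_triangle[of y z x] by simp
    qed
    then have "emeasure ?M (ball x (q m)) \<le> emeasure ?M (ball y r)" by (intro emeasure_mono) auto
    then show ?thesis using m r(1) unfolding maximal_set_def eM by (auto intro: less_le_trans)
  qed
  then show "\<exists>e>0. \<forall>y. dist y x < e \<longrightarrow> y \<in> maximal_set g \<tau>"
    using q[of m] by (intro exI[of _ "r - q m"]) auto
qed

text \<open>The weak type \<open>(1,1)\<close> inequality of the maximal function, from Vitali's covering lemma.\<close>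

lemma emeasure_maximal_set:
  fixes g :: "'a::euclidean_space \<Rightarrow> ennreal"
  assumes [measurable]: "g \<in> borel_measurable borel" and \<tau>: "0 < \<tau>"
    and fin: "(\<integral>\<^sup>+y. g y \<partial>lborel) < \<infinity>"
  shows "emeasure lborel (maximal_set g \<tau>)
    \<le> ennreal (unit_ball_vol (real DIM('a)) * 5 ^ DIM('a) / \<tau>) * (\<integral>\<^sup>+y. g y \<partial>lborel)"
proof -
  let ?n = "DIM('a)" and ?S = "maximal_set g \<tau>" and ?v = "unit_ball_vol (real DIM('a))"
  define I where "I = enn2real (\<integral>\<^sup>+y. g y \<partial>lborel)"
  have I: "(\<integral>\<^sup>+y. g y \<partial>lborel) = ennreal I" "0 \<le> I" using fin by (auto simp: I_def less_top)
  have "\<forall>x\<in>?S. \<exists>r>0. ennreal (\<tau> * r ^ ?n) < (\<integral>\<^sup>+y\<in>ball x r. g y \<partial>lborel)"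
    by (auto simp: maximal_set_def)
  then obtain r where r: "\<And>x. x \<in> ?S \<Longrightarrow> 0 < r x"
      "\<And>x. x \<in> ?S \<Longrightarrow> ennreal (\<tau> * r x ^ ?n) < (\<integral>\<^sup>+y\<in>ball x (r x). g y \<partial>lborel)"
    by metis
  have rb: "r x \<le> max 1 (I / \<tau>)" if x: "x \<in> ?S" for x
  proof (cases "r x \<le> 1")
    case False
    have "(\<integral>\<^sup>+y\<in>ball x (r x). g y \<partial>lborel) \<le> ennreal I"
      unfolding I(1)[symmetric] by (intro nn_integral_mono) (auto simp: indicator_def)
    then have "\<tau> * r x ^ ?n < I"
      using r(2)[OF x] I(2) \<tau> r(1)[OF x] by (metis ennreal_less_iff less_imp_le mult_nonneg_nonneg order_less_le_trans zero_le_power)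
    moreover have "r x \<le> r x ^ ?n" using False DIM_positive[where 'a='a] by (intro self_le_power) auto
    ultimately have "\<tau> * r x < I" using \<tau> by (meson le_less_trans mult_left_mono less_imp_le)
    then show ?thesis using \<tau> by (simp add: field_simps le_max_iff_disj)
  qed simp
  have "?S \<subseteq> (\<Union>x\<in>?S. ball x (r x))" using r(1) by force
  then obtain C where C: "countable C" "C \<subseteq> ?S"
     "pairwise (\<lambda>i j. disjnt (ball i (r i)) (ball j (r j))) C" "?S \<subseteq> (\<Union>i\<in>C. ball i (5 * r i))"
    using Vitali_covering_lemma_balls[of ?S "\<lambda>x. x" r ?S "max 1 (I / \<tau>)"] r(1) rb by (metis (no_types, lifting))
  have "emeasure lborel ?S \<le> emeasure lborel (\<Union>i\<in>C. ball i (5 * r i))"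
    using C by (intro emeasure_mono) (auto intro: sets.countable_UN')
  also have "... \<le> (\<integral>\<^sup>+i. emeasure lborel (ball i (5 * r i)) \<partial>count_space C)"
    by (intro emeasure_UN_le_nn_integral C) auto
  also have "... \<le> (\<integral>\<^sup>+i. ennreal (?v * 5 ^ ?n / \<tau>) * (\<integral>\<^sup>+y\<in>ball i (r i). g y \<partial>lborel) \<partial>count_space C)"
  proof (rule nn_integral_mono)
    fix i assume "i \<in> space (count_space C)"
    then have i: "i \<in> ?S" using C by auto
    have "emeasure lborel (ball i (5 * r i)) = ennreal (?v * (5 * r i) ^ ?n)"
      using r(1)[OF i] by (subst emeasure_ball) auto
    also have "... = ennreal (?v * 5 ^ ?n / \<tau>) * ennreal (\<tau> * r i ^ ?n)"
      using \<tau> r(1)[OF i] by (subst ennreal_mult[symmetric]) (auto simp: power_mult_distrib)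
    also have "... \<le> ennreal (?v * 5 ^ ?n / \<tau>) * (\<integral>\<^sup>+y\<in>ball i (r i). g y \<partial>lborel)"
      using r(2)[OF i] by (intro mult_left_mono) auto
    finally show "emeasure lborel (ball i (5 * r i)) \<le> ennreal (?v * 5 ^ ?n / \<tau>) * (\<integral>\<^sup>+y\<in>ball i (r i). g y \<partial>lborel)" .
  qed
  also have "... = ennreal (?v * 5 ^ ?n / \<tau>) * (\<integral>\<^sup>+i. (\<integral>\<^sup>+y\<in>ball i (r i). g y \<partial>lborel) \<partial>count_space C)"
    by (intro nn_integral_cmult) auto
  also have "(\<integral>\<^sup>+i. (\<integral>\<^sup>+y\<in>ball i (r i). g y \<partial>lborel) \<partial>count_space C) = (\<integral>\<^sup>+y\<in>(\<Union>i\<in>C. ball i (r i)). g y \<partial>lborel)"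
    using C by (intro nn_integral_disjoint_UN) (auto simp: disjoint_family_on_def pairwise_def disjnt_def)
  also have "... \<le> (\<integral>\<^sup>+y. g y \<partial>lborel)"
    by (intro nn_integral_mono) (auto simp: indicator_def)
  finally show ?thesis by (simp add: mult_left_mono)
qed

section \<open>Dyadic cubes\<close>

definition cell_index :: "int \<Rightarrow> 'a::euclidean_space \<Rightarrow> 'a \<Rightarrow> int" where
  "cell_index k x i = \<lfloor>(x \<bullet> i) / 2 powi k\<rfloor>"

text \<open>
  The half-open dyadic cube of side length \<open>2\<^sup>k\<close> that contains \<open>x\<close>. A
  cube is thus named by its level and any of its points, and statements about a cube are invariant
  under a change of that point.
\<close>

definition dcell :: "int \<Rightarrow> 'a::euclidean_space \<Rightarrow> 'a set" where
  "dcell k x = {y. \<forall>i\<in>Basis. cell_index k y i = cell_index k x i}"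

text \<open>The concentric cube of three times the side length.\<close>

definition dtriple :: "int \<Rightarrow> 'a::euclidean_space \<Rightarrow> 'a set" where
  "dtriple k x = {y. \<forall>i\<in>Basis. \<bar>cell_index k y i - cell_index k x i\<bar> \<le> 1}"

definition dcorner :: "int \<Rightarrow> 'a::euclidean_space \<Rightarrow> 'a" where
  "dcorner k x = (\<Sum>i\<in>Basis. (2 powi k * of_int (cell_index k x i)) *\<^sub>R i)"

lemma two_powi_pos [simp]: "0 < (2::real) powi k"
  by (rule zero_less_power_int) simp

lemma dcell_self [simp]: "x \<in> dcell k x"
  by (simp add: dcell_def)

lemma dcell_subset_dtriple: "dcell k x \<subseteq> dtriple k x"
  by (auto simp: dcell_def dtriple_def)

lemma dtriple_self [simp]: "x \<in> dtriple k x"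
  by (simp add: dtriple_def)

lemma dcell_eq: "y \<in> dcell k x \<Longrightarrow> dcell k y = dcell k x"
  by (auto simp: dcell_def)

lemma dtriple_eq: "y \<in> dcell k x \<Longrightarrow> dtriple k y = dtriple k x"
  by (auto simp: dcell_def dtriple_def)

lemma dcell_index_eq: "y \<in> dcell k x \<Longrightarrow> i \<in> Basis \<Longrightarrow> cell_index k y i = cell_index k x i"
  by (auto simp: dcell_def)

lemma cell_index_coarser:
  assumes "k \<le> m"
  shows "cell_index m x i = cell_index k x i div 2 ^ nat (m - k)"
proof -
  obtain d where d: "m = k + int d" using assms zle_iff_zadd by blast
  then have "(2::real) powi m = 2 powi k * of_int (2 ^ d)"
    using power_int_add[of "2::real" k "int d"] by simp
  moreover have "nat (m - k) = d" using d by simp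
  ultimately show ?thesis
    unfolding cell_index_def using floor_divide_real_eq_div[of "2 ^ d" "(x \<bullet> i) / 2 powi k"]
    by (simp add: divide_divide_eq_left)
qed

lemma dcell_mono: "k \<le> m \<Longrightarrow> dcell k x \<subseteq> dcell m x"
  by (auto simp: dcell_def cell_index_coarser[of k m])

lemma dtriple_mono:
  assumes "k \<le> m"
  shows "dtriple k x \<subseteq> dtriple m x"
proof
  fix y assume y: "y \<in> dtriple k x"
  have *: "\<bar>u div d - v div d\<bar> \<le> 1" if "\<bar>u - v\<bar> \<le> 1" "0 < d" for u v d :: int
  proof -
    have mono: "a div d \<le> b div d + 1" if "a \<le> b + 1" for a b
    proof -
      have "a div d \<le> (b + 1) div d" using that \<open>0 < d\<close> by (intro zdiv_mono1)
      also have "... \<le> (b + d) div d" using \<open>0 < d\<close> by (intro zdiv_mono1) auto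
      finally show ?thesis using \<open>0 < d\<close> by simp
    qed
    show ?thesis using mono[of u v] mono[of v u] that by linarith
  qed
  show "y \<in> dtriple m x"
    using y assms by (auto simp: dtriple_def cell_index_coarser[of k m] intro!: *)
qed

lemma dtriple_mono_dcell:
  assumes "k \<le> m" "x \<in> dcell m z"
  shows "dtriple k x \<subseteq> dtriple m z"
  using dtriple_mono[OF assms(1), of x] dtriple_eq[OF assms(2)] by simp

lemma dcell_laminar: "k \<le> m \<Longrightarrow> dcell k x \<inter> dcell m y \<noteq> {} \<Longrightarrow> dcell k x \<subseteq> dcell m y"
  by (metis dcell_eq dcell_mono disjoint_iff subsetD)

lemma cell_index_bounds:
  "2 powi k * of_int (cell_index k x i) \<le> x \<bullet> i" "x \<bullet> i < 2 powi k * of_int (cell_index k x i) + 2 powi k"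
proof -
  have "of_int (cell_index k x i) \<le> (x \<bullet> i) / 2 powi k" "(x \<bullet> i) / 2 powi k < of_int (cell_index k x i) + 1"
    unfolding cell_index_def by linarith+
  then show "2 powi k * of_int (cell_index k x i) \<le> x \<bullet> i" "x \<bullet> i < 2 powi k * of_int (cell_index k x i) + 2 powi k"
    by (simp_all add: pos_le_divide_eq pos_divide_less_eq algebra_simps)
qed

lemma cell_index_unique:
  assumes "2 powi k * of_int z \<le> x \<bullet> i" "x \<bullet> i < 2 powi k * of_int z + 2 powi k"
  shows "cell_index k x i = z"
  unfolding cell_index_def
proof (rule floor_unique)
  show "of_int z \<le> (x \<bullet> i) / 2 powi k" "(x \<bullet> i) / 2 powi k < of_int z + 1"
    using assms by (simp_all add: pos_le_divide_eq pos_divide_less_eq algebra_simps)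
qed

lemma cell_index_eq_iff:
  "cell_index k x i = z \<longleftrightarrow> 2 powi k * of_int z \<le> x \<bullet> i \<and> x \<bullet> i < 2 powi k * of_int z + 2 powi k"
  using cell_index_bounds cell_index_unique by metis

lemma dcorner_inner: "i \<in> Basis \<Longrightarrow> dcorner k x \<bullet> i = 2 powi k * of_int (cell_index k x i)"
  by (simp add: dcorner_def)

lemma dcell_alt:
  "dcell k x = {y. \<forall>i\<in>Basis. dcorner k x \<bullet> i \<le> y \<bullet> i \<and> y \<bullet> i < dcorner k x \<bullet> i + 2 powi k}"
  by (simp add: dcell_def cell_index_eq_iff dcorner_inner)

lemma dtriple_alt:
  fixes x :: "'a::euclidean_space"
  shows "dtriple k x = {y. \<forall>i\<in>Basis. dcorner k x \<bullet> i - 2 powi k \<le> y \<bullet> i \<and> y \<bullet> i < dcorner k x \<bullet> i + 2 * 2 powi k}"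
proof -
  have "\<bar>cell_index k y i - z\<bar> \<le> 1 \<longleftrightarrow> 2 powi k * of_int z - 2 powi k \<le> y \<bullet> i \<and> y \<bullet> i < 2 powi k * of_int z + 2 * 2 powi k"
    for y i :: 'a and z
  proof -
    let ?t = "(y \<bullet> i) / 2 powi k"
    have "\<bar>cell_index k y i - z\<bar> \<le> 1 \<longleftrightarrow> of_int (z - 1) \<le> ?t \<and> ?t < of_int (z + 2)"
      unfolding cell_index_def by (simp only: le_floor_iff[symmetric] floor_less_iff[symmetric]) linarith
    then show ?thesis
      by (simp only: pos_le_divide_eq[OF two_powi_pos] pos_divide_less_eq[OF two_powi_pos]) (simp add: algebra_simps)
  qed
  then show ?thesis by (simp add: dtriple_def dcorner_inner)
qed

lemma half_open_cube:
  fixes a :: "'a::euclidean_space"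
  assumes l: "0 \<le> l"
  defines "Q \<equiv> {y. \<forall>i\<in>Basis. a \<bullet> i \<le> y \<bullet> i \<and> y \<bullet> i < a \<bullet> i + l}"
  shows "Q \<in> sets borel" "emeasure lborel Q = ennreal (l ^ DIM('a))"
    "Q \<subseteq> cbox a (a + l *\<^sub>R One)" "emeasure lborel (cbox a (a + l *\<^sub>R One)) = ennreal (l ^ DIM('a))"
proof -
  have "Q = (\<Inter>i\<in>Basis. {y. a \<bullet> i \<le> y \<bullet> i \<and> y \<bullet> i < a \<bullet> i + l})" unfolding Q_def by auto
  moreover have "{y. a \<bullet> i \<le> y \<bullet> i \<and> y \<bullet> i < a \<bullet> i + l} \<in> sets borel" for i :: 'a by measurable
  ultimately show Q: "Q \<in> sets borel" by (auto intro!: sets.finite_INT)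
  show sub: "Q \<subseteq> cbox a (a + l *\<^sub>R One)" unfolding Q_def by (auto simp: mem_box inner_add_left less_imp_le)
  show e: "emeasure lborel (cbox a (a + l *\<^sub>R One)) = ennreal (l ^ DIM('a))"
    using l by (subst emeasure_lborel_cbox) (auto simp: inner_add_left inner_diff_left)
  have "box a (a + l *\<^sub>R One) \<subseteq> Q" unfolding Q_def by (auto simp: mem_box inner_add_left less_imp_le)
  then have "emeasure lborel (box a (a + l *\<^sub>R One)) \<le> emeasure lborel Q"
    using Q by (intro emeasure_mono) auto
  moreover have "emeasure lborel (box a (a + l *\<^sub>R One)) = ennreal (l ^ DIM('a))"
    using l by (subst emeasure_lborel_box) (auto simp: inner_add_left inner_diff_left)
  moreover have "emeasure lborel Q \<le> emeasure lborel (cbox a (a + l *\<^sub>R One))"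
    using sub by (intro emeasure_mono) auto
  ultimately show "emeasure lborel Q = ennreal (l ^ DIM('a))" using e by simp
qed

lemma dtriple_alt':
  fixes x :: "'a::euclidean_space"
  shows "dtriple k x = {y. \<forall>i\<in>Basis. (dcorner k x - 2 powi k *\<^sub>R One) \<bullet> i \<le> y \<bullet> i \<and>
    y \<bullet> i < (dcorner k x - 2 powi k *\<^sub>R One) \<bullet> i + 3 * 2 powi k}"
  unfolding dtriple_alt by (auto simp: inner_diff_left)

lemma dcell_borel [measurable]: "dcell k x \<in> sets borel"
  using half_open_cube(1)[of "2 powi k" "dcorner k x"] by (simp add: dcell_alt less_imp_le)

lemma emeasure_dcell: "emeasure lborel (dcell k (x::'a::euclidean_space)) = ennreal ((2 powi k) ^ DIM('a))"
  using half_open_cube(2)[of "2 powi k" "dcorner k x"] by (simp add: dcell_alt less_imp_le)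

lemma dtriple_borel [measurable]: "dtriple k x \<in> sets borel"
  unfolding dtriple_alt' by (rule half_open_cube(1)) (simp add: less_imp_le)

lemma emeasure_dtriple: "emeasure lborel (dtriple k (x::'a::euclidean_space)) = ennreal ((3 * 2 powi k) ^ DIM('a))"
  unfolding dtriple_alt' by (rule half_open_cube(2)) (simp add: less_imp_le)

lemma norm_le_of_components:
  fixes x :: "'a::euclidean_space"
  assumes "\<And>i. i \<in> Basis \<Longrightarrow> \<bar>x \<bullet> i\<bar> \<le> c"
  shows "norm x \<le> real DIM('a) * c"
  using order_trans[OF norm_le_l1[of x] sum_bounded_above[of Basis "\<lambda>i. \<bar>x \<bullet> i\<bar>" c]] assms by simp

lemma dist_dcell:
  fixes x :: "'a::euclidean_space"
  assumes "y \<in> dcell k x" shows "norm (x - y) \<le> real DIM('a) * 2 powi k"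
proof (rule norm_le_of_components)
  fix i :: 'a assume i: "i \<in> Basis"
  show "\<bar>(x - y) \<bullet> i\<bar> \<le> 2 powi k"
    using cell_index_bounds[where k=k and x=x and i=i] cell_index_bounds[where k=k and x=y and i=i] dcell_index_eq[OF assms i]
    by (simp add: inner_diff_left abs_le_iff)
qed

lemma dist_dtriple:
  fixes x :: "'a::euclidean_space"
  assumes "y \<in> dtriple k z" "x \<in> dcell k z" shows "norm (x - y) \<le> real DIM('a) * (2 * 2 powi k)"
proof (rule norm_le_of_components)
  fix i :: 'a assume i: "i \<in> Basis"
  have "y \<in> dtriple k x" "dcorner k x \<bullet> i \<le> x \<bullet> i" "x \<bullet> i < dcorner k x \<bullet> i + 2 powi k"
    using assms dtriple_eq i dcell_self[of x k] by (blast, auto simp: dcell_alt)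
  then show "\<bar>(x - y) \<bullet> i\<bar> \<le> 2 * 2 powi k"
    using i unfolding dtriple_alt by (auto simp: inner_diff_left abs_le_iff)
qed

lemma dist_outside_dtriple:
  fixes x :: "'a::euclidean_space"
  assumes "y \<notin> dtriple k z" "x \<in> dcell k z" shows "2 powi k \<le> norm (x - y)"
proof -
  have "y \<notin> dtriple k x" using assms dtriple_eq by blast
  then obtain i where i: "i \<in> Basis" "y \<bullet> i < dcorner k x \<bullet> i - 2 powi k \<or> dcorner k x \<bullet> i + 2 * 2 powi k \<le> y \<bullet> i"
    unfolding dtriple_alt by force
  moreover have "dcorner k x \<bullet> i \<le> x \<bullet> i" "x \<bullet> i < dcorner k x \<bullet> i + 2 powi k"
    using i(1) dcell_self[of x k] unfolding dcell_alt by auto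
  ultimately have "2 powi k \<le> \<bar>(x - y) \<bullet> i\<bar>" by (auto simp: inner_diff_left)
  also have "... \<le> norm (x - y)" using i(1) by (rule Basis_le_norm)
  finally show ?thesis .
qed

lemma countable_dcells: "countable (range (dcell k :: 'a::euclidean_space \<Rightarrow> 'a set))"
proof -
  let ?F = "\<lambda>z::'a \<Rightarrow> int. {y::'a. \<forall>i\<in>Basis. cell_index k y i = z i}"
  have "dcell k x \<in> ?F ` (PiE Basis (\<lambda>_. UNIV))" for x :: 'a
    by (rule image_eqI[of _ _ "restrict (cell_index k x) Basis"]) (auto simp: dcell_def)
  then have "range (dcell k) \<subseteq> ?F ` (PiE Basis (\<lambda>_. UNIV))" by blast
  moreover have "countable (PiE (Basis::'a set) (\<lambda>_. UNIV :: int set))"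
    by (intro countable_PiE) auto
  ultimately show ?thesis by (rule countable_subset[OF _ countable_image])
qed

definition dcells :: "'a::euclidean_space set set" where
  "dcells = (\<Union>k. range (dcell k))"

lemma countable_all_dcells: "countable dcells"
  unfolding dcells_def by (intro countable_UN countable_dcells) auto

text \<open>Partitions of the space into countably many cells of finite positive measure.\<close>

locale cell_partition =
  fixes cell :: "'a::euclidean_space \<Rightarrow> 'a set"
  assumes self: "x \<in> cell x"
    and eq: "y \<in> cell x \<Longrightarrow> cell y = cell x"
    and count: "countable (range cell)"
    and borel: "cell x \<in> sets borel"
    and pos: "0 < emeasure lborel (cell x)"
    and fin: "emeasure lborel (cell x) < \<infinity>"
begin

definition rep :: "'a \<Rightarrow> 'a" where "rep x = (SOME z. z \<in> cell x)"

lemma rep_in: "rep x \<in> cell x"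
  unfolding rep_def using self by (rule someI)

lemma cell_rep [simp]: "cell (rep x) = cell x"
  using eq[OF rep_in] .

lemma rep_const: "y \<in> cell x \<Longrightarrow> rep y = rep x"
  using eq[of y x] by (simp add: rep_def)

lemma countable_reps: "countable (range rep)"
proof -
  have "rep x = (\<lambda>C. SOME z. z \<in> C) (cell x)" for x by (simp add: rep_def)
  then have "range rep \<subseteq> (\<lambda>C. SOME z. z \<in> C) ` range cell" by blast
  then show ?thesis by (rule countable_subset[OF _ countable_image[OF count]])
qed

lemma cell_of_rep: "z \<in> range rep \<Longrightarrow> rep z = z"
  using rep_const[OF rep_in] by auto

lemma disjoint_cells: "disjoint_family_on cell (range rep)"
  unfolding disjoint_family_on_def
proof (intro ballI impI)
  fix m n assume mn: "m \<in> range rep" "n \<in> range rep" "m \<noteq> n"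
  show "cell m \<inter> cell n = {}"
  proof (rule ccontr)
    assume "cell m \<inter> cell n \<noteq> {}"
    then obtain x where "x \<in> cell m" "x \<in> cell n" by blast
    then have "cell m = cell n" using eq by metis
    then have "rep m = rep n" by (simp add: rep_def)
    then show False using mn cell_of_rep by metis
  qed
qed

lemma union_of_cells:
  assumes "\<And>x y. x \<in> S \<Longrightarrow> y \<in> cell x \<Longrightarrow> y \<in> S"
  shows "S = (\<Union>z\<in>S \<inter> range rep. cell z)"
proof (intro equalityI subsetI)
  fix x assume "x \<in> S"
  then have "rep x \<in> S \<inter> range rep" "x \<in> cell (rep x)" using assms rep_in self by auto
  then show "x \<in> (\<Union>z\<in>S \<inter> range rep. cell z)" by blast
qed (use assms in blast)

lemma borel_union_of_cells:
  assumes "\<And>x y. x \<in> S \<Longrightarrow> y \<in> cell x \<Longrightarrow> y \<in> S"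
  shows "S \<in> sets borel"
proof -
  have "countable (S \<inter> range rep)" using countable_reps by (rule countable_Int2)
  then show ?thesis
    using borel by (subst union_of_cells[OF assms]) (auto intro!: sets.countable_UN')
qed

lemma measurable_cell_const:
  assumes "\<And>x y. y \<in> cell x \<Longrightarrow> h y = h x"
  shows "h \<in> borel \<rightarrow>\<^sub>M M \<longleftrightarrow> range h \<subseteq> space M"
proof
  assume "range h \<subseteq> space M"
  then show "h \<in> borel \<rightarrow>\<^sub>M M"
    using assms by (intro measurableI) (auto intro!: borel_union_of_cells)
qed (auto dest: measurable_space)

lemma borel_measurable_cell_const:
  fixes h :: "'a \<Rightarrow> 'b::topological_space"
  shows "(\<And>x y. y \<in> cell x \<Longrightarrow> h y = h x) \<Longrightarrow> h \<in> borel_measurable borel"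
  by (subst measurable_cell_const) auto

lemma nn_integral_cells:
  assumes [measurable]: "g \<in> borel_measurable borel"
    and S: "\<And>x y. x \<in> S \<Longrightarrow> y \<in> cell x \<Longrightarrow> y \<in> S"
  shows "(\<integral>\<^sup>+x\<in>S. g x \<partial>lborel) = (\<integral>\<^sup>+z. (\<integral>\<^sup>+x\<in>cell z. g x \<partial>lborel) \<partial>count_space (S \<inter> range rep))"
proof -
  have "countable (S \<inter> range rep)" using countable_reps by (rule countable_Int2)
  moreover have "disjoint_family_on cell (S \<inter> range rep)"
    using disjoint_cells by (rule disjoint_family_on_mono[rotated]) auto
  ultimately show ?thesis
    using borel nn_integral_disjoint_UN[of g lborel "S \<inter> range rep" cell]
    by (subst union_of_cells[OF S]) auto
qed

text \<open>The conditional expectation with respect to the partition.\<close>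

definition cell_mean :: "('a \<Rightarrow> real) \<Rightarrow> 'a \<Rightarrow> real" where
  "cell_mean f x = (\<integral>y. indicator (cell x) y * f y \<partial>lborel) / measure lborel (cell x)"

lemma cell_mean_const: "y \<in> cell x \<Longrightarrow> cell_mean f y = cell_mean f x"
  using eq[of y x] by (simp add: cell_mean_def)

lemma cell_mean_measurable [measurable]: "cell_mean f \<in> borel_measurable borel"
  by (rule borel_measurable_cell_const) (rule cell_mean_const)

lemma integrable_on_cell:
  assumes "integrable lborel f"
  shows "integrable lborel (\<lambda>y. indicator (cell x) y * (f y :: real))"
  using integrable_mult_indicator[of "cell x" lborel f] borel assms by simp

lemma measure_cell_pos: "0 < measure lborel (cell x)"
  and emeasure_cell: "emeasure lborel (cell x) = ennreal (measure lborel (cell x))"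
proof -
  show "emeasure lborel (cell x) = ennreal (measure lborel (cell x))"
    using fin[of x] by (intro emeasure_eq_ennreal_measure) auto
  then show "0 < measure lborel (cell x)" using pos[of x] by simp
qed

lemma nn_integral_cell_mean:
  assumes f: "integrable lborel f" "\<And>x. 0 \<le> f x"
    and h: "\<And>x y. y \<in> cell x \<Longrightarrow> h y = h x"
  shows "(\<integral>\<^sup>+x. h x * ennreal (cell_mean f x) \<partial>lborel) = (\<integral>\<^sup>+x. h x * ennreal (f x) \<partial>lborel)"
proof -
  have [measurable]: "h \<in> borel_measurable borel" using h by (rule borel_measurable_cell_const)
  have [measurable]: "f \<in> borel_measurable borel" using f by auto
  note [measurable] = borel
  have "(\<integral>\<^sup>+x\<in>UNIV. h x * ennreal (cell_mean f x) \<partial>lborel)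
      = (\<integral>\<^sup>+z. (\<integral>\<^sup>+x\<in>cell z. h x * ennreal (cell_mean f x) \<partial>lborel) \<partial>count_space (UNIV \<inter> range rep))"
    by (rule nn_integral_cells) auto
  also have "... = (\<integral>\<^sup>+z. (\<integral>\<^sup>+x\<in>cell z. h x * ennreal (f x) \<partial>lborel) \<partial>count_space (UNIV \<inter> range rep))"
  proof (rule nn_integral_cong)
    fix z
    let ?m = "measure lborel (cell z)"
    have "(\<integral>\<^sup>+x\<in>cell z. h x * ennreal (cell_mean f x) \<partial>lborel) = (\<integral>\<^sup>+x. (h z * ennreal (cell_mean f z)) * indicator (cell z) x \<partial>lborel)"
      using h[of _ z] cell_mean_const[of _ z f] by (intro nn_integral_cong) (auto split: split_indicator)
    also have "... = h z * (ennreal (cell_mean f z) * ennreal ?m)"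
      by (subst nn_integral_cmult_indicator) (auto simp: emeasure_cell mult.assoc)
    also have "ennreal (cell_mean f z) * ennreal ?m = ennreal (\<integral>y. indicator (cell z) y * f y \<partial>lborel)"
      using measure_cell_pos[of z] f by (simp add: cell_mean_def flip: ennreal_mult)
    also have "... = (\<integral>\<^sup>+y. ennreal (indicator (cell z) y * f y) \<partial>lborel)"
      using integrable_on_cell[OF f(1)] f(2) by (subst nn_integral_eq_integral) auto
    also have "h z * ... = (\<integral>\<^sup>+y. h z * ennreal (indicator (cell z) y * f y) \<partial>lborel)"
      by (rule nn_integral_cmult[symmetric]) measurable
    also have "... = (\<integral>\<^sup>+x\<in>cell z. h x * ennreal (f x) \<partial>lborel)"
      using h[of _ z] by (intro nn_integral_cong) (auto split: split_indicator)
    finally show "(\<integral>\<^sup>+x\<in>cell z. h x * ennreal (cell_mean f x) \<partial>lborel) = (\<integral>\<^sup>+x\<in>cell z. h x * ennreal (f x) \<partial>lborel)" .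
  qed
  also have "... = (\<integral>\<^sup>+x\<in>UNIV. h x * ennreal (f x) \<partial>lborel)"
    by (rule nn_integral_cells[symmetric]) auto
  finally show ?thesis by simp
qed

lemma cell_mean_nonneg: "(\<And>x. 0 \<le> f x) \<Longrightarrow> 0 \<le> cell_mean f x"
  by (auto simp: cell_mean_def intro!: divide_nonneg_nonneg)

lemma abs_cell_mean_le:
  assumes "integrable lborel f"
  shows "\<bar>cell_mean f x\<bar> \<le> cell_mean (\<lambda>y. \<bar>f y\<bar>) x"
  unfolding cell_mean_def abs_divide using measure_cell_pos[of x]
  by (auto simp: abs_mult intro!: divide_right_mono order_trans[OF integral_abs_bound])

lemma integrable_cell_mean:
  assumes f: "integrable lborel f"
  shows "integrable lborel (cell_mean f)" "(\<integral>\<^sup>+x. ennreal \<bar>cell_mean f x\<bar> \<partial>lborel) \<le> (\<integral>\<^sup>+x. ennreal \<bar>f x\<bar> \<partial>lborel)"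
proof -
  have "(\<integral>\<^sup>+x. ennreal \<bar>cell_mean f x\<bar> \<partial>lborel) \<le> (\<integral>\<^sup>+x. 1 * ennreal (cell_mean (\<lambda>y. \<bar>f y\<bar>) x) \<partial>lborel)"
    using abs_cell_mean_le[OF f] by (intro nn_integral_mono) (auto intro: ennreal_leI)
  also have "... = (\<integral>\<^sup>+x. 1 * ennreal \<bar>f x\<bar> \<partial>lborel)"
    using f by (intro nn_integral_cell_mean) auto
  finally show le: "(\<integral>\<^sup>+x. ennreal \<bar>cell_mean f x\<bar> \<partial>lborel) \<le> (\<integral>\<^sup>+x. ennreal \<bar>f x\<bar> \<partial>lborel)" by simp
  have "(\<integral>\<^sup>+x. ennreal \<bar>f x\<bar> \<partial>lborel) < \<infinity>" using f by (simp add: integrable_iff_bounded)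
  then show "integrable lborel (cell_mean f)"
    using le by (auto simp: integrable_iff_bounded intro: le_less_trans)
qed

lemma integral_cell_mean:
  assumes f: "integrable lborel f" and h: "\<And>x y. y \<in> cell x \<Longrightarrow> h y = h x" and B: "\<And>x. \<bar>h x\<bar> \<le> B"
  shows "integrable lborel (\<lambda>x. h x * cell_mean f x)"
    "(\<integral>x. h x * cell_mean f x \<partial>lborel) = (\<integral>x. h x * (f x :: real) \<partial>lborel)"
proof -
  have [measurable]: "h \<in> borel_measurable borel" using h by (rule borel_measurable_cell_const)
  have i: "integrable lborel (\<lambda>x. h x * g x)" if "integrable lborel g" for g :: "'a \<Rightarrow> real"
  proof (rule Bochner_Integration.integrable_bound[where f="\<lambda>x. B * g x"])
    show "(\<lambda>x. h x * g x) \<in> borel_measurable lborel"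
      using borel_measurable_integrable[OF that] by measurable
    show "AE x in lborel. norm (h x * g x) \<le> norm (B * g x)"
      using B by (intro AE_I2) (auto simp: abs_mult intro!: mult_right_mono order_trans[OF B])
  qed (use that in auto)
  show "integrable lborel (\<lambda>x. h x * cell_mean f x)" by (intro i integrable_cell_mean f)
  have nonneg: "(\<integral>x. (h x + c) * cell_mean g x \<partial>lborel) = (\<integral>x. (h x + c) * g x \<partial>lborel)"
    if c: "B \<le> c" and g: "integrable lborel g" "\<And>x. 0 \<le> g x" for c and g :: "'a \<Rightarrow> real"
  proof -
    have hc: "0 \<le> h x + c" for x using B[of x] c by linarith
    have [measurable]: "g \<in> borel_measurable borel" using g by auto
    have "(\<integral>\<^sup>+x. ennreal (h x + c) * ennreal (cell_mean g x) \<partial>lborel) = (\<integral>\<^sup>+x. ennreal (h x + c) * ennreal (g x) \<partial>lborel)"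
      using g h by (intro nn_integral_cell_mean) auto
    then show ?thesis
      using hc g cell_mean_nonneg[of g]
      by (simp add: integral_eq_nn_integral ennreal_mult)
  qed
  have main: "(\<integral>x. h x * cell_mean g x \<partial>lborel) = (\<integral>x. h x * g x \<partial>lborel)"
    if g: "integrable lborel g" "\<And>x. 0 \<le> g x" for g :: "'a \<Rightarrow> real"
    using nonneg[of B, OF _ g] nonneg[of "B + 1", OF _ g] i[OF g(1)] i[OF integrable_cell_mean(1)[OF g(1)]]
      g integrable_cell_mean(1)[OF g(1)]
    by (simp add: distrib_right algebra_simps)
  define p q where "p x = max 0 (f x)" and "q x = max 0 (- f x)" for x
  have pq: "integrable lborel p" "integrable lborel q" "\<And>x. 0 \<le> p x" "\<And>x. 0 \<le> q x"
    using f unfolding p_def q_def by (auto intro!: Bochner_Integration.integrable_max)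
  have f_eq: "f = (\<lambda>x. p x - q x)" by (auto simp: p_def q_def fun_eq_iff)
  have m_eq: "cell_mean f x = cell_mean p x - cell_mean q x" for x
  proof -
    have "(\<integral>y. indicator (cell x) y * f y \<partial>lborel)
        = (\<integral>y. indicator (cell x) y * p y - indicator (cell x) y * q y \<partial>lborel)"
      by (subst f_eq) (simp add: right_diff_distrib)
    also have "... = (\<integral>y. indicator (cell x) y * p y \<partial>lborel) - (\<integral>y. indicator (cell x) y * q y \<partial>lborel)"
      by (intro Bochner_Integration.integral_diff integrable_on_cell pq)
    finally show ?thesis by (simp add: cell_mean_def diff_divide_distrib)
  qed
  have "(\<integral>x. h x * cell_mean f x \<partial>lborel) = (\<integral>x. h x * cell_mean p x - h x * cell_mean q x \<partial>lborel)"
    by (simp only: m_eq right_diff_distrib)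
  also have "... = (\<integral>x. h x * cell_mean p x \<partial>lborel) - (\<integral>x. h x * cell_mean q x \<partial>lborel)"
    by (intro Bochner_Integration.integral_diff i integrable_cell_mean pq)
  also have "... = (\<integral>x. h x * p x \<partial>lborel) - (\<integral>x. h x * q x \<partial>lborel)"
    by (simp only: main[OF pq(1,3)] main[OF pq(2,4)])
  also have "... = (\<integral>x. h x * p x - h x * q x \<partial>lborel)"
    by (intro Bochner_Integration.integral_diff[symmetric] i pq)
  also have "... = (\<integral>x. h x * f x \<partial>lborel)"
    by (subst f_eq) (simp only: right_diff_distrib)
  finally show "(\<integral>x. h x * cell_mean f x \<partial>lborel) = (\<integral>x. h x * f x \<partial>lborel)" .
qed

end

section \<open>The weak type inequality\<close>

definition top_level :: "(int \<Rightarrow> 'a \<Rightarrow> bool) \<Rightarrow> 'a \<Rightarrow> int" where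
  "top_level P x = (THE j. P j x \<and> (\<forall>i>j. \<not> P i x))"

lemma top_level_eqI: "P j x \<Longrightarrow> (\<And>i. j < i \<Longrightarrow> \<not> P i x) \<Longrightarrow> top_level P x = j"
  unfolding top_level_def by (rule the_equality) (auto, meson linorder_cases)

lemma top_level:
  assumes "P j x" and N: "\<And>i. P i x \<Longrightarrow> i \<le> N"
  shows "P (top_level P x) x" "\<And>i. top_level P x < i \<Longrightarrow> \<not> P i x" "j \<le> top_level P x"
proof -
  have fin: "finite {i. j \<le> i \<and> P i x}"
    by (rule finite_subset[of _ "{j..N}"]) (use N in auto)
  define m where "m = Max {i. j \<le> i \<and> P i x}"
  have "m \<in> {i. j \<le> i \<and> P i x}" unfolding m_def using fin assms(1) by (intro Max_in) auto
  then have m: "j \<le> m" "P m x" by auto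
  have above: "\<not> P i x" if "m < i" for i
  proof
    assume "P i x"
    then have "i \<le> m" unfolding m_def using that m fin by (intro Max_ge) auto
    then show False using that by simp
  qed
  have eq: "top_level P x = m" using m(2) above by (rule top_level_eqI)
  show "P (top_level P x) x" "j \<le> top_level P x" using m by (simp_all add: eq)
  show "\<not> P i x" if "top_level P x < i" for i using above that by (simp add: eq)
qed

lemma top_level_dcell:
  assumes const: "\<And>j x y. y \<in> dcell j x \<Longrightarrow> P j y \<longleftrightarrow> P j x"
    and P: "P (top_level P x) x" "\<And>i. top_level P x < i \<Longrightarrow> \<not> P i x"
    and y: "y \<in> dcell (top_level P x) x"
  shows "top_level P y = top_level P x"
proof (rule top_level_eqI)
  show "P (top_level P x) y" using const[OF y] P by simp
  fix i assume i: "top_level P x < i"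
  then have "y \<in> dcell i x" using y dcell_mono[of "top_level P x" i x] by auto
  then show "\<not> P i y" using const P(2)[OF i] by blast
qed

definition cube_mean :: "('a::euclidean_space \<Rightarrow> real) \<Rightarrow> int \<Rightarrow> 'a \<Rightarrow> real" where
  "cube_mean f j x = (\<integral>y. indicator (dcell j x) y * \<bar>f y\<bar> \<partial>lborel) / (2 powi j) ^ DIM('a)"

lemma cube_mean_const: "y \<in> dcell j x \<Longrightarrow> cube_mean f j y = cube_mean f j x"
  using dcell_eq[of y j x] by (simp add: cube_mean_def)

lemma measure_dcell: "measure lborel (dcell k (x::'a::euclidean_space)) = (2 powi k) ^ DIM('a)"
  by (simp add: measure_def emeasure_dcell less_imp_le)

lemma integrable_on_dcell:
  assumes "integrable lborel f"
  shows "integrable lborel (\<lambda>y. indicator (dcell j x) y * \<bar>f y :: real\<bar>)"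
  using integrable_mult_indicator[of "dcell j x" lborel "\<lambda>y. \<bar>f y\<bar>"] assms by simp

lemma cube_mean_le_L1norm:
  fixes f :: "'a::euclidean_space \<Rightarrow> real"
  assumes f: "integrable lborel f"
  shows "cube_mean f j x * (2 powi j) ^ DIM('a) \<le> L1norm f"
proof -
  have "cube_mean f j x * (2 powi j) ^ DIM('a) = (\<integral>y. indicator (dcell j x) y * \<bar>f y\<bar> \<partial>lborel)"
    by (simp add: cube_mean_def less_imp_neq)
  also have "... \<le> L1norm f"
    unfolding L1norm_def using f integrable_on_dcell[OF f]
    by (intro integral_mono) (auto split: split_indicator)
  finally show ?thesis .
qed

lemma cube_mean_parent:
  fixes f :: "'a::euclidean_space \<Rightarrow> real"
  assumes f: "integrable lborel f"
  shows "cube_mean f j x \<le> 2 ^ DIM('a) * cube_mean f (j + 1) x"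
proof -
  have "dcell j x \<subseteq> dcell (j + 1) x" by (rule dcell_mono) simp
  then have "(\<integral>y. indicator (dcell j x) y * \<bar>f y\<bar> \<partial>lborel) \<le> (\<integral>y. indicator (dcell (j + 1) x) y * \<bar>f y\<bar> \<partial>lborel)"
    using integrable_on_dcell[OF f] by (intro integral_mono) (auto split: split_indicator)
  then show ?thesis
    by (simp add: cube_mean_def power_int_add power_mult_distrib divide_right_mono less_imp_le)
qed

lemma dcell_partition:
  assumes J: "\<And>x y. y \<in> dcell (J x) x \<Longrightarrow> J y = J x"
  shows "cell_partition (\<lambda>x::'a::euclidean_space. dcell (J x) x)"
proof
  show "countable (range (\<lambda>x::'a. dcell (J x) x))"
    by (rule countable_subset[OF _ countable_all_dcells]) (auto simp: dcells_def)
  show "0 < emeasure lborel (dcell (J x) x)" "emeasure lborel (dcell (J x) x) < \<infinity>" for x :: 'a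
    by (simp_all add: emeasure_dcell less_imp_le ennreal_less_top)
  show "dcell (J y) y = dcell (J x) x" if "y \<in> dcell (J x) x" for x y
    using J[OF that] dcell_eq[OF that] by simp
qed auto

text \<open>
  The mean over a cube of side \<open>2\<^sup>j\<close> is at most \<open>2\<^bsup>-jn\<^esup>
  \<parallel>f\<parallel>\<^sub>1\<close>.
\<close>

lemma cube_mean_bounded_levels:
  fixes f :: "'a::euclidean_space \<Rightarrow> real"
  assumes f: "integrable lborel f" and \<tau>: "0 < \<tau>"
  obtains N where "\<And>j x. \<tau> < cube_mean f j x \<Longrightarrow> j \<le> int N"
proof -
  obtain N where N: "L1norm f / \<tau> < 2 ^ N" using real_arch_pow[of 2] by auto
  have "j \<le> int N" if "\<tau> < cube_mean f j x" for j x
  proof (rule ccontr)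
    assume "\<not> j \<le> int N"
    then have "(2::real) ^ N \<le> 2 powi j" using power_int_increasing[of "int N" j "2::real"] by simp
    moreover have "(2::real) powi j \<le> (2 powi j) ^ DIM('a)"
      using \<open>\<not> j \<le> int N\<close> power_int_increasing[of 0 j "2::real"] DIM_positive[where 'a='a]
      by (intro self_le_power) auto
    moreover have "\<tau> * (2 powi j) ^ DIM('a) \<le> L1norm f"
      using that cube_mean_le_L1norm[OF f, of j x]
      by (meson less_imp_le mult_right_mono order_trans two_powi_pos zero_le_power)
    ultimately show False
      using N \<tau> by (simp add: field_simps) (meson less_le_trans mult_left_mono less_imp_le not_le order_trans)
  qed
  then show ?thesis using that by blast
qed

text \<open>
  The stopping cubes: the largest dyadic cubes on which the mean of \<open>\<bar>f\<bar>\<close> exceeds \<open>\<tau>\<close>, and the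
  cubes of the smallest admitted level \<open>l\<close> away from these.
\<close>

lemma stopping_cubes:
  fixes f :: "'a::euclidean_space \<Rightarrow> real"
  assumes f: "integrable lborel f" and \<tau>: "0 < \<tau>"
  obtains J :: "'a \<Rightarrow> int" where "\<And>x y. y \<in> dcell (J x) x \<Longrightarrow> J y = J x"
    "\<And>x. cube_mean f (J x) x \<le> 2 ^ DIM('a) * \<tau>"
    "\<And>x. cube_mean f (J x) x \<le> \<tau> \<Longrightarrow> J x = l"
proof -
  define P where "P j x \<longleftrightarrow> j = l \<or> (l \<le> j \<and> \<tau> < cube_mean f j x)" for j x
  obtain N where N: "\<And>j x. \<tau> < cube_mean f j x \<Longrightarrow> j \<le> int N"
    by (rule cube_mean_bounded_levels[OF f \<tau>], rule that)
  have bd: "i \<le> max l (int N)" if "P i x" for i x using that N[of i x] by (auto simp: P_def)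
  have const: "P j y \<longleftrightarrow> P j x" if "y \<in> dcell j x" for j x y
    using cube_mean_const[OF that] by (simp add: P_def)
  have t1: "P (top_level P x) x" and t2: "\<And>i. top_level P x < i \<Longrightarrow> \<not> P i x" and t3: "l \<le> top_level P x" for x
  proof -
    have Pl: "P l x" by (simp add: P_def)
    show "P (top_level P x) x" "l \<le> top_level P x" "\<And>i. top_level P x < i \<Longrightarrow> \<not> P i x"
      using top_level[of P l x "max l (int N)"] Pl bd by blast+
  qed
  show ?thesis
  proof (rule that[of "top_level P"])
    show "top_level P y = top_level P x" if "y \<in> dcell (top_level P x) x" for x y
      using const t1 t2 that by (rule top_level_dcell)
    show "cube_mean f (top_level P x) x \<le> 2 ^ DIM('a) * \<tau>" for x
    proof -
      have "cube_mean f (top_level P x + 1) x \<le> \<tau>"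
        using t2[of x "top_level P x + 1"] t3[of x] by (auto simp: P_def)
      then show ?thesis
        using cube_mean_parent[OF f, of "top_level P x" x] by (meson mult_left_mono order_trans zero_le_numeral zero_le_power)
    qed
    show "top_level P x = l" if "cube_mean f (top_level P x) x \<le> \<tau>" for x
      using t1[of x] that by (auto simp: P_def)
  qed
qed

text \<open>
  Hoermander's condition: sum the smoothness bound over dyadic annuli, using the tail estimate for the
  constant function.
\<close>

lemma Hormander_integral:
  fixes k :: "'a::euclidean_space \<Rightarrow> real"
  assumes k: "CZ_kernel A k" and yc: "2 * norm (y - c) \<le> \<rho>" and \<rho>: "0 < \<rho>"
  shows "(\<integral>\<^sup>+x\<in>{x. \<rho> \<le> norm (c - x)}. ennreal \<bar>k (x - y) - k (x - c)\<bar> \<partial>lborel)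
    \<le> ennreal (A * unit_vol TYPE('a) * 2 ^ DIM('a))"
proof -
  let ?n = "DIM('a)" and ?v = "unit_vol TYPE('a)"
  have A: "0 < A" using k by (simp add: CZ_kernel_def)
  have "(\<integral>\<^sup>+x\<in>{x. \<rho> \<le> norm (c - x)}. ennreal \<bar>k (x - y) - k (x - c)\<bar> \<partial>lborel)
     \<le> (\<integral>\<^sup>+x. ennreal (A * (\<rho> / 2)) * (1 * ennreal (1 / norm (c - x) ^ (?n + 1)) * indicator {x. \<rho> \<le> norm (c - x)} x) \<partial>lborel)"
  proof (rule nn_integral_mono)
    fix x
    show "ennreal \<bar>k (x - y) - k (x - c)\<bar> * indicator {x. \<rho> \<le> norm (c - x)} x
       \<le> ennreal (A * (\<rho> / 2)) * (1 * ennreal (1 / norm (c - x) ^ (?n + 1)) * indicator {x. \<rho> \<le> norm (c - x)} x)"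
    proof (cases "\<rho> \<le> norm (c - x)")
      case True
      have "\<bar>k (x - c) - k (x - y)\<bar> \<le> A * norm ((x - c) - (x - y)) / norm (x - c) ^ (?n + 1)"
      proof -
        have "\<bar>k u - k w\<bar> \<le> A * norm (u - w) / norm u ^ (?n + 1)"
          if "u \<noteq> 0" "2 * norm (u - w) \<le> norm u" for u w
          using k that unfolding CZ_kernel_def by blast
        moreover have "x - c \<noteq> 0" "2 * norm ((x - c) - (x - y)) \<le> norm (x - c)"
          using True yc \<rho> by (auto simp: norm_minus_commute)
        ultimately show ?thesis by blast
      qed
      also have "... \<le> A * (\<rho> / 2) / norm (x - c) ^ (?n + 1)"
        using A yc by (intro divide_right_mono mult_left_mono) auto
      finally have "\<bar>k (x - y) - k (x - c)\<bar> \<le> A * (\<rho> / 2) * (1 / norm (c - x) ^ (?n + 1))"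
        by (simp add: abs_minus_commute norm_minus_commute)
      then show ?thesis using True A \<rho> by (simp add: ennreal_leI flip: ennreal_mult)
    qed simp
  qed
  also have "... = ennreal (A * (\<rho> / 2)) * (\<integral>\<^sup>+x\<in>{x. \<rho> \<le> norm (c - x)}. 1 * ennreal (1 / norm (c - x) ^ (?n + 1)) \<partial>lborel)"
    by (intro nn_integral_cmult) measurable
  also have "... \<le> ennreal (A * (\<rho> / 2)) * ennreal (2 ^ (?n + 1) * ?v / \<rho>)"
    using \<rho> by (intro mult_left_mono nn_integral_tail_bound) (auto simp: emeasure_ball)
  also have "... = ennreal (A * ?v * 2 ^ ?n)"
    using A \<rho> by (subst ennreal_mult[symmetric]) (auto simp: field_simps)
  finally show ?thesis .
qed

text \<open>
  Chebyshev for the squares, with \<open>\<integral> g\<^sup>2 \<le> b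
  \<parallel>g\<parallel>\<^sub>1\<close>.
\<close>

lemma L2_Chebyshev:
  fixes k :: "'a::euclidean_space \<Rightarrow> real"
  assumes k: "good_kernel A B k" and g: "integrable lborel g" "\<And>x. \<bar>g x\<bar> \<le> b" and s: "0 < s"
  shows "emeasure lborel {x. s < \<bar>conv k g x\<bar>} \<le> ennreal (B\<^sup>2 * b * L1norm g / s\<^sup>2)"
proof -
  have gV: "g \<in> bdd_L1" using g by (auto simp: bdd_L1_def)
  have kV: "k \<in> bdd_L1" using k by (simp add: good_kernel_def)
  note cV = conv_bdd_L1[OF kV gV]
  note [measurable] = bdd_L1_measurable[OF kV] bdd_L1_measurable[OF gV] bdd_L1_measurable[OF cV]
  have b0: "0 \<le> b" using g(2)[of undefined] by linarith
  have "ennreal (s\<^sup>2) * emeasure lborel {x. s < \<bar>conv k g x\<bar>} = (\<integral>\<^sup>+x\<in>{x. s < \<bar>conv k g x\<bar>}. ennreal (s\<^sup>2) \<partial>lborel)"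
    by (subst nn_integral_cmult_indicator) auto
  also have "... \<le> (\<integral>\<^sup>+x. ennreal ((conv k g x)\<^sup>2) \<partial>lborel)"
  proof (rule nn_integral_mono)
    fix x
    have "s\<^sup>2 \<le> (conv k g x)\<^sup>2" if "s < \<bar>conv k g x\<bar>"
      using that s by (metis less_imp_le power2_abs power_mono)
    then show "ennreal (s\<^sup>2) * indicator {x. s < \<bar>conv k g x\<bar>} x \<le> ennreal ((conv k g x)\<^sup>2)"
      by (auto simp: indicator_def intro: ennreal_leI)
  qed
  also have "... = ennreal ((L2norm (conv k g))\<^sup>2)"
    using integrable_square[OF cV] by (simp add: L2norm_power2 nn_integral_eq_integral)
  also have "... \<le> ennreal (B\<^sup>2 * b * L1norm g)"
  proof (rule ennreal_leI)
    have "L2norm (conv k g) \<le> B * L2norm g" using k gV by (auto simp: good_kernel_def)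
    then have "(L2norm (conv k g))\<^sup>2 \<le> (B * L2norm g)\<^sup>2" by (intro power_mono L2norm_nonneg)
    also have "... = B\<^sup>2 * (\<integral>x. (g x)\<^sup>2 \<partial>lborel)" by (simp add: power_mult_distrib L2norm_power2)
    also have "(\<integral>x. (g x)\<^sup>2 \<partial>lborel) \<le> (\<integral>x. b * \<bar>g x\<bar> \<partial>lborel)"
    proof (rule integral_mono)
      show "(g x)\<^sup>2 \<le> b * \<bar>g x\<bar>" for x
        using mult_right_mono[OF g(2)[of x] abs_ge_zero[of "g x"]] by (simp add: power2_eq_square)
    qed (use integrable_square[OF gV] g in auto)
    finally show "(L2norm (conv k g))\<^sup>2 \<le> B\<^sup>2 * b * L1norm g"
      by (simp add: L1norm_def mult_left_mono mult.assoc)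
  qed
  finally have *: "ennreal (s\<^sup>2) * emeasure lborel {x. s < \<bar>conv k g x\<bar>} \<le> ennreal (B\<^sup>2 * b * L1norm g)" .
  have "emeasure lborel {x. s < \<bar>conv k g x\<bar>}
      = ennreal (1 / s\<^sup>2) * (ennreal (s\<^sup>2) * emeasure lborel {x. s < \<bar>conv k g x\<bar>})"
    using s by (simp add: mult.assoc[symmetric] flip: ennreal_mult)
  also have "... \<le> ennreal (1 / s\<^sup>2) * ennreal (B\<^sup>2 * b * L1norm g)"
    by (intro mult_left_mono *) simp
  also have "... = ennreal (B\<^sup>2 * b * L1norm g / s\<^sup>2)"
    using b0 by (subst ennreal_mult[symmetric]) (auto simp: L1norm_nonneg)
  finally show ?thesis .
qed

lemma Chebyshev_nn:
  assumes [measurable]: "g \<in> borel_measurable M" and s: "0 < s" and b: "(\<integral>\<^sup>+x. g x \<partial>M) \<le> ennreal b" "0 \<le> b"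
  shows "emeasure M {x \<in> space M. ennreal s < g x} \<le> ennreal (b / s)"
proof -
  have "emeasure M {x \<in> space M. ennreal s < g x} \<le> emeasure M {x \<in> space M. 1 \<le> ennreal (1 / s) * g x}"
  proof (rule emeasure_mono)
    show "{x \<in> space M. ennreal s < g x} \<subseteq> {x \<in> space M. 1 \<le> ennreal (1 / s) * g x}"
    proof safe
      fix x assume "ennreal s < g x"
      then have "ennreal (1 / s) * ennreal s \<le> ennreal (1 / s) * g x" by (intro mult_left_mono) auto
      then show "1 \<le> ennreal (1 / s) * g x" using s by (simp flip: ennreal_mult)
    qed
  qed measurable
  also have "... \<le> ennreal (1 / s) * (\<integral>\<^sup>+x\<in>space M. g x \<partial>M)"
    using nn_integral_Markov_inequality[where u=g and M=M and A="space M" and c="ennreal (1 / s)"] by simp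
  also have "(\<integral>\<^sup>+x\<in>space M. g x \<partial>M) = (\<integral>\<^sup>+x. g x \<partial>M)" by (intro nn_integral_cong) auto
  also have "ennreal (1 / s) * (\<integral>\<^sup>+x. g x \<partial>M) \<le> ennreal (1 / s) * ennreal b"
    by (intro mult_left_mono b) auto
  also have "... = ennreal (b / s)" using s b by (subst ennreal_mult[symmetric]) auto
  finally show ?thesis .
qed

text \<open>
  The summands belong to the good part, the enlarged stopping cubes, and the bad part away from these.
\<close>

definition weak_const :: "real \<Rightarrow> real \<Rightarrow> 'a::euclidean_space itself \<Rightarrow> real" where
  "weak_const A B _ = 9 * B\<^sup>2 * 2 ^ DIM('a) + unit_vol TYPE('a) * (2 * real DIM('a)) ^ DIM('a)
    + 6 * A * unit_vol TYPE('a) * 2 ^ DIM('a)"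

text \<open>
  The Calderon--Zygmund decomposition, stopped at a smallest level \<open>l\<close>. The cubes of
  level \<open>l\<close> that are not selected may carry large values of \<open>f\<close>; as
  \<open>k\<close> is Lipschitz, their contribution tends to \<open>0\<close> with the side length,
  and \<open>l\<close> is chosen so that it is below a third of the level \<open>\<tau>\<close>.
\<close>

theorem weak_type:
  fixes k f :: "'a::euclidean_space \<Rightarrow> real"
  assumes k: "good_kernel A B k" and f: "integrable lborel f" and \<tau>: "0 < \<tau>"
  shows "emeasure lborel {x. \<tau> < \<bar>conv k f x\<bar>} \<le> ennreal (weak_const A B TYPE('a) * L1norm f / \<tau>)"
proof -
  let ?n = "DIM('a)" and ?v = "unit_vol TYPE('a)"
  have kCZ: "CZ_kernel A k" and kV: "k \<in> bdd_L1" using k by (auto simp: good_kernel_def)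
  have A: "0 < A" using kCZ by (simp add: CZ_kernel_def)
  obtain M where M: "\<And>x. \<bar>k x\<bar> \<le> M" using bdd_L1_bound[OF kV] by blast
  obtain L where L: "\<And>x y. \<bar>k x - k y\<bar> \<le> L * norm (x - y)" using k by (auto simp: good_kernel_def)
  have L0: "0 \<le> L"
  proof -
    obtain e :: 'a where "e \<in> Basis" using nonempty_Basis by blast
    then show ?thesis using L[of e 0] by (metis abs_ge_zero diff_zero mult.right_neutral norm_Basis order_trans)
  qed
  note [measurable] = bdd_L1_measurable[OF kV]
  have [measurable]: "f \<in> borel_measurable borel" using f by auto
  define I where "I = L1norm f"
  have I: "0 \<le> I" "(\<integral>\<^sup>+x. ennreal \<bar>f x\<bar> \<partial>lborel) = ennreal I"
    using f by (auto simp: I_def L1norm_nonneg L1norm_def nn_integral_eq_integral)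
  obtain N where N: "L * real ?n * (2 * I) / (\<tau> / 3) < 2 ^ N" using real_arch_pow[of 2] by auto
  define l where "l = - int N"
  have l: "L * (real ?n * 2 powi l) * (2 * I) \<le> \<tau> / 3"
    using N \<tau> by (simp add: l_def power_int_minus field_simps)
  obtain J where J: "\<And>x y. y \<in> dcell (J x) x \<Longrightarrow> J y = J x"
    "\<And>x. cube_mean f (J x) x \<le> 2 ^ ?n * \<tau>" "\<And>x. cube_mean f (J x) x \<le> \<tau> \<Longrightarrow> J x = l"
    by (rule stopping_cubes[OF f \<tau>], rule that)
  define cell where "cell x = dcell (J x) x" for x
  interpret cell_partition cell
    unfolding cell_def by (rule dcell_partition) (rule J)
  have Jc: "J y = J x" if "y \<in> cell x" for x y using J(1) that by (simp add: cell_def)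
  have [measurable]: "J \<in> borel \<rightarrow>\<^sub>M count_space UNIV"
    by (subst measurable_cell_const) (auto intro: Jc)
  have [measurable]: "rep \<in> borel_measurable borel"
    by (rule borel_measurable_cell_const) (rule rep_const)
  \<comment> \<open>The good part is the mean over each cell; the bad part has mean zero on each cell.\<close>
  define g where "g = cell_mean f"
  define b where "b x = f x - g x" for x
  have gi: "integrable lborel g" and gL: "L1norm g \<le> I"
  proof -
    show gi: "integrable lborel g" unfolding g_def by (rule integrable_cell_mean[OF f])
    have "ennreal (L1norm g) = (\<integral>\<^sup>+x. ennreal \<bar>g x\<bar> \<partial>lborel)"
      using gi by (simp add: L1norm_def nn_integral_eq_integral)
    also have "... \<le> ennreal I" unfolding g_def I(2)[symmetric] by (rule integrable_cell_mean[OF f])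
    finally show "L1norm g \<le> I" using I(1) by (simp add: ennreal_le_iff)
  qed
  have [measurable]: "g \<in> borel_measurable borel" "b \<in> borel_measurable borel"
    unfolding b_def g_def by measurable
  have mean: "cell_mean (\<lambda>y. \<bar>f y\<bar>) x = cube_mean f (J x) x" for x
    by (simp add: cell_mean_def cube_mean_def cell_def measure_dcell)
  have gb: "\<bar>g x\<bar> \<le> 2 ^ ?n * \<tau>" for x
    using abs_cell_mean_le[OF f, of x] J(2)[of x] by (simp add: g_def mean)
  have bi: "integrable lborel b" unfolding b_def using f gi by simp
  have bL: "(\<integral>\<^sup>+x. ennreal \<bar>b x\<bar> \<partial>lborel) \<le> ennreal (2 * I)"
  proof -
    have "(\<integral>\<^sup>+x. ennreal \<bar>b x\<bar> \<partial>lborel) \<le> (\<integral>\<^sup>+x. ennreal \<bar>f x\<bar> + ennreal \<bar>g x\<bar> \<partial>lborel)"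
      by (intro nn_integral_mono) (simp add: b_def flip: ennreal_plus)
    also have "... = (\<integral>\<^sup>+x. ennreal \<bar>f x\<bar> \<partial>lborel) + (\<integral>\<^sup>+x. ennreal \<bar>g x\<bar> \<partial>lborel)"
      by (rule nn_integral_add) auto
    also have "(\<integral>\<^sup>+x. ennreal \<bar>g x\<bar> \<partial>lborel) \<le> ennreal I"
      unfolding g_def I(2)[symmetric] by (rule integrable_cell_mean[OF f])
    finally show ?thesis using I by (simp add: add_left_mono flip: ennreal_plus)
  qed
  define \<Omega> where "\<Omega> = {x. \<tau> < cube_mean f (J x) x}"
  have \<Omega>c: "y \<in> \<Omega> \<longleftrightarrow> x \<in> \<Omega>" if "y \<in> cell x" for x y
    using that Jc[OF that] cube_mean_const[of y "J x" x f] by (simp add: \<Omega>_def cell_def)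
  have [measurable]: "\<Omega> \<in> sets borel" by (rule borel_union_of_cells) (use \<Omega>c in blast)
  define \<rho> where "\<rho> x = 2 * real ?n * 2 powi J x" for x
  have \<rho>0: "0 < \<rho> x" for x by (simp add: \<rho>_def DIM_positive)
  have dist_rep: "2 * norm (y - rep y) \<le> \<rho> y" for y
    using dist_dcell[of "rep y" "J y" y] rep_in[of y] by (simp add: cell_def \<rho>_def)
  define D where "D = (\<Union>z\<in>\<Omega> \<inter> range rep. ball z (\<rho> z))"
  have D_open: "open D" unfolding D_def by blast
  have far: "\<rho> y \<le> norm (rep y - x)" if "x \<notin> D" "y \<in> \<Omega>" for x y
  proof -
    have "rep y \<in> \<Omega> \<inter> range rep" using \<Omega>c[OF rep_in] that by auto
    moreover have "\<rho> (rep y) = \<rho> y" using Jc[OF rep_in] by (simp add: \<rho>_def)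
    ultimately show ?thesis using that unfolding D_def by (force simp: dist_norm)
  qed
  have cnt: "countable (\<Omega> \<inter> range rep)" using countable_reps by (rule countable_Int2)
  have emD: "emeasure lborel D \<le> ennreal (?v * (2 * real ?n) ^ ?n * I / \<tau>)"
  proof -
    have "emeasure lborel D \<le> (\<integral>\<^sup>+z. emeasure lborel (ball z (\<rho> z)) \<partial>count_space (\<Omega> \<inter> range rep))"
      unfolding D_def by (intro emeasure_UN_le_nn_integral cnt) auto
    also have "... \<le> (\<integral>\<^sup>+z. ennreal (?v * (2 * real ?n) ^ ?n / \<tau>) * (\<integral>\<^sup>+x\<in>cell z. ennreal \<bar>f x\<bar> \<partial>lborel)
        \<partial>count_space (\<Omega> \<inter> range rep))"
    proof (rule nn_integral_mono)
      fix z assume "z \<in> space (count_space (\<Omega> \<inter> range rep))"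
      then have z: "\<tau> < cube_mean f (J z) z" by (simp add: \<Omega>_def)
      have "\<tau> * (2 powi J z) ^ ?n \<le> cube_mean f (J z) z * (2 powi J z) ^ ?n"
        using z by (intro mult_right_mono) (auto simp: less_imp_le)
      also have "... = (\<integral>y. indicator (cell z) y * \<bar>f y\<bar> \<partial>lborel)"
        by (simp add: cube_mean_def cell_def less_imp_neq)
      finally have "ennreal (\<tau> * (2 powi J z) ^ ?n) \<le> ennreal (\<integral>y. indicator (cell z) y * \<bar>f y\<bar> \<partial>lborel)"
        by (rule ennreal_leI)
      also have "... = (\<integral>\<^sup>+y. ennreal (indicator (cell z) y * \<bar>f y\<bar>) \<partial>lborel)"
        using integrable_on_cell[of "\<lambda>y. \<bar>f y\<bar>" z] f by (subst nn_integral_eq_integral) auto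
      also have "... = (\<integral>\<^sup>+x\<in>cell z. ennreal \<bar>f x\<bar> \<partial>lborel)"
        by (intro nn_integral_cong) (auto split: split_indicator)
      finally have le: "ennreal (\<tau> * (2 powi J z) ^ ?n) \<le> (\<integral>\<^sup>+x\<in>cell z. ennreal \<bar>f x\<bar> \<partial>lborel)" .
      have "emeasure lborel (ball z (\<rho> z)) = ennreal (?v * (\<rho> z) ^ ?n)"
        using \<rho>0[of z] by (intro emeasure_ball) auto
      also have "... = ennreal (?v * (2 * real ?n) ^ ?n / \<tau>) * ennreal (\<tau> * (2 powi J z) ^ ?n)"
        using \<tau> by (subst ennreal_mult[symmetric]) (auto simp: \<rho>_def power_mult_distrib less_imp_le)
      finally show "emeasure lborel (ball z (\<rho> z))
          \<le> ennreal (?v * (2 * real ?n) ^ ?n / \<tau>) * (\<integral>\<^sup>+x\<in>cell z. ennreal \<bar>f x\<bar> \<partial>lborel)"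
        using le by (simp add: mult_left_mono)
    qed
    also have "... = ennreal (?v * (2 * real ?n) ^ ?n / \<tau>) *
        (\<integral>\<^sup>+z. (\<integral>\<^sup>+x\<in>cell z. ennreal \<bar>f x\<bar> \<partial>lborel) \<partial>count_space (\<Omega> \<inter> range rep))"
      by (intro nn_integral_cmult) auto
    also have "(\<integral>\<^sup>+z. (\<integral>\<^sup>+x\<in>cell z. ennreal \<bar>f x\<bar> \<partial>lborel) \<partial>count_space (\<Omega> \<inter> range rep)) = (\<integral>\<^sup>+x\<in>\<Omega>. ennreal \<bar>f x\<bar> \<partial>lborel)"
      by (rule nn_integral_cells[symmetric]) (use \<Omega>c in auto)
    also have "... \<le> ennreal I"
      unfolding I(2)[symmetric] by (intro nn_integral_mono) (auto simp: indicator_def)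
    finally show ?thesis
      using I \<tau> by (simp add: mult_left_mono flip: ennreal_mult)
  qed
  define G where "G x = (\<integral>\<^sup>+y. indicator \<Omega> y * ennreal (\<bar>k (x - y) - k (x - rep y)\<bar> * \<bar>b y\<bar>) * indicator (- D) x \<partial>lborel)" for x
  have [measurable]: "D \<in> sets borel" using D_open by simp
  have [measurable]: "G \<in> borel_measurable borel" unfolding G_def by measurable
  have bad: "\<bar>conv k b x\<bar> \<le> \<tau> / 3 + \<tau> / 3" if x: "x \<notin> D" "G x \<le> ennreal (\<tau> / 3)" for x
  proof -
    have i1: "integrable lborel (\<lambda>y. k (x - y) * b y)" by (rule integrable_conv_integrand[OF _ M bi]) measurable
    have i2: "integrable lborel (\<lambda>y. k (x - rep y) * b y)" by (rule integrable_bdd_mult[OF _ _ bi]) (measurable, rule M)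
    have z: "(\<integral>y. k (x - rep y) * b y \<partial>lborel) = 0"
    proof -
      have i: "integrable lborel (\<lambda>y. k (x - rep y) * f y)" by (rule integrable_bdd_mult[OF _ _ f]) (measurable, rule M)
      note m = integral_cell_mean[OF f, of "\<lambda>y. k (x - rep y)" M]
      have "(\<integral>y. k (x - rep y) * b y \<partial>lborel) = (\<integral>y. k (x - rep y) * f y - k (x - rep y) * g y \<partial>lborel)"
        by (simp add: b_def right_diff_distrib)
      also have "... = (\<integral>y. k (x - rep y) * f y \<partial>lborel) - (\<integral>y. k (x - rep y) * g y \<partial>lborel)"
        unfolding g_def using rep_const M by (intro Bochner_Integration.integral_diff i m(1)) auto
      also have "... = 0" unfolding g_def using rep_const M by (subst m(2)) auto
      finally show ?thesis .
    qed
    have iw: "integrable lborel (\<lambda>y. (k (x - y) - k (x - rep y)) * b y)"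
      using Bochner_Integration.integrable_diff[OF i1 i2] by (simp add: left_diff_distrib)
    have "conv k b x = (\<integral>y. (k (x - y) - k (x - rep y)) * b y \<partial>lborel)"
      using Bochner_Integration.integral_diff[OF i1 i2] z by (simp add: conv_def left_diff_distrib)
    then have "ennreal \<bar>conv k b x\<bar> \<le> (\<integral>\<^sup>+y. ennreal (\<bar>k (x - y) - k (x - rep y)\<bar> * \<bar>b y\<bar>) \<partial>lborel)"
      using integral_norm_bound_ennreal[OF iw] by (simp add: abs_mult)
    also have "... \<le> (\<integral>\<^sup>+y. indicator \<Omega> y * ennreal (\<bar>k (x - y) - k (x - rep y)\<bar> * \<bar>b y\<bar>) * indicator (- D) x
        + ennreal (L * (real ?n * 2 powi l)) * ennreal \<bar>b y\<bar> \<partial>lborel)"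
    proof (rule nn_integral_mono)
      fix y
      show "ennreal (\<bar>k (x - y) - k (x - rep y)\<bar> * \<bar>b y\<bar>)
          \<le> indicator \<Omega> y * ennreal (\<bar>k (x - y) - k (x - rep y)\<bar> * \<bar>b y\<bar>) * indicator (- D) x
        + ennreal (L * (real ?n * 2 powi l)) * ennreal \<bar>b y\<bar>"
      proof (cases "y \<in> \<Omega>")
        case False
        then have "J y = l" using J(3) by (simp add: \<Omega>_def)
        then have r: "norm (y - rep y) \<le> real ?n * 2 powi l"
          using dist_rep[of y] by (simp add: \<rho>_def)
        have "\<bar>k (x - y) - k (x - rep y)\<bar> \<le> L * norm ((x - y) - (x - rep y))" by (rule L)
        also have "... = L * norm (y - rep y)" by (simp add: norm_minus_commute)
        also have "... \<le> L * (real ?n * 2 powi l)" using L0 r by (rule mult_left_mono[rotated])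
        finally have "ennreal (\<bar>k (x - y) - k (x - rep y)\<bar> * \<bar>b y\<bar>) \<le> ennreal (L * (real ?n * 2 powi l) * \<bar>b y\<bar>)"
          by (intro ennreal_leI mult_right_mono) auto
        also have "... = ennreal (L * (real ?n * 2 powi l)) * ennreal \<bar>b y\<bar>"
          using L0 by (subst ennreal_mult) (auto simp: less_imp_le)
        finally show ?thesis using False by simp
      qed (use x in simp)
    qed
    also have "... = G x + ennreal (L * (real ?n * 2 powi l)) * (\<integral>\<^sup>+y. ennreal \<bar>b y\<bar> \<partial>lborel)"
      unfolding G_def by (subst nn_integral_add) (auto simp: nn_integral_cmult)
    also have "... \<le> ennreal (\<tau> / 3) + ennreal (L * (real ?n * 2 powi l)) * ennreal (2 * I)"
      using x bL by (intro add_mono mult_left_mono) auto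
    also have "... = ennreal (\<tau> / 3 + L * (real ?n * 2 powi l) * (2 * I))"
      using L0 I \<tau> by (simp add: ennreal_mult ennreal_plus less_imp_le)
    finally have "\<bar>conv k b x\<bar> \<le> \<tau> / 3 + L * (real ?n * 2 powi l) * (2 * I)"
      using L0 I \<tau> by (subst (asm) ennreal_le_iff) (auto simp: less_imp_le)
    then show ?thesis using l by linarith
  qed
  have GI: "(\<integral>\<^sup>+x. G x \<partial>lborel) \<le> ennreal (A * ?v * 2 ^ ?n * (2 * I))"
  proof -
    have "(\<integral>\<^sup>+x. G x \<partial>lborel)
      = (\<integral>\<^sup>+y. (\<integral>\<^sup>+x. indicator \<Omega> y * ennreal (\<bar>k (x - y) - k (x - rep y)\<bar> * \<bar>b y\<bar>) * indicator (- D) x \<partial>lborel) \<partial>lborel)"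
      unfolding G_def by (rule lborel_pair.Fubini') measurable
    also have "... \<le> (\<integral>\<^sup>+y. ennreal (A * ?v * 2 ^ ?n) * ennreal \<bar>b y\<bar> \<partial>lborel)"
    proof (rule nn_integral_mono)
      fix y
      show "(\<integral>\<^sup>+x. indicator \<Omega> y * ennreal (\<bar>k (x - y) - k (x - rep y)\<bar> * \<bar>b y\<bar>) * indicator (- D) x \<partial>lborel)
          \<le> ennreal (A * ?v * 2 ^ ?n) * ennreal \<bar>b y\<bar>"
      proof (cases "y \<in> \<Omega>")
        case True
        have "(\<integral>\<^sup>+x. indicator \<Omega> y * ennreal (\<bar>k (x - y) - k (x - rep y)\<bar> * \<bar>b y\<bar>) * indicator (- D) x \<partial>lborel)
          \<le> (\<integral>\<^sup>+x. ennreal \<bar>b y\<bar> * (ennreal \<bar>k (x - y) - k (x - rep y)\<bar> * indicator {x. \<rho> y \<le> norm (rep y - x)} x) \<partial>lborel)"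
          using far[OF _ True] True by (intro nn_integral_mono) (auto simp: indicator_def ennreal_mult mult.commute)
        also have "... = ennreal \<bar>b y\<bar> * (\<integral>\<^sup>+x\<in>{x. \<rho> y \<le> norm (rep y - x)}. ennreal \<bar>k (x - y) - k (x - rep y)\<bar> \<partial>lborel)"
          by (rule nn_integral_cmult) measurable
        also have "... \<le> ennreal \<bar>b y\<bar> * ennreal (A * ?v * 2 ^ ?n)"
          by (intro mult_left_mono Hormander_integral kCZ dist_rep \<rho>0) auto
        finally show ?thesis by (simp add: mult.commute)
      qed simp
    qed
    also have "... = ennreal (A * ?v * 2 ^ ?n) * (\<integral>\<^sup>+y. ennreal \<bar>b y\<bar> \<partial>lborel)"
      by (rule nn_integral_cmult) measurable
    also have "... \<le> ennreal (A * ?v * 2 ^ ?n) * ennreal (2 * I)" by (intro mult_left_mono bL) simp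
    finally show ?thesis using A I by (simp flip: ennreal_mult)
  qed
  have emG: "emeasure lborel {x. ennreal (\<tau> / 3) < G x} \<le> ennreal (A * ?v * 2 ^ ?n * (2 * I) / (\<tau> / 3))"
    using Chebyshev_nn[of G lborel "\<tau> / 3", OF _ _ GI] \<tau> A I by simp
  have emg: "emeasure lborel {x. \<tau> / 3 < \<bar>conv k g x\<bar>} \<le> ennreal (B\<^sup>2 * (2 ^ ?n * \<tau>) * I / (\<tau> / 3)\<^sup>2)"
  proof -
    have "emeasure lborel {x. \<tau> / 3 < \<bar>conv k g x\<bar>} \<le> ennreal (B\<^sup>2 * (2 ^ ?n * \<tau>) * L1norm g / (\<tau> / 3)\<^sup>2)"
      using \<tau> by (intro L2_Chebyshev[OF k gi gb]) auto
    also have "... \<le> ennreal (B\<^sup>2 * (2 ^ ?n * \<tau>) * I / (\<tau> / 3)\<^sup>2)"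
      using gL \<tau> by (intro ennreal_leI divide_right_mono mult_left_mono) auto
    finally show ?thesis .
  qed
  have sub: "{x. \<tau> < \<bar>conv k f x\<bar>} \<subseteq> {x. \<tau> / 3 < \<bar>conv k g x\<bar>} \<union> (D \<union> {x. ennreal (\<tau> / 3) < G x})"
  proof (rule subsetI, rule ccontr)
    fix x assume x: "x \<in> {x. \<tau> < \<bar>conv k f x\<bar>}" "x \<notin> {x. \<tau> / 3 < \<bar>conv k g x\<bar>} \<union> (D \<union> {x. ennreal (\<tau> / 3) < G x})"
    have "conv k f x = conv k g x + conv k b x"
    proof -
      have "integrable lborel (\<lambda>y. k (x - y) * g y)" "integrable lborel (\<lambda>y. k (x - y) * b y)"
        by (rule integrable_conv_integrand[OF _ M gi], measurable) (rule integrable_conv_integrand[OF _ M bi], measurable)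
      from Bochner_Integration.integral_add[OF this] show ?thesis
        by (simp add: conv_def b_def algebra_simps)
    qed
    moreover have "\<bar>conv k b x\<bar> \<le> \<tau> / 3 + \<tau> / 3" using x(2) by (intro bad) (auto simp: not_less)
    ultimately show False using x by auto
  qed
  have "emeasure lborel {x. \<tau> < \<bar>conv k f x\<bar>}
      \<le> emeasure lborel {x. \<tau> / 3 < \<bar>conv k g x\<bar>} + (emeasure lborel D + emeasure lborel {x. ennreal (\<tau> / 3) < G x})"
    by (rule order_trans[OF emeasure_mono[OF sub]], measurable)
      (intro order_trans[OF emeasure_subadditive] add_left_mono emeasure_subadditive, measurable)
  also have "... \<le> ennreal (B\<^sup>2 * (2 ^ ?n * \<tau>) * I / (\<tau> / 3)\<^sup>2) +
      (ennreal (?v * (2 * real ?n) ^ ?n * I / \<tau>) + ennreal (A * ?v * 2 ^ ?n * (2 * I) / (\<tau> / 3)))"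
    by (intro add_mono emg emD emG)
  also have "... = ennreal (B\<^sup>2 * (2 ^ ?n * \<tau>) * I / (\<tau> / 3)\<^sup>2 + (?v * (2 * real ?n) ^ ?n * I / \<tau> + A * ?v * 2 ^ ?n * (2 * I) / (\<tau> / 3)))"
    using I \<tau> A by (subst ennreal_plus[symmetric]; (subst ennreal_plus[symmetric])?) auto
  also have "B\<^sup>2 * (2 ^ ?n * \<tau>) * I / (\<tau> / 3)\<^sup>2 + (?v * (2 * real ?n) ^ ?n * I / \<tau> + A * ?v * 2 ^ ?n * (2 * I) / (\<tau> / 3))
      = weak_const A B TYPE('a) * I / \<tau>"
    using \<tau> by (simp add: weak_const_def power2_eq_square field_simps)
  finally show ?thesis by (simp add: I_def)
qed

section \<open>Maximal truncations\<close>

definition trunc_int :: "('a::euclidean_space \<Rightarrow> real) \<Rightarrow> real \<Rightarrow> ('a \<Rightarrow> real) \<Rightarrow> 'a \<Rightarrow> real" where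
  "trunc_int k \<eta> f x = (\<integral>y. indicator {y. \<eta> < norm (x - y)} y * (k (x - y) * f y) \<partial>lborel)"

lemma integrable_trunc_int:
  fixes k f :: "'a::euclidean_space \<Rightarrow> real"
  assumes k: "k \<in> bdd_L1" and f: "integrable lborel f"
  shows "integrable lborel (\<lambda>y. k (x - y) * f y)"
    "integrable lborel (\<lambda>y. indicator {y. \<eta> < norm (x - y)} y * (k (x - y) * f y))"
proof -
  note [measurable] = bdd_L1_measurable[OF k]
  obtain M where M: "\<And>x. \<bar>k x\<bar> \<le> M" using bdd_L1_bound[OF k] by blast
  show i: "integrable lborel (\<lambda>y. k (x - y) * f y)" by (rule integrable_conv_integrand[OF _ M f]) measurable
  show "integrable lborel (\<lambda>y. indicator {y. \<eta> < norm (x - y)} y * (k (x - y) * f y))"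
    using integrable_mult_indicator[OF _ i, of "{y. \<eta> < norm (x - y)}"] by simp
qed

lemma trunc_int_add:
  fixes k f g :: "'a::euclidean_space \<Rightarrow> real"
  assumes k: "k \<in> bdd_L1" and f: "integrable lborel f" and g: "integrable lborel g"
  shows "trunc_int k \<eta> (\<lambda>y. f y + g y) x = trunc_int k \<eta> f x + trunc_int k \<eta> g x"
  unfolding trunc_int_def
  using Bochner_Integration.integral_add[OF integrable_trunc_int(2)[OF k f] integrable_trunc_int(2)[OF k g]]
  by (simp add: distrib_left)

text \<open>
  Cotlar's argument: without the part of \<open>f\<close> in the ball about \<open>x\<close>, the
  integrals at \<open>x\<close> and \<open>z\<close> differ by the variation of the kernel, which the
  tail estimate bounds by the maximal function at \<open>x\<close>.
\<close>

lemma Cotlar_comparison: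
  fixes k f :: "'a::euclidean_space \<Rightarrow> real"
  assumes k: "good_kernel A B k" and f: "integrable lborel f" and \<mu>: "0 \<le> \<mu>"
    and M: "\<And>r. 0 < r \<Longrightarrow> (\<integral>\<^sup>+y\<in>ball x r. ennreal \<bar>f y\<bar> \<partial>lborel) \<le> ennreal (\<mu> * r ^ DIM('a))"
    and \<eta>: "0 < \<eta>" and z: "2 * norm (x - z) \<le> \<eta>"
  shows "\<bar>trunc_int k \<eta> f x\<bar> \<le> \<bar>conv k f z\<bar> + \<bar>conv k (\<lambda>y. indicator (cball x \<eta>) y * f y) z\<bar>
    + A * 2 ^ DIM('a) * \<mu>"
proof -
  let ?n = "DIM('a)"
  have kCZ: "CZ_kernel A k" and kV: "k \<in> bdd_L1" using k by (auto simp: good_kernel_def)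
  have A: "0 < A" and [measurable]: "k \<in> borel_measurable borel" using kCZ by (auto simp: CZ_kernel_def)
  have [measurable]: "f \<in> borel_measurable borel" using f by auto
  have fB: "integrable lborel (\<lambda>y. indicator (cball x \<eta>) y * f y)"
    using integrable_mult_indicator[OF _ f, of "cball x \<eta>"] by simp
  let ?far = "indicator {y. \<eta> < norm (x - y)} :: 'a \<Rightarrow> real"
  note i1 = integrable_trunc_int(2)[OF kV f, of \<eta> x]
  have i2: "integrable lborel (\<lambda>y. ?far y * (k (z - y) * f y))"
    using integrable_mult_indicator[OF _ integrable_trunc_int(1)[OF kV f, of z], of "{y. \<eta> < norm (x - y)}"] by simp
  have split: "conv k f z = (\<integral>y. ?far y * (k (z - y) * f y) \<partial>lborel) + conv k (\<lambda>y. indicator (cball x \<eta>) y * f y) z"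
  proof -
    have "k (z - y) * f y = ?far y * (k (z - y) * f y) + k (z - y) * (indicator (cball x \<eta>) y * f y)" for y
      by (auto simp: indicator_def dist_norm)
    then show ?thesis
      using Bochner_Integration.integral_add[OF i2 integrable_trunc_int(1)[OF kV fB, of z]]
      by (simp add: conv_def)
  qed
  have id: "integrable lborel (\<lambda>y. ?far y * ((k (x - y) - k (z - y)) * f y))"
    using Bochner_Integration.integrable_diff[OF i1 i2] by (simp add: algebra_simps)
  have "trunc_int k \<eta> f x - (\<integral>y. ?far y * (k (z - y) * f y) \<partial>lborel) = (\<integral>y. ?far y * ((k (x - y) - k (z - y)) * f y) \<partial>lborel)"
    using Bochner_Integration.integral_diff[OF i1 i2] by (simp add: trunc_int_def algebra_simps)
  then have "ennreal \<bar>trunc_int k \<eta> f x - (\<integral>y. ?far y * (k (z - y) * f y) \<partial>lborel)\<bar>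
      \<le> (\<integral>\<^sup>+y. ennreal \<bar>?far y * ((k (x - y) - k (z - y)) * f y)\<bar> \<partial>lborel)"
    using integral_norm_bound_ennreal[OF id] by simp
  also have "... \<le> (\<integral>\<^sup>+y. ennreal (A * (\<eta> / 2)) * (ennreal \<bar>f y\<bar> * ennreal (1 / norm (x - y) ^ (?n + 1)) * indicator {y. \<eta> \<le> norm (x - y)} y) \<partial>lborel)"
  proof (rule nn_integral_mono)
    fix y
    show "ennreal \<bar>?far y * ((k (x - y) - k (z - y)) * f y)\<bar>
      \<le> ennreal (A * (\<eta> / 2)) * (ennreal \<bar>f y\<bar> * ennreal (1 / norm (x - y) ^ (?n + 1)) * indicator {y. \<eta> \<le> norm (x - y)} y)"
    proof (cases "\<eta> < norm (x - y)")
      case True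
      have *: "\<bar>k u - k w\<bar> \<le> A * norm (u - w) / norm u ^ (?n + 1)"
        if "u \<noteq> 0" "2 * norm (u - w) \<le> norm u" for u w
        using kCZ that unfolding CZ_kernel_def by blast
      have "\<bar>k (x - y) - k (z - y)\<bar> \<le> A * norm ((x - y) - (z - y)) / norm (x - y) ^ (?n + 1)"
        using True z \<eta> by (intro *) auto
      also have "... \<le> A * (\<eta> / 2) / norm (x - y) ^ (?n + 1)"
        using A z by (intro divide_right_mono mult_left_mono) auto
      finally have "\<bar>(k (x - y) - k (z - y)) * f y\<bar> \<le> A * (\<eta> / 2) / norm (x - y) ^ (?n + 1) * \<bar>f y\<bar>"
        by (simp only: abs_mult mult_right_mono abs_ge_zero)
      then have "ennreal \<bar>(k (x - y) - k (z - y)) * f y\<bar> \<le> ennreal ((A * (\<eta> / 2)) * (\<bar>f y\<bar> * (1 / norm (x - y) ^ (?n + 1))))"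
        by (intro ennreal_leI) (simp add: mult_ac)
      also have "... = ennreal (A * (\<eta> / 2)) * (ennreal \<bar>f y\<bar> * ennreal (1 / norm (x - y) ^ (?n + 1)))"
        using A \<eta> by (simp only: ennreal_mult' ennreal_mult'' mult_nonneg_nonneg less_imp_le abs_ge_zero)
      finally show ?thesis using True by simp
    qed simp
  qed
  also have "... = ennreal (A * (\<eta> / 2)) * (\<integral>\<^sup>+y\<in>{y. \<eta> \<le> norm (x - y)}. ennreal \<bar>f y\<bar> * ennreal (1 / norm (x - y) ^ (?n + 1)) \<partial>lborel)"
    by (intro nn_integral_cmult) measurable
  also have "... \<le> ennreal (A * (\<eta> / 2)) * ennreal (2 ^ (?n + 1) * \<mu> / \<eta>)"
    using \<eta> \<mu> M by (intro mult_left_mono nn_integral_tail_bound) auto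
  also have "... = ennreal (A * 2 ^ ?n * \<mu>)"
    using A \<eta> \<mu> by (subst ennreal_mult[symmetric]) (auto simp: field_simps)
  finally have "\<bar>trunc_int k \<eta> f x - (\<integral>y. ?far y * (k (z - y) * f y) \<partial>lborel)\<bar> \<le> A * 2 ^ ?n * \<mu>"
    using A \<mu> by (subst (asm) ennreal_le_iff) auto
  then show ?thesis using split by linarith
qed

lemma le_add_of_ennreal: "ennreal a \<le> ennreal b + ennreal c \<Longrightarrow> 0 \<le> b \<Longrightarrow> 0 \<le> c \<Longrightarrow> a \<le> b + c"
  by (simp add: ennreal_plus[symmetric] del: ennreal_plus)

text \<open>
  The exceptional set consists of the points where the maximal function of \<open>f\<close> exceeds
  \<open>\<gamma> \<tau>\<close> and those where \<open>{\<bar>T f\<bar> > \<tau>/3}\<close> has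
  density more than a quarter in some ball about the point. Off this set, Cotlar's comparison applies
  at some point \<open>z\<close> of the ball of radius \<open>\<eta>/2\<close> where \<open>T
  f\<close> and \<open>T\<close> of the near part are both small. The bound for the maximal function
  of \<open>f\<close> is recorded as well because the stopping argument needs it on the same set.
\<close>

theorem truncations_weak_type:
  assumes A: "0 < A"
  shows "\<exists>C>0. \<forall>(k :: 'a::euclidean_space \<Rightarrow> real) f \<tau>. good_kernel A B k \<longrightarrow> integrable lborel f \<longrightarrow> 0 < \<tau> \<longrightarrow>
    (\<exists>E. open E \<and> emeasure lborel E \<le> ennreal (C * L1norm f / \<tau>) \<and>
      (\<forall>x. x \<notin> E \<longrightarrow> (\<forall>\<eta>>0. \<bar>trunc_int k \<eta> f x\<bar> \<le> \<tau>) \<and>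
        (\<forall>r>0. (\<integral>\<^sup>+y\<in>ball x r. ennreal \<bar>f y\<bar> \<partial>lborel) \<le> ennreal (\<tau> * r ^ DIM('a)))))"
proof -
  let ?n = "DIM('a)" and ?v = "unit_vol TYPE('a)"
  define W where "W = weak_const A B TYPE('a)"
  have v: "0 < ?v" by simp
  have W: "0 < W" unfolding W_def weak_const_def using A v
    by (intro add_nonneg_pos add_nonneg_nonneg mult_pos_pos) auto
  \<comment> \<open>The first bound absorbs the last term of the comparison; the second leaves room for \<open>z\<close> in the ball.\<close>
  define \<gamma> where "\<gamma> = min 1 (min (1 / (4 * A * 2 ^ ?n)) (?v / (12 * W * 4 ^ ?n)))"
  have \<gamma>: "0 < \<gamma>" "\<gamma> \<le> 1" unfolding \<gamma>_def using A W v by auto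
  have \<gamma>A: "A * 2 ^ ?n * \<gamma> \<le> 1 / 4"
  proof -
    have "\<gamma> \<le> 1 / (4 * A * 2 ^ ?n)" by (simp add: \<gamma>_def)
    then show ?thesis using A by (simp add: field_simps)
  qed
  have \<gamma>W: "3 * W * 4 ^ ?n * \<gamma> \<le> ?v / 4"
  proof -
    have "\<gamma> \<le> ?v / (12 * W * 4 ^ ?n)" by (simp add: \<gamma>_def)
    then show ?thesis using W by (simp add: field_simps)
  qed
  define C where "C = ?v * 5 ^ ?n / \<gamma> + ?v * 5 ^ ?n / (?v / 4) * (W * 3)"
  have C: "0 < C" unfolding C_def using v W \<gamma> by (intro add_pos_pos mult_pos_pos divide_pos_pos) auto
  show ?thesis
  proof (intro exI[of _ C] conjI C allI impI)
    fix k f :: "'a \<Rightarrow> real" and \<tau> :: real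
    assume k: "good_kernel A B k" and f: "integrable lborel f" and \<tau>: "0 < \<tau>"
    have kV: "k \<in> bdd_L1" using k by (auto simp: good_kernel_def)
    note [measurable] = bdd_L1_measurable[OF kV]
    have [measurable]: "f \<in> borel_measurable borel" using f by auto
    define I where "I = L1norm f"
    have I: "0 \<le> I" "(\<integral>\<^sup>+x. ennreal \<bar>f x\<bar> \<partial>lborel) = ennreal I"
      using f by (auto simp: I_def L1norm_nonneg L1norm_def nn_integral_eq_integral)
    define S where "S = {x. \<tau> / 3 < \<bar>conv k f x\<bar>}"
    have [measurable]: "S \<in> sets borel" unfolding S_def by measurable
    have emS: "emeasure lborel S \<le> ennreal (W * 3 * I / \<tau>)"
      using weak_type[OF k f, of "\<tau> / 3"] \<tau> by (simp add: S_def W_def I_def mult_ac)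
    have IS: "(\<integral>\<^sup>+x. indicator S x \<partial>lborel) = emeasure lborel S" by simp
    define E1 where "E1 = maximal_set (\<lambda>y. ennreal \<bar>f y\<bar>) (\<gamma> * \<tau>)"
    define E2 where "E2 = maximal_set (indicator S :: 'a \<Rightarrow> ennreal) (?v / 4)"
    have op: "open E1" "open E2" unfolding E1_def E2_def using \<gamma> \<tau> v by (intro open_maximal_set; simp)+
    have e1: "emeasure lborel E1 \<le> ennreal (?v * 5 ^ ?n / (\<gamma> * \<tau>) * I)"
    proof -
      have "emeasure lborel E1 \<le> ennreal (?v * 5 ^ ?n / (\<gamma> * \<tau>)) * (\<integral>\<^sup>+x. ennreal \<bar>f x\<bar> \<partial>lborel)"
        unfolding E1_def using \<gamma> \<tau> I by (intro emeasure_maximal_set) auto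
      then show ?thesis using I \<gamma> \<tau> by (simp add: ennreal_mult' flip: ennreal_mult)
    qed
    have e2: "emeasure lborel E2 \<le> ennreal (?v * 5 ^ ?n / (?v / 4) * (W * 3 * I / \<tau>))"
    proof -
      have "emeasure lborel E2 \<le> ennreal (?v * 5 ^ ?n / (?v / 4)) * (\<integral>\<^sup>+x. indicator S x \<partial>lborel)"
        unfolding E2_def using v emS by (intro emeasure_maximal_set) (auto simp: IS intro: le_less_trans ennreal_less_top)
      also have "... \<le> ennreal (?v * 5 ^ ?n / (?v / 4)) * ennreal (W * 3 * I / \<tau>)"
        unfolding IS by (intro mult_left_mono emS) simp
      also have "... = ennreal (?v * 5 ^ ?n / (?v / 4) * (W * 3 * I / \<tau>))"
        using W I \<tau> v by (subst ennreal_mult[symmetric]) auto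
      finally show ?thesis .
    qed
    have out: "\<bar>trunc_int k \<eta> f x\<bar> \<le> \<tau>" if x: "x \<notin> E1" "x \<notin> E2" and \<eta>: "0 < \<eta>" for x \<eta>
    proof (rule ccontr)
      assume "\<not> \<bar>trunc_int k \<eta> f x\<bar> \<le> \<tau>"
      then have big: "\<tau> < \<bar>trunc_int k \<eta> f x\<bar>" by simp
      have M: "(\<integral>\<^sup>+y\<in>ball x r. ennreal \<bar>f y\<bar> \<partial>lborel) \<le> ennreal (\<gamma> * \<tau> * r ^ ?n)" if "0 < r" for r
        using maximal_setD[OF x(1)[unfolded E1_def] that] .
      define g where "g y = indicator (cball x \<eta>) y * f y" for y
      have g: "integrable lborel g" unfolding g_def
        using integrable_mult_indicator[OF _ f, of "cball x \<eta>"] by simp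
      have [measurable]: "g \<in> borel_measurable borel" using g by auto
      have gI: "L1norm g \<le> \<gamma> * \<tau> * (2 * \<eta>) ^ ?n"
      proof -
        have "ennreal (L1norm g) = (\<integral>\<^sup>+y. ennreal \<bar>g y\<bar> \<partial>lborel)"
          using g by (simp add: L1norm_def nn_integral_eq_integral)
        also have "... \<le> (\<integral>\<^sup>+y\<in>ball x (2 * \<eta>). ennreal \<bar>f y\<bar> \<partial>lborel)"
          using \<eta> by (intro nn_integral_mono) (auto simp: g_def indicator_def)
        also have "... \<le> ennreal (\<gamma> * \<tau> * (2 * \<eta>) ^ ?n)" using \<eta> by (intro M) simp
        finally show ?thesis using \<gamma> \<tau> \<eta> by (subst (asm) ennreal_le_iff) auto
      qed
      define S' where "S' = {z. \<tau> / 3 < \<bar>conv k g z\<bar>}"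
      have [measurable]: "S' \<in> sets borel" unfolding S'_def by measurable
      have sub: "ball x (\<eta> / 2) \<subseteq> (ball x (\<eta> / 2) \<inter> S) \<union> S'"
      proof
        fix z assume z: "z \<in> ball x (\<eta> / 2)"
        have "\<bar>trunc_int k \<eta> f x\<bar> \<le> \<bar>conv k f z\<bar> + \<bar>conv k g z\<bar> + A * 2 ^ ?n * (\<gamma> * \<tau>)"
          unfolding g_def using z \<gamma> \<tau> M \<eta> by (intro Cotlar_comparison[OF k f]) (auto simp: dist_norm)
        also have "A * 2 ^ ?n * (\<gamma> * \<tau>) \<le> 1 / 4 * \<tau>"
          using mult_right_mono[OF \<gamma>A less_imp_le[OF \<tau>]] by (simp add: mult.assoc)
        finally have "\<tau> / 3 < \<bar>conv k f z\<bar> \<or> \<tau> / 3 < \<bar>conv k g z\<bar>" using big \<tau> by linarith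
        then show "z \<in> (ball x (\<eta> / 2) \<inter> S) \<union> S'" using z by (auto simp: S_def S'_def)
      qed
      have "ennreal (?v * (\<eta> / 2) ^ ?n) = emeasure lborel (ball x (\<eta> / 2))"
        using \<eta> by (subst emeasure_ball) auto
      also have "... \<le> emeasure lborel (ball x (\<eta> / 2) \<inter> S) + emeasure lborel S'"
        by (rule order_trans[OF emeasure_mono[OF sub]], measurable) (rule emeasure_subadditive, measurable)
      also have "emeasure lborel (ball x (\<eta> / 2) \<inter> S) = (\<integral>\<^sup>+y\<in>ball x (\<eta> / 2). indicator S y \<partial>lborel)"
      proof -
        have "(\<integral>\<^sup>+y\<in>ball x (\<eta> / 2). indicator S y \<partial>lborel) = (\<integral>\<^sup>+y. indicator (ball x (\<eta> / 2) \<inter> S) y \<partial>lborel)"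
          by (intro nn_integral_cong) (simp add: indicator_inter_arith mult.commute)
        then show ?thesis by simp
      qed
      also have "... \<le> ennreal (?v / 4 * (\<eta> / 2) ^ ?n)"
        using maximal_setD[OF x(2)[unfolded E2_def], of "\<eta> / 2"] \<eta> by simp
      also have "emeasure lborel S' \<le> ennreal (W * L1norm g / (\<tau> / 3))"
        unfolding S'_def W_def using \<tau> by (intro weak_type[OF k g]) simp
      also have "... \<le> ennreal (?v / 4 * (\<eta> / 2) ^ ?n)"
      proof (rule ennreal_leI)
        have "W * L1norm g / (\<tau> / 3) \<le> W * (\<gamma> * \<tau> * (2 * \<eta>) ^ ?n) / (\<tau> / 3)"
          using gI W \<tau> by (intro divide_right_mono mult_left_mono) auto
        also have "... = 3 * W * 4 ^ ?n * \<gamma> * (\<eta> / 2) ^ ?n"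
        proof -
          have "(2 * \<eta>) ^ ?n = (4 * (\<eta> / 2)) ^ ?n" by simp
          also have "... = 4 ^ ?n * (\<eta> / 2) ^ ?n" by (rule power_mult_distrib)
          finally have "(2 * \<eta>) ^ ?n = 4 ^ ?n * (\<eta> / 2) ^ ?n" .
          then show ?thesis using \<tau> by simp
        qed
        also have "... \<le> ?v / 4 * (\<eta> / 2) ^ ?n"
          using \<eta> by (intro mult_right_mono \<gamma>W) auto
        finally show "W * L1norm g / (\<tau> / 3) \<le> ?v / 4 * (\<eta> / 2) ^ ?n" .
      qed
      finally have "ennreal (?v * (\<eta> / 2) ^ ?n) \<le> ennreal (?v / 4 * (\<eta> / 2) ^ ?n) + ennreal (?v / 4 * (\<eta> / 2) ^ ?n)"
        by (simp add: add_mono)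
      then have "?v * (\<eta> / 2) ^ ?n \<le> ?v / 4 * (\<eta> / 2) ^ ?n + ?v / 4 * (\<eta> / 2) ^ ?n"
        using \<eta> v by (intro le_add_of_ennreal) auto
      moreover have "0 < ?v * (\<eta> / 2) ^ ?n" using \<eta> v by (intro mult_pos_pos) auto
      ultimately show False by linarith
    qed
    show "\<exists>E. open E \<and> emeasure lborel E \<le> ennreal (C * L1norm f / \<tau>) \<and>
      (\<forall>x. x \<notin> E \<longrightarrow> (\<forall>\<eta>>0. \<bar>trunc_int k \<eta> f x\<bar> \<le> \<tau>) \<and>
        (\<forall>r>0. (\<integral>\<^sup>+y\<in>ball x r. ennreal \<bar>f y\<bar> \<partial>lborel) \<le> ennreal (\<tau> * r ^ ?n)))"
    proof (intro exI[of _ "E1 \<union> E2"] conjI allI impI)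
      show "open (E1 \<union> E2)" using op by (rule open_Un)
      have "emeasure lborel (E1 \<union> E2) \<le> emeasure lborel E1 + emeasure lborel E2"
        using op by (intro emeasure_subadditive) auto
      also have "... \<le> ennreal (?v * 5 ^ ?n / (\<gamma> * \<tau>) * I) + ennreal (?v * 5 ^ ?n / (?v / 4) * (W * 3 * I / \<tau>))"
        by (intro add_mono e1 e2)
      also have "... = ennreal (?v * 5 ^ ?n / (\<gamma> * \<tau>) * I + ?v * 5 ^ ?n / (?v / 4) * (W * 3 * I / \<tau>))"
        using \<gamma> \<tau> I W v by (intro ennreal_plus[symmetric] mult_nonneg_nonneg divide_nonneg_nonneg) auto
      also have "?v * 5 ^ ?n / (\<gamma> * \<tau>) * I + ?v * 5 ^ ?n / (?v / 4) * (W * 3 * I / \<tau>) = C * L1norm f / \<tau>"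
        using \<tau> by (simp add: C_def I_def field_simps)
      finally show "emeasure lborel (E1 \<union> E2) \<le> ennreal (C * L1norm f / \<tau>)" .
      fix x assume x: "x \<notin> E1 \<union> E2"
      show "\<bar>trunc_int k \<eta> f x\<bar> \<le> \<tau>" if "0 < \<eta>" for \<eta> using out x that by auto
      fix r :: real assume r: "0 < r"
      have "(\<integral>\<^sup>+y\<in>ball x r. ennreal \<bar>f y\<bar> \<partial>lborel) \<le> ennreal (\<gamma> * \<tau> * r ^ ?n)"
        using maximal_setD[of x "\<lambda>y. ennreal \<bar>f y\<bar>" "\<gamma> * \<tau>" r] x r by (simp add: E1_def)
      also have "... \<le> ennreal (\<tau> * r ^ ?n)"
        using \<gamma> \<tau> r mult_right_mono[of \<gamma> 1 \<tau>] by (intro ennreal_leI mult_right_mono) auto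
      finally show "(\<integral>\<^sup>+y\<in>ball x r. ennreal \<bar>f y\<bar> \<partial>lborel) \<le> ennreal (\<tau> * r ^ ?n)" .
    qed
  qed
qed

lemma ennreal_sum3_mult:
  assumes "0 \<le> a" "0 \<le> b" "0 \<le> c" "0 \<le> d" "0 \<le> e" "0 \<le> g"
  shows "ennreal a * ennreal b + ennreal c * ennreal d + ennreal e * ennreal g = ennreal (a * b + c * d + e * g)"
  using assms by (simp add: ennreal_mult ennreal_plus)

lemma nn_integral_linear3:
  assumes [measurable]: "f \<in> borel_measurable M" "g \<in> borel_measurable M" "h \<in> borel_measurable M"
  shows "(\<integral>\<^sup>+x. (a * f x + b * g x) + c * h x \<partial>M)
    = (a * (\<integral>\<^sup>+x. f x \<partial>M) + b * (\<integral>\<^sup>+x. g x \<partial>M)) + c * (\<integral>\<^sup>+x. h x \<partial>M)"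
  by (simp add: nn_integral_add nn_integral_cmult)

text \<open>
  Far away the kernel varies little between the two points, except where only one of the two
  truncations is active, which happens at distance about \<open>\<eta>\<close>; the maximal function
  at \<open>z\<close> controls both contributions.
\<close>

lemma trunc_int_two_points:
  fixes k h :: "'a::euclidean_space \<Rightarrow> real"
  assumes k: "good_kernel A B k" and h: "integrable lborel h" and \<mu>: "0 \<le> \<mu>" and s: "0 < s"
    and M: "\<And>r. 0 < r \<Longrightarrow> (\<integral>\<^sup>+y\<in>ball z r. ennreal \<bar>h y\<bar> \<partial>lborel) \<le> ennreal (\<mu> * r ^ DIM('a))"
    and xz: "norm (x - z) \<le> real DIM('a) * s"
    and hx: "\<And>y. norm (x - y) < s \<Longrightarrow> h y = 0" and hz: "\<And>y. norm (z - y) < s \<Longrightarrow> h y = 0"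
    and \<eta>: "0 < \<eta>"
  shows "\<bar>trunc_int k \<eta> h x\<bar> \<le> \<bar>trunc_int k \<eta> h z\<bar>
    + A * (2 * (4 * real DIM('a)) ^ DIM('a) + 2 ^ DIM('a) + 8 ^ DIM('a)) * \<mu>"
proof -
  let ?n = "DIM('a)"
  have n: "1 \<le> real ?n" using DIM_positive[where 'a='a] by (simp add: Suc_leI)
  have kCZ: "CZ_kernel A k" and kV: "k \<in> bdd_L1" using k by (auto simp: good_kernel_def)
  have A: "0 < A" and [measurable]: "k \<in> borel_measurable borel" using kCZ by (auto simp: CZ_kernel_def)
  have [measurable]: "h \<in> borel_measurable borel" using h by auto
  \<comment> \<open>At distance \<open>R\<close> and beyond, \<open>x\<close> and \<open>z\<close> are close relative to their distance from \<open>y\<close>.\<close>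
  define R where "R = 4 * real ?n * s"
  have R: "0 < R" using s n by (simp add: R_def)
  have xzR: "norm (x - z) \<le> R / 4" using xz by (simp add: R_def)
  define w where "w p y = indicator {y. \<eta> < norm (p - y)} y * k (p - y)" for p y
  have K1: "\<bar>k u\<bar> \<le> A / norm u ^ ?n" if "u \<noteq> 0" for u
    using kCZ that by (simp add: CZ_kernel_def)
  have K2: "\<bar>k u - k v\<bar> \<le> A * norm (u - v) / norm u ^ (?n + 1)" if "u \<noteq> 0" "2 * norm (u - v) \<le> norm u" for u v
    using kCZ that unfolding CZ_kernel_def by blast
  have K3: "\<bar>k u\<bar> \<le> A / q ^ ?n" if "q \<le> norm u" "0 < q" for u q
  proof -
    have "A / norm u ^ ?n \<le> A / q ^ ?n"
      using that A by (intro divide_left_mono power_mono mult_pos_pos zero_less_power) auto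
    moreover have "u \<noteq> 0" using that by auto
    ultimately show ?thesis using K1[of u] by linarith
  qed
  have w3: "\<bar>w p y\<bar> \<le> A / q ^ ?n" if "q \<le> norm (p - y)" "0 < q" for p q y
    using K3[OF that] A that by (auto simp: w_def indicator_def)
  have near: "ennreal \<bar>w x y - w z y\<bar> * ennreal \<bar>h y\<bar> \<le> ennreal (2 * A / s ^ ?n) * (ennreal \<bar>h y\<bar>)" for y
  proof (cases "norm (x - y) < s \<or> norm (z - y) < s")
    case False
    then have "\<bar>w x y\<bar> \<le> A / s ^ ?n" "\<bar>w z y\<bar> \<le> A / s ^ ?n" using s by (auto intro!: w3)
    then have "\<bar>w x y - w z y\<bar> \<le> 2 * A / s ^ ?n" by simp
    then show ?thesis by (intro mult_right_mono ennreal_leI) auto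
  qed (use hx hz in auto)
  have far: "\<bar>w x y - w z y\<bar> \<le> A * (R / 4) * (1 / norm (z - y) ^ (?n + 1)) + A * 4 ^ ?n / \<eta> ^ ?n * indicator (ball z (2 * \<eta>)) y"
    if y: "R \<le> norm (z - y)" for y
  proof -
    let ?u = "norm (z - y)"
    have u: "0 < ?u" using R y by linarith
    have x2: "?u \<le> norm (x - y) + R / 4" using xzR norm_triangle_ineq[of "z - x" "x - y"] by (simp add: norm_minus_commute)
    have P: "0 \<le> A * (R / 4) * (1 / norm (z - y) ^ (?n + 1))" "0 \<le> A * 4 ^ ?n / \<eta> ^ ?n" using A R \<eta> by auto
    have q: "A / (\<eta> / 4) ^ ?n = A * 4 ^ ?n / \<eta> ^ ?n" by (simp add: power_divide)
    \<comment> \<open>Both truncations see \<open>y\<close>, or none does, or \<open>y\<close> is at distance about \<open>\<eta>\<close> from both points.\<close>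
    consider "\<eta> < norm (x - y)" "\<eta> < ?u" | "norm (x - y) \<le> \<eta>" "?u \<le> \<eta>" | "norm (x - y) \<le> \<eta>" "\<eta> < ?u"
      | "\<eta> < norm (x - y)" "?u \<le> \<eta>" by linarith
    then show ?thesis
    proof cases
      case 1
      have "\<bar>k (z - y) - k (x - y)\<bar> \<le> A * norm ((z - y) - (x - y)) / norm (z - y) ^ (?n + 1)"
        using u xzR y R by (intro K2) (auto simp: norm_minus_commute)
      also have "... \<le> A * (R / 4) / norm (z - y) ^ (?n + 1)"
        using A xzR by (intro divide_right_mono mult_left_mono) (auto simp: norm_minus_commute)
      finally have "\<bar>w x y - w z y\<bar> \<le> A * (R / 4) * (1 / norm (z - y) ^ (?n + 1))"
        using 1 by (simp add: w_def abs_minus_commute)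
      then show ?thesis using P by (auto simp: indicator_def)
    next
      case 2 then show ?thesis using P by (simp add: w_def indicator_def)
    next
      case 3
      have "\<bar>w z y\<bar> \<le> A * 4 ^ ?n / \<eta> ^ ?n" unfolding q[symmetric] using 3 \<eta> by (intro w3) auto
      moreover have "?u < 2 * \<eta>" using 3 x2 y \<eta> by linarith
      ultimately show ?thesis using 3 P by (auto simp: w_def dist_norm)
    next
      case 4
      have "\<bar>w x y\<bar> \<le> A * 4 ^ ?n / \<eta> ^ ?n" unfolding q[symmetric] using 4 \<eta> by (intro w3) auto
      then show ?thesis using 4 P \<eta> by (auto simp: w_def dist_norm)
    qed
  qed
  have iw: "integrable lborel (\<lambda>y. w p y * h y)" for p
    using integrable_trunc_int(2)[OF kV h, of \<eta> p] by (simp add: w_def mult.assoc)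
  have T: "trunc_int k \<eta> h p = (\<integral>y. w p y * h y \<partial>lborel)" for p
    by (simp add: trunc_int_def w_def mult.assoc)
  have id: "integrable lborel (\<lambda>y. (w x y - w z y) * h y)"
    using Bochner_Integration.integrable_diff[OF iw iw, of x z] by (simp add: left_diff_distrib)
  have "trunc_int k \<eta> h x - trunc_int k \<eta> h z = (\<integral>y. (w x y - w z y) * h y \<partial>lborel)"
    using Bochner_Integration.integral_diff[OF iw iw, of x z] by (simp add: T left_diff_distrib)
  then have "ennreal \<bar>trunc_int k \<eta> h x - trunc_int k \<eta> h z\<bar> \<le> (\<integral>\<^sup>+y. ennreal \<bar>w x y - w z y\<bar> * ennreal \<bar>h y\<bar> \<partial>lborel)"
    using integral_norm_bound_ennreal[OF id] by (simp add: abs_mult ennreal_mult)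
  also have "... \<le> (\<integral>\<^sup>+y. (ennreal (2 * A / s ^ ?n) * (ennreal \<bar>h y\<bar> * indicator (ball z R) y)
      + ennreal (A * (R / 4)) * (ennreal \<bar>h y\<bar> * ennreal (1 / norm (z - y) ^ (?n + 1)) * indicator {y. R \<le> norm (z - y)} y))
      + ennreal (A * 4 ^ ?n / \<eta> ^ ?n) * (ennreal \<bar>h y\<bar> * indicator (ball z (2 * \<eta>)) y) \<partial>lborel)"
  proof (rule nn_integral_mono)
    fix y
    show "ennreal \<bar>w x y - w z y\<bar> * ennreal \<bar>h y\<bar> \<le> (ennreal (2 * A / s ^ ?n) * (ennreal \<bar>h y\<bar> * indicator (ball z R) y)
      + ennreal (A * (R / 4)) * (ennreal \<bar>h y\<bar> * ennreal (1 / norm (z - y) ^ (?n + 1)) * indicator {y. R \<le> norm (z - y)} y))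
      + ennreal (A * 4 ^ ?n / \<eta> ^ ?n) * (ennreal \<bar>h y\<bar> * indicator (ball z (2 * \<eta>)) y)"
    proof (cases "norm (z - y) < R")
      case True
      then show ?thesis using near[of y] by (simp add: dist_norm add_increasing2)
    next
      case False
      then have y: "R \<le> norm (z - y)" by simp
      have "ennreal \<bar>w x y - w z y\<bar> \<le> ennreal (A * (R / 4) * (1 / norm (z - y) ^ (?n + 1)) + A * 4 ^ ?n / \<eta> ^ ?n * indicator (ball z (2 * \<eta>)) y)"
        by (intro ennreal_leI far y)
      also have "... = ennreal (A * (R / 4)) * ennreal (1 / norm (z - y) ^ (?n + 1)) + ennreal (A * 4 ^ ?n / \<eta> ^ ?n) * indicator (ball z (2 * \<eta>)) y"
        using A R \<eta> by (subst ennreal_plus; (subst ennreal_mult)?) (auto simp: indicator_def)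
      finally have "ennreal \<bar>w x y - w z y\<bar> * ennreal \<bar>h y\<bar>
        \<le> (ennreal (A * (R / 4)) * ennreal (1 / norm (z - y) ^ (?n + 1)) + ennreal (A * 4 ^ ?n / \<eta> ^ ?n) * indicator (ball z (2 * \<eta>)) y) * ennreal \<bar>h y\<bar>"
        by (rule mult_right_mono) simp
      also have "... \<le> (ennreal (2 * A / s ^ ?n) * (ennreal \<bar>h y\<bar> * indicator (ball z R) y)
      + ennreal (A * (R / 4)) * (ennreal \<bar>h y\<bar> * ennreal (1 / norm (z - y) ^ (?n + 1)) * indicator {y. R \<le> norm (z - y)} y))
      + ennreal (A * 4 ^ ?n / \<eta> ^ ?n) * (ennreal \<bar>h y\<bar> * indicator (ball z (2 * \<eta>)) y)"
        using y False by (simp add: distrib_right distrib_left dist_norm mult_ac)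
      finally show ?thesis .
    qed
  qed
  also have "... = (ennreal (2 * A / s ^ ?n) * (\<integral>\<^sup>+y\<in>ball z R. ennreal \<bar>h y\<bar> \<partial>lborel)
      + ennreal (A * (R / 4)) * (\<integral>\<^sup>+y\<in>{y. R \<le> norm (z - y)}. ennreal \<bar>h y\<bar> * ennreal (1 / norm (z - y) ^ (?n + 1)) \<partial>lborel))
      + ennreal (A * 4 ^ ?n / \<eta> ^ ?n) * (\<integral>\<^sup>+y\<in>ball z (2 * \<eta>). ennreal \<bar>h y\<bar> \<partial>lborel)"
    by (intro nn_integral_linear3 borel_measurable_times_ennreal borel_measurable_indicator) measurable
  also have "... \<le> (ennreal (2 * A / s ^ ?n) * ennreal (\<mu> * R ^ ?n)
      + ennreal (A * (R / 4)) * ennreal (2 ^ (?n + 1) * \<mu> / R))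
      + ennreal (A * 4 ^ ?n / \<eta> ^ ?n) * ennreal (\<mu> * (2 * \<eta>) ^ ?n)"
    using R \<eta> \<mu> M by (intro add_mono mult_left_mono M nn_integral_tail_bound) auto
  also have "... = ennreal ((2 * A / s ^ ?n * (\<mu> * R ^ ?n) + A * (R / 4) * (2 ^ (?n + 1) * \<mu> / R)) + A * 4 ^ ?n / \<eta> ^ ?n * (\<mu> * (2 * \<eta>) ^ ?n))"
    using A R \<eta> \<mu> s by (intro ennreal_sum3_mult) auto
  also have "(2 * A / s ^ ?n * (\<mu> * R ^ ?n) + A * (R / 4) * (2 ^ (?n + 1) * \<mu> / R)) + A * 4 ^ ?n / \<eta> ^ ?n * (\<mu> * (2 * \<eta>) ^ ?n)
      = A * (2 * (4 * real ?n) ^ ?n + 2 ^ ?n / 2 + 8 ^ ?n) * \<mu>"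
  proof -
    have "R ^ ?n = (4 * real ?n) ^ ?n * s ^ ?n" by (simp only: R_def power_mult_distrib)
    then have 1: "2 * A / s ^ ?n * (\<mu> * R ^ ?n) = A * (2 * (4 * real ?n) ^ ?n) * \<mu>"
      using s by simp
    have "4 ^ ?n * (2 * \<eta>) ^ ?n = (4 * (2 * \<eta>)) ^ ?n" by (rule power_mult_distrib[symmetric])
    also have "... = (8 * \<eta>) ^ ?n" by simp
    also have "... = 8 ^ ?n * \<eta> ^ ?n" by (rule power_mult_distrib)
    finally have e: "4 ^ ?n * (2 * \<eta>) ^ ?n = 8 ^ ?n * \<eta> ^ ?n" .
    have "A * 4 ^ ?n / \<eta> ^ ?n * (\<mu> * (2 * \<eta>) ^ ?n) = A * \<mu> * (8 ^ ?n * \<eta> ^ ?n) / \<eta> ^ ?n"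
      unfolding e[symmetric] by simp
    then have 2: "A * 4 ^ ?n / \<eta> ^ ?n * (\<mu> * (2 * \<eta>) ^ ?n) = A * 8 ^ ?n * \<mu>"
      using \<eta> by simp
    have 3: "A * (R / 4) * (2 ^ (?n + 1) * \<mu> / R) = A * (2 ^ ?n / 2) * \<mu>" using R by simp
    show ?thesis unfolding 1 2 3 by (simp only: distrib_left distrib_right)
  qed
  also have "ennreal (A * (2 * (4 * real ?n) ^ ?n + 2 ^ ?n / 2 + 8 ^ ?n) * \<mu>)
      \<le> ennreal (A * (2 * (4 * real ?n) ^ ?n + 2 ^ ?n + 8 ^ ?n) * \<mu>)"
    using A \<mu> by (intro ennreal_leI mult_right_mono mult_left_mono) auto
  finally have "\<bar>trunc_int k \<eta> h x - trunc_int k \<eta> h z\<bar> \<le> A * (2 * (4 * real ?n) ^ ?n + 2 ^ ?n + 8 ^ ?n) * \<mu>"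
    using A \<mu> by (subst (asm) ennreal_le_iff) auto
  then show ?thesis by linarith
qed

section \<open>Sparse domination\<close>

lemma dcorner_in: "dcorner k x \<in> dcell k x"
  unfolding dcell_def by (simp add: cell_index_eq_iff dcorner_inner)

lemma dcorner_const: "y \<in> dcell k x \<Longrightarrow> dcorner k y = dcorner k x"
  by (simp add: dcorner_def dcell_index_eq)

lemma countable_dcorners: "countable (\<Union>k. range (dcorner k :: 'a::euclidean_space \<Rightarrow> 'a))"
proof (rule countable_UN)
  fix k
  have "dcorner k x = dcorner k (SOME z. z \<in> dcell k x)" for x :: 'a
    using someI[of "\<lambda>z. z \<in> dcell k x" x] by (simp add: dcorner_const)
  then have "range (dcorner k :: 'a \<Rightarrow> 'a) \<subseteq> (\<lambda>C. dcorner k (SOME z. z \<in> C)) ` range (dcell k)" by blast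
  then show "countable (range (dcorner k :: 'a \<Rightarrow> 'a))"
    by (rule countable_subset[OF _ countable_image[OF countable_dcells]])
qed simp

text \<open>
  A family of disjoint dyadic cubes with union \<open>\<Omega>\<close>, encoded by the level \<open>J
  x\<close> of the cube that contains the point \<open>x\<close>.
\<close>

definition saturated :: "'a::euclidean_space set \<Rightarrow> ('a \<Rightarrow> int) \<Rightarrow> bool" where
  "saturated \<Omega> J \<longleftrightarrow> (\<forall>x\<in>\<Omega>. dcell (J x) x \<subseteq> \<Omega> \<and> (\<forall>y\<in>dcell (J x) x. J y = J x))"

text \<open>One representative of each cube of the family.\<close>

definition corners :: "'a::euclidean_space set \<Rightarrow> ('a \<Rightarrow> int) \<Rightarrow> 'a set" where
  "corners \<Omega> J = {z\<in>\<Omega>. dcorner (J z) z = z}"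

lemma saturated_cells:
  assumes S: "saturated \<Omega> J"
  shows "countable (corners \<Omega> J)" "disjoint_family_on (\<lambda>z. dcell (J z) z) (corners \<Omega> J)"
    "\<Omega> = (\<Union>z\<in>corners \<Omega> J. dcell (J z) z)" "\<Omega> \<in> sets borel"
proof -
  show c: "countable (corners \<Omega> J)"
  proof (rule countable_subset[OF _ countable_dcorners])
    show "corners \<Omega> J \<subseteq> (\<Union>k. range (dcorner k))"
      unfolding corners_def by (auto intro: sym)
  qed
  show "disjoint_family_on (\<lambda>z. dcell (J z) z) (corners \<Omega> J)"
    unfolding disjoint_family_on_def
  proof (intro ballI impI)
    fix u v assume uv: "u \<in> corners \<Omega> J" "v \<in> corners \<Omega> J" "u \<noteq> v"
    show "dcell (J u) u \<inter> dcell (J v) v = {}"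
    proof (rule ccontr)
      assume "dcell (J u) u \<inter> dcell (J v) v \<noteq> {}"
      then obtain y where y: "y \<in> dcell (J u) u" "y \<in> dcell (J v) v" by blast
      then have "J y = J u" "J y = J v" using S uv by (auto simp: saturated_def corners_def)
      then have "dcorner (J u) u = dcorner (J v) v" using dcorner_const[OF y(1)] dcorner_const[OF y(2)] by simp
      then show False using uv by (simp add: corners_def)
    qed
  qed
  show U: "\<Omega> = (\<Union>z\<in>corners \<Omega> J. dcell (J z) z)"
  proof (intro equalityI subsetI)
    fix x assume x: "x \<in> \<Omega>"
    let ?z = "dcorner (J x) x"
    have z: "?z \<in> dcell (J x) x" by (rule dcorner_in)
    have "dcell (J x) x \<subseteq> \<Omega>" "\<forall>y\<in>dcell (J x) x. J y = J x"
      using S x unfolding saturated_def by blast+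
    with z have "?z \<in> \<Omega>" "J ?z = J x" by blast+
    moreover have "dcorner (J x) ?z = ?z" using z by (rule dcorner_const)
    moreover have "x \<in> dcell (J x) ?z" using dcell_eq[OF z] by simp
    ultimately show "x \<in> (\<Union>z\<in>corners \<Omega> J. dcell (J z) z)" 
      by (intro UN_I[of ?z]) (simp_all add: corners_def)
  qed (use S in \<open>auto simp: saturated_def corners_def\<close>)
  show "\<Omega> \<in> sets borel"
    by (subst U) (intro sets.countable_UN' c, auto)
qed

definition max_trunc :: "('a::euclidean_space \<Rightarrow> real) \<Rightarrow> ('a \<Rightarrow> real) \<Rightarrow> 'a \<Rightarrow> ennreal" where
  "max_trunc k f x = (SUP \<eta>\<in>{0<..}. ennreal \<bar>trunc_int k \<eta> f x\<bar>)"

lemma max_trunc_leI: "(\<And>\<eta>. 0 < \<eta> \<Longrightarrow> ennreal \<bar>trunc_int k \<eta> f x\<bar> \<le> c) \<Longrightarrow> max_trunc k f x \<le> c"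
  unfolding max_trunc_def by (rule SUP_least) auto

lemma max_trunc_upper: "0 < \<eta> \<Longrightarrow> ennreal \<bar>trunc_int k \<eta> f x\<bar> \<le> max_trunc k f x"
  unfolding max_trunc_def by (rule SUP_upper) auto

definition on_triple :: "('a::euclidean_space \<Rightarrow> real) \<Rightarrow> int \<Rightarrow> 'a \<Rightarrow> 'a \<Rightarrow> real" where
  "on_triple f j x y = indicator (dtriple j x) y * f y"

definition triple_mean :: "('a::euclidean_space \<Rightarrow> real) \<Rightarrow> int \<Rightarrow> 'a \<Rightarrow> real" where
  "triple_mean f j x = L1norm (on_triple f j x) / (3 * 2 powi j) ^ DIM('a)"

lemma triple_mean_nonneg: "0 \<le> triple_mean f j x"
  by (simp add: triple_mean_def L1norm_nonneg less_imp_le)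

lemma L1norm_on_triple:
  "L1norm (on_triple f j (x::'a::euclidean_space)) = triple_mean f j x * 3 ^ DIM('a) * (2 powi j) ^ DIM('a)"
  by (simp add: triple_mean_def power_mult_distrib less_imp_neq)

lemma nn_integral_abs_eq_L1norm:
  "integrable lborel f \<Longrightarrow> (\<integral>\<^sup>+y. ennreal \<bar>f y\<bar> \<partial>lborel) = ennreal (L1norm f)"
  by (simp add: L1norm_def nn_integral_eq_integral)

lemma trunc_int_eq_0:
  assumes f: "integrable lborel f" and 0: "L1norm f = 0"
  shows "trunc_int k \<eta> f x = 0"
proof -
  have "AE y in lborel. \<bar>f y\<bar> = 0"
    using 0 f unfolding L1norm_def by (subst (asm) integral_nonneg_eq_0_iff_AE) auto
  then have "AE y in lborel. indicator {y. \<eta> < norm (x - y)} y * (k (x - y) * f y) = 0" by eventually_elim simp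
  then show ?thesis unfolding trunc_int_def by (rule integral_eq_zero_AE)
qed

lemma open_contains_dcell:
  fixes x :: "'a::euclidean_space"
  assumes "open E" "x \<in> E"
  obtains j where "j < q" "dcell j x \<subseteq> E"
proof -
  obtain e where e: "0 < e" "ball x e \<subseteq> E" using assms by (meson open_contains_ball)
  obtain N where N: "real DIM('a) * 2 powi q / e < 2 ^ N" using real_arch_pow[of 2] by auto
  define j where "j = q - int (Suc N)"
  have small: "real DIM('a) * 2 powi j < e"
  proof -
    have pj: "(2::real) powi j = 2 powi q / 2 ^ Suc N"
      unfolding j_def using power_int_diff[of "2::real" q "int (Suc N)"] by (simp del: of_nat_Suc power_Suc)
    have "real DIM('a) * 2 powi q < 2 ^ N * e" using N e(1) by (simp only: pos_divide_less_eq)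
    also have "... \<le> e * 2 ^ Suc N" using e(1) by simp
    finally have "real DIM('a) * 2 powi q / 2 ^ Suc N < e" by (subst pos_divide_less_eq) simp_all
    then show ?thesis by (simp only: pj times_divide_eq_right)
  qed
  have "dcell j x \<subseteq> ball x e"
  proof
    fix y assume "y \<in> dcell j x"
    then have "norm (x - y) < e" using dist_dcell[of y j x] small by linarith
    then show "y \<in> ball x e" by (simp add: dist_norm)
  qed
  then show ?thesis using that[of j] e by (auto simp: j_def)
qed

definition sparse_selection ::
  "real \<Rightarrow> ('a::euclidean_space \<Rightarrow> real) \<Rightarrow> ('a \<Rightarrow> real) \<Rightarrow> int \<Rightarrow> 'a \<Rightarrow> 'a set \<Rightarrow> ('a \<Rightarrow> int) \<Rightarrow> bool" where
  "sparse_selection C0 k f q x0 \<Omega> J \<longleftrightarrow> \<Omega> \<subseteq> dcell q x0 \<and> saturated \<Omega> J \<and> (\<forall>x\<in>\<Omega>. J x < q) \<and>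
    emeasure lborel \<Omega> \<le> ennreal ((2 powi q) ^ DIM('a) / 2) \<and>
    (\<forall>x\<in>dcell q x0. max_trunc k (on_triple f q x0) x \<le> ennreal (C0 * triple_mean f q x0)
      + (if x \<in> \<Omega> then max_trunc k (on_triple f (J x) x) x else 0))"

text \<open>
  One step of the stopping time. Off the selected cubes the maximal truncation is bounded by the mean;
  on a selected cube it exceeds the mean by at most the local maximal truncation of that cube, because
  more than a quarter of each selected cube is left for a point at which all bad sets are avoided.
\<close>

theorem sparse_step:
  assumes A: "0 < A"
  shows "\<exists>C0>0. \<forall>(k :: 'a::euclidean_space \<Rightarrow> real) f q x0. good_kernel A B k \<longrightarrow>
    (\<forall>j x. integrable lborel (on_triple f j x)) \<longrightarrow>
    (\<exists>\<Omega> J. sparse_selection C0 k f q x0 \<Omega> J)"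
proof -
  let ?n = "DIM('a)"
  obtain C where C: "0 < C" and WT: "\<forall>(k :: 'a \<Rightarrow> real) f \<tau>. good_kernel A B k \<longrightarrow> integrable lborel f \<longrightarrow> 0 < \<tau> \<longrightarrow>
    (\<exists>E. open E \<and> emeasure lborel E \<le> ennreal (C * L1norm f / \<tau>) \<and>
      (\<forall>x. x \<notin> E \<longrightarrow> (\<forall>\<eta>>0. \<bar>trunc_int k \<eta> f x\<bar> \<le> \<tau>) \<and>
        (\<forall>r>0. (\<integral>\<^sup>+y\<in>ball x r. ennreal \<bar>f y\<bar> \<partial>lborel) \<le> ennreal (\<tau> * r ^ ?n))))"
    using truncations_weak_type[OF A, of B, where 'a='a] by (elim exE conjE) (rule that)
  \<comment> \<open>An integral over a triple is \<open>3\<^sup>n\<close> cube volumes times the mean; the rest makes the exceptional sets small.\<close>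
  define C1 where "C1 = C * 3 ^ ?n * (4 * 2 ^ ?n)"
  have C1: "0 < C1" using C by (simp add: C1_def)
  define C2 where "C2 = A * (2 * (4 * real ?n) ^ ?n + 2 ^ ?n + 8 ^ ?n)"
  have C2: "0 \<le> C2" using A by (simp add: C2_def)
  define C0 where "C0 = C1 * (1 + C1 * (2 * real ?n) ^ ?n + C2)"
  have C0: "0 < C0" "C1 \<le> C0"
  proof -
    have "1 \<le> 1 + C1 * (2 * real ?n) ^ ?n + C2" using C1 C2 by simp
    then have "C1 * 1 \<le> C0" unfolding C0_def using C1 by (intro mult_left_mono) auto
    then show "0 < C0" "C1 \<le> C0" using C1 by auto
  qed
  show ?thesis
  proof (intro exI[of _ C0] conjI C0(1) allI impI)
    fix k f :: "'a \<Rightarrow> real" and q :: int and x0 :: 'a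
    assume k: "good_kernel A B k" and loc: "\<forall>j x. integrable lborel (on_triple f j x)"
    have kV: "k \<in> bdd_L1" using k by (auto simp: good_kernel_def)
    \<comment> \<open>The exceptional set for the triple of the cube: it has less than a fourth of the measure of the cube.\<close>
    define bad where "bad E j x \<longleftrightarrow> open E \<and> emeasure lborel E \<le> ennreal ((2 powi j) ^ ?n / (4 * 2 ^ ?n)) \<and>
      (\<forall>z. z \<notin> E \<longrightarrow> (\<forall>\<eta>>0. \<bar>trunc_int k \<eta> (on_triple f j x) z\<bar> \<le> C1 * triple_mean f j x) \<and>
        (\<forall>r>0. (\<integral>\<^sup>+y\<in>ball z r. ennreal \<bar>on_triple f j x y\<bar> \<partial>lborel) \<le> ennreal (C1 * triple_mean f j x * r ^ ?n)))" for E j x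
    have exc: "\<exists>E. bad E j x"
      for j x
    proof (cases "triple_mean f j x = 0")
      case True
      then have L0: "L1norm (on_triple f j x) = 0" by (simp add: L1norm_on_triple)
      have "(\<integral>\<^sup>+y\<in>ball z r. ennreal \<bar>on_triple f j x y\<bar> \<partial>lborel) \<le> 0" for z r
      proof -
        have "(\<integral>\<^sup>+y\<in>ball z r. ennreal \<bar>on_triple f j x y\<bar> \<partial>lborel) \<le> (\<integral>\<^sup>+y. ennreal \<bar>on_triple f j x y\<bar> \<partial>lborel)"
          by (intro nn_integral_mono) (auto simp: indicator_def)
        then show ?thesis using L0 loc by (simp add: nn_integral_abs_eq_L1norm)
      qed
      then show ?thesis using True L0 loc by (intro exI[of _ "{}"]) (simp add: bad_def trunc_int_eq_0)
    next
      case False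
      then have a: "0 < triple_mean f j x" using triple_mean_nonneg[of f j x] by simp
      have "C * L1norm (on_triple f j x) / (C1 * triple_mean f j x) = (2 powi j) ^ ?n / (4 * 2 ^ ?n)"
        using a C by (simp add: L1norm_on_triple C1_def field_simps)
      moreover have "0 < C1 * triple_mean f j x" using a C1 by simp
      ultimately show ?thesis
        using WT[rule_format, OF k loc[rule_format], of "C1 * triple_mean f j x" j x] by (simp only: bad_def)
    qed
    define Ex where "Ex j x = (SOME E. bad E j x)" for j x
    have "bad (Ex j x) j x" for j x unfolding Ex_def using exc by (rule someI_ex)
    then have Ex: "\<And>j x. open (Ex j x)"
      "\<And>j x. emeasure lborel (Ex j x) \<le> ennreal ((2 powi j) ^ ?n / (4 * 2 ^ ?n))"
      "\<And>j x z \<eta>. z \<notin> Ex j x \<Longrightarrow> 0 < \<eta> \<Longrightarrow> \<bar>trunc_int k \<eta> (on_triple f j x) z\<bar> \<le> C1 * triple_mean f j x"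
      "\<And>j x z r. z \<notin> Ex j x \<Longrightarrow> 0 < r \<Longrightarrow> (\<integral>\<^sup>+y\<in>ball z r. ennreal \<bar>on_triple f j x y\<bar> \<partial>lborel) \<le> ennreal (C1 * triple_mean f j x * r ^ ?n)"
      unfolding bad_def by blast+
    have [measurable]: "Ex j x \<in> sets borel" for j x using Ex(1) by simp
    define E where "E = Ex q x0"
    have [measurable]: "E \<in> sets borel" unfolding E_def by simp
    define a where "a = triple_mean f q x0"
    have a: "0 \<le> a" by (simp add: a_def triple_mean_nonneg)
    \<comment> \<open>Few cubes pass this threshold; a maximal one has a parent that fails it, so it is at most half bad.\<close>
    define P where "P j x \<longleftrightarrow> j < q \<and> ennreal ((2 powi j) ^ ?n / (2 * 2 ^ ?n)) < emeasure lborel (dcell j x \<inter> E)" for j x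
    define J where "J = top_level P"
    define \<Omega> where "\<Omega> = {x \<in> dcell q x0. \<exists>j. P j x}"
    have const: "P j y \<longleftrightarrow> P j x" if "y \<in> dcell j x" for j x y using dcell_eq[OF that] by (simp add: P_def)
    have top: "P (J x) x" "\<And>i. J x < i \<Longrightarrow> \<not> P i x" if xO: "x \<in> \<Omega>" for x
    proof -
      obtain j where j: "P j x" using xO by (auto simp: \<Omega>_def)
      have b: "\<And>i. P i x \<Longrightarrow> i \<le> q" by (simp add: P_def)
      show "P (J x) x" "\<And>i. J x < i \<Longrightarrow> \<not> P i x" unfolding J_def using top_level[of P j x q] j b by blast+
    qed
    have Jq: "J x < q" if "x \<in> \<Omega>" for x using top(1)[OF that] by (simp add: P_def)
    have sat: "saturated \<Omega> J"
      unfolding saturated_def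
    proof (intro ballI conjI subsetI)
      fix x y assume x: "x \<in> \<Omega>" and y: "y \<in> dcell (J x) x"
      show "J y = J x" unfolding J_def
        by (rule top_level_dcell[where P=P, OF const]) (use top[OF x] y in \<open>auto simp: J_def\<close>)
      have "y \<in> dcell q x" using y dcell_mono[of "J x" q x] Jq[OF x] by auto
      then have "y \<in> dcell q x0" using x dcell_eq[of x q x0] by (auto simp: \<Omega>_def)
      moreover have "P (J x) y" using const[OF y] top(1)[OF x] by simp
      ultimately show "y \<in> \<Omega>" by (auto simp: \<Omega>_def)
    qed
    note cells = saturated_cells[OF sat]
    have em: "emeasure lborel \<Omega> \<le> ennreal ((2 powi q) ^ ?n / 2)"
    proof -
      have "emeasure lborel \<Omega> \<le> (\<integral>\<^sup>+z. emeasure lborel (dcell (J z) z) \<partial>count_space (corners \<Omega> J))"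
        by (subst cells(3)) (intro emeasure_UN_le_nn_integral cells(1), simp)
      also have "... \<le> (\<integral>\<^sup>+z. ennreal (2 * 2 ^ ?n) * emeasure lborel (dcell (J z) z \<inter> E) \<partial>count_space (corners \<Omega> J))"
      proof (rule nn_integral_mono)
        fix z assume "z \<in> space (count_space (corners \<Omega> J))"
        then have "P (J z) z" using top by (auto simp: corners_def)
        then have "ennreal (2 * 2 ^ ?n) * ennreal ((2 powi J z) ^ ?n / (2 * 2 ^ ?n)) \<le> ennreal (2 * 2 ^ ?n) * emeasure lborel (dcell (J z) z \<inter> E)"
          by (intro mult_left_mono) (auto simp: P_def)
        then show "emeasure lborel (dcell (J z) z) \<le> ennreal (2 * 2 ^ ?n) * emeasure lborel (dcell (J z) z \<inter> E)"
          by (simp add: emeasure_dcell less_imp_le flip: ennreal_mult)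
      qed
      also have "... = ennreal (2 * 2 ^ ?n) * (\<integral>\<^sup>+z. emeasure lborel (dcell (J z) z \<inter> E) \<partial>count_space (corners \<Omega> J))"
        by (rule nn_integral_cmult) simp
      also have "(\<integral>\<^sup>+z. emeasure lborel (dcell (J z) z \<inter> E) \<partial>count_space (corners \<Omega> J)) = emeasure lborel (\<Union>z\<in>corners \<Omega> J. dcell (J z) z \<inter> E)"
        using cells(2) by (intro emeasure_UN_countable[symmetric] cells(1)) (auto simp: disjoint_family_on_def)
      also have "... \<le> emeasure lborel E" by (intro emeasure_mono) auto
      also have "... \<le> ennreal ((2 powi q) ^ ?n / (4 * 2 ^ ?n))" unfolding E_def by (rule Ex)
      finally have "emeasure lborel \<Omega> \<le> ennreal (2 * 2 ^ ?n) * ennreal ((2 powi q) ^ ?n / (4 * 2 ^ ?n))"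
        by (simp add: mult_left_mono)
      also have "... = ennreal ((2 powi q) ^ ?n / 2)" by (subst ennreal_mult[symmetric]) (auto simp: less_imp_le)
      finally show ?thesis .
    qed
    have off: "max_trunc k (on_triple f q x0) x \<le> ennreal (C0 * a)" if x: "x \<in> dcell q x0" "x \<notin> \<Omega>" for x
    proof -
      have "x \<notin> E"
      proof
        assume "x \<in> E"
        then obtain j where j: "j < q" "dcell j x \<subseteq> E" using Ex(1) unfolding E_def by (metis open_contains_dcell)
        have "(2 powi j) ^ ?n / (2 * 2 ^ ?n) < (2 powi j :: real) ^ ?n"
        proof -
          have "1 < 2 * (2::real) ^ ?n" using one_le_power[of "2::real" ?n] by linarith
          then have "(2 powi j) ^ ?n * 1 < (2 powi j :: real) ^ ?n * (2 * 2 ^ ?n)"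
            by (intro mult_strict_left_mono) auto
          then show ?thesis by (subst pos_divide_less_eq) auto
        qed
        then have "ennreal ((2 powi j) ^ ?n / (2 * 2 ^ ?n)) < emeasure lborel (dcell j x)"
          by (simp add: emeasure_dcell ennreal_less_iff less_imp_le)
        moreover have "dcell j x \<inter> E = dcell j x" using j by blast
        ultimately have "P j x" using j by (simp add: P_def)
        then show False using x by (auto simp: \<Omega>_def)
      qed
      show ?thesis
      proof (rule max_trunc_leI, rule ennreal_leI)
        fix \<eta> :: real assume "0 < \<eta>"
        then have "\<bar>trunc_int k \<eta> (on_triple f q x0) x\<bar> \<le> C1 * a"
          using Ex(3)[of x q x0 \<eta>] \<open>x \<notin> E\<close> by (simp add: E_def a_def)
        also have "... \<le> C0 * a" using C0 a by (intro mult_right_mono)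
        finally show "\<bar>trunc_int k \<eta> (on_triple f q x0) x\<bar> \<le> C0 * a" .
      qed
    qed
    have on: "max_trunc k (on_triple f q x0) x \<le> ennreal (C0 * a) + max_trunc k (on_triple f (J x) x) x" if x: "x \<in> \<Omega>" for x
    proof -
      define j where "j = J x"
      define s where "s = (2::real) powi j"
      have s: "0 < s" by (simp add: s_def)
      have jq: "j < q" using Jq[OF x] by (simp add: j_def)
      have xq: "x \<in> dcell q x0" using x by (simp add: \<Omega>_def)
      define F where "F = on_triple f q x0"
      define G where "G = on_triple f j x"
      define h where "h y = F y - G y" for y
      have Fi: "integrable lborel F" and Gi: "integrable lborel G" using loc by (auto simp: F_def G_def)
      have hi: "integrable lborel h" unfolding h_def using Fi Gi by simp
      have tri: "dtriple j x \<subseteq> dtriple q x0" using jq xq by (intro dtriple_mono_dcell) auto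
      have Gh: "G y = indicator (dtriple j x) y * F y" "h y = indicator (- dtriple j x) y * F y" for y
        using tri by (auto simp: h_def F_def G_def on_triple_def indicator_def)
      have small: "emeasure lborel (dcell j x \<inter> E) \<le> ennreal (s ^ ?n / 2)"
      proof (cases "j + 1 = q")
        case True
        have "emeasure lborel (dcell j x \<inter> E) \<le> emeasure lborel E" by (intro emeasure_mono) auto
        also have "... \<le> ennreal ((2 powi q) ^ ?n / (4 * 2 ^ ?n))" unfolding E_def by (rule Ex)
        also have "... \<le> ennreal (s ^ ?n / 2)"
          unfolding True[symmetric] s_def by (intro ennreal_leI) (simp add: power_int_add power_mult_distrib)
        finally show ?thesis .
      next
        case False
        have "\<not> P (j + 1) x" using top(2)[OF x, of "j + 1"] by (simp add: j_def)
        then have "emeasure lborel (dcell (j + 1) x \<inter> E) \<le> ennreal ((2 powi (j + 1)) ^ ?n / (2 * 2 ^ ?n))"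
          using False jq by (auto simp: P_def not_less)
        moreover have "(2 powi (j + 1)) ^ ?n / (2 * 2 ^ ?n) = s ^ ?n / 2"
          by (simp add: s_def power_int_add power_mult_distrib)
        moreover have "emeasure lborel (dcell j x \<inter> E) \<le> emeasure lborel (dcell (j + 1) x \<inter> E)"
          using dcell_mono[of j "j + 1" x] by (intro emeasure_mono) auto
        ultimately show ?thesis by simp
      qed
      have "\<exists>z\<in>dcell j x. z \<notin> E \<and> z \<notin> Ex j x"
      proof (rule ccontr)
        assume "\<not> ?thesis"
        then have "dcell j x \<subseteq> (dcell j x \<inter> E) \<union> Ex j x" by blast
        then have "emeasure lborel (dcell j x) \<le> emeasure lborel ((dcell j x \<inter> E) \<union> Ex j x)"
          by (intro emeasure_mono) auto
        also have "... \<le> emeasure lborel (dcell j x \<inter> E) + emeasure lborel (Ex j x)"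
          by (rule emeasure_subadditive) auto
        also have "... \<le> ennreal (s ^ ?n / 2) + ennreal (s ^ ?n / (4 * 2 ^ ?n))"
          using small Ex(2)[of j x] by (intro add_mono) (auto simp: s_def)
        finally have "ennreal (s ^ ?n) \<le> ennreal (s ^ ?n / 2) + ennreal (s ^ ?n / (4 * 2 ^ ?n))"
          by (simp add: emeasure_dcell s_def)
        then have "s ^ ?n \<le> s ^ ?n / 2 + s ^ ?n / (4 * 2 ^ ?n)" using s by (intro le_add_of_ennreal) auto
        moreover have "s ^ ?n / (4 * 2 ^ ?n) \<le> s ^ ?n / 4"
          using s by (intro divide_left_mono) auto
        moreover have "0 < s ^ ?n" using s by simp
        ultimately show False by linarith
      qed
      then obtain z where z: "z \<in> dcell j x" "z \<notin> E" "z \<notin> Ex j x" by blast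
      have MF: "(\<integral>\<^sup>+y\<in>ball z r. ennreal \<bar>F y\<bar> \<partial>lborel) \<le> ennreal (C1 * a * r ^ ?n)" if "0 < r" for r
        using Ex(4)[of z q x0 r] z that by (simp add: E_def a_def F_def)
      have Mh: "(\<integral>\<^sup>+y\<in>ball z r. ennreal \<bar>h y\<bar> \<partial>lborel) \<le> ennreal (C1 * a * r ^ ?n)" if "0 < r" for r
      proof -
        have "(\<integral>\<^sup>+y\<in>ball z r. ennreal \<bar>h y\<bar> \<partial>lborel) \<le> (\<integral>\<^sup>+y\<in>ball z r. ennreal \<bar>F y\<bar> \<partial>lborel)"
          by (intro nn_integral_mono) (auto simp: Gh(2) indicator_def)
        then show ?thesis using MF[OF that] by (rule order_trans)
      qed
      define b where "b = triple_mean f j x"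
      have bb: "b \<le> C1 * a * (2 * real ?n) ^ ?n"
      proof -
        have n: "1 \<le> real ?n" using DIM_positive[where 'a='a] by (simp add: Suc_leI)
        let ?R = "4 * real ?n * s"
        have "ennreal (L1norm G) = (\<integral>\<^sup>+y. ennreal \<bar>G y\<bar> \<partial>lborel)" using Gi by (simp add: nn_integral_abs_eq_L1norm)
        also have "... \<le> (\<integral>\<^sup>+y\<in>ball z ?R. ennreal \<bar>F y\<bar> \<partial>lborel)"
        proof (rule nn_integral_mono)
          fix y
          have "y \<in> ball z ?R" if "y \<in> dtriple j x"
          proof -
            have "norm (z - y) \<le> real ?n * (2 * s)" using dist_dtriple[OF that z(1)] by (simp add: s_def)
            also have "... < ?R" using n s by simp
            finally show ?thesis by (simp add: dist_norm)
          qed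
          then show "ennreal \<bar>G y\<bar> \<le> ennreal \<bar>F y\<bar> * indicator (ball z ?R) y"
            by (auto simp: Gh(1) indicator_def)
        qed
        also have "... \<le> ennreal (C1 * a * ?R ^ ?n)" using n s by (intro MF) simp
        finally have "L1norm G \<le> C1 * a * ?R ^ ?n" using C1 a s by (subst (asm) ennreal_le_iff) auto
        then have "b * (3 ^ ?n * s ^ ?n) \<le> C1 * a * (4 * real ?n) ^ ?n * s ^ ?n"
          by (simp add: G_def L1norm_on_triple b_def s_def power_mult_distrib mult.assoc)
        then have "b * 3 ^ ?n \<le> C1 * a * (4 * real ?n) ^ ?n" using s by (simp add: mult.assoc[symmetric])
        also have "... \<le> C1 * a * (3 * (2 * real ?n)) ^ ?n"
          using C1 a by (intro mult_left_mono power_mono) auto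
        also have "(3 * (2 * real ?n)) ^ ?n = 3 ^ ?n * (2 * real ?n) ^ ?n" by (rule power_mult_distrib)
        finally have "b * 3 ^ ?n \<le> (C1 * a * (2 * real ?n) ^ ?n) * 3 ^ ?n" by (simp only: mult_ac)
        then show ?thesis by (rule mult_right_le_imp_le) simp
      qed
      have "ennreal \<bar>trunc_int k \<eta> F x\<bar> \<le> ennreal (C0 * a) + max_trunc k G x" if \<eta>: "0 < \<eta>" for \<eta>
      proof -
        have split: "trunc_int k \<eta> F p = trunc_int k \<eta> G p + trunc_int k \<eta> h p" for p
          using trunc_int_add[OF kV Gi hi, of \<eta> p] by (simp add: h_def)
        have "\<bar>trunc_int k \<eta> h x\<bar> \<le> \<bar>trunc_int k \<eta> h z\<bar> + C2 * (C1 * a)"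
          unfolding C2_def
        proof (rule trunc_int_two_points[OF k hi _ s Mh _ _ _ \<eta>])
          show "0 \<le> C1 * a" using C1 a by simp
          show "norm (x - z) \<le> real ?n * s" using dist_dcell[OF z(1)] by (simp add: s_def)
          show "h y = 0" if "norm (x - y) < s" for y
            using dist_outside_dtriple[of y j x x] that by (auto simp: Gh(2) s_def indicator_def not_less)
          show "h y = 0" if "norm (z - y) < s" for y
            using dist_outside_dtriple[of y j x z] z(1) that by (auto simp: Gh(2) s_def indicator_def not_less)
        qed
        moreover have "\<bar>trunc_int k \<eta> F z\<bar> \<le> C1 * a"
          using Ex(3)[of z q x0 \<eta>] z \<eta> by (simp add: F_def E_def a_def)
        moreover have "\<bar>trunc_int k \<eta> G z\<bar> \<le> C1 * b"
          using Ex(3)[of z j x \<eta>] z \<eta> by (simp add: G_def b_def)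
        moreover have "C1 * b \<le> C1 * (C1 * a * (2 * real ?n) ^ ?n)" using bb C1 by (intro mult_left_mono) auto
        ultimately have "\<bar>trunc_int k \<eta> F x\<bar> \<le> \<bar>trunc_int k \<eta> G x\<bar> + (C1 * a + C1 * (C1 * a * (2 * real ?n) ^ ?n) + C2 * (C1 * a))"
          using split[of x] split[of z] by linarith
        also have "C1 * a + C1 * (C1 * a * (2 * real ?n) ^ ?n) + C2 * (C1 * a) = C0 * a"
          by (simp add: C0_def algebra_simps)
        finally have "ennreal \<bar>trunc_int k \<eta> F x\<bar> \<le> ennreal (\<bar>trunc_int k \<eta> G x\<bar> + C0 * a)" by (rule ennreal_leI)
        also have "... = ennreal \<bar>trunc_int k \<eta> G x\<bar> + ennreal (C0 * a)"
          using C0 a by (intro ennreal_plus) auto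
        also have "... \<le> max_trunc k G x + ennreal (C0 * a)" using \<eta> by (intro add_right_mono max_trunc_upper)
        finally show ?thesis by (simp add: add.commute)
      qed
      then show ?thesis unfolding F_def G_def j_def by (rule max_trunc_leI)
    qed
    show "\<exists>\<Omega> J. sparse_selection C0 k f q x0 \<Omega> J"
      unfolding sparse_selection_def
      using sat Jq em on off by (intro exI[of _ \<Omega>] exI[of _ J]) (auto simp: \<Omega>_def a_def)
  qed
qed

text \<open>
  A stopping tree: generation \<open>m\<close> consists of the pairwise disjoint cubes \<open>dcell
  (lev m x) x\<close> with \<open>x \<in> Om m\<close>, and each cube loses at most half of its
  measure to the next generation.
\<close>

definition sparse_tree :: "(nat \<Rightarrow> 'a::euclidean_space set) \<Rightarrow> (nat \<Rightarrow> 'a \<Rightarrow> int) \<Rightarrow> bool" where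
  "sparse_tree Om lev \<longleftrightarrow> (\<forall>m. saturated (Om m) (lev m) \<and> Om (Suc m) \<subseteq> Om m \<and>
    (\<forall>x\<in>Om m. emeasure lborel (dcell (lev m x) x \<inter> Om (Suc m)) \<le> ennreal ((2 powi lev m x) ^ DIM('a) / 2)))"

lemma sparse_treeD:
  assumes "sparse_tree Om lev"
  shows "saturated (Om m) (lev m)" "Om (Suc m) \<subseteq> Om m" "Om m \<in> sets borel"
proof -
  show s: "saturated (Om m) (lev m)" and "Om (Suc m) \<subseteq> Om m"
    using assms unfolding sparse_tree_def by blast+
  show "Om m \<in> sets borel" using s by (rule saturated_cells)
qed

lemma sparse_tree_halves:
  fixes Om :: "nat \<Rightarrow> 'a::euclidean_space set"
  assumes T: "sparse_tree Om lev" and q: "\<And>m x. x \<in> Om m \<Longrightarrow> lev m x \<le> q"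
  shows "emeasure lborel (dcell q x \<inter> Om m) \<le> ennreal ((2 powi q) ^ DIM('a) * (1 / 2) ^ m)"
    (is "_ \<le> ennreal (?c * _)")
proof (induction m)
  case 0
  have "Om 0 \<in> sets borel" using T by (rule sparse_treeD)
  then have "emeasure lborel (dcell q x \<inter> Om 0) \<le> emeasure lborel (dcell q x)" by (intro emeasure_mono) auto
  then show ?case by (simp add: emeasure_dcell)
next
  case (Suc m)
  let ?S = "Om m \<inter> dcell q x"
  note sat = sparse_treeD(1)[OF T, of m] and sub = sparse_treeD(2)[OF T, of m] and B = sparse_treeD(3)[OF T]
  have satS: "saturated ?S (lev m)"
    unfolding saturated_def
  proof (intro ballI conjI)
    fix y assume y: "y \<in> ?S"
    have "dcell (lev m y) y \<subseteq> dcell q y" using q y by (intro dcell_mono) auto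
    moreover have "dcell q y = dcell q x" using y dcell_eq by blast
    moreover have "dcell (lev m y) y \<subseteq> Om m" using sat y unfolding saturated_def by blast
    ultimately show "dcell (lev m y) y \<subseteq> ?S" by blast
  next
    fix y v assume "y \<in> ?S" "v \<in> dcell (lev m y) y"
    then show "lev m v = lev m y" using sat unfolding saturated_def by blast
  qed
  note c = saturated_cells[OF satS]
  let ?I = "corners ?S (lev m)"
  have "dcell q x \<inter> Om (Suc m) \<subseteq> (\<Union>z\<in>?I. dcell (lev m z) z \<inter> Om (Suc m))"
    using sub c(3) by blast
  then have "emeasure lborel (dcell q x \<inter> Om (Suc m)) \<le> emeasure lborel (\<Union>z\<in>?I. dcell (lev m z) z \<inter> Om (Suc m))"
    using B by (intro emeasure_mono) (auto intro!: sets.countable_UN' c(1))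
  also have "... \<le> (\<integral>\<^sup>+z. emeasure lborel (dcell (lev m z) z \<inter> Om (Suc m)) \<partial>count_space ?I)"
    using B by (intro emeasure_UN_le_nn_integral c(1)) auto
  also have "... \<le> (\<integral>\<^sup>+z. ennreal (1 / 2) * emeasure lborel (dcell (lev m z) z) \<partial>count_space ?I)"
  proof (rule nn_integral_mono)
    fix z assume "z \<in> space (count_space ?I)"
    then have "z \<in> Om m" by (simp add: corners_def)
    then have "emeasure lborel (dcell (lev m z) z \<inter> Om (Suc m)) \<le> ennreal ((2 powi lev m z) ^ DIM('a) / 2)"
      using T unfolding sparse_tree_def by blast
    also have "... = ennreal (1 / 2) * emeasure lborel (dcell (lev m z) z)"
      by (simp only: emeasure_dcell) (subst ennreal_mult[symmetric], auto simp: less_imp_le)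
    finally show "emeasure lborel (dcell (lev m z) z \<inter> Om (Suc m)) \<le> ennreal (1 / 2) * emeasure lborel (dcell (lev m z) z)" .
  qed
  also have "... = ennreal (1 / 2) * (\<integral>\<^sup>+z. emeasure lborel (dcell (lev m z) z) \<partial>count_space ?I)"
    by (rule nn_integral_cmult) simp
  also have "(\<integral>\<^sup>+z. emeasure lborel (dcell (lev m z) z) \<partial>count_space ?I) = emeasure lborel ?S"
    by (subst (2) c(3)) (intro emeasure_UN_countable[symmetric] c(1,2), simp)
  also have "ennreal (1 / 2) * emeasure lborel ?S \<le> ennreal (1 / 2) * ennreal (?c * (1 / 2) ^ m)"
    using Suc.IH by (intro mult_left_mono) (simp_all add: Int_commute)
  also have "... = ennreal (?c * (1 / 2) ^ Suc m)"
    by (subst ennreal_mult[symmetric]) (auto simp: less_imp_le)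
  finally show ?case .
qed

lemma sparse_tree_null:
  fixes Om :: "nat \<Rightarrow> 'a::euclidean_space set"
  assumes T: "sparse_tree Om lev" and q: "\<And>m x. x \<in> Om m \<Longrightarrow> lev m x \<le> q"
  shows "AE x in lborel. \<exists>m. x \<notin> Om m"
proof -
  have B[measurable]: "Om m \<in> sets borel" for m using T by (rule sparse_treeD)
  let ?N = "\<Inter>m. Om m"
  have null: "C \<inter> ?N \<in> null_sets lborel" if C: "C \<in> range (dcell q)" for C
  proof -
    obtain x where x: "C = dcell q x" using C by blast
    let ?c = "(2 powi q :: real) ^ DIM('a)"
    have le: "emeasure lborel (C \<inter> ?N) \<le> ennreal (?c * (1 / 2) ^ m)" for m
    proof -
      have "emeasure lborel (C \<inter> ?N) \<le> emeasure lborel (dcell q x \<inter> Om m)"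
        unfolding x by (intro emeasure_mono) auto
      also have "... \<le> ennreal (?c * (1 / 2) ^ m)" by (rule sparse_tree_halves[OF T q])
      finally show ?thesis .
    qed
    have "(\<lambda>m. ennreal (?c * (1 / 2) ^ m)) \<longlonglongrightarrow> ennreal (?c * 0)"
      by (intro tendsto_ennrealI tendsto_mult tendsto_const LIMSEQ_power_zero) simp
    then have "emeasure lborel (C \<inter> ?N) \<le> ennreal (?c * 0)"
      by (rule LIMSEQ_le_const) (use le in auto)
    then show ?thesis unfolding x by (intro null_setsI) auto
  qed
  have "(\<Union>C\<in>range (dcell q). C \<inter> ?N) \<in> null_sets lborel"
    by (intro null_sets_UN' countable_dcells null)
  then show ?thesis
    by (rule AE_I') (auto intro: dcell_self)
qed

text \<open>
  Iterate the stopping step on the selected cubes. The remainder lives on generation \<open>m\<close>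
  of the tree, and almost every point belongs to finitely many generations, as their measures decay
  geometrically.
\<close>

theorem sparse_domination:
  assumes A: "0 < A"
  shows "\<exists>C0>0. \<forall>(k :: 'a::euclidean_space \<Rightarrow> real) f q. good_kernel A B k \<longrightarrow>
    (\<forall>j x. integrable lborel (on_triple f j x)) \<longrightarrow>
    (\<exists>Om lev. sparse_tree Om lev \<and>
      (AE x in lborel. max_trunc k (on_triple f q x) x
        \<le> (\<Sum>m. indicator (Om m) x * ennreal (C0 * triple_mean f (lev m x) x))))"
proof -
  let ?n = "DIM('a)"
  obtain C0 where C0: "0 < C0" and step: "\<forall>(k :: 'a::euclidean_space \<Rightarrow> real) f q x0. good_kernel A B k \<longrightarrow>
    (\<forall>j x. integrable lborel (on_triple f j x)) \<longrightarrow>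
    (\<exists>\<Omega> J. sparse_selection C0 k f q x0 \<Omega> J)"
    using sparse_step[OF A, of B, where 'a='a] by (elim exE conjE) (rule that)
  show ?thesis
  proof (intro exI[of _ C0] conjI C0 allI impI)
    fix k f :: "'a \<Rightarrow> real" and q :: int
    assume k: "good_kernel A B k" and loc: "\<forall>j x. integrable lborel (on_triple f j x)"
    define ok where "ok \<Omega> J j z \<longleftrightarrow> sparse_selection C0 k f j z \<Omega> J" for \<Omega> J j z
    have "\<exists>\<Omega> J. ok \<Omega> J j z" for j z
      using step[rule_format, OF k loc[rule_format], of j z] unfolding ok_def .
    then have ex: "\<exists>p. ok (fst p) (snd p) j z" for j z by fastforce
    define W where "W j z = fst (SOME p. ok (fst p) (snd p) j z)" for j z
    define L where "L j z = snd (SOME p. ok (fst p) (snd p) j z)" for j z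
    have ok: "ok (W j z) (L j z) j z" for j z
      unfolding W_def L_def using ex by (rule someI_ex)
    define st where "st = rec_nat (UNIV :: 'a set, \<lambda>_::'a. q)
      (\<lambda>_ p. ({x \<in> fst p. x \<in> W (snd p x) (dcorner (snd p x) x)}, \<lambda>x. L (snd p x) (dcorner (snd p x) x) x))"
    define Om where "Om m = fst (st m)" for m
    define lev where "lev m = snd (st m)" for m
    have Om0: "Om 0 = UNIV" "lev 0 = (\<lambda>_. q)" by (simp_all add: Om_def lev_def st_def)
    have OmS: "x \<in> Om (Suc m) \<longleftrightarrow> x \<in> Om m \<and> x \<in> W (lev m x) (dcorner (lev m x) x)"
      and levS: "lev (Suc m) x = L (lev m x) (dcorner (lev m x) x) x" for m x
      by (simp_all add: Om_def lev_def st_def)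
    have sat: "saturated (Om m) (lev m)" for m
    proof (induction m)
      case 0 show ?case by (simp add: Om0 saturated_def)
    next
      case (Suc m)
      have "y \<in> Om (Suc m) \<and> lev (Suc m) y = lev (Suc m) x"
        if x: "x \<in> Om (Suc m)" and y: "y \<in> dcell (lev (Suc m) x) x" for x y
      proof -
        define j where "j = lev m x"
        define z where "z = dcorner j x"
        have xm: "x \<in> Om m" and xW: "x \<in> W j z" using x by (auto simp: OmS j_def z_def)
        have e: "lev (Suc m) x = L j z x" by (simp add: levS j_def z_def)
        have okz: "W j z \<subseteq> dcell j z" "saturated (W j z) (L j z)" using ok[of j z] by (auto simp: ok_def sparse_selection_def)
        have "dcell (L j z x) x \<subseteq> W j z" "\<forall>v\<in>dcell (L j z x) x. L j z v = L j z x"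
          using okz(2) xW unfolding saturated_def by blast+
        then have yW: "y \<in> W j z" and Ly: "L j z y = L j z x" using y unfolding e by blast+
        have "dcell j z = dcell j x" unfolding z_def by (rule dcell_eq[OF dcorner_in])
        then have yx: "y \<in> dcell j x" using yW okz(1) by blast
        have "dcell (lev m x) x \<subseteq> Om m" "\<forall>v\<in>dcell (lev m x) x. lev m v = lev m x"
          using Suc.IH xm unfolding saturated_def by blast+
        then have ym: "y \<in> Om m" and yl: "lev m y = j" using yx unfolding j_def by blast+
        have yz: "dcorner j y = z" unfolding z_def by (rule dcorner_const[OF yx])
        have "y \<in> Om (Suc m)" unfolding OmS yl yz using ym yW by blast
        moreover have "lev (Suc m) y = lev (Suc m) x" unfolding e levS[of m y] yl yz by (rule Ly)
        ultimately show ?thesis by blast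
      qed
      then show ?case unfolding saturated_def by blast
    qed
    have cellx: "dcell (lev m x) (dcorner (lev m x) x) = dcell (lev m x) x" for m x
      by (rule dcell_eq[OF dcorner_in])
    have corn: "dcorner (lev m y) y = dcorner (lev m x) x" "lev m y = lev m x"
      if "x \<in> Om m" "y \<in> dcell (lev m x) x" for m x y
    proof -
      show "lev m y = lev m x" using sat that unfolding saturated_def by blast
      then show "dcorner (lev m y) y = dcorner (lev m x) x" using dcorner_const[OF that(2)] by simp
    qed
    have tree: "sparse_tree Om lev"
      unfolding sparse_tree_def
    proof (intro allI conjI ballI sat)
      show "Om (Suc m) \<subseteq> Om m" for m by (auto simp: OmS)
      fix m x assume x: "x \<in> Om m"
      let ?z = "dcorner (lev m x) x"
      have "dcell (lev m x) x \<inter> Om (Suc m) \<subseteq> W (lev m x) ?z"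
      proof
        fix y assume y: "y \<in> dcell (lev m x) x \<inter> Om (Suc m)"
        then have "y \<in> W (lev m y) (dcorner (lev m y) y)" by (simp add: OmS)
        then show "y \<in> W (lev m x) ?z" using corn[OF x, of y] y by simp
      qed
      moreover have "saturated (W (lev m x) ?z) (L (lev m x) ?z)" using ok by (simp add: ok_def sparse_selection_def)
      then have "W (lev m x) ?z \<in> sets borel" by (rule saturated_cells)
      ultimately have "emeasure lborel (dcell (lev m x) x \<inter> Om (Suc m)) \<le> emeasure lborel (W (lev m x) ?z)"
        by (intro emeasure_mono) auto
      also have "... \<le> ennreal ((2 powi lev m x) ^ ?n / 2)" using ok by (simp add: ok_def sparse_selection_def)
      finally show "emeasure lborel (dcell (lev m x) x \<inter> Om (Suc m)) \<le> ennreal ((2 powi lev m x) ^ ?n / 2)" .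
    qed
    have levq: "x \<in> Om m \<Longrightarrow> lev m x \<le> q" for m x
    proof (induction m)
      case (Suc m)
      then have "x \<in> W (lev m x) (dcorner (lev m x) x)" "lev m x \<le> q" by (auto simp: OmS)
      then show ?case using ok[of "lev m x" "dcorner (lev m x) x"] unfolding ok_def sparse_selection_def levS by force
    qed (simp add: Om0)
    define V where "V m x = max_trunc k (on_triple f (lev m x) x) x" for m x
    have triple_z: "on_triple f j (dcorner j x) = on_triple f j x" for j x
      using dtriple_eq[OF dcorner_in[of j x]] by (simp add: on_triple_def fun_eq_iff)
    have Vstep: "V m x \<le> ennreal (C0 * triple_mean f (lev m x) x) + (if x \<in> Om (Suc m) then V (Suc m) x else 0)"
      if x: "x \<in> Om m" for m x
    proof -
      let ?z = "dcorner (lev m x) x"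
      have "x \<in> dcell (lev m x) ?z" using cellx[of m x] by simp
      then have "max_trunc k (on_triple f (lev m x) ?z) x \<le> ennreal (C0 * triple_mean f (lev m x) ?z)
        + (if x \<in> W (lev m x) ?z then max_trunc k (on_triple f (L (lev m x) ?z x) x) x else 0)"
        using ok[of "lev m x" ?z] unfolding ok_def sparse_selection_def by blast
      then show ?thesis using x by (simp only: V_def OmS levS triple_z triple_mean_def simp_thms)
    qed
    have Vsum: "V 0 x \<le> (\<Sum>i<m. indicator (Om i) x * ennreal (C0 * triple_mean f (lev i x) x)) + (if x \<in> Om m then V m x else 0)" for m x
    proof (induction m)
      case (Suc m)
      show ?case
      proof (cases "x \<in> Om m")
        case True
        have "V 0 x \<le> (\<Sum>i<m. indicator (Om i) x * ennreal (C0 * triple_mean f (lev i x) x))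
            + (ennreal (C0 * triple_mean f (lev m x) x) + (if x \<in> Om (Suc m) then V (Suc m) x else 0))"
          using Suc.IH unfolding if_P[OF True] by (rule order_trans[OF _ add_left_mono[OF Vstep[OF True]]])
        then show ?thesis using True by (simp only: sum.lessThan_Suc indicator_simps mult_1 add.assoc)
      next
        case False
        then show ?thesis using Suc.IH by (simp add: OmS)
      qed
    qed (simp add: Om0)
    have "AE x in lborel. \<exists>m. x \<notin> Om m" using tree levq by (rule sparse_tree_null)
    then have "AE x in lborel. max_trunc k (on_triple f q x) x
        \<le> (\<Sum>m. indicator (Om m) x * ennreal (C0 * triple_mean f (lev m x) x))"
    proof eventually_elim
      fix x assume "\<exists>m. x \<notin> Om m"
      then obtain m where m: "x \<notin> Om m" ..
      have "V 0 x \<le> (\<Sum>i<m. indicator (Om i) x * ennreal (C0 * triple_mean f (lev i x) x))"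
        using Vsum[of x m] m by simp
      also have "... \<le> (\<Sum>i. indicator (Om i) x * ennreal (C0 * triple_mean f (lev i x) x))"
        by (rule sum_le_suminf) auto
      finally show "max_trunc k (on_triple f q x) x \<le> (\<Sum>m. indicator (Om m) x * ennreal (C0 * triple_mean f (lev m x) x))"
        by (simp add: V_def Om0)
    qed
    then show "\<exists>Om lev. sparse_tree Om lev \<and>
      (AE x in lborel. max_trunc k (on_triple f q x) x
        \<le> (\<Sum>m. indicator (Om m) x * ennreal (C0 * triple_mean f (lev m x) x)))"
      using tree by blast
  qed
qed

section \<open>Carleson embeddings\<close>

definition laminar :: "'i set \<Rightarrow> ('i \<Rightarrow> 'b set) \<Rightarrow> bool" where
  "laminar I P \<longleftrightarrow> (\<forall>i\<in>I. \<forall>j\<in>I. P i \<inter> P j = {} \<or> P i \<subseteq> P j \<or> P j \<subseteq> P i)"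

text \<open>The maximal members of the family are disjoint and have the same union.\<close>

lemma laminar_weak_type:
  fixes g :: "'b \<Rightarrow> ennreal"
  assumes I: "finite I" "laminar I P" and [measurable]: "g \<in> borel_measurable M"
    and P: "\<And>i. i \<in> I \<Longrightarrow> P i \<in> sets M" and c: "\<And>i. i \<in> I \<Longrightarrow> c * emeasure M (P i) \<le> (\<integral>\<^sup>+x\<in>P i. g x \<partial>M)"
  shows "c * emeasure M (\<Union>i\<in>I. P i) \<le> (\<integral>\<^sup>+x. g x \<partial>M)"
proof -
  define S where "S = {Q \<in> P ` I. \<forall>Q'\<in>P ` I. Q \<subseteq> Q' \<longrightarrow> Q = Q'}"
  have fS: "finite S" using I by (auto simp: S_def)
  have SP: "S \<subseteq> P ` I" by (auto simp: S_def)
  have U: "(\<Union>i\<in>I. P i) = \<Union>S"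
  proof
    show "(\<Union>i\<in>I. P i) \<subseteq> \<Union>S"
    proof
      fix x assume "x \<in> (\<Union>i\<in>I. P i)"
      then obtain i where i: "i \<in> I" "x \<in> P i" by blast
      obtain Q where "Q \<in> P ` I" "P i \<subseteq> Q" "\<forall>Q'\<in>P ` I. Q \<subseteq> Q' \<longrightarrow> Q = Q'"
        using finite_has_maximal2[of "P ` I" "P i"] I(1) i(1) by auto
      then show "x \<in> \<Union>S" using i by (auto simp: S_def)
    qed
  qed (use SP in auto)
  have dis: "disjoint_family_on (\<lambda>Q. Q) S"
    unfolding disjoint_family_on_def
  proof (intro ballI impI)
    fix Q Q' assume Q: "Q \<in> S" "Q' \<in> S" "Q \<noteq> Q'"
    then obtain i j where ij: "i \<in> I" "j \<in> I" "Q = P i" "Q' = P j" using SP by blast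
    then have "Q \<inter> Q' = {} \<or> Q \<subseteq> Q' \<or> Q' \<subseteq> Q" using I(2) unfolding laminar_def by blast
    then show "Q \<inter> Q' = {}" using Q unfolding S_def by blast
  qed
  have SM: "Q \<in> sets M" if "Q \<in> S" for Q using that SP P by blast
  have "c * emeasure M (\<Union>S) = c * (\<Sum>Q\<in>S. emeasure M Q)"
  proof -
    have "S \<subseteq> sets M" using SM by blast
    then show ?thesis using sum_emeasure[of "\<lambda>Q. Q" S M] dis fS by simp
  qed
  also have "... = (\<Sum>Q\<in>S. c * emeasure M Q)" by (simp add: sum_distrib_left)
  also have "... \<le> (\<Sum>Q\<in>S. \<integral>\<^sup>+x\<in>Q. g x \<partial>M)"
    using SP c by (intro sum_mono) blast
  also have "... = (\<integral>\<^sup>+Q. (\<integral>\<^sup>+x\<in>Q. g x \<partial>M) \<partial>count_space S)"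
    using fS by (simp add: nn_integral_count_space_finite)
  also have "... = (\<integral>\<^sup>+x\<in>(\<Union>Q\<in>S. Q). g x \<partial>M)"
    using fS SM by (intro nn_integral_disjoint_UN dis countable_finite) auto
  also have "... \<le> (\<integral>\<^sup>+x. g x \<partial>M)" by (intro nn_integral_mono) (auto simp: indicator_def)
  finally show ?thesis by (simp add: U)
qed

lemma nn_integral_powr_layer:
  assumes "0 \<le> a" "0 < t"
  shows "(\<integral>\<^sup>+u. ennreal (u powr (t - 1)) * indicator {0..a} u \<partial>lborel) = ennreal (a powr t / t)"
  using nn_integral_has_integral_lebesgue'[OF _ has_integral_powr_from_0[of "t - 1" a]] assms by simp

text \<open>
  The \<open>L\<^sup>s\<close> bound for the maximal function over a laminar family, in the form of a Carleson embedding: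
  only the part of \<open>h\<close> above half the level matters for the weak type inequality, and integrating the
  latter over all levels gives the claim.
\<close>

lemma Carleson_embedding:
  fixes h :: "'b \<Rightarrow> real"
  assumes M: "sigma_finite_measure M" and I: "finite I" "laminar I P"
    and P: "\<And>i. i \<in> I \<Longrightarrow> P i \<in> sets M" "\<And>i. i \<in> I \<Longrightarrow> emeasure M (P i) < \<infinity>"
    and E: "\<And>i. i \<in> I \<Longrightarrow> E i \<in> sets M" "\<And>i. i \<in> I \<Longrightarrow> E i \<subseteq> P i" "disjoint_family_on E I"
    and h[measurable]: "h \<in> borel_measurable M" and h0: "\<And>x. 0 \<le> h x" and a: "\<And>i. i \<in> I \<Longrightarrow> 0 \<le> a i"
    and mean: "\<And>i. i \<in> I \<Longrightarrow> ennreal (a i) * emeasure M (P i) \<le> (\<integral>\<^sup>+x\<in>P i. ennreal (h x) \<partial>M)"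
    and s: "1 < s"
  shows "(\<Sum>i\<in>I. ennreal (a i powr s) * emeasure M (E i)) \<le> ennreal (2 powr s * s / (s - 1)) * (\<integral>\<^sup>+x. ennreal (h x powr s) \<partial>M)"
proof -
  interpret pair_sigma_finite M "lborel :: real measure"
    using M by (intro pair_sigma_finite.intro sigma_finite_lborel)
  have level: "(\<Sum>i\<in>I. indicator {0..a i} u * emeasure M (E i)) \<le> ennreal (2 / u) * (\<integral>\<^sup>+x. ennreal (h x) * indicator {0..2 * h x} u \<partial>M)"
    if u: "0 < u" for u
  proof -
    define g where "g x = ennreal (h x) * indicator {0..2 * h x} u" for x
    have [measurable]: "g \<in> borel_measurable M"
      unfolding g_def indicator_def atLeastAtMost_iff by measurable
    define I' where "I' = {i\<in>I. u \<le> a i}"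
    have half: "ennreal (u / 2) * emeasure M (P i) \<le> (\<integral>\<^sup>+x\<in>P i. g x \<partial>M)" if i: "i \<in> I'" for i
    proof -
      note iI = i[unfolded I'_def, simplified]
      note [measurable] = P(1)[of i]
      define m where "m = measure M (P i)"
      have m: "emeasure M (P i) = ennreal m" "0 \<le> m"
        unfolding m_def using P(2)[of i] iI by (auto intro!: emeasure_eq_ennreal_measure)
      have "ennreal u * ennreal m \<le> ennreal (a i) * emeasure M (P i)"
        using iI m by (auto intro!: mult_right_mono ennreal_leI)
      also have "... \<le> (\<integral>\<^sup>+x\<in>P i. ennreal (h x) \<partial>M)" using iI mean by blast
      also have "... \<le> (\<integral>\<^sup>+x. g x * indicator (P i) x + ennreal (u / 2) * indicator (P i) x \<partial>M)"
        using h0 u by (intro nn_integral_mono) (auto simp: g_def indicator_def intro!: ennreal_leI)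
      also have "... = (\<integral>\<^sup>+x\<in>P i. g x \<partial>M) + ennreal (u / 2) * ennreal m"
        using iI P(1) m by (subst nn_integral_add) (auto simp: nn_integral_cmult_indicator)
      finally have le: "ennreal (u * m) \<le> (\<integral>\<^sup>+x\<in>P i. g x \<partial>M) + ennreal (u / 2 * m)"
        using u m by (simp only: ennreal_mult less_imp_le divide_nonneg_nonneg zero_le_numeral)
      show ?thesis
      proof (cases "(\<integral>\<^sup>+x\<in>P i. g x \<partial>M)")
        case (real v)
        then have "ennreal (u * m) \<le> ennreal v + ennreal (u / 2 * m)" using le by simp
        then have "u * m \<le> v + u / 2 * m" using real u m by (intro le_add_of_ennreal) auto
        then have "u / 2 * m \<le> v" by simp
        then have "ennreal (u / 2 * m) \<le> ennreal v" by (rule ennreal_leI)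
        then show ?thesis using real u m by (simp only: ennreal_mult less_imp_le divide_nonneg_nonneg zero_le_numeral)
      qed simp
    qed
    have lam: "laminar I' P" using I(2) by (auto simp: laminar_def I'_def)
    have fin: "finite I'" using I(1) by (simp add: I'_def)
    have "ennreal (u / 2) * (\<Sum>i\<in>I'. emeasure M (E i)) = ennreal (u / 2) * emeasure M (\<Union>i\<in>I'. E i)"
      using sum_emeasure[of E I' M] E fin disjoint_family_on_mono[of I' I E] by (auto simp: I'_def image_subset_iff)
    also have "... \<le> ennreal (u / 2) * emeasure M (\<Union>i\<in>I'. P i)"
      using E P fin by (intro mult_left_mono emeasure_mono) (auto simp: I'_def)
    also have "... \<le> (\<integral>\<^sup>+x. g x \<partial>M)"
      using P by (intro laminar_weak_type fin lam half) (auto simp: I'_def)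
    finally have le: "ennreal (u / 2) * (\<Sum>i\<in>I'. emeasure M (E i)) \<le> (\<integral>\<^sup>+x. g x \<partial>M)" .
    have "(\<Sum>i\<in>I. indicator {0..a i} u * emeasure M (E i)) = (\<Sum>i\<in>I'. emeasure M (E i))"
      unfolding I'_def using I(1) u by (intro sum.mono_neutral_cong_right) (auto simp: indicator_def)
    also have "... = ennreal (2 / u) * (ennreal (u / 2) * (\<Sum>i\<in>I'. emeasure M (E i)))"
      using u by (simp add: mult.assoc[symmetric] flip: ennreal_mult)
    also have "... \<le> ennreal (2 / u) * (\<integral>\<^sup>+x. g x \<partial>M)" by (intro mult_left_mono le) simp
    finally show ?thesis by (simp add: g_def)
  qed
  have "(\<Sum>i\<in>I. ennreal (a i powr s) * emeasure M (E i))
      = (\<Sum>i\<in>I. \<integral>\<^sup>+u. ennreal (s * u powr (s - 1)) * (indicator {0..a i} u * emeasure M (E i)) \<partial>lborel)"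
  proof (rule sum.cong)
    fix i assume i: "i \<in> I"
    have "(\<integral>\<^sup>+u. ennreal (s * u powr (s - 1)) * (indicator {0..a i} u * emeasure M (E i)) \<partial>lborel)
        = (\<integral>\<^sup>+u. (ennreal s * emeasure M (E i)) * (ennreal (u powr (s - 1)) * indicator {0..a i} u) \<partial>lborel)"
      using s by (intro nn_integral_cong) (simp add: ennreal_mult mult_ac)
    also have "... = (ennreal s * emeasure M (E i)) * ennreal (a i powr s / s)"
      using s a[OF i] by (subst nn_integral_cmult) (auto simp: nn_integral_powr_layer)
    also have "... = emeasure M (E i) * (ennreal s * ennreal (a i powr s / s))" by (simp add: mult_ac)
    also have "ennreal s * ennreal (a i powr s / s) = ennreal (a i powr s)"
      using s by (simp flip: ennreal_mult)
    finally show "ennreal (a i powr s) * emeasure M (E i)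
        = (\<integral>\<^sup>+u. ennreal (s * u powr (s - 1)) * (indicator {0..a i} u * emeasure M (E i)) \<partial>lborel)"
      by (simp add: mult.commute)
  qed simp
  also have "... = (\<integral>\<^sup>+u. (\<Sum>i\<in>I. ennreal (s * u powr (s - 1)) * (indicator {0..a i} u * emeasure M (E i))) \<partial>lborel)"
    by (rule nn_integral_sum[symmetric]) measurable
  also have "... \<le> (\<integral>\<^sup>+u. (\<integral>\<^sup>+x. ennreal (2 * s * h x) * (ennreal (u powr (s - 1 - 1)) * indicator {0..2 * h x} u) \<partial>M) \<partial>lborel)"
  proof (rule nn_integral_mono)
    fix u :: real
    show "(\<Sum>i\<in>I. ennreal (s * u powr (s - 1)) * (indicator {0..a i} u * emeasure M (E i)))
      \<le> (\<integral>\<^sup>+x. ennreal (2 * s * h x) * (ennreal (u powr (s - 1 - 1)) * indicator {0..2 * h x} u) \<partial>M)"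
    proof (cases "0 < u")
      case True
      have m: "(\<lambda>x. ennreal (h x) * indicator {0..2 * h x} u) \<in> borel_measurable M"
        unfolding indicator_def atLeastAtMost_iff by measurable
      have "(\<Sum>i\<in>I. ennreal (s * u powr (s - 1)) * (indicator {0..a i} u * emeasure M (E i)))
          \<le> ennreal (s * u powr (s - 1)) * (ennreal (2 / u) * (\<integral>\<^sup>+x. ennreal (h x) * indicator {0..2 * h x} u \<partial>M))"
        unfolding sum_distrib_left[symmetric] by (intro mult_left_mono level True) simp
      also have "... = ennreal (s * u powr (s - 1) * (2 / u)) * (\<integral>\<^sup>+x. ennreal (h x) * indicator {0..2 * h x} u \<partial>M)"
        using s True by (subst mult.assoc[symmetric], subst ennreal_mult[symmetric]) auto
      also have "s * u powr (s - 1) * (2 / u) = 2 * s * u powr (s - 1 - 1)"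
      proof -
        have "u powr (s - 1 - 1) = u powr (s - 1) / u" using powr_diff[of u "s - 1" 1] True by simp
        then show ?thesis by simp
      qed
      also have "ennreal (2 * s * u powr (s - 1 - 1)) * (\<integral>\<^sup>+x. ennreal (h x) * indicator {0..2 * h x} u \<partial>M)
          = (\<integral>\<^sup>+x. ennreal (2 * s * u powr (s - 1 - 1)) * (ennreal (h x) * indicator {0..2 * h x} u) \<partial>M)"
        by (rule nn_integral_cmult[symmetric, OF m])
      also have "... = (\<integral>\<^sup>+x. ennreal (2 * s * h x) * (ennreal (u powr (s - 1 - 1)) * indicator {0..2 * h x} u) \<partial>M)"
        using s h0 by (intro nn_integral_cong) (simp add: ennreal_mult mult_ac)
      finally show ?thesis .
    next
      case False
      then have z: "ennreal (s * u powr (s - 1)) * (indicator {0..a i} u * emeasure M (E i)) = 0" for i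
        by (cases "u = 0") (auto simp: indicator_def)
      show ?thesis by (subst sum.neutral) (use z in auto)
    qed
  qed
  also have "... = (\<integral>\<^sup>+x. (\<integral>\<^sup>+u. ennreal (2 * s * h x) * (ennreal (u powr (s - 1 - 1)) * indicator {0..2 * h x} u) \<partial>lborel) \<partial>M)"
    by (rule Fubini') (unfold indicator_def atLeastAtMost_iff, measurable)
  also have "... = (\<integral>\<^sup>+x. ennreal (2 powr s * s / (s - 1)) * ennreal (h x powr s) \<partial>M)"
  proof (rule nn_integral_cong)
    fix x
    have "(\<integral>\<^sup>+u. ennreal (2 * s * h x) * (ennreal (u powr (s - 1 - 1)) * indicator {0..2 * h x} u) \<partial>lborel)
        = ennreal (2 * s * h x) * ennreal ((2 * h x) powr (s - 1) / (s - 1))"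
    proof -
      have "(\<integral>\<^sup>+u. ennreal (u powr (s - 1 - 1)) * indicator {0..2 * h x} u \<partial>lborel) = ennreal ((2 * h x) powr (s - 1) / (s - 1))"
        using s h0[of x] by (intro nn_integral_powr_layer) auto
      then show ?thesis by (subst nn_integral_cmult) auto
    qed
    also have "... = ennreal (2 * s * h x * ((2 * h x) powr (s - 1) / (s - 1)))"
      using s h0[of x] by (intro ennreal_mult[symmetric]) auto
    also have "2 * s * h x * ((2 * h x) powr (s - 1) / (s - 1)) = 2 powr s * s / (s - 1) * h x powr s"
    proof (cases "h x = 0")
      case False
      then have "2 * h x * (2 * h x) powr (s - 1) = (2 * h x) powr s"
        using h0[of x] by (simp add: powr_diff)
      moreover have "(2 * h x) powr s = 2 powr s * h x powr s" using h0[of x] by (simp add: powr_mult)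
      ultimately have e: "2 * h x * (2 * h x) powr (s - 1) = 2 powr s * h x powr s" by simp
      have "2 * s * h x * ((2 * h x) powr (s - 1) / (s - 1)) = (2 * h x * (2 * h x) powr (s - 1)) * s / (s - 1)"
        by simp
      then show ?thesis unfolding e by simp
    qed simp
    also have "ennreal (2 powr s * s / (s - 1) * h x powr s) = ennreal (2 powr s * s / (s - 1)) * ennreal (h x powr s)"
      using s by (intro ennreal_mult) auto
    finally show "(\<integral>\<^sup>+u. ennreal (2 * s * h x) * (ennreal (u powr (s - 1 - 1)) * indicator {0..2 * h x} u) \<partial>lborel)
      = ennreal (2 powr s * s / (s - 1)) * ennreal (h x powr s)" .
  qed
  also have "... = ennreal (2 powr s * s / (s - 1)) * (\<integral>\<^sup>+x. ennreal (h x powr s) \<partial>M)"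
    by (rule nn_integral_cmult) measurable
  finally show ?thesis .
qed

text \<open>
  The triples of dyadic cubes split into \<open>3\<^sup>n\<close> laminar families. In one coordinate, the left end points
  of the triples of level \<open>j\<close> in one family are \<open>2\<^sup>j v\<close> with \<open>(-1)\<^sup>j v\<close> in a fixed residue class mod \<open>3\<close>;
  since \<open>2 \<equiv> -1\<close>, the end points of level \<open>j + 1\<close> are among those of level \<open>j\<close>.
\<close>

definition triple_class :: "int \<Rightarrow> 'a::euclidean_space \<Rightarrow> 'a \<Rightarrow> int" where
  "triple_class j x i = ((if even j then 1 else -1) * (cell_index j x i - 1)) mod 3"

lemma int_le_div_iff:
  fixes u t D :: int
  assumes "0 < D"
  shows "u \<le> t div D \<longleftrightarrow> u * D \<le> t"
proof
  assume "u \<le> t div D"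
  then have "u * D \<le> (t div D) * D" using assms by (intro mult_right_mono) auto
  also have "... \<le> t" using div_mult_mod_eq[of t D] pos_mod_sign[OF assms, of t] by linarith
  finally show "u * D \<le> t" .
next
  assume "u * D \<le> t"
  then have "(u * D) div D \<le> t div D" using assms by (intro zdiv_mono1)
  then show "u \<le> t div D" using assms by simp
qed

lemma triple_class_laminar:
  fixes x z :: "'a::euclidean_space"
  assumes c: "\<And>i. i \<in> Basis \<Longrightarrow> triple_class j x i = triple_class m z i" and jm: "j \<le> m"
    and ne: "dtriple j x \<inter> dtriple m z \<noteq> {}"
  shows "dtriple j x \<subseteq> dtriple m z"
proof
  fix y assume y: "y \<in> dtriple j x"
  obtain y0 where y0: "y0 \<in> dtriple j x" "y0 \<in> dtriple m z" using ne by blast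
  show "y \<in> dtriple m z"
    unfolding dtriple_def mem_Collect_eq
  proof
    fix i :: 'a assume i: "i \<in> Basis"
    define d where "d = nat (m - j)"
    define D where "D = (2::int) ^ d"
    have D: "1 \<le> D" by (simp add: D_def)
    define u v where "u = cell_index m z i - 1" and "v = cell_index j x i - 1"
    define t t0 where "t = cell_index j y i" and "t0 = cell_index j y0 i"
    have cm: "cell_index m q i = cell_index j q i div D" for q
      using cell_index_coarser[OF jm] by (simp add: D_def d_def)
    have m: "m = j + int d" using jm by (simp add: d_def)
    have D3: "3 dvd (D - (if even d then 1 else -1))"
      unfolding D_def
    proof (induction d)
      case (Suc d)
      have "2 ^ Suc d - (if even (Suc d) then 1 else - 1 :: int) = 2 * (2 ^ d - (if even d then 1 else -1)) + 3 * (if even d then 1 else -1)"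
        by auto
      also have "3 dvd ..." by (intro dvd_add dvd_mult Suc.IH dvd_triv_left)
      finally show ?case .
    qed simp
    have "3 dvd ((if even j then 1 else -1) * v - (if even m then 1 else -1) * u)"
      using c[OF i] unfolding triple_class_def u_def v_def by (simp only: mod_eq_dvd_iff)
    then have "3 dvd (D * u - v)"
    proof -
      assume *: "3 dvd ((if even j then 1 else -1) * v - (if even m then 1 else -1) * u)"
      have "D * u - v = (D - (if even d then 1 else -1)) * u
         - (if even j then 1 else -1) * ((if even j then 1 else -1) * v - (if even m then 1 else -1) * u)"
        by (auto simp: m algebra_simps)
      also have "3 dvd ..." by (intro dvd_diff dvd_mult2 D3 dvd_mult *)
      finally show ?thesis .
    qed
    then obtain a where a: "D * u = v + 3 * a" by (metis add.commute diff_add_cancel dvd_def)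
    have tv: "v \<le> t" "t \<le> v + 2" "v \<le> t0" "t0 \<le> v + 2"
      using y y0 i by (auto simp: dtriple_def t_def t0_def v_def abs_le_iff)
    have "u \<le> t0 div D" "t0 div D \<le> u + 2"
      using y0(2) i by (auto simp: dtriple_def cm t0_def u_def abs_le_iff)
    then have 1: "D * u \<le> t0" and 2: "t0 < D * (u + 3)"
      using int_le_div_iff[of D u t0] int_le_div_iff[of D "u + 3" t0] D by (simp_all add: mult.commute)
    have "a \<le> 0" using 1 a tv by linarith
    moreover have "0 < a + D" using 2 a tv by (simp add: distrib_left)
    ultimately have 3: "D * u \<le> t" "t < D * (u + 3)" using a tv by (auto simp: distrib_left)
    have "u \<le> t div D" "t div D < u + 3"
      using 3 int_le_div_iff[of D u t] int_le_div_iff[of D "u + 3" t] D by (simp_all add: mult.commute)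
    then show "\<bar>cell_index m y i - cell_index m z i\<bar> \<le> 1"
      by (simp add: cm t_def[symmetric] u_def)
  qed
qed

section \<open>The estimate for one cube\<close>

text \<open>
  Jensen's inequality for the geometric mean: if \<open>\<Prod> u\<^sub>i\<^sup>t\<^sup>i = 1\<close> pointwise, then the same product of the
  means of the \<open>u\<^sub>i\<close> is at least \<open>1\<close>. Integrate \<open>ln (u\<^sub>i / m\<^sub>i) \<le> u\<^sub>i / m\<^sub>i - 1\<close>.
\<close>

lemma product_of_means:
  fixes u :: "'i \<Rightarrow> 'b \<Rightarrow> real"
  assumes I: "finite I" and E: "E \<in> sets M" "emeasure M E < \<infinity>" "0 < measure M E"
    and u: "\<And>i x. i \<in> I \<Longrightarrow> 0 < u i x" "\<And>i. i \<in> I \<Longrightarrow> integrable M (\<lambda>x. indicator E x * u i x)"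
    and t: "\<And>i. i \<in> I \<Longrightarrow> 0 \<le> t i" and one: "\<And>x. (\<Sum>i\<in>I. t i * ln (u i x)) = 0"
  shows "0 \<le> (\<Sum>i\<in>I. t i * ln ((\<integral>x. indicator E x * u i x \<partial>M) / measure M E))"
    and "\<And>i. i \<in> I \<Longrightarrow> 0 < (\<integral>x. indicator E x * u i x \<partial>M)"
proof -
  have iE: "integrable M (indicat_real E)" using E by (intro integrable_real_indicator) (auto simp: less_top)
  define m where "m i = (\<integral>x. indicator E x * u i x \<partial>M) / measure M E" for i
  show pos: "0 < (\<integral>x. indicator E x * u i x \<partial>M)" if i: "i \<in> I" for i
  proof -
    have "0 \<le> (\<integral>x. indicator E x * u i x \<partial>M)"
      using u(1)[OF i] by (intro integral_nonneg_AE) (auto simp: less_imp_le)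
    moreover have "(\<integral>x. indicator E x * u i x \<partial>M) \<noteq> 0"
    proof
      assume "(\<integral>x. indicator E x * u i x \<partial>M) = 0"
      then have "AE x in M. indicator E x * u i x = 0"
        using u(1)[OF i] by (subst (asm) integral_nonneg_eq_0_iff_AE[OF u(2)[OF i]]) (auto simp: less_imp_le)
      then have "AE x in M. x \<notin> E"
      proof eventually_elim
        fix x assume "indicator E x * u i x = 0"
        then show "x \<notin> E" using u(1)[OF i, of x] by (auto simp: indicator_def)
      qed
      then have "E \<in> null_sets M" using E(1) by (subst AE_iff_null_sets) auto
      then show False using E(3) by (simp add: null_setsD1 measure_def)
    qed
    ultimately show ?thesis by simp
  qed
  have m: "0 < m i" if "i \<in> I" for i using pos[OF that] E(3) by (simp add: m_def)
  have pt: "0 \<le> (\<Sum>i\<in>I. t i * ln (m i)) + (\<Sum>i\<in>I. t i * (u i x / m i - 1))" for x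
  proof -
    have "0 = (\<Sum>i\<in>I. t i * ln (m i)) + (\<Sum>i\<in>I. t i * ln (u i x / m i))"
      unfolding sum.distrib[symmetric] one[of x, symmetric]
    proof (rule sum.cong)
      fix i assume i: "i \<in> I"
      have e: "ln (u i x) = ln (m i) + ln (u i x / m i)" using u(1)[OF i, of x] m[OF i] by (simp add: ln_div)
      show "t i * ln (u i x) = t i * ln (m i) + t i * ln (u i x / m i)" by (subst e) (rule distrib_left)
    qed simp
    also have "(\<Sum>i\<in>I. t i * ln (u i x / m i)) \<le> (\<Sum>i\<in>I. t i * (u i x / m i - 1))"
      using u(1) m t by (intro sum_mono mult_left_mono ln_le_minus_one divide_pos_pos)
    finally show ?thesis by simp
  qed
  have "0 \<le> (\<integral>x. indicator E x * ((\<Sum>i\<in>I. t i * ln (m i)) + (\<Sum>i\<in>I. t i * (u i x / m i - 1))) \<partial>M)"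
    using pt by (intro integral_nonneg_AE) auto
  also have "... = (\<integral>x. (\<Sum>i\<in>I. t i * ln (m i)) * indicator E x
      + (\<Sum>i\<in>I. (t i / m i) * (indicator E x * u i x) - t i * indicator E x) \<partial>M)"
    by (intro Bochner_Integration.integral_cong) (auto simp: algebra_simps sum_distrib_left)
  also have "... = (\<Sum>i\<in>I. t i * ln (m i)) * measure M E + (\<Sum>i\<in>I. (t i / m i) * (\<integral>x. indicator E x * u i x \<partial>M) - t i * measure M E)"
    using iE u(2) E(1) sets.sets_into_space[OF E(1)]
    by (simp add: Bochner_Integration.integral_sum Bochner_Integration.integrable_sum inf.absorb1)
  also have "(\<Sum>i\<in>I. (t i / m i) * (\<integral>x. indicator E x * u i x \<partial>M) - t i * measure M E) = 0"
  proof (intro sum.neutral ballI)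
    fix i assume i: "i \<in> I"
    have "(\<integral>x. indicator E x * u i x \<partial>M) = m i * measure M E" using E(3) by (simp add: m_def)
    then show "(t i / m i) * (\<integral>x. indicator E x * u i x \<partial>M) - t i * measure M E = 0" using m[OF i] by simp
  qed
  finally have "0 \<le> (\<Sum>i\<in>I. t i * ln (m i)) * measure M E" by simp
  then show "0 \<le> (\<Sum>i\<in>I. t i * ln ((\<integral>x. indicator E x * u i x \<partial>M) / measure M E))"
    using E(3) by (simp add: m_def zero_le_mult_iff)
qed

definition mass :: "('a::euclidean_space \<Rightarrow> real) \<Rightarrow> 'a set \<Rightarrow> real" where
  "mass w Q = (\<integral>x. indicator Q x * w x \<partial>lborel)"

text \<open>
  The estimate for one cube, where both \<open>A\<^sub>p\<close> and \<open>A\<^sub>r\<close> enter. With the averages \<open>W\<close>, \<open>S\<close>, \<open>R\<close> of \<open>w\<close>,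
  \<open>w\<^bsup>-1/(p-1)\<^esup>\<close> and \<open>w\<^bsup>-1/(r-1)\<^esup>\<close> over \<open>P\<close>, the constant is \<open>A\<^sub>p\<^bsup>1/(p-1)\<^esup> A\<^sub>r\<^bsup>1-1/(p-1)\<^esup> = W S R\<^sup>g\<close>.
  It bounds the left-hand side by \<open>R\<^bsup>-g\<^esup>\<close>, and the passage from \<open>P\<close> to its ample subset \<open>E\<close> only
  involves negative powers; the exponents are such that the geometric mean of \<open>w\<close> cancels on \<open>E\<close>.
\<close>

lemma one_cube_estimate:
  fixes w :: "'a::euclidean_space \<Rightarrow> real"
  assumes p: "2 \<le> p" "p \<le> r" and w: "\<And>x. 0 < w x"
    and P: "P \<in> sets borel" "emeasure lborel P < \<infinity>" and E: "E \<in> sets borel" "E \<subseteq> P" "0 < measure lborel E"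
    and \<kappa>: "measure lborel P \<le> \<kappa> * measure lborel E"
    and i: "integrable lborel (\<lambda>x. indicator P x * w x)"
      "integrable lborel (\<lambda>x. indicator P x * w x powr (- (1 / (p - 1))))"
      "integrable lborel (\<lambda>x. indicator P x * w x powr (- (1 / (r - 1))))"
    and g: "g = (r - 1) * (1 - 1 / (p - 1))"
    and C: "mass w P / measure lborel P * (mass (\<lambda>x. w x powr (- (1 / (p - 1)))) P / measure lborel P)
      * (mass (\<lambda>x. w x powr (- (1 / (r - 1)))) P / measure lborel P) powr g \<le> C"
  shows "mass w P * mass (\<lambda>x. w x powr (- (1 / (p - 1)))) P / measure lborel P
    \<le> C * \<kappa> powr (1 + g) * (mass w E powr (1 - 1 / p) * mass (\<lambda>x. w x powr (- (1 / (p - 1)))) E powr (1 / p))"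
proof -
  define \<sigma> where "\<sigma> x = w x powr (- (1 / (p - 1)))" for x
  define \<rho> where "\<rho> x = w x powr (- (1 / (r - 1)))" for x
  have \<sigma>: "0 < \<sigma> x" and \<rho>: "0 < \<rho> x" for x using w[of x] by (simp_all add: \<sigma>_def \<rho>_def)
  note C = C[folded \<sigma>_def \<rho>_def]
  have iP: "integrable lborel (\<lambda>x. indicator P x * w x)" "integrable lborel (\<lambda>x. indicator P x * \<sigma> x)"
    "integrable lborel (\<lambda>x. indicator P x * \<rho> x)" using i by (simp_all only: \<sigma>_def \<rho>_def)
  have iE: "integrable lborel (\<lambda>x. indicator E x * v x)" if "integrable lborel (\<lambda>x. indicator P x * v x)" for v :: "'a \<Rightarrow> real"
  proof -
    have "integrable lborel (\<lambda>x. indicator E x *\<^sub>R (indicator P x * v x))"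
      using E by (intro integrable_mult_indicator that) auto
    moreover have "(\<lambda>x. indicator E x *\<^sub>R (indicator P x * v x)) = (\<lambda>x. indicator E x * v x)"
      using E(2) by (auto simp: indicator_def fun_eq_iff)
    ultimately show ?thesis by (simp only:)
  qed
  have mono: "mass v E \<le> mass v P" if "integrable lborel (\<lambda>x. indicator P x * v x)" "\<And>x. 0 < v x" for v
    unfolding mass_def using E(2) that by (intro integral_mono iE) (auto simp: indicator_def less_imp_le)
  define e where "e = measure lborel E"
  define m where "m = measure lborel P"
  have e: "0 < e" using E by (simp add: e_def)
  have finE: "emeasure lborel E < \<infinity>" using E P by (metis emeasure_mono le_less_trans sets_lborel)
  have em: "e \<le> m" unfolding e_def m_def using E P by (intro measure_mono_fmeasurable) (auto simp: fmeasurable_def)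
  have m: "0 < m" using e em by simp
  have \<kappa>0: "1 \<le> \<kappa>" "m \<le> \<kappa> * e"
  proof -
    show "m \<le> \<kappa> * e" using \<kappa> by (simp add: m_def e_def)
    then have "1 * e \<le> \<kappa> * e" using em by simp
    then show "1 \<le> \<kappa>" using e by simp
  qed
  have p1: "0 < p - 1" and r1: "0 < r - 1" using p by auto
  have g0: "0 \<le> g" unfolding g using p by (intro mult_nonneg_nonneg) auto
  define I where "I = {0, 1, 2::nat}"
  define u where "u = (\<lambda>k::nat. if k = 0 then w else if k = 1 then \<sigma> else \<rho>)"
  define t where "t = (\<lambda>k::nat. if k = 0 then 1 - 1 / p else if k = 1 then 1 / p else g)"
  have one: "(\<Sum>k\<in>I. t k * ln (u k x)) = 0" for x
    proof -
      have "(\<Sum>k\<in>I. t k * ln (u k x)) = ((1 - 1 / p) - 1 / p * (1 / (p - 1)) - g * (1 / (r - 1))) * ln (w x)"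
        using w[of x] by (simp add: I_def t_def u_def algebra_simps) (simp add: \<sigma>_def \<rho>_def algebra_simps)
      also have "(1 - 1 / p) - 1 / p * (1 / (p - 1)) - g * (1 / (r - 1)) = 0"
      proof -
        have "g * (1 / (r - 1)) = 1 - 1 / (p - 1)" using r1 by (simp add: g)
        moreover have "1 / p * (1 / (p - 1)) = 1 / (p - 1) - 1 / p" using p1 p by (simp add: field_simps)
        ultimately show ?thesis by simp
      qed
      finally show ?thesis by simp
    qed
  have finI: "finite I" by (simp add: I_def)
  have EM: "E \<in> sets lborel" using E by simp
  have upos: "0 < u k x" if "k \<in> I" for k x using w \<sigma> \<rho> by (simp add: u_def)
  have uint: "integrable lborel (\<lambda>x. indicator E x * u k x)" if "k \<in> I" for k
    using iE[OF iP(1)] iE[OF iP(2)] iE[OF iP(3)] by (simp add: u_def)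
  have tnn: "0 \<le> t k" if "k \<in> I" for k using g0 p by (simp add: t_def)
  note pm = product_of_means[of I E lborel u t, OF finI EM finE E(3) upos uint tnn one]
  have J: "0 \<le> (\<Sum>k\<in>I. t k * ln ((\<integral>x. indicator E x * u k x \<partial>lborel) / measure lborel E))"
    by (rule pm(1))
  have posE: "0 < (\<integral>x. indicator E x * u k x \<partial>lborel)" if "k \<in> I" for k
    using product_of_means(2)[where I=I and E=E and M=lborel and u=u and t=t, OF finI EM finE E(3)] upos uint tnn one that by blast
  have pE: "0 < mass w E" "0 < mass \<sigma> E" "0 < mass \<rho> E"
    using posE[of 0] posE[of 1] posE[of 2] by (auto simp: I_def u_def mass_def)
  have "0 \<le> (1 - 1 / p) * ln (mass w E / e) + 1 / p * ln (mass \<sigma> E / e) + g * ln (mass \<rho> E / e)"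
    using J by (simp add: I_def u_def t_def mass_def e_def)
  also have "... = ln ((mass w E / e) powr (1 - 1 / p) * (mass \<sigma> E / e) powr (1 / p) * (mass \<rho> E / e) powr g)"
    using pE e by (simp add: ln_mult ln_powr)
  finally have "1 \<le> (mass w E / e) powr (1 - 1 / p) * (mass \<sigma> E / e) powr (1 / p) * (mass \<rho> E / e) powr g"
    using pE e by (subst (asm) ln_ge_zero_iff) auto
  also have "... = (mass w E powr (1 - 1 / p) * mass \<sigma> E powr (1 / p)) / e * (mass \<rho> E / e) powr g"
  proof -
    have "e powr (1 - 1 / p) * e powr (1 / p) = e" using e by (simp flip: powr_add)
    then show ?thesis using pE e by (simp add: powr_divide)
  qed
  finally have main: "e \<le> (mass w E powr (1 - 1 / p) * mass \<sigma> E powr (1 / p)) * (mass \<rho> E / e) powr g"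
    using e by (simp add: field_simps)
  define Z where "Z = mass w E powr (1 - 1 / p) * mass \<sigma> E powr (1 / p)"
  have Z: "0 < Z" using pE by (simp add: Z_def)
  define R where "R = mass \<rho> P / m"
  have R: "mass \<rho> E / e / \<kappa> \<le> R"
  proof -
    have "mass \<rho> E / e / \<kappa> = mass \<rho> E / (\<kappa> * e)" by (simp add: mult.commute)
    also have "... \<le> mass \<rho> P / m"
      using mono[OF iP(3) \<rho>] pE \<kappa>0 m e by (intro frac_le) auto
    finally show ?thesis by (simp add: R_def)
  qed
  have R0: "0 < R" using R pE e \<kappa>0 by (smt (verit) divide_pos_pos)
  have eR: "e \<le> Z * (\<kappa> powr g * R powr g)"
  proof -
    have "0 < \<kappa>" using \<kappa>0 by simp
    then have "mass \<rho> E / e \<le> R * \<kappa>" using R by (simp only: pos_divide_le_eq)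
    then have "mass \<rho> E / e \<le> \<kappa> * R" by (simp only: mult.commute)
    then have "(mass \<rho> E / e) powr g \<le> (\<kappa> * R) powr g" using g0 pE e by (intro powr_mono2) auto
    also have "... = \<kappa> powr g * R powr g" using \<kappa>0 R0 by (simp add: powr_mult)
    finally have "Z * (mass \<rho> E / e) powr g \<le> Z * (\<kappa> powr g * R powr g)" using Z by (intro mult_left_mono) auto
    then show ?thesis using main unfolding Z_def[symmetric] by (rule order_trans[rotated])
  qed
  have "mass w P * mass \<sigma> P / m * R powr g = m * (mass w P / m * (mass \<sigma> P / m) * R powr g)"
    using m by (simp add: field_simps)
  also have "... \<le> m * C" using C m by (intro mult_left_mono) (auto simp: R_def m_def)
  finally have 1: "mass w P * mass \<sigma> P / m * R powr g \<le> m * C" .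
  have C0: "0 \<le> C"
  proof -
    have "0 \<le> mass w P / m * (mass \<sigma> P / m) * R powr g"
      using mono[OF iP(1) w] mono[OF iP(2) \<sigma>] pE m by (intro mult_nonneg_nonneg divide_nonneg_nonneg) auto
    then show ?thesis using C by (simp add: R_def m_def)
  qed
  have "mass w P * mass \<sigma> P / m * R powr g \<le> (\<kappa> * e) * C"
    by (rule order_trans[OF 1 mult_right_mono[OF \<kappa>0(2) C0]])
  also have "... \<le> (\<kappa> * (Z * (\<kappa> powr g * R powr g))) * C"
    using eR \<kappa>0 C0 by (intro mult_right_mono mult_left_mono) auto
  also have "... = (C * \<kappa> powr (1 + g) * Z) * R powr g"
    using \<kappa>0 by (simp add: powr_add mult_ac)
  finally have "mass w P * mass \<sigma> P / m \<le> C * \<kappa> powr (1 + g) * Z"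
    by (rule mult_right_le_imp_le) (use R0 in simp)
  then show ?thesis by (simp only: Z_def m_def \<sigma>_def[abs_def])
qed

lemma Holder_sum:
  fixes a b :: "'i \<Rightarrow> real"
  assumes p: "1 < p" and a: "\<And>i. i \<in> I \<Longrightarrow> 0 \<le> a i" and b: "\<And>i. i \<in> I \<Longrightarrow> 0 \<le> b i"
    and A: "(\<Sum>i\<in>I. a i powr p) \<le> A" and B: "(\<Sum>i\<in>I. b i powr (p / (p - 1))) \<le> B" and pos: "0 < A" "0 < B"
  shows "(\<Sum>i\<in>I. a i * b i) \<le> A powr (1 / p) * B powr (1 - 1 / p)"
proof -
  define q where "q = p / (p - 1)"
  have q: "1 < q" "1 / p + 1 / q = 1" "1 / q = 1 - 1 / p" using p by (auto simp: q_def field_simps)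
  define \<alpha> \<beta> where "\<alpha> = A powr (1 / p)" and "\<beta> = B powr (1 - 1 / p)"
  have \<alpha>\<beta>: "0 < \<alpha>" "0 < \<beta>" using pos by (auto simp: \<alpha>_def \<beta>_def)
  have e: "\<alpha> powr p = A" "\<beta> powr q = B"
  proof -
    have "(1 - 1 / p) * q = 1" unfolding q(3)[symmetric] using q(1) by simp
    then show "\<alpha> powr p = A" "\<beta> powr q = B" using p pos by (simp_all add: \<alpha>_def \<beta>_def powr_powr)
  qed
  have "(\<Sum>i\<in>I. (a i / \<alpha>) * (b i / \<beta>)) \<le> (\<Sum>i\<in>I. (a i / \<alpha>) powr p / p + (b i / \<beta>) powr q / q)"
    using a b \<alpha>\<beta> p q by (intro sum_mono Youngs_inequality) auto
  also have "... = (\<Sum>i\<in>I. a i powr p / A / p + b i powr q / B / q)"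
    using a b \<alpha>\<beta> by (intro sum.cong) (auto simp: powr_divide e less_imp_le)
  also have "... = (\<Sum>i\<in>I. a i powr p) / A / p + (\<Sum>i\<in>I. b i powr q) / B / q"
    by (simp add: sum.distrib sum_divide_distrib)
  also have "... \<le> 1 / p + 1 / q"
    using A B pos p q by (intro add_mono divide_right_mono) (auto simp: q_def)
  finally have "(\<Sum>i\<in>I. (a i * b i) / (\<alpha> * \<beta>)) \<le> 1" using q by simp
  then have "(\<Sum>i\<in>I. a i * b i) / (\<alpha> * \<beta>) \<le> 1" by (simp only: sum_divide_distrib)
  then show ?thesis using \<alpha>\<beta> by (simp add: \<alpha>_def \<beta>_def pos_divide_le_eq)
qed

section \<open>The sparse operator on weighted spaces\<close>

lemma emeasure_density_mass:
  fixes v :: "'a::euclidean_space \<Rightarrow> real"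
  assumes [measurable]: "v \<in> borel_measurable borel" "Q \<in> sets borel" and v: "\<And>x. 0 \<le> v x"
    and i: "integrable lborel (\<lambda>x. indicator Q x * v x)"
  shows "emeasure (density lborel (\<lambda>x. ennreal (v x))) Q = ennreal (mass v Q)"
proof -
  have "emeasure (density lborel (\<lambda>x. ennreal (v x))) Q = (\<integral>\<^sup>+x. ennreal (indicator Q x * v x) \<partial>lborel)"
    by (subst emeasure_density) (auto intro!: nn_integral_cong simp: indicator_def)
  then show ?thesis using i v by (simp add: mass_def nn_integral_eq_integral)
qed

lemma sigma_finite_density_real:
  fixes v :: "'a::euclidean_space \<Rightarrow> real"
  assumes "v \<in> borel_measurable borel"
  shows "sigma_finite_measure (density lborel (\<lambda>x. ennreal (v x)))"
  using assms by (subst sigma_finite_measure.sigma_finite_iff_density_finite[OF sigma_finite_lborel]) auto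

lemma Carleson_embedding_weight:
  fixes v :: "'a::euclidean_space \<Rightarrow> real"
  assumes I: "finite I" "laminar I P" and [measurable]: "v \<in> borel_measurable borel" and v: "\<And>x. 0 \<le> v x"
    and P: "\<And>i. i \<in> I \<Longrightarrow> P i \<in> sets borel" "\<And>i. i \<in> I \<Longrightarrow> integrable lborel (\<lambda>x. indicator (P i) x * v x)"
    and E: "\<And>i. i \<in> I \<Longrightarrow> E i \<in> sets borel" "\<And>i. i \<in> I \<Longrightarrow> E i \<subseteq> P i" "disjoint_family_on E I"
    and [measurable]: "h \<in> borel_measurable borel" and h: "\<And>x. 0 \<le> h x" and a: "\<And>i. i \<in> I \<Longrightarrow> 0 \<le> a i"
    and mean: "\<And>i. i \<in> I \<Longrightarrow> ennreal (a i * mass v (P i)) \<le> (\<integral>\<^sup>+x\<in>P i. ennreal (h x * v x) \<partial>lborel)"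
    and s: "1 < s"
  shows "(\<Sum>i\<in>I. ennreal (a i powr s * mass v (E i)))
    \<le> ennreal (2 powr s * s / (s - 1)) * (\<integral>\<^sup>+x. ennreal (h x powr s * v x) \<partial>lborel)"
proof -
  let ?M = "density lborel (\<lambda>x. ennreal (v x))"
  have mass0: "0 \<le> mass v B" for B unfolding mass_def using v by (intro integral_nonneg_AE) auto
  have iE: "integrable lborel (\<lambda>x. indicator (E i) x * v x)" if iI: "i \<in> I" for i
  proof -
    have "integrable lborel (\<lambda>x. indicator (E i) x *\<^sub>R (indicator (P i) x * v x))"
      using E(1)[OF iI] by (intro integrable_mult_indicator P iI) auto
    moreover have "(\<lambda>x. indicator (E i) x *\<^sub>R (indicator (P i) x * v x)) = (\<lambda>x. indicator (E i) x * v x)"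
      using E(2)[OF iI] by (auto simp: indicator_def fun_eq_iff)
    ultimately show ?thesis by (simp only:)
  qed
  have "(\<Sum>i\<in>I. ennreal (a i powr s * mass v (E i))) = (\<Sum>i\<in>I. ennreal (a i powr s) * emeasure ?M (E i))"
  proof (rule sum.cong)
    fix i assume i: "i \<in> I"
    show "ennreal (a i powr s * mass v (E i)) = ennreal (a i powr s) * emeasure ?M (E i)"
      using emeasure_density_mass[OF _ E(1)[OF i] v iE[OF i]] mass0 by (simp add: ennreal_mult)
  qed simp
  also have "... \<le> ennreal (2 powr s * s / (s - 1)) * (\<integral>\<^sup>+x. ennreal (h x powr s) \<partial>?M)"
  proof (rule Carleson_embedding[where P=P])
    show "sigma_finite_measure ?M" by (rule sigma_finite_density_real) simp
    show "emeasure ?M (P k) < \<infinity>" if "k \<in> I" for k using emeasure_density_mass[OF _ P(1)[OF that] v P(2)[OF that]] by simp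
    show "ennreal (a k) * emeasure ?M (P k) \<le> (\<integral>\<^sup>+x\<in>P k. ennreal (h x) \<partial>?M)" if k: "k \<in> I" for k
    proof -
      have [measurable]: "P k \<in> sets borel" by (rule P(1)[OF k])
      have "ennreal (a k) * emeasure ?M (P k) = ennreal (a k * mass v (P k))"
        using emeasure_density_mass[OF _ P(1)[OF k] v P(2)[OF k]] a[OF k] mass0 by (simp add: ennreal_mult)
      also have "... \<le> (\<integral>\<^sup>+x\<in>P k. ennreal (h x * v x) \<partial>lborel)" by (rule mean[OF k])
      also have "... = (\<integral>\<^sup>+x\<in>P k. ennreal (h x) \<partial>?M)"
        using h v by (subst nn_integral_density) (auto intro!: nn_integral_cong simp: ennreal_mult mult_ac)
      finally show ?thesis .
    qed
  qed (use I E P h a s in auto)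
  also have "(\<integral>\<^sup>+x. ennreal (h x powr s) \<partial>?M) = (\<integral>\<^sup>+x. ennreal (h x powr s * v x) \<partial>lborel)"
    using v by (subst nn_integral_density) (auto intro!: nn_integral_cong simp: ennreal_mult mult_ac)
  finally show ?thesis .
qed

lemma Carleson_embedding_cells:
  fixes v :: "'a::euclidean_space \<Rightarrow> real" and lv :: "'i \<Rightarrow> int" and pt :: "'i \<Rightarrow> 'a"
  assumes I: "finite I" and v: "v \<in> borel_measurable borel" "\<And>x. 0 \<le> v x"
    and i: "\<And>j z. integrable lborel (\<lambda>x. indicator (dcell j z) x * v x)"
    and E: "\<And>i. i \<in> I \<Longrightarrow> E i \<in> sets borel" "\<And>i. i \<in> I \<Longrightarrow> E i \<subseteq> dcell (lv i) (pt i)" "disjoint_family_on E I"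
    and h: "h \<in> borel_measurable borel" "\<And>x. 0 \<le> h x" and a: "\<And>i. i \<in> I \<Longrightarrow> 0 \<le> a i"
    and mean: "\<And>i. i \<in> I \<Longrightarrow> ennreal (a i * mass v (dcell (lv i) (pt i))) \<le> (\<integral>\<^sup>+x\<in>dcell (lv i) (pt i). ennreal (h x * v x) \<partial>lborel)"
    and s: "1 < s"
  shows "(\<Sum>i\<in>I. ennreal (a i powr s * mass v (E i)))
    \<le> ennreal (2 powr s * s / (s - 1)) * (\<integral>\<^sup>+x. ennreal (h x powr s * v x) \<partial>lborel)"
proof (rule Carleson_embedding_weight[where P="\<lambda>i. dcell (lv i) (pt i)"])
  show "laminar I (\<lambda>i. dcell (lv i) (pt i))"
    unfolding laminar_def
  proof (intro ballI)
    fix i j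
    show "dcell (lv i) (pt i) \<inter> dcell (lv j) (pt j) = {} \<or> dcell (lv i) (pt i) \<subseteq> dcell (lv j) (pt j)
        \<or> dcell (lv j) (pt j) \<subseteq> dcell (lv i) (pt i)"
      using dcell_laminar[of "lv i" "lv j" "pt i" "pt j"] dcell_laminar[of "lv j" "lv i" "pt j" "pt i"]
        linear[of "lv i" "lv j"] by blast
  qed
qed (use assms in auto)

text \<open>
  Apply the embedding to each of the \<open>3\<^sup>n\<close> laminar classes of triples.
\<close>

lemma Carleson_embedding_triples:
  fixes v :: "'a::euclidean_space \<Rightarrow> real" and lv :: "'i \<Rightarrow> int" and pt :: "'i \<Rightarrow> 'a"
  assumes I: "finite I" and v: "v \<in> borel_measurable borel" "\<And>x. 0 \<le> v x"
    and i: "\<And>j z. integrable lborel (\<lambda>x. indicator (dtriple j z) x * v x)"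
    and E: "\<And>i. i \<in> I \<Longrightarrow> E i \<in> sets borel" "\<And>i. i \<in> I \<Longrightarrow> E i \<subseteq> dtriple (lv i) (pt i)" "disjoint_family_on E I"
    and h: "h \<in> borel_measurable borel" "\<And>x. 0 \<le> h x" and a: "\<And>i. i \<in> I \<Longrightarrow> 0 \<le> a i"
    and mean: "\<And>i. i \<in> I \<Longrightarrow> ennreal (a i * mass v (dtriple (lv i) (pt i))) \<le> (\<integral>\<^sup>+x\<in>dtriple (lv i) (pt i). ennreal (h x * v x) \<partial>lborel)"
    and s: "1 < s"
  shows "(\<Sum>i\<in>I. ennreal (a i powr s * mass v (E i)))
    \<le> ennreal (3 ^ DIM('a) * (2 powr s * s / (s - 1))) * (\<integral>\<^sup>+x. ennreal (h x powr s * v x) \<partial>lborel)"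
proof -
  let ?P = "\<lambda>i. dtriple (lv i) (pt i)"
  define cl where "cl i = restrict (triple_class (lv i) (pt i)) Basis" for i
  define CL where "CL = PiE (Basis::'a set) (\<lambda>_. {0..2::int})"
  have cl: "cl i \<in> CL" for i
  proof -
    have "u mod 3 \<in> {0..2}" for u :: int using pos_mod_bound[of 3 u] pos_mod_sign[of 3 u] by auto
    then show ?thesis unfolding cl_def CL_def triple_class_def by simp
  qed
  have fCL: "finite CL" unfolding CL_def by (intro finite_PiE) auto
  have cCL: "card CL = 3 ^ DIM('a)" unfolding CL_def by (simp add: card_PiE)
  let ?B = "ennreal (2 powr s * s / (s - 1)) * (\<integral>\<^sup>+x. ennreal (h x powr s * v x) \<partial>lborel)"
  have one: "(\<Sum>i\<in>{i\<in>I. cl i = c}. ennreal (a i powr s * mass v (E i))) \<le> ?B" for c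
  proof (rule Carleson_embedding_weight[where P="?P"])
    show "laminar {i\<in>I. cl i = c} ?P"
      unfolding laminar_def
    proof (intro ballI)
      fix i j assume ij: "i \<in> {i\<in>I. cl i = c}" "j \<in> {i\<in>I. cl i = c}"
      have e: "triple_class (lv i) (pt i) b = triple_class (lv j) (pt j) b" if "b \<in> Basis" for b
      proof -
        have "cl i b = cl j b" using ij by simp
        then show ?thesis using that by (simp add: cl_def)
      qed
      show "?P i \<inter> ?P j = {} \<or> ?P i \<subseteq> ?P j \<or> ?P j \<subseteq> ?P i"
      proof (cases "lv i \<le> lv j")
        case True
        then show ?thesis using triple_class_laminar[of "lv i" "pt i" "lv j" "pt j"] e by blast
      next
        case False
        then have "lv j \<le> lv i" by simp
        moreover have "triple_class (lv j) (pt j) b = triple_class (lv i) (pt i) b" if "b \<in> Basis" for b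
          using e[OF that] by simp
        ultimately show ?thesis using triple_class_laminar[of "lv j" "pt j" "lv i" "pt i"] by blast
      qed
    qed
  qed (use I v i E h a mean s in \<open>auto intro: disjoint_family_on_mono[of _ I E]\<close>)
  have "(\<Sum>i\<in>I. ennreal (a i powr s * mass v (E i))) = (\<Sum>c\<in>CL. \<Sum>i\<in>{i\<in>I. cl i = c}. ennreal (a i powr s * mass v (E i)))"
    using cl by (intro sum.group[symmetric] I fCL) auto
  also have "... \<le> (\<Sum>c\<in>CL. ?B)" by (intro sum_mono one)
  also have "... = ennreal (3 ^ DIM('a)) * ?B" by (simp add: cCL ennreal_of_nat_eq_real_of_nat)
  also have "... = ennreal (3 ^ DIM('a) * (2 powr s * s / (s - 1))) * (\<integral>\<^sup>+x. ennreal (h x powr s * v x) \<partial>lborel)"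
    using s by (subst mult.assoc[symmetric], subst ennreal_mult[symmetric]) auto
  finally show ?thesis .
qed

lemma sparse_tree_antimono:
  assumes T: "sparse_tree Om lev" and "m \<le> m'"
  shows "Om m' \<subseteq> Om m"
  using assms(2)
proof (induction m' rule: dec_induct)
  case (step k)
  then show ?case using sparse_treeD(2)[OF T, of k] by blast
qed simp

lemma sparse_tree_pieces:
  fixes Om :: "nat \<Rightarrow> 'a::euclidean_space set"
  assumes T: "sparse_tree Om lev"
  defines "Idx \<equiv> Sigma UNIV (\<lambda>m. corners (Om m) (lev m))"
    and "Q \<equiv> (\<lambda>(m, z). dcell (lev m z) z)" and "E \<equiv> (\<lambda>(m, z). dcell (lev m z) z - Om (Suc m))"
  shows "countable Idx" "disjoint_family_on E Idx" "\<And>i. E i \<in> sets borel" "\<And>i. E i \<subseteq> Q i"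
    "\<And>i. i \<in> Idx \<Longrightarrow> measure lborel (Q i) \<le> 2 * measure lborel (E i)"
proof -
  note B = sparse_treeD(3)[OF T]
  note cells = saturated_cells[OF sparse_treeD(1)[OF T]]
  show "countable Idx" unfolding Idx_def by (intro countable_SIGMA cells(1)) auto
  show EB: "E i \<in> sets borel" for i unfolding E_def using B by (auto split: prod.split)
  show "E i \<subseteq> Q i" for i unfolding E_def Q_def by (auto split: prod.split)
  have sep: "E (m, z) \<inter> E (m', z') = {}" if "m < m'" "z' \<in> corners (Om m') (lev m')" for m m' z z'
  proof -
    have "dcell (lev m' z') z' \<subseteq> Om m'" using that(2) sparse_treeD(1)[OF T, of m']
      unfolding saturated_def corners_def by blast
    also have "... \<subseteq> Om (Suc m)" using that(1) by (intro sparse_tree_antimono[OF T]) auto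
    finally show ?thesis unfolding E_def by auto
  qed
  show "disjoint_family_on E Idx"
    unfolding disjoint_family_on_def
  proof (intro ballI impI)
    fix i j assume ij: "i \<in> Idx" "j \<in> Idx" "i \<noteq> j"
    obtain m z m' z' where i: "i = (m, z)" and j: "j = (m', z')" by fastforce
    have z: "z \<in> corners (Om m) (lev m)" "z' \<in> corners (Om m') (lev m')" using ij by (auto simp: Idx_def i j)
    consider "m < m'" | "m' < m" | "m = m'" by linarith
    then show "E i \<inter> E j = {}"
    proof cases
      case 3
      then have "z \<noteq> z'" using ij by (auto simp: i j)
      then have "dcell (lev m z) z \<inter> dcell (lev m z') z' = {}"
        using cells(2)[of m] z 3 unfolding disjoint_family_on_def by blast
      then show ?thesis unfolding i j E_def using 3 by auto
    qed (use sep z i j in \<open>simp_all add: Int_commute\<close>, use sep z i j in blast)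
  qed
  fix i assume i: "i \<in> Idx"
  obtain m z where mz: "i = (m, z)" by fastforce
  have z: "z \<in> Om m" using i by (auto simp: Idx_def mz corners_def)
  let ?Q = "dcell (lev m z) z" and ?c = "(2 powi lev m z :: real) ^ DIM('a)"
  have fm: "?Q \<in> fmeasurable lborel" by (intro fmeasurableI) (auto simp: emeasure_dcell)
  have "emeasure lborel (?Q \<inter> Om (Suc m)) \<le> ennreal (?c / 2)" using T z unfolding sparse_tree_def by blast
  then have "measure lborel (?Q \<inter> Om (Suc m)) \<le> ?c / 2"
    unfolding measure_def by (intro enn2real_leI) (auto simp: less_imp_le)
  moreover have "measure lborel (?Q - ?Q \<inter> Om (Suc m)) = measure lborel ?Q - measure lborel (?Q \<inter> Om (Suc m))"
    by (intro measurable_measure_Diff fm) (use B in auto)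
  moreover have "?Q - ?Q \<inter> Om (Suc m) = E i" by (auto simp: E_def mz)
  moreover have "measure lborel ?Q = ?c" by (rule measure_dcell)
  ultimately show "measure lborel (Q i) \<le> 2 * measure lborel (E i)" by (simp add: Q_def mz)
qed

lemma mass_pos:
  fixes v :: "'a::euclidean_space \<Rightarrow> real"
  assumes "\<And>x. 0 < v x" "Q \<in> sets borel" "emeasure lborel Q < \<infinity>" "0 < measure lborel Q"
    "integrable lborel (\<lambda>x. indicator Q x * v x)"
  shows "0 < mass v Q"
  unfolding mass_def
  by (rule product_of_means(2)[where I="{()}" and u="\<lambda>_. v" and t="\<lambda>_. 0" and M=lborel]) (use assms in auto)

definition embedding_const :: "real \<Rightarrow> real" where
  "embedding_const s = 2 powr s * s / (s - 1)"

text \<open>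
  The first factor is the loss of the one-cube estimate for the triple of a cube and the ample part of
  the cube; the others are the embeddings for triples and for cubes.
\<close>

definition sparse_const :: "real \<Rightarrow> real \<Rightarrow> 'a::euclidean_space itself \<Rightarrow> real" where
  "sparse_const p r _ = (2 * 3 ^ DIM('a)) powr (1 + (r - 1) * (1 - 1 / (p - 1)))
    * ((3 ^ DIM('a) * embedding_const p) powr (1 / p) * embedding_const (p / (p - 1)) powr (1 - 1 / p))"

text \<open>
  Duality: with \<open>S\<close> the sparse operator applied to \<open>f\<close> and \<open>\<sigma> =
  w\<^bsup>-1/(p-1)\<^esup>\<close>, expand \<open>N = \<integral> S\<^sup>p w = \<integral> S
  (S\<^bsup>p-1\<^esup> w)\<close> over the cubes. Each term is at most \<open>w(P) \<sigma>(P) /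
  \<bar>P\<bar>\<close> times the \<open>\<sigma>\<close>-mean of \<open>\<bar>f\<bar> /
  \<sigma>\<close> over the triple \<open>P\<close> and the \<open>w\<close>-mean of
  \<open>S\<^bsup>p-1\<^esup>\<close> over the cube. The one-cube estimate, Hoelder's inequality and
  the two Carleson embeddings give \<open>N \<le> C \<parallel>f\<parallel>
  N\<^bsup>1-1/p\<^esup>\<close>, and \<open>N\<close> is finite because the family is.
\<close>

theorem sparse_operator_finite:
  fixes w f :: "'a::euclidean_space \<Rightarrow> real" and lev :: "nat \<Rightarrow> 'a \<Rightarrow> int"
  assumes p: "2 \<le> p" "p \<le> r" and w[measurable]: "w \<in> borel_measurable borel" and w0: "\<And>x. 0 < w x"
    and iw: "\<And>j z. integrable lborel (\<lambda>x. indicator (dtriple j z) x * w x)"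
      "\<And>j z. integrable lborel (\<lambda>x. indicator (dtriple j z) x * w x powr (- (1 / (p - 1))))"
      "\<And>j z. integrable lborel (\<lambda>x. indicator (dtriple j z) x * w x powr (- (1 / (r - 1))))"
    and C: "\<And>j z. mass w (dtriple j z) / measure lborel (dtriple j z)
      * (mass (\<lambda>x. w x powr (- (1 / (p - 1)))) (dtriple j z) / measure lborel (dtriple j z))
      * (mass (\<lambda>x. w x powr (- (1 / (r - 1)))) (dtriple j z) / measure lborel (dtriple j z)) powr ((r - 1) * (1 - 1 / (p - 1))) \<le> C"
    and T: "sparse_tree Om lev" and f[measurable]: "f \<in> borel_measurable borel"
    and floc: "\<And>j z. integrable lborel (on_triple f j z)"
    and F: "(\<integral>\<^sup>+x. ennreal (\<bar>f x\<bar> powr p * w x) \<partial>lborel) = ennreal F" "0 \<le> F"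
    and I: "finite I" "I \<subseteq> Sigma UNIV (\<lambda>m. corners (Om m) (lev m))"
  shows "(\<integral>\<^sup>+x. ennreal ((\<Sum>(m, z)\<in>I. indicator (dcell (lev m z) z) x * triple_mean f (lev m z) z) powr p * w x) \<partial>lborel)
    \<le> ennreal ((C * sparse_const p r TYPE('a)) powr p * F)"
proof -
  define lv where "lv = (\<lambda>(m, z). lev m z)"
  define pt where "pt = (snd :: nat \<times> 'a \<Rightarrow> 'a)"
  define Q where "Q i = dcell (lv i) (pt i)" for i
  define P where "P i = dtriple (lv i) (pt i)" for i
  define E where "E = (\<lambda>(m, z). dcell (lev m z) z - Om (Suc m))"
  have Q': "Q = (\<lambda>(m, z). dcell (lev m z) z)" by (auto simp: Q_def lv_def pt_def fun_eq_iff)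
  note pieces = sparse_tree_pieces[OF T, folded E_def Q']
  have E: "E i \<in> sets borel" "E i \<subseteq> Q i" for i using pieces(3,4) by auto
  have Edis: "disjoint_family_on E I" using pieces(2) I(2) by (rule disjoint_family_on_mono[rotated])
  have EQ: "measure lborel (Q i) \<le> 2 * measure lborel (E i)" if "i \<in> I" for i using pieces(5) I(2) that by blast
  have QP: "Q i \<subseteq> P i" for i unfolding Q_def P_def by (rule dcell_subset_dtriple)
  have [measurable]: "Q i \<in> sets borel" "P i \<in> sets borel" for i by (simp_all add: Q_def P_def)
  define c where "c i = (2 powi lv i :: real) ^ DIM('a)" for i
  have c: "0 < c i" for i by (simp add: c_def)
  have mQ: "measure lborel (Q i) = c i" "emeasure lborel (Q i) = ennreal (c i)" for i
    by (simp_all add: Q_def c_def measure_dcell emeasure_dcell)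
  have mP: "measure lborel (P i) = 3 ^ DIM('a) * c i" "emeasure lborel (P i) = ennreal (3 ^ DIM('a) * c i)" for i
    using c[of i] by (simp_all add: P_def c_def measure_def emeasure_dtriple power_mult_distrib)
  define \<kappa> where "\<kappa> = 2 * (3::real) ^ DIM('a)"
  have \<kappa>E: "measure lborel (P i) \<le> \<kappa> * measure lborel (E i)" if "i \<in> I" for i
  proof -
    have "3 ^ DIM('a) * c i \<le> 3 ^ DIM('a) * (2 * measure lborel (E i))" using EQ[OF that] by (simp add: mQ)
    then show ?thesis by (simp add: mP \<kappa>_def mult_ac)
  qed
  have mE: "0 < measure lborel (E i)" if "i \<in> I" for i using EQ[OF that] c[of i] by (simp add: mQ)
  define \<sigma> where "\<sigma> x = w x powr (- (1 / (p - 1)))" for x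
  have \<sigma>: "0 < \<sigma> x" for x using w0[of x] by (simp add: \<sigma>_def)
  have [measurable]: "\<sigma> \<in> borel_measurable borel" unfolding \<sigma>_def[abs_def] by measurable
  have i\<sigma>: "integrable lborel (\<lambda>x. indicator (dtriple j z) x * \<sigma> x)" for j z using iw(2) by (simp add: \<sigma>_def)
  have sub: "integrable lborel (\<lambda>x. indicator B x * v x)"
    if "B \<in> sets borel" "B \<subseteq> P'" "integrable lborel (\<lambda>x. indicator P' x * v x)" for B P' and v :: "'a \<Rightarrow> real"
  proof -
    have "integrable lborel (\<lambda>x. indicator B x *\<^sub>R (indicator P' x * v x))"
      using that by (intro integrable_mult_indicator) auto
    moreover have "(\<lambda>x. indicator B x *\<^sub>R (indicator P' x * v x)) = (\<lambda>x. indicator B x * v x)"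
      using that(2) by (auto simp: indicator_def fun_eq_iff)
    ultimately show ?thesis by (simp only:)
  qed
  have iQw: "integrable lborel (\<lambda>x. indicator (dcell j z) x * w x)" for j z
    by (rule sub[OF _ dcell_subset_dtriple iw(1)]) simp
  have mwQ: "0 < mass w (Q i)" for i
    using w0 iQw c[of i] unfolding Q_def by (intro mass_pos) (simp_all add: mQ[unfolded Q_def])
  have m\<sigma>P: "0 < mass \<sigma> (P i)" for i
    using \<sigma> i\<sigma> c[of i] unfolding P_def by (intro mass_pos) (simp_all add: mP[unfolded P_def])
  have mwQP: "mass w (Q i) \<le> mass w (P i)" for i
    unfolding mass_def Q_def P_def using iQw iw(1) w0 dcell_subset_dtriple[of "lv i" "pt i"]
    by (intro integral_mono) (auto simp: indicator_def less_imp_le)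
  define a where "a i = triple_mean f (lv i) (pt i)" for i
  have a0: "0 \<le> a i" for i by (simp add: a_def triple_mean_nonneg)
  define S where "S x = (\<Sum>i\<in>I. indicator (Q i) x * a i)" for x
  have [measurable]: "S \<in> borel_measurable borel" unfolding S_def[abs_def] by measurable
  have S0: "0 \<le> S x" for x unfolding S_def by (intro sum_nonneg) (simp add: a0)
  have S_eq: "(\<Sum>(m, z)\<in>I. indicator (dcell (lev m z) z) x * triple_mean f (lev m z) z) = S x" for x
    unfolding S_def by (intro sum.cong) (auto simp: Q_def a_def lv_def pt_def)
  define b where "b = (\<Sum>i\<in>I. a i)"
  have Sb: "S x \<le> b" for x unfolding S_def b_def by (intro sum_mono) (auto simp: indicator_def a0)
  have iS: "integrable lborel (\<lambda>x. S x powr t * w x)" if t: "0 < t" for t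
  proof (rule Bochner_Integration.integrable_bound)
    show "integrable lborel (\<lambda>x. b powr t * (\<Sum>i\<in>I. indicator (Q i) x * w x))"
      using iQw by (intro integrable_mult_right Bochner_Integration.integrable_sum) (simp add: Q_def)
    show "AE x in lborel. norm (S x powr t * w x) \<le> norm (b powr t * (\<Sum>i\<in>I. indicator (Q i) x * w x))"
    proof (intro AE_I2)
      fix x
      have n: "0 \<le> (\<Sum>i\<in>I. indicator (Q i) x * w x)" using w0 by (intro sum_nonneg) (simp add: less_imp_le)
      have "S x powr t * w x \<le> b powr t * (\<Sum>i\<in>I. indicator (Q i) x * w x)"
      proof (cases "\<exists>i\<in>I. x \<in> Q i")
        case True
        then obtain i where i: "i \<in> I" "x \<in> Q i" by blast
        have "w x = indicator (Q i) x * w x" using i by simp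
        also have "... \<le> (\<Sum>i\<in>I. indicator (Q i) x * w x)"
          using i(1) I(1) w0 by (intro member_le_sum) (simp_all add: less_imp_le)
        finally show ?thesis using S0 Sb t w0[of x] by (intro mult_mono powr_mono2) (auto simp: less_imp_le)
      next
        case False
        then have "S x = 0" unfolding S_def by (intro sum.neutral) auto
        then show ?thesis using n by simp
      qed
      then show "norm (S x powr t * w x) \<le> norm (b powr t * (\<Sum>i\<in>I. indicator (Q i) x * w x))"
        using n w0[of x] by (simp add: abs_mult)
    qed
  qed measurable
  define N where "N = (\<integral>x. S x powr p * w x \<partial>lborel)"
  have N0: "0 \<le> N" unfolding N_def using w0 by (intro integral_nonneg_AE) (auto simp: less_imp_le)
  have N_nn: "(\<integral>\<^sup>+x. ennreal (S x powr p * w x) \<partial>lborel) = ennreal N"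
    unfolding N_def using iS[of p] p w0 by (intro nn_integral_eq_integral) (auto simp: less_imp_le)
  define G where "G i = (\<integral>x. indicator (Q i) x * (S x powr (p - 1) * w x) \<partial>lborel)" for i
  have iG: "integrable lborel (\<lambda>x. indicator (Q i) x * (S x powr (p - 1) * w x))" for i
    using integrable_mult_indicator[OF _ iS[of "p - 1"], of "Q i"] p by simp
  have G0: "0 \<le> G i" for i unfolding G_def using w0 by (intro integral_nonneg_AE) (auto simp: less_imp_le)
  have NG: "N = (\<Sum>i\<in>I. a i * G i)"
  proof -
    have "S x powr p * w x = (\<Sum>i\<in>I. a i * (indicator (Q i) x * (S x powr (p - 1) * w x)))" for x
    proof -
      have "S x powr p = S x * S x powr (p - 1)"
        using S0[of x] p by (cases "S x = 0") (auto simp: powr_diff)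
      also have "S x * S x powr (p - 1) = (\<Sum>i\<in>I. indicator (Q i) x * a i) * S x powr (p - 1)" by (simp add: S_def)
      finally have e: "S x powr p = (\<Sum>i\<in>I. indicator (Q i) x * a i) * S x powr (p - 1)" .
      show ?thesis unfolding e sum_distrib_right by (intro sum.cong) (simp_all add: mult_ac)
    qed
    then have "N = (\<integral>x. (\<Sum>i\<in>I. a i * (indicator (Q i) x * (S x powr (p - 1) * w x))) \<partial>lborel)" by (simp only: N_def)
    also have "... = (\<Sum>i\<in>I. \<integral>x. a i * (indicator (Q i) x * (S x powr (p - 1) * w x)) \<partial>lborel)"
      by (intro Bochner_Integration.integral_sum integrable_mult_right iG)
    finally show ?thesis by (simp add: G_def)
  qed
  define d where "d i = L1norm (on_triple f (lv i) (pt i)) / mass \<sigma> (P i)" for i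
  define e where "e i = G i / mass w (Q i)" for i
  have d0: "0 \<le> d i" for i using m\<sigma>P[of i] by (simp add: d_def L1norm_nonneg)
  have e0: "0 \<le> e i" for i using mwQ[of i] G0 by (simp add: e_def)
  define K where "K = \<kappa> powr (1 + (r - 1) * (1 - 1 / (p - 1)))"
  have mass0: "0 \<le> mass w B" "0 \<le> mass \<sigma> B" for B
    unfolding mass_def using w0 \<sigma> by (auto intro!: integral_nonneg_AE simp: less_imp_le)
  have C0: "0 \<le> C"
  proof -
    have "0 \<le> mass w (dtriple 0 0) / measure lborel (dtriple 0 (0::'a))
      * (mass (\<lambda>x. w x powr (- (1 / (p - 1)))) (dtriple 0 0) / measure lborel (dtriple 0 (0::'a)))
      * (mass (\<lambda>x. w x powr (- (1 / (r - 1)))) (dtriple 0 0) / measure lborel (dtriple 0 (0::'a))) powr ((r - 1) * (1 - 1 / (p - 1)))"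
      using mass0 by (intro mult_nonneg_nonneg divide_nonneg_nonneg) (auto simp: \<sigma>_def[abs_def])
    also have "... \<le> C" by (rule C)
    finally show ?thesis .
  qed
  have cube_bound: "a i * G i \<le> C * K * ((d i * mass \<sigma> (E i) powr (1 / p)) * (e i * mass w (E i) powr (1 - 1 / p)))" if i: "i \<in> I" for i
  proof -
    have aeq: "a i = d i * mass \<sigma> (P i) / measure lborel (P i)"
      using m\<sigma>P[of i] by (simp add: a_def triple_mean_def d_def mP c_def power_mult_distrib)
    have "G i = e i * mass w (Q i)" using mwQ[of i] by (simp add: e_def)
    also have "... \<le> e i * mass w (P i)" using mwQP e0 by (rule mult_left_mono)
    finally have "a i * G i \<le> a i * (e i * mass w (P i))" using a0 by (rule mult_left_mono)
    also have "... = (d i * e i) * (mass w (P i) * mass \<sigma> (P i) / measure lborel (P i))"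
      unfolding aeq by simp
    also have "... \<le> (d i * e i) * (C * K * (mass w (E i) powr (1 - 1 / p) * mass \<sigma> (E i) powr (1 / p)))"
    proof (rule mult_left_mono)
      have "emeasure lborel (P i) < \<infinity>" by (simp add: mP(2))
      moreover have "E i \<subseteq> P i" using E(2) QP by blast
      ultimately show "mass w (P i) * mass \<sigma> (P i) / measure lborel (P i) \<le> C * K * (mass w (E i) powr (1 - 1 / p) * mass \<sigma> (E i) powr (1 / p))"
        unfolding K_def \<sigma>_def[abs_def]
        by (intro one_cube_estimate[where r=r] p w0 E(1) mE[OF i] \<kappa>E[OF i] refl) (use iw C in \<open>simp_all add: P_def\<close>)
      show "0 \<le> d i * e i" using d0 e0 by simp
    qed
    finally show ?thesis by (simp add: mult_ac)
  qed
  let ?A = "3 ^ DIM('a) * embedding_const p" and ?B = "embedding_const (p / (p - 1))"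
  have p': "1 < p / (p - 1)" using p by (simp add: field_simps)
  have cpos: "0 < ?A" "0 < ?B" using p p' by (auto simp: embedding_const_def intro!: mult_pos_pos divide_pos_pos)
  have sumA: "(\<Sum>i\<in>I. d i powr p * mass \<sigma> (E i)) \<le> ?A * F"
  proof -
    define h where "h x = \<bar>f x\<bar> / \<sigma> x" for x
    have [measurable]: "h \<in> borel_measurable borel" unfolding h_def[abs_def] by measurable
    have h0: "0 \<le> h x" for x using \<sigma>[of x] by (simp add: h_def)
    have h\<sigma>: "h x * \<sigma> x = \<bar>f x\<bar>" for x using \<sigma>[of x] by (simp add: h_def)
    have hp: "h x powr p * \<sigma> x = \<bar>f x\<bar> powr p * w x" for x
    proof -
      have "h x powr p * \<sigma> x = \<bar>f x\<bar> powr p * (\<sigma> x / \<sigma> x powr p)" using \<sigma>[of x] by (simp add: h_def powr_divide)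
      also have "\<sigma> x / \<sigma> x powr p = \<sigma> x powr (1 - p)" using \<sigma>[of x] by (simp add: powr_diff)
      also have "\<sigma> x powr (1 - p) = w x powr (- (1 / (p - 1)) * (1 - p))" by (simp add: \<sigma>_def powr_powr)
      also have "- (1 / (p - 1)) * (1 - p) = 1" using p by (simp add: field_simps)
      finally show ?thesis using w0[of x] by simp
    qed
    have "(\<Sum>i\<in>I. ennreal (d i powr p * mass \<sigma> (E i))) \<le> ennreal ?A * (\<integral>\<^sup>+x. ennreal (h x powr p * \<sigma> x) \<partial>lborel)"
      unfolding embedding_const_def
    proof (rule Carleson_embedding_triples[where lv=lv and pt=pt])
      fix i
      have "ennreal (d i * mass \<sigma> (dtriple (lv i) (pt i))) = ennreal (L1norm (on_triple f (lv i) (pt i)))"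
        using m\<sigma>P[of i] by (simp add: d_def P_def)
      also have "... = (\<integral>\<^sup>+x. ennreal \<bar>on_triple f (lv i) (pt i) x\<bar> \<partial>lborel)"
        by (rule nn_integral_abs_eq_L1norm[symmetric, OF floc])
      also have "... = (\<integral>\<^sup>+x\<in>dtriple (lv i) (pt i). ennreal (h x * \<sigma> x) \<partial>lborel)"
        by (intro nn_integral_cong) (auto simp: h\<sigma> on_triple_def indicator_def)
      finally show "ennreal (d i * mass \<sigma> (dtriple (lv i) (pt i))) \<le> (\<integral>\<^sup>+x\<in>dtriple (lv i) (pt i). ennreal (h x * \<sigma> x) \<partial>lborel)" by simp
      show "E i \<subseteq> dtriple (lv i) (pt i)" using E(2)[of i] QP[of i] by (simp add: P_def)
    qed (use I(1) \<sigma> i\<sigma> E Edis h0 d0 p in \<open>auto simp: less_imp_le\<close>)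
    also have "... = ennreal (?A * F)" unfolding hp F(1) using cpos F(2) by (simp add: ennreal_mult)
    finally have "ennreal (\<Sum>i\<in>I. d i powr p * mass \<sigma> (E i)) \<le> ennreal (?A * F)"
      using mass0 by (subst sum_ennreal[symmetric]) auto
    then show ?thesis using cpos F(2) by (subst (asm) ennreal_le_iff) (auto simp: less_imp_le)
  qed
  have sumB: "(\<Sum>i\<in>I. e i powr (p / (p - 1)) * mass w (E i)) \<le> ?B * N"
  proof -
    define h where "h x = S x powr (p - 1)" for x
    have [measurable]: "h \<in> borel_measurable borel" unfolding h_def[abs_def] by measurable
    have hp: "h x powr (p / (p - 1)) * w x = S x powr p * w x" for x using p by (simp add: h_def powr_powr)
    have "(\<Sum>i\<in>I. ennreal (e i powr (p / (p - 1)) * mass w (E i))) \<le> ennreal ?B * (\<integral>\<^sup>+x. ennreal (h x powr (p / (p - 1)) * w x) \<partial>lborel)"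
      unfolding embedding_const_def
    proof (rule Carleson_embedding_cells[where lv=lv and pt=pt])
      fix i
      have "ennreal (e i * mass w (dcell (lv i) (pt i))) = ennreal (G i)"
        using mwQ[of i] by (simp add: e_def Q_def)
      also have "... = (\<integral>\<^sup>+x. ennreal (indicator (Q i) x * (S x powr (p - 1) * w x)) \<partial>lborel)"
        unfolding G_def using iG w0 by (intro nn_integral_eq_integral[symmetric]) (auto simp: less_imp_le)
      also have "... = (\<integral>\<^sup>+x\<in>dcell (lv i) (pt i). ennreal (h x * w x) \<partial>lborel)"
        by (intro nn_integral_cong) (auto simp: h_def Q_def indicator_def)
      finally show "ennreal (e i * mass w (dcell (lv i) (pt i))) \<le> (\<integral>\<^sup>+x\<in>dcell (lv i) (pt i). ennreal (h x * w x) \<partial>lborel)" by simp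
      show "E i \<subseteq> dcell (lv i) (pt i)" using E(2)[of i] by (simp add: Q_def)
    qed (use I(1) w0 iQw E Edis e0 p' in \<open>auto simp: less_imp_le h_def\<close>)
    also have "... = ennreal (?B * N)" unfolding hp N_nn using cpos N0 by (simp add: ennreal_mult)
    finally have "ennreal (\<Sum>i\<in>I. e i powr (p / (p - 1)) * mass w (E i)) \<le> ennreal (?B * N)"
      using mass0 by (subst sum_ennreal[symmetric]) auto
    then show ?thesis using cpos N0 by (subst (asm) ennreal_le_iff) (auto simp: less_imp_le)
  qed
  have final: "N \<le> (C * sparse_const p r TYPE('a)) powr p * F"
  proof (cases "N = 0")
    case True then show ?thesis using F by simp
  next
    case False
    then have N: "0 < N" using N0 by simp
    have Fpos: "0 < F"
    proof (rule ccontr)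
      assume "\<not> 0 < F"
      then have "(\<integral>\<^sup>+x. ennreal (\<bar>f x\<bar> powr p * w x) \<partial>lborel) = 0" using F by simp
      then have "AE x in lborel. ennreal (\<bar>f x\<bar> powr p * w x) = 0" by (subst (asm) nn_integral_0_iff_AE) auto
      then have fz: "AE x in lborel. f x = 0"
      proof eventually_elim
        fix x assume "ennreal (\<bar>f x\<bar> powr p * w x) = 0"
        then have "\<bar>f x\<bar> powr p * w x \<le> 0" by (simp add: ennreal_eq_0_iff)
        then show "f x = 0" using w0[of x] by (simp add: mult_le_0_iff)
      qed
      have "a i = 0" for i
      proof -
        have "L1norm (on_triple f (lv i) (pt i)) = 0"
          unfolding L1norm_def by (rule integral_eq_zero_AE) (use fz in \<open>eventually_elim, simp add: on_triple_def\<close>)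
        then show ?thesis by (simp add: a_def triple_mean_def)
      qed
      then show False using NG N by simp
    qed
    have "N \<le> (\<Sum>i\<in>I. C * K * ((d i * mass \<sigma> (E i) powr (1 / p)) * (e i * mass w (E i) powr (1 - 1 / p))))"
      unfolding NG by (intro sum_mono cube_bound)
    also have "... = C * K * (\<Sum>i\<in>I. (d i * mass \<sigma> (E i) powr (1 / p)) * (e i * mass w (E i) powr (1 - 1 / p)))"
      by (simp add: sum_distrib_left)
    also have "... \<le> C * K * ((?A * F) powr (1 / p) * (?B * N) powr (1 - 1 / p))"
    proof (intro mult_left_mono Holder_sum)
      have 1: "(d i * mass \<sigma> (E i) powr (1 / p)) powr p = d i powr p * mass \<sigma> (E i)" for i
        using d0 mass0 p by (simp add: powr_mult powr_powr)
      show "(\<Sum>i\<in>I. (d i * mass \<sigma> (E i) powr (1 / p)) powr p) \<le> ?A * F" unfolding 1 by (rule sumA)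
      have "(1 - 1 / p) * (p / (p - 1)) = 1" using p by (simp add: field_simps)
      then have 2: "(e i * mass w (E i) powr (1 - 1 / p)) powr (p / (p - 1)) = e i powr (p / (p - 1)) * mass w (E i)" for i
        using e0 mass0 p by (simp add: powr_mult powr_powr)
      show "(\<Sum>i\<in>I. (e i * mass w (E i) powr (1 - 1 / p)) powr (p / (p - 1))) \<le> ?B * N" unfolding 2 by (rule sumB)
    qed (use p d0 e0 cpos Fpos N C0 in \<open>auto simp: K_def\<close>)
    also have "... = (C * (K * (?A powr (1 / p) * ?B powr (1 - 1 / p)))) * F powr (1 / p) * N powr (1 - 1 / p)"
      using cpos Fpos N by (simp add: powr_mult mult_ac)
    also have "K * (?A powr (1 / p) * ?B powr (1 - 1 / p)) = sparse_const p r TYPE('a)"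
      by (simp add: K_def \<kappa>_def sparse_const_def)
    finally have le: "N \<le> (C * sparse_const p r TYPE('a)) * F powr (1 / p) * N powr (1 - 1 / p)" .
    let ?D = "C * sparse_const p r TYPE('a)"
    have D0: "0 \<le> ?D" using C0 by (simp add: sparse_const_def)
    have "N powr (1 / p) * N powr (1 - 1 / p) = N" using N by (simp flip: powr_add)
    then have "N powr (1 / p) * N powr (1 - 1 / p) \<le> (?D * F powr (1 / p)) * N powr (1 - 1 / p)" using le by simp
    then have "N powr (1 / p) \<le> ?D * F powr (1 / p)" by (rule mult_right_le_imp_le) (use N in simp)
    then have "(N powr (1 / p)) powr p \<le> (?D * F powr (1 / p)) powr p" using p by (intro powr_mono2) auto
    then show ?thesis using N Fpos D0 p by (simp add: powr_mult powr_powr)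
  qed
  show ?thesis unfolding S_eq N_nn by (rule ennreal_leI) (rule final)
qed

section \<open>Powers of extended nonnegative numbers\<close>

lemma epowr_ennreal: "0 \<le> x \<Longrightarrow> 0 < a \<Longrightarrow> epowr (ennreal x) a = ennreal (x powr a)"
  by (auto simp: epowr_def)

lemma epowr_top: "0 < a \<Longrightarrow> epowr top a = top"
  by (simp add: epowr_def)

lemma epowr_mono:
  assumes "x \<le> y" "0 < a"
  shows "epowr x a \<le> epowr y a"
proof (cases y)
  case (real s)
  then obtain t where t: "x = ennreal t" "0 \<le> t" using assms(1) by (cases x) (auto simp: top_unique)
  then have "t \<le> s" using real assms(1) by simp
  then show ?thesis using real t assms(2) by (simp add: epowr_ennreal powr_mono2 ennreal_leI)
qed (simp add: epowr_top assms)

lemma epowr_epowr_inverse: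
  assumes "0 < a"
  shows "epowr (epowr x a) (1 / a) = x" "epowr (epowr x (1 / a)) a = x"
  using assms by (cases x; simp add: epowr_ennreal powr_powr epowr_top)+

lemma epowr_mult:
  assumes "0 < a"
  shows "epowr (x * y) a = epowr x a * epowr y a"
proof (cases x)
  case xr: (real s)
  show ?thesis
  proof (cases y)
    case (real t)
    then show ?thesis using xr assms
      by (simp add: epowr_ennreal powr_mult ennreal_mult[symmetric])
  next
    case top
    then show ?thesis using xr assms
      by (cases "s = 0") (simp_all add: epowr_ennreal epowr_top ennreal_mult_top, simp_all add: epowr_def)
  qed
next
  case xt: top
  show ?thesis
  proof (cases y)
    case (real t)
    then show ?thesis using xt assms
      by (cases "t = 0") (simp_all add: epowr_ennreal epowr_top ennreal_top_mult, simp_all add: epowr_def)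
  next
    case top
    then show ?thesis using xt assms by (simp add: epowr_top)
  qed
qed

lemma epowr_le_iff:
  assumes "0 < a"
  shows "epowr x a \<le> c \<longleftrightarrow> x \<le> epowr c (1 / a)"
proof
  assume "epowr x a \<le> c"
  then have "epowr (epowr x a) (1 / a) \<le> epowr c (1 / a)" using assms by (intro epowr_mono) auto
  then show "x \<le> epowr c (1 / a)" using assms by (simp only: epowr_epowr_inverse)
next
  assume "x \<le> epowr c (1 / a)"
  then have "epowr x a \<le> epowr (epowr c (1 / a)) a" using assms by (intro epowr_mono) auto
  then show "epowr x a \<le> c" using assms by (simp only: epowr_epowr_inverse)
qed

lemma epowr_SUP_le:
  assumes "0 < a" "\<And>i. i \<in> I \<Longrightarrow> epowr (g i) a \<le> c"
  shows "epowr (SUP i\<in>I. g i) a \<le> c"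
  unfolding epowr_le_iff[OF assms(1)] using assms by (intro SUP_least) (simp add: epowr_le_iff)

lemma ennreal_mult_weight_le_iff:
  assumes "0 < w"
  shows "x * ennreal w \<le> c \<longleftrightarrow> x \<le> c * ennreal (1 / w)"
proof
  assume "x * ennreal w \<le> c"
  then have "x * ennreal w * ennreal (1 / w) \<le> c * ennreal (1 / w)" by (rule mult_right_mono) simp
  then show "x \<le> c * ennreal (1 / w)" using assms by (simp add: mult.assoc ennreal_mult[symmetric])
next
  assume "x \<le> c * ennreal (1 / w)"
  then have "x * ennreal w \<le> c * ennreal (1 / w) * ennreal w" by (rule mult_right_mono) simp
  then show "x * ennreal w \<le> c" using assms by (simp add: mult.assoc ennreal_mult[symmetric])
qed

lemma epowr_SUP_weight_le:
  assumes "0 < a" "0 < w" "\<And>i. i \<in> I \<Longrightarrow> epowr (g i) a * ennreal w \<le> c"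
  shows "epowr (SUP i\<in>I. g i) a * ennreal w \<le> c"
  using assms unfolding ennreal_mult_weight_le_iff[OF assms(2)] by (intro epowr_SUP_le) auto

section \<open>Truncations of singular integrals on weighted spaces\<close>

lemma triple_mean_const: "y \<in> dcell j x \<Longrightarrow> triple_mean f j y = triple_mean f j x"
  by (simp add: triple_mean_def on_triple_def[abs_def] dtriple_eq)

text \<open>
  The averages run over triples of dyadic cubes only, and the last clause bounds the mixed product of
  Muckenhoupt constants on these, written out as \<open>W S R\<^bsup>(r-1)(1-1/(p-1))\<^esup>\<close>
  with the averages \<open>W\<close>, \<open>S\<close>, \<open>R\<close> of \<open>w\<close>,
  \<open>w\<^bsup>-1/(p-1)\<^esup>\<close>, \<open>w\<^bsup>-1/(r-1)\<^esup>\<close>.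
\<close>

definition admissible_weight :: "real \<Rightarrow> real \<Rightarrow> real \<Rightarrow> ('a::euclidean_space \<Rightarrow> real) \<Rightarrow> bool" where
  "admissible_weight p r C w \<longleftrightarrow> w \<in> borel_measurable borel \<and> (\<forall>x. 0 < w x) \<and>
    (\<forall>j z. integrable lborel (\<lambda>x. indicator (dtriple j z) x * w x)) \<and>
    (\<forall>j z. integrable lborel (\<lambda>x. indicator (dtriple j z) x * w x powr (- (1 / (p - 1))))) \<and>
    (\<forall>j z. integrable lborel (\<lambda>x. indicator (dtriple j z) x * w x powr (- (1 / (r - 1))))) \<and>
    (\<forall>j z. mass w (dtriple j z) / measure lborel (dtriple j z)
      * (mass (\<lambda>x. w x powr (- (1 / (p - 1)))) (dtriple j z) / measure lborel (dtriple j z))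
      * (mass (\<lambda>x. w x powr (- (1 / (r - 1)))) (dtriple j z) / measure lborel (dtriple j z)) powr ((r - 1) * (1 - 1 / (p - 1))) \<le> C)"

text \<open>
  Exhaust the countably many cubes of the tree by finite families and pass to the limit;
  \<open>H\<close> is the limit of the finite sums.
\<close>

lemma sparse_operator_bound:
  fixes w f :: "'a::euclidean_space \<Rightarrow> real" and lev :: "nat \<Rightarrow> 'a \<Rightarrow> int"
  assumes p: "2 \<le> p" "p \<le> r" and w: "admissible_weight p r C w"
    and T: "sparse_tree Om lev" and f: "f \<in> borel_measurable borel"
    and floc: "\<And>j z. integrable lborel (on_triple f j z)"
    and F: "(\<integral>\<^sup>+x. ennreal (\<bar>f x\<bar> powr p * w x) \<partial>lborel) = ennreal F" "0 \<le> F"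
  obtains H where "H \<in> borel_measurable borel" "\<And>x. (\<Sum>m. indicator (Om m) x * ennreal (triple_mean f (lev m x) x)) \<le> H x"
    "(\<integral>\<^sup>+x. epowr (H x) p * ennreal (w x) \<partial>lborel) \<le> ennreal ((C * sparse_const p r TYPE('a)) powr p * F)"
proof -
  define Idx where "Idx = Sigma UNIV (\<lambda>m. corners (Om m) (lev m))"
  have cnt: "countable Idx" unfolding Idx_def using sparse_tree_pieces(1)[OF T] .
  define I where "I n = {i \<in> Idx. to_nat_on Idx i < n}" for n
  have fin: "finite (I n)" for n
  proof -
    have "finite (to_nat_on Idx -` {..<n} \<inter> Idx)" by (intro finite_vimage_IntI inj_on_to_nat_on cnt) simp
    then show ?thesis by (rule finite_subset[rotated]) (auto simp: I_def)
  qed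
  have Isub: "I n \<subseteq> Idx" for n by (auto simp: I_def)
  have Imono: "I n \<subseteq> I m" if "n \<le> m" for n m using that by (auto simp: I_def)
  define t where "t x = (\<lambda>(m, z). indicator (dcell (lev m z) z) x * triple_mean f (lev m z) z)" for x
  define S where "S n x = (\<Sum>i\<in>I n. t x i)" for n x
  have t0: "0 \<le> t x i" for x i by (auto simp: t_def triple_mean_nonneg split: prod.split)
  have S0: "0 \<le> S n x" for n x unfolding S_def by (intro sum_nonneg t0)
  have Smono: "S n x \<le> S m x" if "n \<le> m" for n m x
    unfolding S_def using fin Imono[OF that] t0 by (intro sum_mono2) auto
  have "(\<lambda>x. t x i) \<in> borel_measurable borel" for i
    by (cases i) (simp add: t_def)
  then have [measurable]: "S n \<in> borel_measurable borel" for n unfolding S_def[abs_def] by measurable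
  have wm[measurable]: "w \<in> borel_measurable borel" and w0: "\<And>x. 0 < w x" using w by (auto simp: admissible_weight_def)
  define H where "H x = (SUP n. ennreal (S n x))" for x
  have Hm: "H \<in> borel_measurable borel" unfolding H_def[abs_def] by measurable
  have cover: "(\<Sum>m. indicator (Om m) x * ennreal (triple_mean f (lev m x) x)) \<le> H x" for x
    unfolding suminf_eq_SUP
  proof (rule SUP_least)
    fix k
    let ?M = "{m. m < k \<and> x \<in> Om m}"
    let ?i = "\<lambda>m. (m, dcorner (lev m x) x)"
    have corner: "?i m \<in> Idx" "t x (?i m) = triple_mean f (lev m x) x" if m: "x \<in> Om m" for m
    proof -
      let ?z = "dcorner (lev m x) x"
      have z: "?z \<in> dcell (lev m x) x" by (rule dcorner_in)
      have s: "dcell (lev m x) x \<subseteq> Om m" "\<forall>y\<in>dcell (lev m x) x. lev m y = lev m x"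
        using sparse_treeD(1)[OF T, of m] m unfolding saturated_def by blast+
      have lz: "lev m ?z = lev m x" using s z by blast
      have zO: "?z \<in> Om m" using s(1) z by blast
      have "dcorner (lev m ?z) ?z = ?z" unfolding lz by (rule dcorner_const[OF z])
      then have "?z \<in> corners (Om m) (lev m)" using zO unfolding corners_def by (intro CollectI conjI)
      then show "?i m \<in> Idx" unfolding Idx_def by (intro SigmaI UNIV_I)
      have "x \<in> dcell (lev m x) ?z" using dcell_eq[OF z] by simp
      then show "t x (?i m) = triple_mean f (lev m x) x"
        using triple_mean_const[OF z] by (simp add: t_def lz)
    qed
    have finM: "finite ?M" by simp
    obtain n where n: "?i ` ?M \<subseteq> I n"
    proof
      show "?i ` ?M \<subseteq> I (Suc (Max (insert 0 ((\<lambda>m. to_nat_on Idx (?i m)) ` ?M))))"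
        using corner(1) finM by (auto simp: I_def less_Suc_eq_le intro!: Max_ge)
    qed
    have "(\<Sum>m<k. indicator (Om m) x * ennreal (triple_mean f (lev m x) x)) = (\<Sum>m\<in>?M. ennreal (triple_mean f (lev m x) x))"
      by (intro sum.mono_neutral_cong_right) (auto simp: indicator_def)
    also have "... = (\<Sum>m\<in>?M. ennreal (t x (?i m)))" using corner(2) by (intro sum.cong) auto
    also have "... = ennreal (\<Sum>m\<in>?M. t x (?i m))" by (intro sum_ennreal t0)
    also have "(\<Sum>m\<in>?M. t x (?i m)) = (\<Sum>i\<in>?i ` ?M. t x i)" by (subst sum.reindex) (auto simp: inj_on_def)
    also have "ennreal ... \<le> ennreal (S n x)"
      unfolding S_def using n fin t0 by (intro ennreal_leI sum_mono2) auto
    also have "... \<le> H x" unfolding H_def by (rule SUP_upper) simp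
    finally show "(\<Sum>m<k. indicator (Om m) x * ennreal (triple_mean f (lev m x) x)) \<le> H x" .
  qed
  let ?B = "ennreal ((C * sparse_const p r TYPE('a)) powr p * F)"
  have fin_bound: "(\<integral>\<^sup>+x. ennreal (S n x powr p * w x) \<partial>lborel) \<le> ?B" for n
    unfolding S_def t_def
    by (rule sparse_operator_finite[OF p wm w0 _ _ _ _ T f floc F fin]) (use w Isub in \<open>auto simp: admissible_weight_def Idx_def\<close>)
  have pt: "epowr (H x) p * ennreal (w x) \<le> (SUP n. ennreal (S n x powr p * w x))" for x
    unfolding H_def
  proof (rule epowr_SUP_weight_le)
    fix n
    have "epowr (ennreal (S n x)) p * ennreal (w x) = ennreal (S n x powr p * w x)"
      using S0[of n x] p w0[of x] by (simp add: epowr_ennreal ennreal_mult)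
    also have "... \<le> (SUP n. ennreal (S n x powr p * w x))" by (rule SUP_upper) simp
    finally show "epowr (ennreal (S n x)) p * ennreal (w x) \<le> (SUP n. ennreal (S n x powr p * w x))" .
  qed (use p w0 in auto)
  have "(\<integral>\<^sup>+x. epowr (H x) p * ennreal (w x) \<partial>lborel) \<le> (\<integral>\<^sup>+x. (SUP n. ennreal (S n x powr p * w x)) \<partial>lborel)"
    by (intro nn_integral_mono pt)
  also have "... = (SUP n. \<integral>\<^sup>+x. ennreal (S n x powr p * w x) \<partial>lborel)"
    using Smono S0 p w0
    by (intro nn_integral_monotone_convergence_SUP) (auto simp: incseq_def le_fun_def less_imp_le intro!: ennreal_leI mult_right_mono powr_mono2)
  also have "... \<le> ?B" by (intro SUP_least fin_bound)
  finally show ?thesis using that Hm cover by blast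
qed

abbreviation annulus :: "'a::euclidean_space \<Rightarrow> real \<Rightarrow> real \<Rightarrow> 'a set" where
  "annulus x \<eta> \<delta> \<equiv> {y. \<eta> < norm (x - y) \<and> norm (x - y) < \<delta>}"

definition annulus_int :: "('a::euclidean_space \<Rightarrow> real) \<Rightarrow> ('a \<Rightarrow> real) \<Rightarrow> real \<Rightarrow> real \<Rightarrow> 'a \<Rightarrow> real" where
  "annulus_int K f \<eta> \<delta> x = (\<integral>y. indicator (annulus x \<eta> \<delta>) y * (K (x - y) * f y) \<partial>lborel)"

text \<open>
  The truncations between \<open>a\<close> and \<open>b\<close> only see the good truncation of the kernel and the values of \<open>f\<close> on
  the triple of a dyadic cube of side length at least \<open>b\<close>.
\<close>

lemma annulus_int_good:
  fixes K f :: "'a::euclidean_space \<Rightarrow> real"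
  assumes k: "good_kernel A B k" and kK: "\<And>x. a \<le> norm x \<Longrightarrow> norm x \<le> b \<Longrightarrow> k x = K x"
    and floc: "integrable lborel (on_triple f q x)" and \<eta>: "a \<le> \<eta>" "0 < \<eta>" "\<eta> < \<delta>" "\<delta> \<le> b" and q: "b \<le> 2 powi q"
  shows "integrable lborel (\<lambda>y. indicator (annulus x \<eta> \<delta>) y * (K (x - y) * f y))"
    "ennreal \<bar>annulus_int K f \<eta> \<delta> x\<bar> \<le> 2 * max_trunc k (on_triple f q x) x"
proof -
  let ?F = "on_triple f q x"
  let ?g = "\<lambda>y. indicator (annulus x \<eta> \<delta>) y * (K (x - y) * f y)"
  have kV: "k \<in> bdd_L1" using k by (auto simp: good_kernel_def)
  have eq: "?g y = indicator (annulus x \<eta> \<delta>) y * (k (x - y) * ?F y)" for y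
  proof (cases "\<eta> < norm (x - y) \<and> norm (x - y) < \<delta>")
    case True
    then have "y \<in> dtriple q x" using dist_outside_dtriple[of y q x x] \<eta> q by fastforce
    then show ?thesis using True kK[of "x - y"] \<eta> by (simp add: on_triple_def)
  qed simp
  note i = integrable_trunc_int(2)[OF kV floc]
  have "integrable lborel (\<lambda>y. indicator (annulus x \<eta> \<delta>) y *\<^sub>R (k (x - y) * ?F y))"
    by (intro integrable_mult_indicator integrable_trunc_int(1)[OF kV floc]) measurable
  then show ig: "integrable lborel ?g" by (simp only: eq real_scaleR_def)
  have null: "AE y in lborel. norm (x - y) \<noteq> \<delta>"
  proof -
    have "sphere x \<delta> \<in> null_sets lborel"
      using negligible_sphere[of x \<delta>] by (simp add: negligible_iff_null_sets null_sets_completion_iff)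
    then show ?thesis by (rule AE_I') (auto simp: dist_norm)
  qed
  have "annulus_int K f \<eta> \<delta> x = (\<integral>y. indicator {y. \<eta> < norm (x - y)} y * (k (x - y) * ?F y)
      - indicator {y. \<delta> < norm (x - y)} y * (k (x - y) * ?F y) \<partial>lborel)"
    unfolding annulus_int_def
  proof (rule integral_cong_AE)
    show "AE y in lborel. ?g y = indicator {y. \<eta> < norm (x - y)} y * (k (x - y) * ?F y)
      - indicator {y. \<delta> < norm (x - y)} y * (k (x - y) * ?F y)"
      using null by eventually_elim (unfold eq, use \<eta> in \<open>auto simp: indicator_def\<close>)
  qed (use ig i in auto)
  also have "... = trunc_int k \<eta> ?F x - trunc_int k \<delta> ?F x"
    unfolding trunc_int_def by (rule Bochner_Integration.integral_diff[OF i i])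
  finally have "\<bar>annulus_int K f \<eta> \<delta> x\<bar> \<le> \<bar>trunc_int k \<eta> ?F x\<bar> + \<bar>trunc_int k \<delta> ?F x\<bar>" by simp
  then have "ennreal \<bar>annulus_int K f \<eta> \<delta> x\<bar> \<le> ennreal \<bar>trunc_int k \<eta> ?F x\<bar> + ennreal \<bar>trunc_int k \<delta> ?F x\<bar>"
    by (simp add: ennreal_leI flip: ennreal_plus)
  also have "... \<le> max_trunc k ?F x + max_trunc k ?F x"
    using \<eta> by (intro add_mono max_trunc_upper) auto
  finally show "ennreal \<bar>annulus_int K f \<eta> \<delta> x\<bar> \<le> 2 * max_trunc k ?F x" by (simp add: mult_2)
qed

definition max_annulus_int :: "('a::euclidean_space \<Rightarrow> real) \<Rightarrow> ('a \<Rightarrow> real) \<Rightarrow> 'a \<Rightarrow> ennreal" where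
  "max_annulus_int K f x = (SUP (\<eta>, \<delta>)\<in>{(\<eta>, \<delta>). 0 < \<eta> \<and> \<eta> < \<delta>}. ennreal \<bar>annulus_int K f \<eta> \<delta> x\<bar>)"

text \<open>
  The majorant \<open>U\<close> of the supremum over uncountably many radii is measurable, so several
  such bounds can be added.
\<close>

definition weighted_bound :: "real \<Rightarrow> real \<Rightarrow> real \<Rightarrow> ('a::euclidean_space \<Rightarrow> real) \<Rightarrow> bool" where
  "weighted_bound p r c K \<longleftrightarrow> (\<forall>w C f F. admissible_weight p r C w \<longrightarrow> f \<in> borel_measurable borel \<longrightarrow>
    (\<forall>j z. integrable lborel (on_triple f j z)) \<longrightarrow> 0 \<le> F \<longrightarrow> 0 \<le> C \<longrightarrow>
    (\<integral>\<^sup>+x. ennreal (\<bar>f x\<bar> powr p * w x) \<partial>lborel) = ennreal F \<longrightarrow>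
    (\<forall>x \<eta> \<delta>. 0 < \<eta> \<longrightarrow> \<eta> < \<delta> \<longrightarrow>
      integrable lborel (\<lambda>y. indicator (annulus x \<eta> \<delta>) y * (K (x - y) * f y))) \<and>
    (\<exists>U\<in>borel_measurable lborel. (AE x in lborel. epowr (max_annulus_int K f x) p * ennreal (w x) \<le> U x) \<and>
      (\<integral>\<^sup>+x. U x \<partial>lborel) \<le> ennreal ((c * C) powr p * F)))"

text \<open>
  A fixed pair of radii lies between \<open>1/(N+1)\<close> and \<open>N+1\<close> for all large
  \<open>N\<close>, so the \<open>N\<close>-th good truncation of the kernel sees it. The sparse
  bounds are uniform in \<open>N\<close>; their lower limit majorizes all pairs simultaneously, and
  Fatou's lemma bounds its integral.
\<close>

theorem annulus_int_bound:
  fixes K :: "'a::euclidean_space \<Rightarrow> real"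
  assumes K: "CZ_kernel A K" "radial_cancellation K" and p: "2 \<le> p" "p \<le> r"
  shows "\<exists>c>0. weighted_bound p r c K"
proof -
  obtain A' B where A': "0 < A'" and trunc: "\<forall>a b. 0 < a \<longrightarrow> (\<exists>k. good_kernel A' B k \<and> (\<forall>x. a \<le> norm x \<longrightarrow> norm x \<le> b \<longrightarrow> k x = K x))"
    using exists_good_truncation[OF K] by (elim exE conjE) (rule that)
  obtain C0 where C0: "0 < C0" and dom: "\<forall>(k :: 'a \<Rightarrow> real) f q. good_kernel A' B k \<longrightarrow>
    (\<forall>j x. integrable lborel (on_triple f j x)) \<longrightarrow>
    (\<exists>Om lev. sparse_tree Om lev \<and>
      (AE x in lborel. max_trunc k (on_triple f q x) x
        \<le> (\<Sum>m. indicator (Om m) x * ennreal (C0 * triple_mean f (lev m x) x))))"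
    using sparse_domination[OF A', of B, where 'a='a] by (elim exE conjE) (rule that)
  let ?sc = "sparse_const p r TYPE('a)"
  have p1: "1 < p / (p - 1)" using p by (simp add: field_simps)
  have sc: "0 < ?sc" using p p1 by (auto simp: sparse_const_def embedding_const_def intro!: mult_pos_pos divide_pos_pos)
  define c where "c = 2 * C0 * ?sc"
  have c: "0 < c" using C0 sc by (simp add: c_def)
  show ?thesis
    unfolding weighted_bound_def
  proof (intro exI[of _ c] conjI c allI impI)
    fix w f :: "'a \<Rightarrow> real" and C F :: real
    assume w: "admissible_weight p r C w" and f: "f \<in> borel_measurable borel"
      and loc: "\<forall>j z. integrable lborel (on_triple f j z)" and F: "0 \<le> F" and C: "0 \<le> C"
      and FI: "(\<integral>\<^sup>+x. ennreal (\<bar>f x\<bar> powr p * w x) \<partial>lborel) = ennreal F"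
    have w0: "\<And>x. 0 < w x" and [measurable]: "w \<in> borel_measurable borel" using w by (auto simp: admissible_weight_def)
    define a where "a N = 1 / real (Suc N)" for N
    define b where "b N = real (Suc N)" for N
    have a: "0 < a N" for N by (simp add: a_def)
    have ex_k: "\<exists>k. good_kernel A' B k \<and> (\<forall>x. a N \<le> norm x \<longrightarrow> norm x \<le> b N \<longrightarrow> k x = K x)" for N
      using trunc a by blast
    define k where "k N = (SOME k. good_kernel A' B k \<and> (\<forall>x. a N \<le> norm x \<longrightarrow> norm x \<le> b N \<longrightarrow> k x = K x))" for N
    have "good_kernel A' B (k N) \<and> (\<forall>x. a N \<le> norm x \<longrightarrow> norm x \<le> b N \<longrightarrow> k N x = K x)" for N
      using someI_ex[OF ex_k[of N]] unfolding k_def .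
    then have k: "good_kernel A' B (k N)" "\<And>x. a N \<le> norm x \<Longrightarrow> norm x \<le> b N \<Longrightarrow> k N x = K x" for N by blast+
    define q where "q N = int (Suc N)" for N
    have q: "b N \<le> 2 powi q N" for N
    proof -
      have "real (Suc N) \<le> real (2 ^ Suc N)" using less_exp[of "Suc N"] by (simp only: of_nat_le_iff less_imp_le)
      moreover have "2 powi q N = (2::real) ^ Suc N" unfolding q_def by (rule power_int_of_nat)
      ultimately show ?thesis by (simp only: b_def of_nat_power of_nat_numeral)
    qed
    have good: "integrable lborel (\<lambda>y. indicator (annulus x \<eta> \<delta>) y * (K (x - y) * f y))"
      "ennreal \<bar>annulus_int K f \<eta> \<delta> x\<bar> \<le> 2 * max_trunc (k N) (on_triple f (q N) x) x"
      if "a N \<le> \<eta>" "0 < \<eta>" "\<eta> < \<delta>" "\<delta> \<le> b N" for N \<eta> \<delta> x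
      by ((rule annulus_int_good[OF k(1)[of N] _ loc[rule_format] that q], rule k(2), assumption+)+)
    have large: "\<exists>N0. \<forall>N\<ge>N0. a N \<le> \<eta> \<and> \<delta> \<le> b N" if e: "0 < \<eta>" for \<eta> \<delta>
    proof -
      obtain N1 where N1: "inverse (real (Suc N1)) < \<eta>" using reals_Archimedean[OF e] by blast
      obtain N2 where N2: "\<delta> < real N2" using reals_Archimedean2 by blast
      have "a N \<le> \<eta> \<and> \<delta> \<le> b N" if "max N1 N2 \<le> N" for N
      proof
        have "1 / real (Suc N) \<le> 1 / real (Suc N1)" using that by (intro divide_left_mono) auto
        then show "a N \<le> \<eta>" using N1 by (simp add: a_def inverse_eq_divide)
        show "\<delta> \<le> b N" using N2 that by (simp add: b_def)
      qed
      then show ?thesis by blast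
    qed
    show "integrable lborel (\<lambda>y. indicator (annulus x \<eta> \<delta>) y * (K (x - y) * f y))"
      if e: "0 < \<eta>" "\<eta> < \<delta>" for x \<eta> \<delta>
    proof -
      obtain N where "a N \<le> \<eta>" "\<delta> \<le> b N" using large[OF e(1), of \<delta>] by blast
      then show ?thesis using good(1)[OF _ e] by blast
    qed
    let ?B = "ennreal ((C * ?sc) powr p * F)"
    have "\<exists>H. H \<in> borel_measurable borel \<and> (AE x in lborel. max_trunc (k N) (on_triple f (q N) x) x \<le> ennreal C0 * H x) \<and>
       (\<integral>\<^sup>+x. epowr (H x) p * ennreal (w x) \<partial>lborel) \<le> ?B" for N
    proof -
      obtain Om lev where T: "sparse_tree Om lev" and ae: "AE x in lborel. max_trunc (k N) (on_triple f (q N) x) x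
        \<le> (\<Sum>m. indicator (Om m) x * ennreal (C0 * triple_mean f (lev m x) x))"
        using dom[rule_format, OF k(1)[of N] loc[rule_format], of "q N"] by (elim exE conjE) (rule that)
      obtain H where H: "H \<in> borel_measurable borel" "\<And>x. (\<Sum>m. indicator (Om m) x * ennreal (triple_mean f (lev m x) x)) \<le> H x"
        "(\<integral>\<^sup>+x. epowr (H x) p * ennreal (w x) \<partial>lborel) \<le> ?B"
        by (rule sparse_operator_bound[OF p w T f loc[rule_format] FI F], rule that)
      have "AE x in lborel. max_trunc (k N) (on_triple f (q N) x) x \<le> ennreal C0 * H x"
        using ae
      proof eventually_elim
        fix x assume "max_trunc (k N) (on_triple f (q N) x) x \<le> (\<Sum>m. indicator (Om m) x * ennreal (C0 * triple_mean f (lev m x) x))"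
        also have "... = (\<Sum>m. ennreal C0 * (indicator (Om m) x * ennreal (triple_mean f (lev m x) x)))"
          using C0 by (intro suminf_cong) (auto simp: indicator_def ennreal_mult triple_mean_nonneg)
        also have "... = ennreal C0 * (\<Sum>m. indicator (Om m) x * ennreal (triple_mean f (lev m x) x))"
          by (rule ennreal_suminf_cmult)
        also have "... \<le> ennreal C0 * H x" by (intro mult_left_mono H) simp
        finally show "max_trunc (k N) (on_triple f (q N) x) x \<le> ennreal C0 * H x" .
      qed
      then show ?thesis using H by blast
    qed
    note ex_H = this
    define H where "H N = (SOME H. H \<in> borel_measurable borel \<and> (AE x in lborel. max_trunc (k N) (on_triple f (q N) x) x \<le> ennreal C0 * H x) \<and>
       (\<integral>\<^sup>+x. epowr (H x) p * ennreal (w x) \<partial>lborel) \<le> ?B)" for N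
    have H[measurable]: "H N \<in> borel_measurable borel"
      and Hae: "AE x in lborel. max_trunc (k N) (on_triple f (q N) x) x \<le> ennreal C0 * H N x"
      and HB: "(\<integral>\<^sup>+x. epowr (H N x) p * ennreal (w x) \<partial>lborel) \<le> ?B" for N
      using someI_ex[OF ex_H[of N], folded H_def] by blast+
    have [measurable]: "(\<lambda>x. epowr (g x) p) \<in> borel_measurable borel" if [measurable]: "g \<in> borel_measurable borel" for g :: "'a \<Rightarrow> ennreal"
      unfolding epowr_def by measurable
    define u where "u N x = epowr (2 * ennreal C0) p * (epowr (H N x) p * ennreal (w x))" for N x
    have [measurable]: "u N \<in> borel_measurable lborel" for N unfolding u_def[abs_def] by measurable
    have "AE x in lborel. \<forall>N. max_trunc (k N) (on_triple f (q N) x) x \<le> ennreal C0 * H N x"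
      using Hae by (subst AE_all_countable) blast
    then have ae: "AE x in lborel. epowr (max_annulus_int K f x) p * ennreal (w x)
        \<le> liminf (\<lambda>N. u N x)"
    proof eventually_elim
      fix x assume le: "\<forall>N. max_trunc (k N) (on_triple f (q N) x) x \<le> ennreal C0 * H N x"
      show "epowr (max_annulus_int K f x) p * ennreal (w x)
        \<le> liminf (\<lambda>N. u N x)"
        unfolding max_annulus_int_def
      proof (rule epowr_SUP_weight_le)
        fix i :: "real \<times> real" assume i: "i \<in> {(\<eta>, \<delta>). 0 < \<eta> \<and> \<eta> < \<delta>}"
        obtain \<eta> \<delta> where ed: "i = (\<eta>, \<delta>)" "0 < \<eta>" "\<eta> < \<delta>" using i by blast
        obtain N0 where N0: "\<forall>N\<ge>N0. a N \<le> \<eta> \<and> \<delta> \<le> b N" using large[OF ed(2)] by blast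
        have "epowr (ennreal \<bar>annulus_int K f \<eta> \<delta> x\<bar>) p * ennreal (w x) \<le> u N x" if "N0 \<le> N" for N
        proof -
          have "ennreal \<bar>annulus_int K f \<eta> \<delta> x\<bar> \<le> 2 * max_trunc (k N) (on_triple f (q N) x) x"
            using good(2)[OF _ ed(2,3)] N0 that by blast
          also have "... \<le> 2 * (ennreal C0 * H N x)" using le by (intro mult_left_mono) auto
          finally have "epowr (ennreal \<bar>annulus_int K f \<eta> \<delta> x\<bar>) p \<le> epowr (2 * ennreal C0 * H N x) p"
            using p by (intro epowr_mono) (simp_all add: mult.assoc)
          also have "... = epowr (2 * ennreal C0) p * epowr (H N x) p" using p by (intro epowr_mult) simp
          finally show ?thesis unfolding u_def mult.assoc[symmetric] by (intro mult_right_mono) simp_all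
        qed
        then have "epowr (ennreal \<bar>annulus_int K f \<eta> \<delta> x\<bar>) p * ennreal (w x) \<le> liminf (\<lambda>N. u N x)"
          by (intro Liminf_bounded) (auto simp: eventually_sequentially)
        then show "epowr (case i of (\<eta>, \<delta>) \<Rightarrow> ennreal \<bar>annulus_int K f \<eta> \<delta> x\<bar>) p * ennreal (w x) \<le> liminf (\<lambda>N. u N x)"
          by (simp add: ed)
      qed (use p w0 in auto)
    qed
    have "(\<integral>\<^sup>+x. liminf (\<lambda>N. u N x) \<partial>lborel) \<le> liminf (\<lambda>N. \<integral>\<^sup>+x. u N x \<partial>lborel)"
      by (rule nn_integral_liminf) measurable
    also have "... \<le> ennreal ((c * C) powr p * F)"
    proof -
      have "(\<integral>\<^sup>+x. u N x \<partial>lborel) \<le> ennreal ((c * C) powr p * F)" for N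
      proof -
        have "(\<integral>\<^sup>+x. u N x \<partial>lborel) = epowr (2 * ennreal C0) p * (\<integral>\<^sup>+x. epowr (H N x) p * ennreal (w x) \<partial>lborel)"
          unfolding u_def by (rule nn_integral_cmult) measurable
        also have "... \<le> epowr (2 * ennreal C0) p * ?B" by (intro mult_left_mono HB) simp
        also have "2 * ennreal C0 = ennreal (2 * C0)" using C0 by (simp add: ennreal_mult)
        also have "epowr (ennreal (2 * C0)) p * ?B = ennreal ((2 * C0) powr p * ((C * ?sc) powr p * F))"
          using C0 p F by (simp add: epowr_ennreal[of "2 * C0"] ennreal_mult[symmetric])
        also have "(2 * C0) powr p * ((C * ?sc) powr p * F) = (c * C) powr p * F"
          using C0 sc C by (simp add: c_def powr_mult mult_ac)
        finally show ?thesis .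
      qed
      then have "liminf (\<lambda>N. \<integral>\<^sup>+x. u N x \<partial>lborel) \<le> liminf (\<lambda>N::nat. ennreal ((c * C) powr p * F))"
        by (intro Liminf_mono) auto
      also have "... = ennreal ((c * C) powr p * F)" by (intro Liminf_const) simp
      finally show ?thesis .
    qed
    finally have B: "(\<integral>\<^sup>+x. liminf (\<lambda>N. u N x) \<partial>lborel) \<le> ennreal ((c * C) powr p * F)" .
    show "\<exists>U\<in>borel_measurable lborel. (AE x in lborel. epowr (max_annulus_int K f x) p * ennreal (w x) \<le> U x) \<and>
      (\<integral>\<^sup>+x. U x \<partial>lborel) \<le> ennreal ((c * C) powr p * F)"
      by (rule bexI[of _ "\<lambda>x. liminf (\<lambda>N. u N x)"], intro conjI ae B) measurable
  qed
qed

section \<open>Weights with finite mixed constant\<close>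

lemma nn_integral_lebesgue: "(\<integral>\<^sup>+x. g x \<partial>lebesgue) = (\<integral>\<^sup>+x. g x \<partial>lborel)"
  by (rule nn_integral_completion)

lemma epowr_pos: "0 < x \<Longrightarrow> epowr (ennreal x) a = ennreal (x powr a)"
  by (auto simp: epowr_def)

lemma epowr_neg_pos: "a < 0 \<Longrightarrow> 0 < epowr (ennreal x) a"
  by (cases "0 < x") (simp add: epowr_pos, simp add: epowr_def ennreal_neg)

lemma epowr_nonzero: "x \<noteq> 0 \<Longrightarrow> 0 \<le> a \<Longrightarrow> epowr x a \<noteq> 0"
  by (cases x) (simp_all add: epowr_pos, simp add: epowr_def)

lemma average_cong_AE:
  assumes "AE x in lborel. g x = h x"
  shows "average Q g = average Q h"
  unfolding average_def nn_integral_lebesgue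
  by (rule arg_cong[of _ _ "\<lambda>x. x / _"], rule nn_integral_cong_AE) (use assms in auto)

lemma mixed_constant_cong_AE:
  assumes "AE x in lborel. w x = v x"
  shows "mixed_constant p \<alpha> r \<beta> w = mixed_constant p \<alpha> r \<beta> v"
proof -
  have "Ap q w Q = Ap q v Q" for q Q
    unfolding Ap_def
    by (intro arg_cong2[where f="(*)"] arg_cong[of _ _ "\<lambda>x. epowr x _"] average_cong_AE) (use assms in auto)
  then show ?thesis by (simp add: mixed_constant_def)
qed

lemma opnorm_cong_AE:
  assumes "AE x in lborel. w x = v x"
  shows "opnorm p w T = opnorm p v T"
proof -
  have "wnorm p w g = wnorm p v g" for g
    unfolding wnorm_def nn_integral_lebesgue
    by (rule arg_cong[of _ _ "\<lambda>x. epowr x _"], rule nn_integral_cong_AE) (use assms in auto)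
  then show ?thesis by (simp add: opnorm_def Lp_def)
qed

text \<open>
  A weight is only Lebesgue measurable; the sparse bounds are formulated for Borel functions.
\<close>

definition regular_weight :: "('a::euclidean_space \<Rightarrow> real) \<Rightarrow> bool" where
  "regular_weight v \<longleftrightarrow> v \<in> borel_measurable borel \<and> (\<forall>x. 0 \<le> v x) \<and>
    (\<forall>a b. (\<integral>\<^sup>+x. indicator (cbox a b) x * ennreal (v x) \<partial>lborel) < top)"

lemma weight_regular_version:
  fixes w :: "'a::euclidean_space \<Rightarrow> real"
  assumes "weight w"
  obtains v where "regular_weight v" "AE x in lborel. w x = v x"
proof -
  have w0: "0 \<le> w x" for x using assms by (simp add: weight_def)
  have loc: "(\<lambda>x. indicator S x * w x) \<in> borel_measurable lebesgue" "integrable lebesgue (\<lambda>x. indicator S x * w x)"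
    if "compact S" for S
  proof -
    show "integrable lebesgue (\<lambda>x. indicator S x * w x)"
      using assms that by (simp add: weight_def set_integrable_def)
    then show "(\<lambda>x. indicator S x * w x) \<in> borel_measurable lebesgue" by (rule borel_measurable_integrable)
  qed
  have "w \<in> borel_measurable lebesgue"
  proof (rule borel_measurable_LIMSEQ_real)
    fix x :: 'a
    obtain N where "norm x \<le> real N" using real_arch_simple by blast
    then have "indicator (cball 0 (real n)) x * w x = w x" if "N \<le> n" for n using that by simp
    then show "(\<lambda>n. indicator (cball 0 (real n)) x * w x) \<longlonglongrightarrow> w x"
      by (intro tendsto_eventually) (auto simp: eventually_sequentially)
  qed (rule loc(1), rule compact_cball)
  then obtain v where v: "v \<in> borel_measurable lborel" "AE x in lborel. w x = v x"
    using completion_ex_borel_measurable_real[of w lborel] by blast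
  define u where "u x = max 0 (v x)" for x
  have ae: "AE x in lborel. w x = u x" using v(2)
  proof eventually_elim
    fix x assume "w x = v x"
    then show "w x = u x" using w0[of x] by (simp add: u_def)
  qed
  have "(\<integral>\<^sup>+x. indicator (cbox a b) x * ennreal (u x) \<partial>lborel) < top" for a b
  proof -
    have "(\<integral>\<^sup>+x. indicator (cbox a b) x * ennreal (u x) \<partial>lborel) = (\<integral>\<^sup>+x. ennreal (indicator (cbox a b) x * w x) \<partial>lebesgue)"
      unfolding nn_integral_lebesgue by (rule nn_integral_cong_AE) (use ae in \<open>auto simp: indicator_def\<close>)
    also have "... < top"
      using loc(2)[OF compact_cbox, of a b] w0 by (simp add: integrable_iff_bounded)
    finally show ?thesis .
  qed
  moreover have "u \<in> borel_measurable borel" using v(1) unfolding u_def[abs_def] by simp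
  ultimately show thesis by (intro that[OF _ ae]) (simp_all add: regular_weight_def, simp add: u_def)
qed

lemma average_top_iff:
  assumes "cube Q"
  shows "average Q g = top \<longleftrightarrow> (\<integral>\<^sup>+x. indicator Q x * g x \<partial>lborel) = top"
    "average Q g = 0 \<longleftrightarrow> (\<integral>\<^sup>+x. indicator Q x * g x \<partial>lborel) = 0"
proof -
  obtain a l where Q: "Q = cbox a (a + l *\<^sub>R One)" and l: "0 < l" using assms by (auto simp: cube_def)
  have "emeasure lborel Q = ennreal (l ^ DIM('a))" unfolding Q using half_open_cube(4)[of l a] l by simp
  then have m: "emeasure lebesgue Q = ennreal (l ^ DIM('a))" by (simp add: Q)
  have "0 < l ^ DIM('a)" using l by simp
  then show "average Q g = top \<longleftrightarrow> (\<integral>\<^sup>+x. indicator Q x * g x \<partial>lborel) = top"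
    "average Q g = 0 \<longleftrightarrow> (\<integral>\<^sup>+x. indicator Q x * g x \<partial>lborel) = 0"
    unfolding average_def m nn_integral_lebesgue using l
    by (simp_all add: ennreal_divide_eq_top_iff ennreal_divide_eq_0_iff mult.commute)
qed

lemma cube_pos_measure: "cube Q \<Longrightarrow> 0 < emeasure lborel Q"
  unfolding cube_def by (elim exE conjE) (simp add: half_open_cube(4))

lemma average_pos:
  assumes Q: "cube Q" and g: "g \<in> borel_measurable borel" "\<And>x. 0 < g x"
  shows "average Q g \<noteq> 0"
proof
  assume "average Q g = 0"
  moreover have Qm[measurable]: "Q \<in> sets borel" using Q by (auto simp: cube_def)
  ultimately have "AE x in lborel. indicator Q x * g x = 0"
    using g(1) average_top_iff(2)[OF Q] nn_integral_0_iff_AE[of "\<lambda>x. indicator Q x * g x" lborel] by simp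
  then have "AE x in lborel. x \<notin> Q"
    by eventually_elim (use g(2) in \<open>auto simp: indicator_def less_le split: if_splits\<close>)
  then have "emeasure lborel Q = 0" using AE_iff_null_sets[of Q lborel] by auto
  then show False using cube_pos_measure[OF Q] by simp
qed

lemma epowr_measurable [measurable]:
  assumes [measurable]: "g \<in> borel_measurable M"
  shows "(\<lambda>x. epowr (g x) a) \<in> borel_measurable M"
  unfolding epowr_def by measurable

text \<open>
  If the integral is infinite, then so is the \<open>A\<^sub>p\<close> factor, while the
  \<open>A\<^sub>r\<close> factor is positive; the product would be infinite.
\<close>

lemma dual_average_finite:
  fixes v :: "'a::euclidean_space \<Rightarrow> real"
  assumes v: "v \<in> borel_measurable borel" and p: "2 \<le> p" "p \<le> r" and Q: "cube Q"
    and fin: "mixed_constant p (1 / (p - 1)) r (1 - 1 / (p - 1)) v < top"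
    and mass: "(\<integral>\<^sup>+x. indicator Q x * ennreal (v x) \<partial>lborel) \<noteq> 0"
  shows "(\<integral>\<^sup>+x. indicator Q x * epowr (ennreal (v x)) (- (1 / (p - 1))) \<partial>lborel) < top"
proof (rule ccontr)
  assume "\<not> ?thesis"
  then have top: "average Q (\<lambda>x. epowr (ennreal (v x)) (- (1 / (p - 1)))) = top"
    unfolding average_top_iff(1)[OF Q] by (simp add: not_less top_unique)
  let ?W = "average Q (\<lambda>x. ennreal (v x))"
  have W: "?W \<noteq> 0" using mass by (simp add: average_top_iff(2)[OF Q])
  have "Ap p v Q = top" using W p by (simp add: Ap_def top epowr_top ennreal_mult_top)
  then have "epowr (Ap p v Q) (1 / (p - 1)) = top" using p by (simp add: epowr_top)
  moreover have "Ap r v Q \<noteq> 0"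
  proof -
    have "average Q (\<lambda>x. epowr (ennreal (v x)) (- (1 / (r - 1)))) \<noteq> 0"
      using p v by (intro average_pos[OF Q]) (auto intro!: epowr_neg_pos)
    then have "epowr (average Q (\<lambda>x. epowr (ennreal (v x)) (- (1 / (r - 1))))) (r - 1) \<noteq> 0"
      using p by (intro epowr_nonzero) simp_all
    then show ?thesis using W by (simp add: Ap_def)
  qed
  then have "epowr (Ap r v Q) (1 - 1 / (p - 1)) \<noteq> 0"
    using p by (intro epowr_nonzero) (simp_all add: field_simps)
  ultimately have "epowr (Ap p v Q) (1 / (p - 1)) * epowr (Ap r v Q) (1 - 1 / (p - 1)) = top"
    by (simp add: ennreal_top_mult)
  then have "top \<le> mixed_constant p (1 / (p - 1)) r (1 - 1 / (p - 1)) v"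
    unfolding mixed_constant_def using Q by (intro SUP_upper2[of Q]) simp_all
  then show False using fin by simp
qed

lemma cube_around:
  assumes "0 < k"
  shows "cube (cbox (- k *\<^sub>R One) (k *\<^sub>R One :: 'a::euclidean_space))"
proof -
  have "(2 * k) *\<^sub>R (One::'a) = k *\<^sub>R One + k *\<^sub>R One" by (simp only: mult_2 scaleR_add_left)
  then have "k *\<^sub>R (One::'a) = - k *\<^sub>R One + (2 * k) *\<^sub>R One" by simp
  then show ?thesis using assms unfolding cube_def by (intro exI[of _ "- k *\<^sub>R One"] exI[of _ "2 * k"]) simp
qed

lemma in_cube_around:
  fixes x :: "'a::euclidean_space"
  assumes "norm x \<le> k"
  shows "x \<in> cbox (- k *\<^sub>R One) (k *\<^sub>R One)"
  unfolding mem_box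
proof
  fix i :: 'a assume i: "i \<in> Basis"
  have "\<bar>x \<bullet> i\<bar> \<le> k" using Basis_le_norm[OF i, of x] assms by simp
  moreover have "(- k *\<^sub>R One) \<bullet> i = - k" "(k *\<^sub>R One) \<bullet> i = k" using i by simp_all
  ultimately show "(- k *\<^sub>R One) \<bullet> i \<le> x \<bullet> i \<and> x \<bullet> i \<le> (k *\<^sub>R One) \<bullet> i" by linarith
qed

text \<open>
  Where \<open>v\<close> vanishes, its negative powers are infinite, but they are integrable over
  every cube on which \<open>v\<close> has positive mass, hence over all large cubes about the origin
  unless \<open>v\<close> is null.
\<close>

lemma weight_positive:
  fixes v :: "'a::euclidean_space \<Rightarrow> real"
  assumes v: "regular_weight v" and p: "2 \<le> p" "p \<le> r"
    and fin: "mixed_constant p (1 / (p - 1)) r (1 - 1 / (p - 1)) v < top"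
    and nz: "\<not> (AE x in lborel. v x = 0)"
  shows "AE x in lborel. 0 < v x"
proof -
  let ?Q = "\<lambda>n. cbox (- real (Suc n) *\<^sub>R One) (real (Suc n) *\<^sub>R One :: 'a)"
  have vm[measurable]: "v \<in> borel_measurable borel" and v0: "\<And>x. 0 \<le> v x" using v by (auto simp: regular_weight_def)
  have "\<exists>N. (\<integral>\<^sup>+x. indicator (?Q N) x * ennreal (v x) \<partial>lborel) \<noteq> 0"
  proof (rule ccontr)
    assume "\<not> ?thesis"
    then have "AE x in lborel. indicator (?Q n) x * ennreal (v x) = 0" for n
      by (subst (asm) nn_integral_0_iff_AE) auto
    then have "AE x in lborel. \<forall>n. indicator (?Q n) x * ennreal (v x) = 0" by (subst AE_all_countable) blast
    then have "AE x in lborel. v x = 0"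
    proof eventually_elim
      fix x assume z: "\<forall>n. indicator (?Q n) x * ennreal (v x) = 0"
      obtain n where "norm x \<le> real n" using real_arch_simple by blast
      then have "x \<in> ?Q n" by (intro in_cube_around) simp
      then have "ennreal (v x) = 0" using z[rule_format, of n] by (simp only: indicator_simps mult_1)
      then show "v x = 0" using v0[of x] by (simp add: ennreal_eq_0_iff)
    qed
    then show False using nz by blast
  qed
  then obtain N where N: "(\<integral>\<^sup>+x. indicator (?Q N) x * ennreal (v x) \<partial>lborel) \<noteq> 0" by blast
  have "AE x in lborel. indicator (?Q (N + n)) x * epowr (ennreal (v x)) (- (1 / (p - 1))) \<noteq> \<infinity>" for n
  proof (rule nn_integral_PInf_AE)
    have sub: "?Q N \<subseteq> ?Q (N + n)"
      by (rule subset_box_imp) (auto simp: inner_minus_left)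
    have "(\<integral>\<^sup>+x. indicator (?Q N) x * ennreal (v x) \<partial>lborel) \<le> (\<integral>\<^sup>+x. indicator (?Q (N + n)) x * ennreal (v x) \<partial>lborel)"
      using sub by (intro nn_integral_mono mult_right_mono) (auto simp: indicator_def)
    then have "(\<integral>\<^sup>+x. indicator (?Q (N + n)) x * ennreal (v x) \<partial>lborel) \<noteq> 0" using N by auto
    from dual_average_finite[OF vm p cube_around fin this, OF of_nat_0_less_iff[THEN iffD2, OF zero_less_Suc]]
    show "(\<integral>\<^sup>+x. indicator (?Q (N + n)) x * epowr (ennreal (v x)) (- (1 / (p - 1))) \<partial>lborel) \<noteq> \<infinity>" by auto
  qed measurable
  then have "AE x in lborel. \<forall>n. indicator (?Q (N + n)) x * epowr (ennreal (v x)) (- (1 / (p - 1))) \<noteq> \<infinity>"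
    by (subst AE_all_countable) blast
  then show ?thesis
  proof eventually_elim
    fix x assume f: "\<forall>n. indicator (?Q (N + n)) x * epowr (ennreal (v x)) (- (1 / (p - 1))) \<noteq> \<infinity>"
    obtain n where "norm x \<le> real n" using real_arch_simple by blast
    then have "x \<in> ?Q (N + n)" by (intro in_cube_around) simp
    then have "epowr (ennreal (v x)) (- (1 / (p - 1))) \<noteq> top" using f[rule_format, of n] by (simp only: indicator_simps mult_1) simp
    then have "v x \<noteq> 0" using p by (auto simp: epowr_def)
    then show "0 < v x" using v0[of x] by simp
  qed
qed

lemma triple_mean_le_average:
  fixes g :: "'a::euclidean_space \<Rightarrow> real"
  assumes g: "g \<in> borel_measurable borel" "\<And>x. 0 \<le> g x"
    and Q: "Q = cbox (dcorner j z - 2 powi j *\<^sub>R One) (dcorner j z - 2 powi j *\<^sub>R One + (3 * 2 powi j) *\<^sub>R One)"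
    and fin: "(\<integral>\<^sup>+x. indicator Q x * ennreal (g x) \<partial>lborel) < top"
  shows "integrable lborel (\<lambda>x. indicator (dtriple j z) x * g x)"
    "ennreal (mass g (dtriple j z) / measure lborel (dtriple j z)) \<le> average Q (\<lambda>x. ennreal (g x))"
proof -
  have l: "0 \<le> 3 * (2::real) powi j" using two_powi_pos[of j, THEN less_imp_le] by simp
  have PQ: "dtriple j z \<subseteq> Q" unfolding dtriple_alt' Q by (rule half_open_cube(3)[OF l])
  have mP: "emeasure lborel (dtriple j z) = ennreal ((3 * 2 powi j) ^ DIM('a))" by (rule emeasure_dtriple)
  have mQ: "emeasure lborel Q = ennreal ((3 * 2 powi j) ^ DIM('a))" unfolding Q by (rule half_open_cube(4)[OF l])
  have le: "(\<integral>\<^sup>+x. ennreal (indicator (dtriple j z) x * g x) \<partial>lborel) \<le> (\<integral>\<^sup>+x. indicator Q x * ennreal (g x) \<partial>lborel)"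
    using PQ by (intro nn_integral_mono) (auto simp: indicator_def)
  show int: "integrable lborel (\<lambda>x. indicator (dtriple j z) x * g x)"
  proof (rule integrableI_nonneg)
    show "(\<integral>\<^sup>+x. ennreal (indicator (dtriple j z) x * g x) \<partial>lborel) < \<infinity>" using le fin by (simp add: le_less_trans)
  qed (use g in auto)
  have "ennreal (mass g (dtriple j z)) = (\<integral>\<^sup>+x. ennreal (indicator (dtriple j z) x * g x) \<partial>lborel)"
    unfolding mass_def using int g by (intro nn_integral_eq_integral[symmetric]) auto
  then have m: "ennreal (mass g (dtriple j z)) \<le> (\<integral>\<^sup>+x. indicator Q x * ennreal (g x) \<partial>lborel)" using le by simp
  have pos: "0 < (3 * (2::real) powi j) ^ DIM('a)" by simp
  have "measure lborel (dtriple j z) = (3 * 2 powi j) ^ DIM('a)" using mP l by (simp add: measure_def)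
  moreover have "0 \<le> mass g (dtriple j z)" unfolding mass_def using g by (intro integral_nonneg_AE) auto
  ultimately have "ennreal (mass g (dtriple j z) / measure lborel (dtriple j z)) = ennreal (mass g (dtriple j z)) / emeasure lborel Q"
    unfolding mQ using pos by (simp only: divide_ennreal)
  also have "... \<le> (\<integral>\<^sup>+x. indicator Q x * ennreal (g x) \<partial>lborel) / emeasure lborel Q" by (rule divide_right_mono_ennreal[OF m])
  also have "... = average Q (\<lambda>x. ennreal (g x))"
    unfolding average_def nn_integral_lebesgue by (simp add: Q mult.commute)
  finally show "ennreal (mass g (dtriple j z) / measure lborel (dtriple j z)) \<le> average Q (\<lambda>x. ennreal (g x))" .
qed

lemma ennreal_pos_cases:
  assumes "x \<noteq> 0" "x \<noteq> top"
  obtains s where "x = ennreal s" "0 < s"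
  using assms by (cases x) (auto simp: less_le)

lemma cube_average_product:
  fixes W S R p r :: real
  assumes p: "2 \<le> p" "p \<le> r" and pos: "0 < W" "0 < S" "0 < R"
  shows "epowr (ennreal W * epowr (ennreal S) (p - 1)) (1 / (p - 1)) * epowr (ennreal W * epowr (ennreal R) (r - 1)) (1 - 1 / (p - 1))
    = ennreal (W * S * R powr ((r - 1) * (1 - 1 / (p - 1))))"
proof -
  define \<alpha> where "\<alpha> = 1 / (p - 1)"
  have \<alpha>: "(p - 1) * \<alpha> = 1" using p by (simp add: \<alpha>_def)
  have 1: "epowr (ennreal W * epowr (ennreal S) (p - 1)) \<alpha> = ennreal (W powr \<alpha> * S)"
    using pos by (simp add: epowr_pos powr_mult powr_powr \<alpha> ennreal_mult[symmetric])
  have 2: "epowr (ennreal W * epowr (ennreal R) (r - 1)) (1 - \<alpha>) = ennreal (W powr (1 - \<alpha>) * R powr ((r - 1) * (1 - \<alpha>)))"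
    using pos by (simp add: epowr_pos powr_mult powr_powr ennreal_mult[symmetric])
  have "W powr \<alpha> * W powr (1 - \<alpha>) = W powr 1" unfolding powr_add[symmetric] by simp
  then have 3: "W powr \<alpha> * W powr (1 - \<alpha>) = W" using pos by simp
  have "ennreal (W powr \<alpha> * S) * ennreal (W powr (1 - \<alpha>) * R powr ((r - 1) * (1 - \<alpha>)))
      = ennreal (W powr \<alpha> * S * (W powr (1 - \<alpha>) * R powr ((r - 1) * (1 - \<alpha>))))"
    using pos by (intro ennreal_mult[symmetric]) auto
  also have "W powr \<alpha> * S * (W powr (1 - \<alpha>) * R powr ((r - 1) * (1 - \<alpha>)))
      = W powr \<alpha> * W powr (1 - \<alpha>) * S * R powr ((r - 1) * (1 - \<alpha>))"
    by (simp only: mult_ac)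
  finally show ?thesis unfolding \<alpha>_def[symmetric] 1 2 3 .
qed

text \<open>
  The triple of a dyadic cube is a half-open cube; its closure has the same measure and is one of the
  cubes in the supremum.
\<close>

lemma admissible_weightI:
  fixes v :: "'a::euclidean_space \<Rightarrow> real"
  assumes v: "regular_weight v" and pos: "\<And>x. 0 < v x" and p: "2 \<le> p" "p \<le> r"
    and L: "mixed_constant p (1 / (p - 1)) r (1 - 1 / (p - 1)) v = ennreal L" "0 \<le> L"
  shows "admissible_weight p r L v"
proof -
  have vm[measurable]: "v \<in> borel_measurable borel" using v by (auto simp: regular_weight_def)
  let ?a = "1 / (p - 1)" and ?b = "1 / (r - 1)"
  let ?\<gamma> = "(r - 1) * (1 - 1 / (p - 1))"
  have fin: "mixed_constant p ?a r (1 - ?a) v < top" using L by simp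
  have triple: "integrable lborel (\<lambda>x. indicator (dtriple j z) x * v x) \<and>
     integrable lborel (\<lambda>x. indicator (dtriple j z) x * v x powr (- ?a)) \<and>
     integrable lborel (\<lambda>x. indicator (dtriple j z) x * v x powr (- ?b)) \<and>
     mass v (dtriple j z) / measure lborel (dtriple j z)
      * (mass (\<lambda>x. v x powr (- ?a)) (dtriple j z) / measure lborel (dtriple j z))
      * (mass (\<lambda>x. v x powr (- ?b)) (dtriple j z) / measure lborel (dtriple j z)) powr ?\<gamma> \<le> L" for j z
  proof -
    define c where "c = dcorner j z - 2 powi j *\<^sub>R (One::'a)"
    define Q where "Q = cbox c (c + (3 * 2 powi j) *\<^sub>R One)"
    have Q: "cube Q" unfolding cube_def Q_def by (intro exI[of _ c] exI[of _ "3 * 2 powi j"]) simp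
    have Qm[measurable]: "Q \<in> sets borel" by (simp add: Q_def)
    have Wf: "(\<integral>\<^sup>+x. indicator Q x * ennreal (v x) \<partial>lborel) < top" using v by (simp add: regular_weight_def Q_def)
    have Wp: "average Q (\<lambda>x. ennreal (v x)) \<noteq> 0" using pos by (intro average_pos[OF Q]) auto
    then have "(\<integral>\<^sup>+x. indicator Q x * ennreal (v x) \<partial>lborel) \<noteq> 0" using average_top_iff(2)[OF Q] by blast
    from dual_average_finite[OF vm p Q fin this]
    have Sf: "(\<integral>\<^sup>+x. indicator Q x * ennreal (v x powr (- ?a)) \<partial>lborel) < top" using pos by (simp add: epowr_pos)
    have Rf: "(\<integral>\<^sup>+x. indicator Q x * ennreal (v x powr (- ?b)) \<partial>lborel) < top"
    proof -
      have ab: "?b \<le> ?a" "0 \<le> ?b" using p by (simp_all add: frac_le)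
      \<comment> \<open>The smaller of the two negative powers is controlled by the larger one and \<open>1\<close>.\<close>
      have "v x powr (- ?b) \<le> 1 + v x powr (- ?a)" for x
      proof (cases "1 \<le> v x")
        case True
        then have "v x powr (- ?b) \<le> v x powr 0" using ab by (intro powr_mono) auto
        then show ?thesis using pos[of x] by (simp add: add_increasing2)
      next
        case False
        then have "v x powr (- ?b) \<le> v x powr (- ?a)" using ab pos[of x] by (intro powr_mono') auto
        then show ?thesis by simp
      qed
      then have "ennreal (v x powr (- ?b)) \<le> 1 + ennreal (v x powr (- ?a))" for x
        by (simp add: ennreal_leI flip: ennreal_1 ennreal_plus)
      then have "(\<integral>\<^sup>+x. indicator Q x * ennreal (v x powr (- ?b)) \<partial>lborel)
        \<le> (\<integral>\<^sup>+x. indicator Q x + indicator Q x * ennreal (v x powr (- ?a)) \<partial>lborel)"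
        by (intro nn_integral_mono) (auto simp: indicator_def)
      also have "... = emeasure lborel Q + (\<integral>\<^sup>+x. indicator Q x * ennreal (v x powr (- ?a)) \<partial>lborel)"
        by (subst nn_integral_add) auto
      also have "... < top" using Sf emeasure_lborel_cbox_finite unfolding Q_def by (simp add: less_top)
      finally show ?thesis .
    qed
    note Qe = Q_def[unfolded c_def]
    note Wm = triple_mean_le_average[where g=v, OF vm less_imp_le[OF pos] Qe Wf]
    have Sg: "(\<lambda>x. v x powr (- ?a)) \<in> borel_measurable borel" by measurable
    note Sm = triple_mean_le_average[where g="\<lambda>x. v x powr (- ?a)", OF Sg powr_ge_zero Qe Sf]
    have Rg: "(\<lambda>x. v x powr (- ?b)) \<in> borel_measurable borel" by measurable
    note Rm = triple_mean_le_average[where g="\<lambda>x. v x powr (- ?b)", OF Rg powr_ge_zero Qe Rf]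
    let ?W = "average Q (\<lambda>x. ennreal (v x))" and ?S = "average Q (\<lambda>x. ennreal (v x powr (- ?a)))"
      and ?R = "average Q (\<lambda>x. ennreal (v x powr (- ?b)))"
    have nz: "?W \<noteq> 0" "?S \<noteq> 0" "?R \<noteq> 0" "?W \<noteq> top" "?S \<noteq> top" "?R \<noteq> top"
    proof -
      have "v x \<noteq> 0" for x using pos[of x] by simp
      then show "?S \<noteq> 0" "?R \<noteq> 0" by (intro average_pos[OF Q]; simp)+
    qed (use Wf Sf Rf Wp in \<open>simp_all add: average_top_iff(1)[OF Q]\<close>)
    obtain W where W: "?W = ennreal W" "0 < W" by (rule ennreal_pos_cases[OF nz(1,4)])
    obtain S where S: "?S = ennreal S" "0 < S" by (rule ennreal_pos_cases[OF nz(2,5)])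
    obtain R where R: "?R = ennreal R" "0 < R" by (rule ennreal_pos_cases[OF nz(3,6)])
    have "ennreal (W * S * R powr ?\<gamma>) = epowr (Ap p v Q) ?a * epowr (Ap r v Q) (1 - ?a)"
      unfolding cube_average_product[OF p W(2) S(2) R(2), symmetric] Ap_def epowr_pos[OF pos] W(1) S(1) R(1) ..
    also have "... \<le> ennreal L" unfolding L(1)[symmetric] mixed_constant_def using Q by (intro SUP_upper) simp
    finally have WSR: "W * S * R powr ?\<gamma> \<le> L" using L(2) by simp
    have \<gamma>: "0 \<le> ?\<gamma>" using p by (intro mult_nonneg_nonneg) (auto simp: field_simps)
    let ?w = "mass v (dtriple j z) / measure lborel (dtriple j z)"
      and ?s = "mass (\<lambda>x. v x powr (- ?a)) (dtriple j z) / measure lborel (dtriple j z)"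
      and ?t = "mass (\<lambda>x. v x powr (- ?b)) (dtriple j z) / measure lborel (dtriple j z)"
    have mass0: "0 \<le> mass g P" if "\<And>x. 0 \<le> g x" for g :: "'a \<Rightarrow> real" and P
      unfolding mass_def using that by (intro integral_nonneg_AE) auto
    have n0: "0 \<le> ?w" "0 \<le> ?s" "0 \<le> ?t" by (intro divide_nonneg_nonneg mass0 measure_nonneg powr_ge_zero less_imp_le[OF pos])+
    have "?w \<le> W" "?s \<le> S" "?t \<le> R" using Wm(2) Sm(2) Rm(2) W S R by simp_all
    moreover have "?t powr ?\<gamma> \<le> R powr ?\<gamma>" by (intro powr_mono2 \<gamma> n0(3) \<open>?t \<le> R\<close>)
    ultimately have "?w * ?s * ?t powr ?\<gamma> \<le> W * S * R powr ?\<gamma>"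
      by (intro mult_mono mult_nonneg_nonneg powr_ge_zero n0 less_imp_le[OF W(2)] less_imp_le[OF S(2)])
    then have "?w * ?s * ?t powr ?\<gamma> \<le> L" using WSR by linarith
    then show ?thesis using Wm(1) Sm(1) Rm(1) by (intro conjI)
  qed
  show ?thesis unfolding admissible_weight_def using vm pos triple by blast
qed

section \<open>The operator norm\<close>

lemma weighted_power: "0 \<le> a \<Longrightarrow> 0 < p \<Longrightarrow> 0 \<le> w \<Longrightarrow> ennreal (a powr p * w) = epowr (ennreal a) p * ennreal w"
  by (simp add: epowr_ennreal ennreal_mult)

lemma ennreal_sum4: "a + a + a + a = 4 * (a :: ennreal)"
proof -
  have "a + a + a + a = 2 * (2 * a)" by (simp only: mult_2 add.assoc)
  also have "... = 4 * a" by (simp add: mult.assoc[symmetric])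
  finally show ?thesis .
qed

lemma epowr_sum4_le:
  assumes p: "0 < p"
  shows "epowr (a + b + c + d) p \<le> epowr 4 p * (epowr a p + epowr b p + epowr c p + epowr d p)"
proof -
  define m where "m = max (max a b) (max c d)"
  have m: "a \<le> m" "b \<le> m" "c \<le> m" "d \<le> m" by (simp_all add: m_def le_max_iff_disj)
  have "a + b + c + d \<le> m + m + m + m" by (intro add_mono m)
  also have "... = 4 * m" by (rule ennreal_sum4)
  finally have "epowr (a + b + c + d) p \<le> epowr (4 * m) p" using p by (rule epowr_mono)
  also have "... = epowr 4 p * epowr m p" using p by (rule epowr_mult)
  also have "epowr m p \<le> epowr a p + epowr b p + epowr c p + epowr d p"
  proof -
    have "m = a \<or> m = b \<or> m = c \<or> m = d" unfolding m_def max_def by presburger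
    then show ?thesis by (elim disjE) (simp_all add: add_increasing add_increasing2)
  qed
  finally show ?thesis by (simp add: mult_left_mono)
qed

text \<open>
  \<open>\<bar>f\<bar> \<le> \<bar>f\<bar>\<^sup>p w + w\<^bsup>-1/(p-1)\<^esup>\<close>: if
  \<open>\<bar>f\<bar>\<close> exceeds the second term, then \<open>1 \<le>
  \<bar>f\<bar>\<^bsup>p-1\<^esup> w\<close>.
\<close>

lemma integrable_of_weighted:
  fixes w f :: "'a::euclidean_space \<Rightarrow> real"
  assumes w: "admissible_weight p r C w" and p: "2 \<le> p" and f: "f \<in> borel_measurable borel"
    and fin: "(\<integral>\<^sup>+x. ennreal (\<bar>f x\<bar> powr p * w x) \<partial>lborel) < top"
  shows "integrable lborel (on_triple f j z)"
proof (rule Bochner_Integration.integrable_bound)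
  let ?s = "\<lambda>x. w x powr (- (1 / (p - 1)))"
  have [measurable]: "w \<in> borel_measurable borel" "f \<in> borel_measurable borel" and w0: "\<And>x. 0 < w x"
    using w f by (auto simp: admissible_weight_def)
  have "integrable lborel (\<lambda>x. \<bar>f x\<bar> powr p * w x)"
    using fin by (intro integrableI_nonneg AE_I2 mult_nonneg_nonneg powr_ge_zero less_imp_le[OF w0]) auto
  moreover have "integrable lborel (\<lambda>x. indicator (dtriple j z) x * ?s x)" using w by (simp add: admissible_weight_def)
  ultimately show "integrable lborel (\<lambda>x. \<bar>f x\<bar> powr p * w x + indicator (dtriple j z) x * ?s x)"
    by (rule Bochner_Integration.integrable_add)
  have "\<bar>f x\<bar> \<le> \<bar>f x\<bar> powr p * w x + ?s x" for x
  proof (cases "\<bar>f x\<bar> \<le> ?s x")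
    case True
    then show ?thesis using w0[of x] by (simp add: add_increasing)
  next
    case False
    have s: "0 < ?s x" using w0[of x] by simp
    then have f0: "0 < \<bar>f x\<bar>" using False by linarith
    have "?s x powr (p - 1) = w x powr (-1)" using p by (simp add: powr_powr)
    then have "1 / w x = ?s x powr (p - 1)" using w0[of x] by (simp add: powr_minus_divide)
    also have "... \<le> \<bar>f x\<bar> powr (p - 1)" using False s p by (intro powr_mono2) auto
    finally have "1 \<le> \<bar>f x\<bar> powr (p - 1) * w x" using w0[of x] by (simp add: pos_divide_le_eq)
    then have "\<bar>f x\<bar> * 1 \<le> \<bar>f x\<bar> * (\<bar>f x\<bar> powr (p - 1) * w x)" by (rule mult_left_mono) simp
    also have "\<bar>f x\<bar> * (\<bar>f x\<bar> powr (p - 1) * w x) = \<bar>f x\<bar> powr p * w x"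
      using powr_mult_base[of "\<bar>f x\<bar>" "p - 1"] f0 by (simp add: mult.assoc[symmetric])
    finally show ?thesis using s by linarith
  qed
  then show "AE x in lborel. norm (on_triple f j z x) \<le> norm (\<bar>f x\<bar> powr p * w x + indicator (dtriple j z) x * ?s x)"
    using w0 by (intro AE_I2) (auto simp: on_triple_def indicator_def less_imp_le)
  show "on_triple f j z \<in> borel_measurable lborel" unfolding on_triple_def[abs_def] by measurable
qed

lemma complex_annulus_integral_le:
  fixes K f :: "'a::euclidean_space \<Rightarrow> complex" and f1 f2 :: "'a \<Rightarrow> real"
  defines "K1 \<equiv> \<lambda>x. Re (K x)" and "K2 \<equiv> \<lambda>x. Im (K x)"
  assumes K: "K1 \<in> borel_measurable borel" "K2 \<in> borel_measurable borel"
    and f: "f \<in> borel_measurable lebesgue" and f12: "f1 \<in> borel_measurable borel" "f2 \<in> borel_measurable borel"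
    and ae: "AE x in lborel. Re (f x) = f1 x" "AE x in lborel. Im (f x) = f2 x"
    and int: "\<And>k g. k \<in> {K1, K2} \<Longrightarrow> g \<in> {f1, f2} \<Longrightarrow>
      integrable lborel (\<lambda>y. indicator (annulus x \<eta> \<delta>) y * (k (x - y) * g y))"
  shows "norm (LINT y:annulus x \<eta> \<delta>|lebesgue. f y * K (x - y))
    \<le> \<bar>annulus_int K1 f1 \<eta> \<delta> x\<bar> + \<bar>annulus_int K2 f2 \<eta> \<delta> x\<bar> + \<bar>annulus_int K1 f2 \<eta> \<delta> x\<bar> + \<bar>annulus_int K2 f1 \<eta> \<delta> x\<bar>"
proof -
  let ?A = "(annulus x \<eta> \<delta>)"
  define g where "g k u y = indicator ?A y * (k (x - y) * u y)" for k u :: "'a \<Rightarrow> real" and y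
  have gi: "complex_integrable lborel (\<lambda>y. complex_of_real (g k u y))" if "k \<in> {K1, K2}" "u \<in> {f1, f2}" for k u
    using int[OF that] unfolding g_def by (rule integrable_of_real)
  have gi4: "complex_integrable lborel (\<lambda>y. complex_of_real (g K1 f1 y))" "complex_integrable lborel (\<lambda>y. complex_of_real (g K2 f2 y))"
    "complex_integrable lborel (\<lambda>y. complex_of_real (g K1 f2 y))" "complex_integrable lborel (\<lambda>y. complex_of_real (g K2 f1 y))"
    by (rule gi; simp)+
  have annulus: "annulus_int k u \<eta> \<delta> x = (\<integral>y. g k u y \<partial>lborel)" for k u
    by (simp add: annulus_int_def g_def)
  let ?h = "\<lambda>y. complex_of_real (g K1 f1 y) - complex_of_real (g K2 f2 y) + \<i> * (complex_of_real (g K1 f2 y) + complex_of_real (g K2 f1 y))"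
  note [measurable] = f f12
  have [measurable]: "K \<in> borel_measurable borel"
    using K unfolding K1_def K2_def by (simp add: borel_measurable_complex_iff)
  have Kx: "(\<lambda>y. K (x - y)) \<in> borel_measurable borel" by measurable
  then have [measurable]: "(\<lambda>y. K (x - y)) \<in> borel_measurable lebesgue" by (intro measurable_completion) simp
  have hm: "?h \<in> borel_measurable lborel"
    by (intro borel_measurable_add borel_measurable_diff borel_measurable_times borel_measurable_const gi4[THEN borel_measurable_integrable])
  have "(LINT y:?A|lebesgue. f y * K (x - y)) = (\<integral>y. ?h y \<partial>lebesgue)"
    unfolding set_lebesgue_integral_def
  proof (rule integral_cong_AE)
    have "?A \<in> sets lborel" by measurable
    then have "?A \<in> sets lebesgue" by (rule sets_completionI_sets)
    then show "(\<lambda>y. indicat_real ?A y *\<^sub>R (f y * K (x - y))) \<in> borel_measurable lebesgue" by measurable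
    show "?h \<in> borel_measurable lebesgue" using hm by (rule measurable_completion)
    show "AE y in lebesgue. indicat_real ?A y *\<^sub>R (f y * K (x - y)) = ?h y"
    proof (rule AE_completion)
      show "AE y in lborel. indicat_real ?A y *\<^sub>R (f y * K (x - y)) = ?h y"
        using ae by eventually_elim (simp add: complex_eq_iff g_def K1_def K2_def algebra_simps)
    qed
  qed
  also have "... = (\<integral>y. ?h y \<partial>lborel)" using hm by (rule integral_completion)
  also have "... = complex_of_real (annulus_int K1 f1 \<eta> \<delta> x) - complex_of_real (annulus_int K2 f2 \<eta> \<delta> x)
      + \<i> * (complex_of_real (annulus_int K1 f2 \<eta> \<delta> x) + complex_of_real (annulus_int K2 f1 \<eta> \<delta> x))"
    using gi4 by (simp add: annulus)
  also have "norm ... \<le> \<bar>annulus_int K1 f1 \<eta> \<delta> x\<bar> + \<bar>annulus_int K2 f2 \<eta> \<delta> x\<bar> + \<bar>annulus_int K1 f2 \<eta> \<delta> x\<bar> + \<bar>annulus_int K2 f1 \<eta> \<delta> x\<bar>"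
    by (rule order_trans[OF cmod_le]) simp
  finally show ?thesis .
qed

text \<open>
  Real and imaginary parts of \<open>K\<close> and \<open>f\<close> give four real operators. The
  \<open>p\<close>-th power of a sum of four is at most \<open>4\<^sup>p\<close> times the sum of the
  powers, and \<open>4 \<cdot> 4\<^sup>p \<le> 16\<^sup>p\<close> explains the factor
  \<open>16\<close>.
\<close>

theorem opnorm_admissible_weight:
  fixes K :: "'a::euclidean_space \<Rightarrow> complex"
  assumes K1: "CZ_kernel A (\<lambda>x. Re (K x))" "radial_cancellation (\<lambda>x. Re (K x))"
    and K2: "CZ_kernel B (\<lambda>x. Im (K x))" "radial_cancellation (\<lambda>x. Im (K x))"
    and p: "2 \<le> p" "p \<le> r"
  shows "\<exists>c>0. \<forall>w L. admissible_weight p r L w \<longrightarrow> 0 \<le> L \<longrightarrow> opnorm p w (max_sing_int K) \<le> ennreal (c * L)"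
proof -
  let ?K1 = "\<lambda>x. Re (K x)" and ?K2 = "\<lambda>x. Im (K x)"
  let ?int = "\<lambda>k g. \<forall>x \<eta> \<delta>. 0 < \<eta> \<longrightarrow> \<eta> < \<delta> \<longrightarrow>
      integrable lborel (\<lambda>y. indicator (annulus x \<eta> \<delta>) y * (k (x - y) * g y))"
  let ?G = "max_annulus_int"
  obtain c1 where c1: "0 < c1" and b1: "weighted_bound p r c1 ?K1"
    using annulus_int_bound[OF K1 p] by (elim exE conjE) (rule that)
  obtain c2 where c2: "0 < c2" and b2: "weighted_bound p r c2 ?K2"
    using annulus_int_bound[OF K2 p] by (elim exE conjE) (rule that)
  define c where "c = max c1 c2"
  have c: "0 < c" "c1 \<le> c" "c2 \<le> c" using c1 by (auto simp: c_def)
  have p0: "0 < p" using p by simp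
  show ?thesis
  proof (intro exI[of _ "16 * c"] conjI allI impI)
    fix w :: "'a \<Rightarrow> real" and L :: real
    assume w: "admissible_weight p r L w" and L: "0 \<le> L"
    have w0: "\<And>x. 0 < w x" and [measurable]: "w \<in> borel_measurable borel" using w by (auto simp: admissible_weight_def)
    have wn: "\<And>x. 0 \<le> w x" using w0 by (rule less_imp_le)
    show "opnorm p w (max_sing_int K) \<le> ennreal (16 * c * L)"
      unfolding opnorm_def
    proof (rule Inf_lower, rule CollectI, rule ballI)
      fix f assume fLp: "f \<in> Lp p w"
      define X where "X = (\<integral>\<^sup>+x. epowr (ennreal (norm (f x))) p * ennreal (w x) \<partial>lborel)"
      have wX: "wnorm p w (\<lambda>x. ennreal (norm (f x))) = epowr X (1 / p)"
        by (simp add: wnorm_def X_def nn_integral_lebesgue)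
      define Y where "Y = ennreal ((c * L) powr p) * X"
      have fm: "f \<in> borel_measurable lebesgue" and "epowr X (1 / p) < top" using fLp by (auto simp: Lp_def wX)
      then have X: "X < top" using p0 by (cases "X = top") (auto simp: epowr_top less_top)
      have "(\<lambda>x. Re (f x)) \<in> borel_measurable lebesgue" "(\<lambda>x. Im (f x)) \<in> borel_measurable lebesgue"
        using fm by (simp_all add: borel_measurable_complex_iff)
      from this[THEN completion_ex_borel_measurable_real]
      obtain f1 f2 where f12: "f1 \<in> borel_measurable borel" "f2 \<in> borel_measurable borel"
        and ae: "AE x in lborel. Re (f x) = f1 x" "AE x in lborel. Im (f x) = f2 x" by auto
      have bound: "?int k g \<and> (\<exists>U\<in>borel_measurable lborel. (AE x in lborel. epowr (?G k g x) p * ennreal (w x) \<le> U x) \<and>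
          (\<integral>\<^sup>+x. U x \<partial>lborel) \<le> Y)"
        if k: "k = ?K1 \<or> k = ?K2" and g: "g \<in> borel_measurable borel" and aeg: "AE x in lborel. \<bar>g x\<bar> \<le> norm (f x)" for k g
      proof -
        have "(\<integral>\<^sup>+x. ennreal (\<bar>g x\<bar> powr p * w x) \<partial>lborel) \<le> X"
          unfolding X_def
        proof (rule nn_integral_mono_AE)
          show "AE x in lborel. ennreal (\<bar>g x\<bar> powr p * w x) \<le> epowr (ennreal (norm (f x))) p * ennreal (w x)"
            using aeg
          proof eventually_elim
            fix x assume "\<bar>g x\<bar> \<le> norm (f x)"
            then show "ennreal (\<bar>g x\<bar> powr p * w x) \<le> epowr (ennreal (norm (f x))) p * ennreal (w x)"
              unfolding weighted_power[OF abs_ge_zero p0 wn] by (intro mult_right_mono epowr_mono p0 ennreal_leI) simp_all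
          qed
        qed
        then obtain F where F: "(\<integral>\<^sup>+x. ennreal (\<bar>g x\<bar> powr p * w x) \<partial>lborel) = ennreal F" "0 \<le> F" "ennreal F \<le> X"
          using X by (cases "\<integral>\<^sup>+x. ennreal (\<bar>g x\<bar> powr p * w x) \<partial>lborel") (auto simp: top_unique)
        have "(\<integral>\<^sup>+x. ennreal (\<bar>g x\<bar> powr p * w x) \<partial>lborel) < top" using F(1) by simp
        then have loc: "\<forall>j z. integrable lborel (on_triple g j z)" using integrable_of_weighted[OF w p(1) g] by blast
        obtain c' where c': "0 < c'" "c' \<le> c" and b: "?int k g \<and>
          (\<exists>U\<in>borel_measurable lborel. (AE x in lborel. epowr (?G k g x) p * ennreal (w x) \<le> U x) \<and>
          (\<integral>\<^sup>+x. U x \<partial>lborel) \<le> ennreal ((c' * L) powr p * F))"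
          using k
        proof
          assume "k = ?K1"
          then show ?thesis
            using that[OF c1 c(2)] b1[unfolded weighted_bound_def, rule_format, OF w g loc[rule_format] F(2) L F(1)] by simp
        next
          assume "k = ?K2"
          then show ?thesis
            using that[OF c2 c(3)] b2[unfolded weighted_bound_def, rule_format, OF w g loc[rule_format] F(2) L F(1)] by simp
        qed
        have "ennreal ((c' * L) powr p * F) \<le> ennreal ((c * L) powr p * F)"
          using c' L F(2) p0 by (intro ennreal_leI mult_right_mono powr_mono2) auto
        also have "... = ennreal ((c * L) powr p) * ennreal F" using F(2) by (simp add: ennreal_mult)
        also have "... \<le> Y" unfolding Y_def using F(3) by (rule mult_left_mono) simp
        finally have le: "ennreal ((c' * L) powr p * F) \<le> Y" .
        from b obtain U where "U \<in> borel_measurable lborel" "AE x in lborel. epowr (?G k g x) p * ennreal (w x) \<le> U x"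
          "(\<integral>\<^sup>+x. U x \<partial>lborel) \<le> ennreal ((c' * L) powr p * F)" by (elim conjE bexE) (rule that)
        with b le show ?thesis by (intro conjI bexI[of _ U]) (simp_all add: order_trans[OF _ le])
      qed
      have af1: "AE x in lborel. \<bar>f1 x\<bar> \<le> norm (f x)" using ae(1)
      proof eventually_elim
        fix x assume "Re (f x) = f1 x"
        then show "\<bar>f1 x\<bar> \<le> norm (f x)" using abs_Re_le_cmod[of "f x"] by simp
      qed
      have af2: "AE x in lborel. \<bar>f2 x\<bar> \<le> norm (f x)" using ae(2)
      proof eventually_elim
        fix x assume "Im (f x) = f2 x"
        then show "\<bar>f2 x\<bar> \<le> norm (f x)" using abs_Im_le_cmod[of "f x"] by simp
      qed
      note B11 = bound[OF disjI1[OF refl] f12(1) af1] and B12 = bound[OF disjI1[OF refl] f12(2) af2]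
        and B21 = bound[OF disjI2[OF refl] f12(1) af1] and B22 = bound[OF disjI2[OF refl] f12(2) af2]
      from B11 obtain U11 where U11: "U11 \<in> borel_measurable lborel" "AE x in lborel. epowr (?G ?K1 f1 x) p * ennreal (w x) \<le> U11 x"
          "(\<integral>\<^sup>+x. U11 x \<partial>lborel) \<le> Y" by (elim conjE bexE) (rule that)
      from B12 obtain U12 where U12: "U12 \<in> borel_measurable lborel" "AE x in lborel. epowr (?G ?K1 f2 x) p * ennreal (w x) \<le> U12 x"
          "(\<integral>\<^sup>+x. U12 x \<partial>lborel) \<le> Y" by (elim conjE bexE) (rule that)
      from B21 obtain U21 where U21: "U21 \<in> borel_measurable lborel" "AE x in lborel. epowr (?G ?K2 f1 x) p * ennreal (w x) \<le> U21 x"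
          "(\<integral>\<^sup>+x. U21 x \<partial>lborel) \<le> Y" by (elim conjE bexE) (rule that)
      from B22 obtain U22 where U22: "U22 \<in> borel_measurable lborel" "AE x in lborel. epowr (?G ?K2 f2 x) p * ennreal (w x) \<le> U22 x"
          "(\<integral>\<^sup>+x. U22 x \<partial>lborel) \<le> Y" by (elim conjE bexE) (rule that)
      note [measurable] = U11(1) U12(1) U21(1) U22(1)
      have Km: "?K1 \<in> borel_measurable borel" "?K2 \<in> borel_measurable borel" using K1 K2 by (simp_all add: CZ_kernel_def)
      have pt: "max_sing_int K f x \<le> ?G ?K1 f1 x + ?G ?K2 f2 x + ?G ?K1 f2 x + ?G ?K2 f1 x" for x
        unfolding max_sing_int_def
      proof (rule SUP_least)
        fix i :: "real \<times> real" assume i: "i \<in> {(\<eta>, \<delta>). 0 < \<eta> \<and> \<eta> < \<delta>}"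
        obtain \<eta> \<delta> where ed: "i = (\<eta>, \<delta>)" "0 < \<eta>" "\<eta> < \<delta>" using i by blast
        have up: "ennreal \<bar>annulus_int k g \<eta> \<delta> x\<bar> \<le> ?G k g x" for k g
          unfolding max_annulus_int_def by (rule SUP_upper2[of "(\<eta>, \<delta>)"]) (use ed in auto)
        have "norm (LINT y:annulus x \<eta> \<delta>|lebesgue. f y * K (x - y))
          \<le> \<bar>annulus_int ?K1 f1 \<eta> \<delta> x\<bar> + \<bar>annulus_int ?K2 f2 \<eta> \<delta> x\<bar> + \<bar>annulus_int ?K1 f2 \<eta> \<delta> x\<bar> + \<bar>annulus_int ?K2 f1 \<eta> \<delta> x\<bar>"
        proof (rule complex_annulus_integral_le[OF Km fm f12 ae])
          fix k g assume k: "k \<in> {?K1, ?K2}" and g: "g \<in> {f1, f2}"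
          have "?int k g" using k g B11 B12 B21 B22 by blast
          then show "integrable lborel (\<lambda>y. indicator (annulus x \<eta> \<delta>) y * (k (x - y) * g y))"
            using ed(2,3) by blast
        qed
        then have "ennreal (norm (LINT y:annulus x \<eta> \<delta>|lebesgue. f y * K (x - y)))
          \<le> ennreal (\<bar>annulus_int ?K1 f1 \<eta> \<delta> x\<bar> + \<bar>annulus_int ?K2 f2 \<eta> \<delta> x\<bar> + \<bar>annulus_int ?K1 f2 \<eta> \<delta> x\<bar> + \<bar>annulus_int ?K2 f1 \<eta> \<delta> x\<bar>)"
          by (rule ennreal_leI)
        also have "... = ennreal \<bar>annulus_int ?K1 f1 \<eta> \<delta> x\<bar> + ennreal \<bar>annulus_int ?K2 f2 \<eta> \<delta> x\<bar>
            + ennreal \<bar>annulus_int ?K1 f2 \<eta> \<delta> x\<bar> + ennreal \<bar>annulus_int ?K2 f1 \<eta> \<delta> x\<bar>"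
          by simp
        also have "... \<le> ?G ?K1 f1 x + ?G ?K2 f2 x + ?G ?K1 f2 x + ?G ?K2 f1 x" by (intro add_mono up)
        finally show "(case i of (\<eta>, \<delta>) \<Rightarrow> ennreal (norm (LINT y:annulus x \<eta> \<delta>|lebesgue. f y * K (x - y))))
          \<le> ?G ?K1 f1 x + ?G ?K2 f2 x + ?G ?K1 f2 x + ?G ?K2 f1 x" by (simp add: ed(1))
      qed
      let ?U = "\<lambda>x. epowr 4 p * (U11 x + U22 x + U12 x + U21 x)"
      have "(\<integral>\<^sup>+x. epowr (max_sing_int K f x) p * ennreal (w x) \<partial>lborel) \<le> (\<integral>\<^sup>+x. ?U x \<partial>lborel)"
      proof (rule nn_integral_mono_AE)
        show "AE x in lborel. epowr (max_sing_int K f x) p * ennreal (w x) \<le> ?U x"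
          using U11(2) U12(2) U21(2) U22(2)
        proof eventually_elim
          fix x assume u: "epowr (?G ?K1 f1 x) p * ennreal (w x) \<le> U11 x" "epowr (?G ?K1 f2 x) p * ennreal (w x) \<le> U12 x"
            "epowr (?G ?K2 f1 x) p * ennreal (w x) \<le> U21 x" "epowr (?G ?K2 f2 x) p * ennreal (w x) \<le> U22 x"
          have "epowr (max_sing_int K f x) p \<le> epowr (?G ?K1 f1 x + ?G ?K2 f2 x + ?G ?K1 f2 x + ?G ?K2 f1 x) p"
            by (rule epowr_mono[OF pt p0])
          also have "... \<le> epowr 4 p * (epowr (?G ?K1 f1 x) p + epowr (?G ?K2 f2 x) p + epowr (?G ?K1 f2 x) p + epowr (?G ?K2 f1 x) p)"
            by (rule epowr_sum4_le[OF p0])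
          finally have "epowr (max_sing_int K f x) p * ennreal (w x)
            \<le> epowr 4 p * (epowr (?G ?K1 f1 x) p + epowr (?G ?K2 f2 x) p + epowr (?G ?K1 f2 x) p + epowr (?G ?K2 f1 x) p) * ennreal (w x)"
            by (rule mult_right_mono) simp
          also have "... = epowr 4 p * (epowr (?G ?K1 f1 x) p * ennreal (w x) + epowr (?G ?K2 f2 x) p * ennreal (w x)
              + epowr (?G ?K1 f2 x) p * ennreal (w x) + epowr (?G ?K2 f1 x) p * ennreal (w x))"
            by (simp only: distrib_right mult.assoc)
          also have "... \<le> ?U x" by (intro mult_left_mono add_mono u) simp
          finally show "epowr (max_sing_int K f x) p * ennreal (w x) \<le> ?U x" .
        qed
      qed
      also have "... = epowr 4 p * ((\<integral>\<^sup>+x. U11 x \<partial>lborel) + (\<integral>\<^sup>+x. U22 x \<partial>lborel) + (\<integral>\<^sup>+x. U12 x \<partial>lborel) + (\<integral>\<^sup>+x. U21 x \<partial>lborel))"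
        by (simp add: nn_integral_cmult nn_integral_add)
      also have "... \<le> epowr 4 p * (Y + Y + Y + Y)"
        by (intro mult_left_mono add_mono U11 U12 U21 U22) simp
      also have "... = ennreal (4 powr p * (4 * (c * L) powr p)) * X"
      proof -
        have e: "epowr 4 p = ennreal (4 powr p)" using epowr_pos[of 4 p] by simp
        have "Y + Y + Y + Y
          = ennreal (4 * (c * L) powr p) * X"
          unfolding ennreal_sum4 Y_def by (simp add: ennreal_mult mult.assoc)
        then show ?thesis by (simp add: e ennreal_mult mult.assoc)
      qed
      also have "... \<le> ennreal ((16 * c * L) powr p) * X"
      proof (intro mult_right_mono ennreal_leI)
        have "(4::real) powr 1 \<le> 4 powr p" using p by (intro powr_mono) auto
        then have "4 powr p * (4 * (c * L) powr p) \<le> 4 powr p * (4 powr p * (c * L) powr p)"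
          by (intro mult_left_mono mult_right_mono) auto
        also have "... = (4 * (4 * (c * L))) powr p" using c L by (simp only: powr_mult mult_nonneg_nonneg less_imp_le zero_le_numeral)
        finally show "4 powr p * (4 * (c * L) powr p) \<le> (16 * c * L) powr p" by (simp add: mult.assoc[symmetric])
      qed simp
      finally have "epowr (\<integral>\<^sup>+x. epowr (max_sing_int K f x) p * ennreal (w x) \<partial>lborel) (1 / p)
          \<le> epowr (ennreal ((16 * c * L) powr p) * X) (1 / p)"
        using p0 by (intro epowr_mono) auto
      also have "... = epowr (ennreal ((16 * c * L) powr p)) (1 / p) * epowr X (1 / p)" using p0 by (intro epowr_mult) simp
      also have "epowr (ennreal ((16 * c * L) powr p)) (1 / p) = ennreal (16 * c * L)"
        using p0 c L by (simp add: epowr_ennreal powr_powr)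
      finally show "wnorm p w (max_sing_int K f) \<le> ennreal (16 * c * L) * wnorm p w (\<lambda>x. ennreal (norm (f x)))"
        unfolding wX wnorm_def[of p w "max_sing_int K f"] nn_integral_lebesgue .
    qed
  qed (use c in simp)
qed

lemma opnorm_null_weight:
  assumes "AE x in lborel. w x = 0" "0 < p"
  shows "opnorm p w T = 0"
proof -
  have "wnorm p w g = 0" for g
  proof -
    have "AE x in lborel. epowr (g x) p * ennreal (w x) = 0" using assms(1) by eventually_elim simp
    from nn_integral_cong_AE[OF this] show ?thesis using assms(2) by (simp add: wnorm_def nn_integral_lebesgue epowr_def)
  qed
  then have "opnorm p w T \<le> 0" unfolding opnorm_def by (intro Inf_lower) simp
  then show ?thesis by simp
qed

text \<open>
  The bound is trivial if the constant is infinite or the weight is null. Otherwise the weight agrees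
  almost everywhere with an admissible one.
\<close>

theorem opnorm_le_mixed_constant:
  fixes K :: "'a::euclidean_space \<Rightarrow> complex"
  assumes K1: "CZ_kernel A (\<lambda>x. Re (K x))" "radial_cancellation (\<lambda>x. Re (K x))"
    and K2: "CZ_kernel B (\<lambda>x. Im (K x))" "radial_cancellation (\<lambda>x. Im (K x))"
    and p: "2 \<le> p" "p \<le> r"
  shows "\<exists>c>0. \<forall>w. weight w \<longrightarrow> opnorm p w (max_sing_int K)
    \<le> ennreal c * mixed_constant p (1 / (p - 1)) r (1 - 1 / (p - 1)) w"
proof -
  obtain c where c: "0 < c" and bound: "\<forall>w L. admissible_weight p r L w \<longrightarrow> 0 \<le> L \<longrightarrow> opnorm p w (max_sing_int K) \<le> ennreal (c * L)"
    using opnorm_admissible_weight[OF K1 K2 p] by (elim exE conjE) (rule that)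
  show ?thesis
  proof (intro exI[of _ c] conjI c allI impI)
    fix w :: "'a \<Rightarrow> real" assume "weight w"
    then obtain v where v: "regular_weight v" and wv: "AE x in lborel. w x = v x" by (rule weight_regular_version)
    let ?M = "mixed_constant p (1 / (p - 1)) r (1 - 1 / (p - 1))"
    have "?M v = top \<or> ?M v < top" by (simp add: less_top[symmetric])
    then consider "?M v = top" | "AE x in lborel. v x = 0" | "?M v < top" "\<not> (AE x in lborel. v x = 0)"
      by blast
    then have "opnorm p v (max_sing_int K) \<le> ennreal c * ?M v"
    proof cases
      case 1
      then show ?thesis using c by (simp add: ennreal_mult_top)
    next
      case 2
      then show ?thesis using p by (simp add: opnorm_null_weight)
    next
      case 3
      define u where "u x = (if v x \<le> 0 then 1 else v x)" for x
      have vu: "AE x in lborel. v x = u x"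
        using weight_positive[OF v p 3] by eventually_elim (simp add: u_def)
      have vm[measurable]: "v \<in> borel_measurable borel" using v by (simp add: regular_weight_def)
      have "(\<integral>\<^sup>+x. indicator (cbox a b) x * ennreal (u x) \<partial>lborel) = (\<integral>\<^sup>+x. indicator (cbox a b) x * ennreal (v x) \<partial>lborel)" for a b
      proof (rule nn_integral_cong_AE)
        show "AE x in lborel. indicator (cbox a b) x * ennreal (u x) = indicator (cbox a b) x * ennreal (v x)"
          using vu by eventually_elim simp
      qed
      then have u: "regular_weight u" using v by (auto simp: regular_weight_def u_def[abs_def])
      obtain L where L: "?M u = ennreal L" "0 \<le> L"
        using 3(1) mixed_constant_cong_AE[OF vu] by (cases "?M u") auto
      have "admissible_weight p r L u" by (rule admissible_weightI[OF u _ p L]) (simp add: u_def)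
      then have "opnorm p u (max_sing_int K) \<le> ennreal (c * L)" using bound L(2) by blast
      also have "... = ennreal c * ?M u" using c L by (simp add: ennreal_mult)
      finally show ?thesis unfolding opnorm_cong_AE[OF vu] mixed_constant_cong_AE[OF vu] .
    qed
    then show "opnorm p w (max_sing_int K) \<le> ennreal c * ?M w"
      unfolding opnorm_cong_AE[OF wv] mixed_constant_cong_AE[OF wv] .
  qed
qed

section \<open>The kernels\<close>

text \<open>A change of variables by \<open>U\<close> turns the integral into its negative.\<close>

lemma radial_cancellationI:
  fixes K :: "'a::euclidean_space \<Rightarrow> real"
  assumes K[measurable]: "K \<in> borel_measurable borel" and U[measurable]: "U \<in> borel_measurable borel"
    and inv: "distr lborel borel U = (lborel :: 'a measure)" and norm: "\<And>x. norm (U x) = norm x"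
    and odd: "\<And>x. x \<noteq> 0 \<Longrightarrow> K (U x) = - K x"
  shows "radial_cancellation K"
  unfolding radial_cancellation_def
proof (intro allI impI)
  fix \<phi> :: "real \<Rightarrow> real" assume [measurable]: "\<phi> \<in> borel_measurable borel"
  have "(\<integral>x. \<phi> (norm x) * K x \<partial>lborel) = (\<integral>x. \<phi> (norm x) * K x \<partial>distr lborel borel U)" by (simp add: inv)
  also have "... = (\<integral>x. \<phi> (norm (U x)) * K (U x) \<partial>lborel)" by (rule integral_distr) measurable
  also have "... = (\<integral>x. - (\<phi> (norm x) * K x) \<partial>lborel)"
  proof (rule integral_cong_AE)
    show "AE x in lborel. \<phi> (norm (U x)) * K (U x) = - (\<phi> (norm x) * K x)"
      using AE_lborel_singleton[of 0] by eventually_elim (simp add: norm odd)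
  qed measurable
  also have "... = - (\<integral>x. \<phi> (norm x) * K x \<partial>lborel)" by simp
  finally show "(\<integral>x. \<phi> (norm x) * K x \<partial>lborel) = 0" by simp
qed

theorem maximal_operator_bound:
  fixes K :: "'a::euclidean_space \<Rightarrow> complex"
  assumes A: "0 < A" and K: "K \<in> borel_measurable borel"
    and size: "\<And>x. x \<noteq> 0 \<Longrightarrow> norm (K x) \<le> A / norm x ^ DIM('a)"
    and smooth: "\<And>x y. x \<noteq> 0 \<Longrightarrow> 2 * norm (x - y) \<le> norm x \<Longrightarrow> norm (K x - K y) \<le> A * norm (x - y) / norm x ^ (DIM('a) + 1)"
    and U: "U \<in> borel_measurable borel" "distr lborel borel U = (lborel :: 'a measure)"
      "\<And>x. norm (U x) = norm x" "\<And>x. x \<noteq> 0 \<Longrightarrow> K (U x) = - K x"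
    and p: "2 \<le> p" "p \<le> r"
  shows "\<exists>c>0. \<forall>w. weight w \<longrightarrow> opnorm p w (max_sing_int K)
    \<le> ennreal c * mixed_constant p (1 / (p - 1)) r (1 - 1 / (p - 1)) w"
proof (rule opnorm_le_mixed_constant[OF _ _ _ _ p])
  have m: "(\<lambda>x. Re (K x)) \<in> borel_measurable borel" "(\<lambda>x. Im (K x)) \<in> borel_measurable borel"
    using K by (simp_all add: borel_measurable_complex_iff)
  show "CZ_kernel A (\<lambda>x. Re (K x))" "CZ_kernel A (\<lambda>x. Im (K x))"
    unfolding CZ_kernel_def
    using A m order_trans[OF abs_Re_le_cmod size] order_trans[OF abs_Im_le_cmod size]
      order_trans[OF abs_Re_le_cmod smooth] order_trans[OF abs_Im_le_cmod smooth] by auto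
  show "radial_cancellation (\<lambda>x. Re (K x))" "radial_cancellation (\<lambda>x. Im (K x))"
    by (rule radial_cancellationI[OF _ U(1,2,3)]; simp add: m U(4))+
qed

lemma reflection_preserves_lborel: "distr lborel borel uminus = (lborel :: 'a::euclidean_space measure)"
  using lborel_distr_reflect[of "0::'a"] by simp

lemma power_diff_le:
  fixes a b :: real
  assumes "0 \<le> a" "a \<le> M" "0 \<le> b" "b \<le> M"
  shows "\<bar>a ^ Suc m - b ^ Suc m\<bar> \<le> real (Suc m) * M ^ m * \<bar>a - b\<bar>"
proof (induction m)
  case (Suc m)
  have "a ^ Suc (Suc m) - b ^ Suc (Suc m) = a * (a ^ Suc m - b ^ Suc m) + (a - b) * b ^ Suc m"
    by (simp add: algebra_simps)
  also have "\<bar>...\<bar> \<le> \<bar>a\<bar> * \<bar>a ^ Suc m - b ^ Suc m\<bar> + \<bar>a - b\<bar> * \<bar>b ^ Suc m\<bar>"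
    unfolding abs_mult[symmetric] by (rule abs_triangle_ineq)
  also have "... \<le> M * (real (Suc m) * M ^ m * \<bar>a - b\<bar>) + \<bar>a - b\<bar> * M ^ Suc m"
  proof (intro add_mono mult_mono Suc)
    have "b ^ Suc m \<le> M ^ Suc m" by (intro power_mono assms)
    then show "\<bar>b ^ Suc m\<bar> \<le> M ^ Suc m" using assms(3) by simp
  qed (use assms in auto)
  also have "... = real (Suc (Suc m)) * M ^ Suc m * \<bar>a - b\<bar>" by (simp add: algebra_simps)
  finally show ?case .
qed simp

theorem riesz_transform_bound:
  fixes u :: "'a::euclidean_space"
  assumes u: "u \<in> Basis" and p: "2 \<le> p" "p \<le> r"
  shows "\<exists>c>0. \<forall>w :: 'a \<Rightarrow> real. weight w \<longrightarrow> opnorm p w (max_sing_int (\<lambda>x. complex_of_real ((x \<bullet> u) / norm x ^ (DIM('a) + 1))))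
    \<le> ennreal c * mixed_constant p (1 / (p - 1)) r (1 - 1 / (p - 1)) w"
proof (rule maximal_operator_bound[OF _ _ _ _ _ reflection_preserves_lborel _ _ p])
  let ?n = "DIM('a)"
  let ?A = "1 + real (?n + 1) * 2 ^ ?n"
  show A: "0 < ?A" by (intro add_pos_nonneg) auto
  show "(\<lambda>x. complex_of_real ((x \<bullet> u) / norm x ^ (?n + 1))) \<in> borel_measurable borel" by measurable
  have comp: "\<bar>x \<bullet> u\<bar> \<le> norm x" for x :: 'a by (rule Basis_le_norm[OF u])
  fix x :: 'a assume x: "x \<noteq> 0"
  have "\<bar>(x \<bullet> u) / norm x ^ (?n + 1)\<bar> \<le> norm x / norm x ^ (?n + 1)"
    unfolding abs_divide using comp[of x] by (simp add: divide_right_mono del: power_Suc)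
  also have "... = 1 / norm x ^ ?n" using x by simp
  also have "... \<le> ?A / norm x ^ ?n" by (intro divide_right_mono) auto
  finally show "norm (complex_of_real ((x \<bullet> u) / norm x ^ (?n + 1))) \<le> ?A / norm x ^ ?n" by (simp only: norm_of_real)
  fix y :: 'a assume near: "2 * norm (x - y) \<le> norm x"
  define a b d where "a = norm x" and "b = norm y" and "d = norm (x - y)"
  have ab: "0 < a" "\<bar>a - b\<bar> \<le> d" "2 * d \<le> a"
    using x near norm_triangle_ineq3[of x y] by (auto simp: a_def b_def d_def)
  then have b: "0 < b" "a \<le> 2 * b" by linarith+
  have "\<bar>(x \<bullet> u) / a ^ (?n + 1) - (y \<bullet> u) / b ^ (?n + 1)\<bar> \<le> ?A * d / a ^ (?n + 1)"
  proof -
    have "(x \<bullet> u) / a ^ (?n + 1) - (y \<bullet> u) / b ^ (?n + 1)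
      = ((x - y) \<bullet> u) / a ^ (?n + 1) + (y \<bullet> u) * (1 / a ^ (?n + 1) - 1 / b ^ (?n + 1))"
      by (simp add: inner_diff_left diff_divide_distrib right_diff_distrib del: power_Suc)
    also have "\<bar>...\<bar> \<le> \<bar>((x - y) \<bullet> u) / a ^ (?n + 1)\<bar> + \<bar>(y \<bullet> u) * (1 / a ^ (?n + 1) - 1 / b ^ (?n + 1))\<bar>"
      by (rule abs_triangle_ineq)
    also have "\<bar>((x - y) \<bullet> u) / a ^ (?n + 1)\<bar> \<le> d / a ^ (?n + 1)"
      using comp[of "x - y"] ab by (simp add: d_def divide_right_mono del: power_Suc)
    also have "\<bar>(y \<bullet> u) * (1 / a ^ (?n + 1) - 1 / b ^ (?n + 1))\<bar> \<le> b * (real (?n + 1) * (2 * b) ^ ?n * d / (a ^ (?n + 1) * b ^ (?n + 1)))"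
      unfolding abs_mult
    proof (rule mult_mono)
      have "1 / a ^ (?n + 1) - 1 / b ^ (?n + 1) = (b ^ (?n + 1) - a ^ (?n + 1)) / (a ^ (?n + 1) * b ^ (?n + 1))"
        using ab b by (simp add: diff_frac_eq del: power_Suc)
      also have "\<bar>...\<bar> = \<bar>b ^ Suc ?n - a ^ Suc ?n\<bar> / (a ^ (?n + 1) * b ^ (?n + 1))"
        using ab b by (simp add: abs_divide del: power_Suc)
      also have "... \<le> (real (Suc ?n) * (2 * b) ^ ?n * \<bar>b - a\<bar>) / (a ^ (?n + 1) * b ^ (?n + 1))"
        using ab b by (intro divide_right_mono power_diff_le) auto
      also have "... \<le> (real (Suc ?n) * (2 * b) ^ ?n * d) / (a ^ (?n + 1) * b ^ (?n + 1))"
        using ab b by (intro divide_right_mono mult_left_mono) auto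
      finally show "\<bar>1 / a ^ (?n + 1) - 1 / b ^ (?n + 1)\<bar> \<le> real (?n + 1) * (2 * b) ^ ?n * d / (a ^ (?n + 1) * b ^ (?n + 1))"
        by simp
    qed (use comp[of y] b in \<open>auto simp: b_def\<close>)
    also have "b * (real (?n + 1) * (2 * b) ^ ?n * d / (a ^ (?n + 1) * b ^ (?n + 1))) = real (?n + 1) * 2 ^ ?n * d / a ^ (?n + 1)"
      using b ab by (simp add: power_mult_distrib field_simps)
    finally show ?thesis by (simp add: add_divide_distrib distrib_right)
  qed
  then show "norm (complex_of_real ((x \<bullet> u) / norm x ^ (?n + 1)) - complex_of_real ((y \<bullet> u) / norm y ^ (?n + 1)))
    \<le> ?A * norm (x - y) / norm x ^ (?n + 1)"
    unfolding of_real_diff[symmetric] norm_of_real a_def b_def d_def .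
qed simp_all

lemma rotation_preserves_lborel: "distr lborel borel ((*) \<i>) = (lborel :: complex measure)"
proof (rule lborel_eqI[symmetric])
  fix l u :: complex assume lu: "\<And>b. b \<in> Basis \<Longrightarrow> l \<bullet> b \<le> u \<bullet> b"
  have "(*) \<i> -` box l u = box (Complex (Im l) (- Re u)) (Complex (Im u) (- Re l))"
    by (auto simp: box_def Basis_complex_def inner_complex_def)
  then have "emeasure (distr lborel borel ((*) \<i>)) (box l u) = emeasure lborel (box (Complex (Im l) (- Re u)) (Complex (Im u) (- Re l)))"
    by (subst emeasure_distr) auto
  also have "... = (\<Prod>b\<in>Basis. (Complex (Im u) (- Re l) - Complex (Im l) (- Re u)) \<bullet> b)"
    using lu[of 1] lu[of \<i>] by (intro emeasure_lborel_box) (auto simp: Basis_complex_def inner_complex_def)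
  also have "(\<Prod>b\<in>Basis. (Complex (Im u) (- Re l) - Complex (Im l) (- Re u)) \<bullet> b) = (\<Prod>b\<in>Basis. (u - l) \<bullet> b)"
    by (simp add: Basis_complex_def inner_complex_def mult.commute)
  finally show "emeasure (distr lborel borel ((*) \<i>)) (box l u) = (\<Prod>b\<in>Basis. (u - l) \<bullet> b)" .
qed simp

text \<open>
  The reflection leaves this kernel unchanged, but the rotation by a right angle changes its sign, as
  \<open>(\<i> z)\<^sup>2 = - z\<^sup>2\<close>.
\<close>

theorem beurling_transform_bound:
  assumes p: "2 \<le> p" "p \<le> r"
  shows "\<exists>c>0. \<forall>w :: complex \<Rightarrow> real. weight w \<longrightarrow> opnorm p w (max_sing_int (\<lambda>z. 1 / z ^ 2))
    \<le> ennreal c * mixed_constant p (1 / (p - 1)) r (1 - 1 / (p - 1)) w"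
proof (rule maximal_operator_bound[OF _ _ _ _ _ rotation_preserves_lborel _ _ p])
  show "0 < (10::real)" by simp
  show "(\<lambda>z::complex. 1 / z ^ 2) \<in> borel_measurable borel" by measurable
  fix x :: complex assume x: "x \<noteq> 0"
  show "norm (1 / x ^ 2) \<le> 10 / norm x ^ DIM(complex)"
    by (simp add: norm_divide norm_power divide_right_mono)
  fix y assume near: "2 * norm (x - y) \<le> norm x"
  have b: "norm x \<le> 2 * norm y" "norm y \<le> 3 / 2 * norm x"
    using near norm_triangle_ineq2[of x y] norm_triangle_ineq2[of y x] by (auto simp: norm_minus_commute)
  then have y: "y \<noteq> 0" using x by auto
  have "1 / x ^ 2 - 1 / y ^ 2 = (y - x) * (y + x) / (x ^ 2 * y ^ 2)"
    using x y by (simp add: diff_frac_eq power2_eq_square algebra_simps)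
  then have "norm (1 / x ^ 2 - 1 / y ^ 2) = norm (x - y) * norm (y + x) / (norm x ^ 2 * norm y ^ 2)"
    by (simp add: norm_divide norm_mult norm_power norm_minus_commute)
  also have "... \<le> norm (x - y) * (5 / 2 * norm x) / (norm x ^ 2 * (norm x / 2) ^ 2)"
    using b x y norm_triangle_ineq[of y x] by (intro frac_le mult_mono power_mono mult_pos_pos mult_nonneg_nonneg) auto
  also have "... = 10 * norm (x - y) / norm x ^ (DIM(complex) + 1)"
    using x by (simp add: power2_eq_square power3_eq_cube divide_simps)
  finally show "norm (1 / x ^ 2 - 1 / y ^ 2) \<le> 10 * norm (x - y) / norm x ^ (DIM(complex) + 1)" .
qed (simp_all add: norm_mult power_mult_distrib)

text \<open>
  The bound on the first derivative and the mean value inequality give the smoothness: the ball of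
  radius \<open>\<bar>x\<bar>/2\<close> about \<open>x\<close> stays away from the origin, where
  \<open>\<bar>K'\<bar> \<le> 4c / x\<^sup>2\<close>.
\<close>

theorem odd_C2_kernel_bound:
  assumes K: "odd_C2_kernel K" and p: "2 \<le> p" "p \<le> r"
  shows "\<exists>c>0. \<forall>w :: real \<Rightarrow> real. weight w \<longrightarrow> opnorm p w (max_sing_int K)
    \<le> ennreal c * mixed_constant p (1 / (p - 1)) r (1 - 1 / (p - 1)) w"
proof -
  obtain D :: "nat \<Rightarrow> real \<Rightarrow> complex" and c :: real where odd: "\<And>x. x \<noteq> 0 \<Longrightarrow> K (- x) = - K x" and D0: "D 0 = K"
    and D: "\<forall>i<2. \<forall>x. x \<noteq> 0 \<longrightarrow> (D i has_vector_derivative D (Suc i) x) (at x)"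
    and c: "\<forall>i\<le>2. \<forall>x. x \<noteq> 0 \<longrightarrow> norm (D i x) \<le> c / \<bar>x\<bar> ^ (1 + i)"
    using K unfolding odd_C2_kernel_def by (elim exE conjE) (rule that, simp_all)
  have D1: "(K has_vector_derivative D 1 x) (at x)" if "x \<noteq> 0" for x using D[rule_format, of 0 x] that by (simp add: D0)
  have size: "norm (K x) \<le> c / \<bar>x\<bar>" if "x \<noteq> 0" for x using c[rule_format, of 0 x] that by (simp add: D0)
  have size1: "norm (D 1 x) \<le> c / \<bar>x\<bar> ^ 2" if "x \<noteq> 0" for x using c[rule_format, of 1 x] that by (simp add: numeral_2_eq_2)
  have c0: "0 \<le> c" using order_trans[OF norm_ge_zero size[of 1]] by simp
  show ?thesis
  proof (rule maximal_operator_bound[OF _ _ _ _ _ reflection_preserves_lborel _ _ p])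
    show "0 < 4 * c + 1" using c0 by simp
    have "continuous_on (UNIV - {0}) K"
      using D1 by (intro continuous_at_imp_continuous_on ballI) (auto intro: has_vector_derivative_continuous)
    then show "K \<in> borel_measurable borel"
      by (intro borel_measurable_continuous_countable_exceptions[where X="{0}"]) (auto simp: Compl_eq_Diff_UNIV)
    fix x :: real assume x: "x \<noteq> 0"
    show "norm (K x) \<le> (4 * c + 1) / norm x ^ DIM(real)"
      using c0 by (intro order_trans[OF size[OF x]]) (simp add: divide_right_mono)
    fix y :: real assume near: "2 * norm (x - y) \<le> norm x"
    have "norm (K y - K x) \<le> (4 * c / \<bar>x\<bar> ^ 2) * norm (y - x)"
    proof (rule differentiable_bound[where S = "cball x (\<bar>x\<bar> / 2)" and f' = "\<lambda>z h. h *\<^sub>R D 1 z"])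
      fix z assume "z \<in> cball x (\<bar>x\<bar> / 2)"
      then have "\<bar>x - z\<bar> \<le> \<bar>x\<bar> / 2" by (simp add: dist_real_def)
      then have z: "\<bar>x\<bar> / 2 \<le> \<bar>z\<bar>" using abs_triangle_ineq2[of x z] by linarith
      with x have z: "\<bar>x\<bar> / 2 \<le> \<bar>z\<bar>" "z \<noteq> 0" by auto
      show "(K has_derivative (\<lambda>h. h *\<^sub>R D 1 z)) (at z within cball x (\<bar>x\<bar> / 2))"
        using D1[OF z(2)] unfolding has_vector_derivative_def by (rule has_derivative_at_withinI)
      show "onorm (\<lambda>h. h *\<^sub>R D 1 z) \<le> 4 * c / \<bar>x\<bar> ^ 2"
      proof (rule onorm_le)
        fix h :: real
        have "norm (D 1 z) \<le> c / \<bar>z\<bar> ^ 2" by (rule size1[OF z(2)])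
        also have "... \<le> c / (\<bar>x\<bar> / 2) ^ 2" using z x c0 by (intro divide_left_mono power_mono mult_pos_pos zero_less_power) auto
        also have "... = 4 * c / \<bar>x\<bar> ^ 2" by (simp add: power_divide)
        finally have "norm (D 1 z) * norm h \<le> 4 * c / \<bar>x\<bar> ^ 2 * norm h" by (rule mult_right_mono) simp
        then show "norm (h *\<^sub>R D 1 z) \<le> 4 * c / \<bar>x\<bar> ^ 2 * norm h" by (simp only: norm_scaleR real_norm_def mult.commute)
      qed
    qed (use near in \<open>auto simp: dist_real_def\<close>)
    also have "... \<le> (4 * c + 1) * norm (x - y) / norm x ^ (DIM(real) + 1)"
      using x by (simp add: abs_minus_commute numeral_2_eq_2[symmetric] power2_eq_square divide_right_mono mult_right_mono)
    finally show "norm (K x - K y) \<le> (4 * c + 1) * norm (x - y) / norm x ^ (DIM(real) + 1)" by (simp add: norm_minus_commute)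
  qed (simp_all add: odd)
qed

theorem theorem1p1:
  fixes p r :: real
  assumes "2 \<le> p" and "p \<le> r"
  shows
    "(\<exists>c>0. \<forall>w :: real \<Rightarrow> real. weight w \<longrightarrow>
        opnorm p w (max_sing_int (\<lambda>x. complex_of_real (1 / x)))
          \<le> ennreal c * mixed_constant p (1 / (p - 1)) r (1 - 1 / (p - 1)) w)
     \<and> (CARD('n::finite) \<ge> 2 \<longrightarrow> (\<forall>j::'n. \<exists>c>0. \<forall>w :: real ^ 'n \<Rightarrow> real. weight w \<longrightarrow>
        opnorm p w (max_sing_int (\<lambda>x. complex_of_real (x $ j / norm x ^ (CARD('n) + 1))))
          \<le> ennreal c * mixed_constant p (1 / (p - 1)) r (1 - 1 / (p - 1)) w))
     \<and> (\<exists>c>0. \<forall>w :: complex \<Rightarrow> real. weight w \<longrightarrow>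
        opnorm p w (max_sing_int (\<lambda>z. 1 / z ^ 2))
          \<le> ennreal c * mixed_constant p (1 / (p - 1)) r (1 - 1 / (p - 1)) w)
     \<and> (\<forall>K :: real \<Rightarrow> complex. odd_C2_kernel K \<longrightarrow> (\<exists>c>0. \<forall>w :: real \<Rightarrow> real. weight w \<longrightarrow>
        opnorm p w (max_sing_int K)
          \<le> ennreal c * mixed_constant p (1 / (p - 1)) r (1 - 1 / (p - 1)) w))"
proof (intro conjI impI allI)
  have hilbert: "(x \<bullet> 1) / norm x ^ (DIM(real) + 1) = 1 / x" for x :: real
    by (simp add: power2_eq_square[symmetric] numeral_2_eq_2[symmetric]) (simp add: power2_eq_square)
  show "\<exists>c>0. \<forall>w :: real \<Rightarrow> real. weight w \<longrightarrow>
        opnorm p w (max_sing_int (\<lambda>x. complex_of_real (1 / x)))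
          \<le> ennreal c * mixed_constant p (1 / (p - 1)) r (1 - 1 / (p - 1)) w"
    using riesz_transform_bound[of "1::real", OF _ assms] unfolding hilbert by simp
next
  fix j :: 'n
  have axis: "axis j 1 \<in> (Basis :: (real ^ 'n) set)" by (simp add: axis_in_Basis_iff)
  have dim: "DIM(real ^ 'n) = CARD('n)" by simp
  show "\<exists>c>0. \<forall>w :: real ^ 'n \<Rightarrow> real. weight w \<longrightarrow>
        opnorm p w (max_sing_int (\<lambda>x. complex_of_real (x $ j / norm x ^ (CARD('n) + 1))))
          \<le> ennreal c * mixed_constant p (1 / (p - 1)) r (1 - 1 / (p - 1)) w"
    using riesz_transform_bound[OF axis assms] unfolding dim inner_axis by simp
qed (rule beurling_transform_bound[OF assms], rule odd_C2_kernel_bound[OF _ assms])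

end
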